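(* Assume the following two conjectures. (Conjecture A) For every $n$, if $L_p$ is the largest pseudosquare with $L_p\le n$, then $p=O(\log n\log\log n)$. (Conjecture B) For all positive integers $a,b$ with $\gcd(a,b)=1$ and all $x,y$, $$\#\{m\le x:\ m\equiv a \pmod b,\ p(m)>y\}\ \ll\ \frac{x}{b}\prod_{\substack{p\le y\\ \gcd(p,b)=1}}\left(1-\frac1p\right),$$ where $p(m)$ denotes the smallest prime divisor of $m$ and the product is over primes $p$. Let $c>2$ be a constant. Then there is an algorithm that, when given an integer $k>2$, a list of $k$ distinct linear polynomials over the integers with positive leading coefficients, $P=(f_1(x),\ldots,f_k(x))$ (the pattern), and a search bound $n$, finds all integers $x$ such that $\max\{f_i(x)\}\le n$ and all the values $f_1(x),\ldots,f_k(x)$ are prime. This algorithm uses at most $O_P\big(n/(\log\log n)^{k-1}\big)$ arithmetic operations and $n^{1/c}$ bits of space. The correctness of the algorithm's output does not depend on Conjectures A and B (only the bound on the number of operations does).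
   Context: The pseudosquare $L_p$ (for a prime $p$) is the smallest positive integer that is not a perfect square, is congruent to $1 \bmod 8$, and is a quadratic residue modulo every odd prime $q\le p$. Model of computation: a random access machine with direct-access memory addressable at the bit or word level, with word size $\Theta(\log n)$ bits; arithmetic operations on integers of $O(\log n)$ bits, memory accesses, comparisons and other basic operations each cost constant time. Space is counted in bits and does not include the space of the output. The notation $O_P(\cdot)$ means the implied constant may depend on the pattern $P$ (including $k$). *)

theory Defs
  imports
    "HOL-Number_Theory.Number_Theory"
    "HOL-Computational_Algebra.Computational_Algebra"
    "HOL-Library.Log_Nat"
    "HOL-Library.Landau_Symbols"
begin

section \<open>Word RAM\<close>

text \<open>
  The machine has finitely many registers and a memory of cells addressed by natural numbers.
  Registers and cells hold signed words of \<open>w\<close> bits (two's complement). A step that would produce a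
  value that does not fit into \<open>w\<close> bits, divide by zero, or use a negative address has no result, so
  unbounded intermediate values cannot be exploited.

  In \<open>Load r s\<close> and \<open>Store r s\<close> register \<open>s\<close> holds the cell address. In \<open>LoadBit r s t\<close> and
  \<open>StoreBit r s t\<close> the bit accessed is the one with the index in register \<open>t\<close>, counted through
  consecutive cells from the cell whose address is in register \<open>s\<close>. Register names are a type
  parameter only so that \<open>set_instr\<close> yields the registers an instruction mentions; jump targets are
  plain natural numbers.
\<close>

datatype alu_op =
  AddOp | SubOp | MulOp | DivOp | ModOp | AndOp | OrOp | XorOp | ShlOp | ShrOp

datatype 'r instr =
    Const 'r int
  | Alu alu_op 'r 'r 'r
  | Load 'r 'r
  | Store 'r 'r
  | LoadBit 'r 'r 'r
  | StoreBit 'r 'r 'r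
  | JumpLess 'r 'r nat
  | JumpEq 'r 'r nat
  | Output 'r
  | Halt

type_synonym program = "nat instr list"

text \<open>\<open>cells s\<close> is the length of the shortest initial segment of the memory that contains the
  input and all cells read or written so far.\<close>

record ram_state =
  pc :: nat
  reg :: "nat \<Rightarrow> int"
  mem :: "nat \<Rightarrow> int"
  cells :: nat
  printed :: "int list"

definition fits :: "nat \<Rightarrow> int \<Rightarrow> bool" where
  "fits w v \<longleftrightarrow> - (2 ^ w) \<le> 2 * v \<and> 2 * v < 2 ^ w"

fun alu :: "alu_op \<Rightarrow> int \<Rightarrow> int \<Rightarrow> int option" where
  "alu AddOp a b = Some (a + b)"
| "alu SubOp a b = Some (a - b)"
| "alu MulOp a b = Some (a * b)"
| "alu DivOp a b = (if b = 0 then None else Some (a div b))"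
| "alu ModOp a b = (if b = 0 then None else Some (a mod b))"
| "alu AndOp a b = Some (semiring_bit_operations_class.and a b)"
| "alu OrOp a b = Some (semiring_bit_operations_class.or a b)"
| "alu XorOp a b = Some (semiring_bit_operations_class.xor a b)"
| "alu ShlOp a b = (if b < 0 then None else Some (push_bit (nat b) a))"
| "alu ShrOp a b = (if b < 0 then None else Some (drop_bit (nat b) a))"

definition set_reg :: "nat \<Rightarrow> nat \<Rightarrow> int \<Rightarrow> ram_state \<Rightarrow> ram_state option" where
  "set_reg w r v s =
     (if fits w v then Some (s\<lparr>reg := (reg s)(r := v), pc := Suc (pc s)\<rparr>) else None)"

definition set_cell :: "nat \<Rightarrow> nat \<Rightarrow> int \<Rightarrow> ram_state \<Rightarrow> ram_state option" where
  "set_cell w a v s =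
     (if fits w v then Some (s\<lparr>mem := (mem s)(a := v), pc := Suc (pc s)\<rparr>) else None)"

definition touch :: "nat \<Rightarrow> ram_state \<Rightarrow> ram_state" where
  "touch a s = s\<lparr>cells := max (cells s) (Suc a)\<rparr>"

definition jump :: "bool \<Rightarrow> nat \<Rightarrow> ram_state \<Rightarrow> ram_state option" where
  "jump b l s = Some (s\<lparr>pc := (if b then l else Suc (pc s))\<rparr>)"

fun exec_instr :: "nat \<Rightarrow> nat instr \<Rightarrow> ram_state \<Rightarrow> ram_state option" where
  "exec_instr w (Const r v) s = set_reg w r v s"
| "exec_instr w (Alu f r p q) s =
     Option.bind (alu f (reg s p) (reg s q)) (\<lambda>v. set_reg w r v s)"
| "exec_instr w (Load r p) s =
     (if reg s p < 0 then None
      else let a = nat (reg s p) in set_reg w r (mem s a) (touch a s))"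
| "exec_instr w (Store r p) s =
     (if reg s p < 0 then None
      else let a = nat (reg s p) in set_cell w a (reg s r) (touch a s))"
| "exec_instr w (LoadBit r p q) s =
     (if reg s p < 0 \<or> reg s q < 0 then None
      else let a = nat (reg s p) + nat (reg s q) div w; j = nat (reg s q) mod w
           in set_reg w r (of_bool (bit (mem s a) j)) (touch a s))"
| "exec_instr w (StoreBit r p q) s =
     (if reg s p < 0 \<or> reg s q < 0 then None
      else let a = nat (reg s p) + nat (reg s q) div w; j = nat (reg s q) mod w;
               v = (if reg s r \<noteq> 0 then set_bit j (mem s a) else unset_bit j (mem s a))
           in set_cell w a (signed_take_bit (w - 1) v) (touch a s))"
| "exec_instr w (JumpLess p q l) s = jump (reg s p < reg s q) l s"
| "exec_instr w (JumpEq p q l) s = jump (reg s p = reg s q) l s"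
| "exec_instr w (Output r) s = Some (s\<lparr>printed := printed s @ [reg s r], pc := Suc (pc s)\<rparr>)"
| "exec_instr w Halt s = None"

definition step :: "nat \<Rightarrow> program \<Rightarrow> ram_state \<Rightarrow> ram_state option" where
  "step w prog s = (if pc s < length prog then exec_instr w (prog ! pc s) s else None)"

definition halted :: "program \<Rightarrow> ram_state \<Rightarrow> bool" where
  "halted prog s \<longleftrightarrow> pc s < length prog \<and> prog ! pc s = Halt"

definition init_state :: "int list \<Rightarrow> ram_state" where
  "init_state inp =
     \<lparr>pc = 0, reg = (\<lambda>_. 0), mem = (\<lambda>a. if a < length inp then inp ! a else 0),
      cells = length inp, printed = []\<rparr>"

text \<open>Words are a constant factor \<open>\<kappa>\<close> longer than the longest number in the input.\<close>

definition word_size :: "nat \<Rightarrow> int list \<Rightarrow> nat" where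
  "word_size \<kappa> inp = \<kappa> * Max ((\<lambda>v. floorlog 2 (nat \<bar>v\<bar>)) ` set inp)"

text \<open>
  On input \<open>inp\<close> the program halts properly after \<open>t\<close> executed instructions with output \<open>outp\<close>,
  having used \<open>sp\<close> bits: all registers it mentions and the memory segment, input included. The
  output stream is write-only and not counted. Since no step is possible in a halted state,
  \<open>outp\<close>, \<open>t\<close> and \<open>sp\<close> are determined by the program and the input.
\<close>

definition ram_computes ::
    "nat \<Rightarrow> program \<Rightarrow> int list \<Rightarrow> int list \<Rightarrow> nat \<Rightarrow> nat \<Rightarrow> bool" where
  "ram_computes \<kappa> prog inp outp t sp \<longleftrightarrow>
     (let w = word_size \<kappa> inp in
      \<exists>s. ((\<lambda>s'. Option.bind s' (step w prog)) ^^ t) (Some (init_state inp)) = Some s \<and>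
          halted prog s \<and> outp = printed s \<and>
          sp = w * (card (\<Union>i\<in>set prog. set_instr i) + cells s))"


section \<open>Patterns\<close>

definition is_pattern :: "int poly list \<Rightarrow> bool" where
  "is_pattern P \<longleftrightarrow> distinct P \<and> (\<forall>f\<in>set P. degree f = 1 \<and> lead_coeff f > 0)"

definition pattern_input :: "int poly list \<Rightarrow> nat \<Rightarrow> int list" where
  "pattern_input P n =
     int (length P) # int n # concat (map (\<lambda>f. [coeff f 1, coeff f 0]) P)"

definition prime_pattern_positions :: "int poly list \<Rightarrow> nat \<Rightarrow> int set" where
  "prime_pattern_positions P n =
     {x. Max ((\<lambda>f. poly f x) ` set P) \<le> int n \<and> (\<forall>f\<in>set P. prime (poly f x))}"


section \<open>The two conjectures\<close>

text \<open>As usual for pseudosquares, 0 does not count as a quadratic residue: the first values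
  \<open>L\<^sub>2 = 17\<close>, \<open>L\<^sub>3 = 73\<close>, \<open>L\<^sub>5 = 241\<close> require the Legendre symbol to be 1.\<close>

definition pseudosquare :: "nat \<Rightarrow> nat" where
  "pseudosquare p =
     (LEAST L. 0 < L \<and> \<not> is_square L \<and> [L = 1] (mod 8) \<and>
        (\<forall>q. prime q \<and> odd q \<and> q \<le> p \<longrightarrow> Legendre (int L) (int q) = 1))"

text \<open>Pseudosquares are at least 17, so \<open>ln (ln n) > 0\<close> whenever the premise holds.\<close>

definition conjecture_A :: bool where
  "conjecture_A \<longleftrightarrow>
     (\<exists>C::real. \<forall>(n::nat) (p::nat).
        prime p \<and> pseudosquare p \<le> n \<and>
        (\<forall>q. prime q \<and> pseudosquare q \<le> n \<longrightarrow> pseudosquare q \<le> pseudosquare p) \<longrightarrow>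
        real p \<le> C * (ln (real n) * ln (ln (real n))))"

definition least_prime_divisor :: "nat \<Rightarrow> nat" where
  "least_prime_divisor m = (LEAST q. prime q \<and> q dvd m)"

text \<open>
  The implied constant is absolute. No such constant exists for literally all \<open>x\<close> and \<open>y\<close>: for
  \<open>a = x = 3\<close>, \<open>y = 2\<close> the left-hand side is 1 for every \<open>b > 3\<close> with 3 not dividing \<open>b\<close>, while the right-hand
  side tends to 0 as \<open>b\<close> grows. The estimate is therefore read in the usual range of sieve bounds,
  in which the progression has at least about \<open>y\<close> terms up to \<open>x\<close>. This is implied by any reading
  with a larger range, so a theorem assuming it also covers those readings.
\<close>

definition conjecture_B :: bool where
  "conjecture_B \<longleftrightarrow>
     (\<exists>C::real. \<forall>(a::nat) (b::nat) (x::real) (y::real).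
        0 < a \<and> 0 < b \<and> coprime a b \<and> 1 \<le> y \<and> y \<le> x / real b \<longrightarrow>
        real (card {m::nat. 1 < m \<and> real m \<le> x \<and> [m = a] (mod b) \<and>
                            real (least_prime_divisor m) > y})
        \<le> C * (x / real b *
                (\<Prod>p | prime p \<and> real p \<le> y \<and> coprime p b. 1 - 1 / real p)))"

end

theory Submission
 imports Defs "HOL-Analysis.Harmonic_Numbers" "HOL-Real_Asymp.Real_Asymp"
begin

text \<open>
 Let \<open>y\<close> be about \<open>n\<close> to the power \<open>1/K\<close> for a large constant \<open>K\<close>, and let \<open>M\<close> be the largest
 primorial that is at most \<open>y\<close>. The search range is split into residue classes modulo \<open>M\<close>. Only a
 proportion of order \<open>(log log n)\<close> to the power \<open>-k\<close> of the classes contains no value divisible by a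
 prime factor of \<open>M\<close>. Each of these is sieved by the primes up to \<open>y\<close> in segments of length
 \<open>y\<close> squared, at a cost of order \<open>log log n\<close> per position, so that sieving takes
 \<open>n / (log log n)^(k-1)\<close> operations in space \<open>y\<close> squared. By Brun's pure sieve at most
 \<open>n (log log n / log n)^k\<close> positions survive. They are tested with the pseudosquare primality test of
 Lukes, Patterson and Williams: if \<open>m\<close> has no prime factor up to \<open>y\<close> and is not a perfect power,
 the Euler criterion for all small prime bases, up to a bound on the least quadratic nonresidues of
 pseudosquare candidates up to \<open>n / y\<close>, decides primality. The program computes this bound
 itself, so that correctness is unconditional; Conjecture A bounds it by a power of \<open>log n\<close> with
 exponent \<open>9/7\<close>. As \<open>k > 2\<close>, the cost of all tests is of smaller order than the cost of sieving.
\<close>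

section \<open>A structured language for the word RAM\<close>

text \<open>A divisor that could deceive the primality test is a proper divisor of \<open>m\<close>,
  hence at most \<open>n div y\<close>; so the program can afford to examine every candidate up to
  \<open>n div y\<close> and to record the largest least nonresidue. This costs \<open>n / y\<close>
  up to a power of \<open>log n\<close>, which the factor \<open>y\<close> absorbs. The exponent
  \<open>9/7\<close> comes from trading logarithms for eighth powers; what matters is that its
  double, \<open>18/7\<close>, stays below 3, since the search for a witness base is quadratic in
  the bound while sieving gains at least three factors \<open>log n\<close>. Crude prime estimates
  suffice: upper bounds of the right order for the sum of \<open>1/p\<close> and the product of
  \<open>1 - 1/p\<close>, and a Chebyshev lower bound for the number of primes. On the machine side
  the obstacle is the fixed word length: every intermediate value must be shown to fit. The programs
  are therefore written in a small structured language whose semantics carries a bound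
  \<open>B\<close> on values, are verified by weakest preconditions that also count loop iterations,
  and are compiled by one general theorem.\<close>

datatype exp = N int | V nat | Bin alu_op exp exp

datatype bexp = Lt exp exp | Eq exp exp

datatype com =
  Skip
 | Assign nat exp
 | Get nat exp
 | Put exp exp
 | Print exp
 | Seq com com
 | Cond bexp com com
 | Loop bexp com

notation Seq (infixr ";;" 60)
notation Assign (infix "::=" 65)

abbreviation plus_exp (infixl "[+]" 75) where "a [+] b \<equiv> Bin AddOp a b"
abbreviation minus_exp (infixl "[-]" 75) where "a [-] b \<equiv> Bin SubOp a b"
abbreviation times_exp (infixl "[*]" 80) where "a [*] b \<equiv> Bin MulOp a b"
abbreviation div_exp (infixl "[div]" 80) where "a [div] b \<equiv> Bin DivOp a b"
abbreviation mod_exp (infixl "[mod]" 80) where "a [mod] b \<equiv> Bin ModOp a b"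

text \<open>Only the five arithmetic operations occur in the programs; bit operations and shifts get
  a dummy value and are ruled out by \<open>binop_defined\<close>.\<close>

fun binop :: "alu_op \<Rightarrow> int \<Rightarrow> int \<Rightarrow> int" where
 "binop AddOp a b = a + b"
| "binop SubOp a b = a - b"
| "binop MulOp a b = a * b"
| "binop DivOp a b = a div b"
| "binop ModOp a b = a mod b"
| "binop _ a b = 0"

fun binop_defined :: "alu_op \<Rightarrow> int \<Rightarrow> bool" where
 "binop_defined AddOp b = True"
| "binop_defined SubOp b = True"
| "binop_defined MulOp b = True"
| "binop_defined DivOp b = (b \<noteq> 0)"
| "binop_defined ModOp b = (b \<noteq> 0)"
| "binop_defined _ b = False"

lemma alu_binop: "binop_defined f b \<Longrightarrow> alu f a b = Some (binop f a b)"
 by (cases f) auto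

fun aval :: "(nat \<Rightarrow> int) \<Rightarrow> exp \<Rightarrow> int" where
 "aval R (N c) = c"
| "aval R (V x) = R x"
| "aval R (Bin f a b) = binop f (aval R a) (aval R b)"

text \<open>Every value that the compiled expression writes to a scratch register must stay below
  \<open>B\<close>. A variable is read in place, so it is not checked here; where its value is
  copied or stored, the rules of \<open>big\<close> ask for the bound separately.\<close>

fun safe :: "int \<Rightarrow> (nat \<Rightarrow> int) \<Rightarrow> exp \<Rightarrow> bool" where
 "safe B R (N c) \<longleftrightarrow> \<bar>c\<bar> < B"
| "safe B R (V x) \<longleftrightarrow> True"
| "safe B R (Bin f a b) \<longleftrightarrow> safe B R a \<and> safe B R b \<and> binop_defined f (aval R b) \<and>
   \<bar>binop f (aval R a) (aval R b)\<bar> < B"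

fun test :: "(nat \<Rightarrow> int) \<Rightarrow> bexp \<Rightarrow> bool" where
 "test R (Lt a b) \<longleftrightarrow> aval R a < aval R b"
| "test R (Eq a b) \<longleftrightarrow> aval R a = aval R b"

fun safe_test :: "int \<Rightarrow> (nat \<Rightarrow> int) \<Rightarrow> bexp \<Rightarrow> bool" where
 "safe_test B R (Lt a b) \<longleftrightarrow> safe B R a \<and> safe B R b"
| "safe_test B R (Eq a b) \<longleftrightarrow> safe B R a \<and> safe B R b"

text \<open>The cost of an execution is the number of loop iterations; the running time of the compiled
 code is larger by at most a factor that depends only on the command. The program counter of a
 state plays no role here.\<close>

inductive big :: "int \<Rightarrow> com \<Rightarrow> ram_state \<Rightarrow> nat \<Rightarrow> ram_state \<Rightarrow> bool" for B where
 Skip: "big B Skip s 0 s"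
| Assign: "safe B (reg s) e \<Longrightarrow> \<bar>aval (reg s) e\<bar> < B \<Longrightarrow>
  big B (Assign x e) s 0 (s\<lparr>reg := (reg s)(x := aval (reg s) e)\<rparr>)"
| Get: "safe B (reg s) e \<Longrightarrow> 0 \<le> aval (reg s) e \<Longrightarrow> \<bar>mem s (nat (aval (reg s) e))\<bar> < B \<Longrightarrow>
  big B (Get x e) s 0 (s\<lparr>reg := (reg s)(x := mem s (nat (aval (reg s) e))),
   cells := max (cells s) (Suc (nat (aval (reg s) e)))\<rparr>)"
| Put: "safe B (reg s) e \<Longrightarrow> safe B (reg s) e' \<Longrightarrow> 0 \<le> aval (reg s) e \<Longrightarrow>
  \<bar>aval (reg s) e'\<bar> < B \<Longrightarrow>
  big B (Put e e') s 0 (s\<lparr>mem := (mem s)(nat (aval (reg s) e) := aval (reg s) e'),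
   cells := max (cells s) (Suc (nat (aval (reg s) e)))\<rparr>)"
| Print: "safe B (reg s) e \<Longrightarrow>
  big B (Print e) s 0 (s\<lparr>printed := printed s @ [aval (reg s) e]\<rparr>)"
| Seq: "big B c1 s t1 s' \<Longrightarrow> big B c2 s' t2 s'' \<Longrightarrow> big B (Seq c1 c2) s (t1 + t2) s''"
| CondT: "safe_test B (reg s) b \<Longrightarrow> test (reg s) b \<Longrightarrow> big B c1 s t s' \<Longrightarrow>
  big B (Cond b c1 c2) s t s'"
| CondF: "safe_test B (reg s) b \<Longrightarrow> \<not> test (reg s) b \<Longrightarrow> big B c2 s t s' \<Longrightarrow>
  big B (Cond b c1 c2) s t s'"
| LoopF: "safe_test B (reg s) b \<Longrightarrow> \<not> test (reg s) b \<Longrightarrow> big B (Loop b c) s 0 s"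
| LoopT: "safe_test B (reg s) b \<Longrightarrow> test (reg s) b \<Longrightarrow> big B c s t1 s' \<Longrightarrow>
  big B (Loop b c) s' t2 s'' \<Longrightarrow> big B (Loop b c) s (Suc (t1 + t2)) s''"

subsection \<open>Compilation\<close>

fun operand :: "exp \<Rightarrow> nat \<Rightarrow> nat" where
 "operand (V x) d = x"
| "operand e d = d"

text \<open>Scratch registers from \<open>d\<close> upward serve as an evaluation stack; variables
  live below \<open>d\<close> and are read in place.\<close>

fun code_exp :: "exp \<Rightarrow> nat \<Rightarrow> nat instr list" where
 "code_exp (N c) d = [Const d c]"
| "code_exp (V x) d = []"
| "code_exp (Bin f a b) d =
   code_exp a d @ code_exp b (Suc d) @ [Alu f d (operand a d) (operand b (Suc d))]"

fun code_test :: "bexp \<Rightarrow> nat \<Rightarrow> nat instr list" where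
 "code_test (Lt a b) d = code_exp a d @ code_exp b (Suc d)"
| "code_test (Eq a b) d = code_exp a d @ code_exp b (Suc d)"

fun branch :: "bexp \<Rightarrow> nat \<Rightarrow> nat \<Rightarrow> nat instr" where
 "branch (Lt a b) d l = JumpLess (operand a d) (operand b (Suc d)) l"
| "branch (Eq a b) d l = JumpEq (operand a d) (operand b (Suc d)) l"

text \<open>The machine has no move instruction, so an assignment adds a freshly loaded 0;
  \<open>JumpEq d d\<close> is the unconditional jump. In \<open>Cond\<close> the code for the false
  case comes first, because the branch jumps exactly when the test holds. The last argument is the
  address at which the code will be placed.\<close>

fun code :: "nat \<Rightarrow> com \<Rightarrow> nat \<Rightarrow> nat instr list" where
 "code d Skip p = []"
| "code d (Assign x e) p =
   code_exp e d @ [Const (Suc d) 0, Alu AddOp x (operand e d) (Suc d)]"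
| "code d (Get x e) p = code_exp e d @ [Load x (operand e d)]"
| "code d (Put e e') p =
   code_exp e d @ code_exp e' (Suc d) @ [Store (operand e' (Suc d)) (operand e d)]"
| "code d (Print e) p = code_exp e d @ [Output (operand e d)]"
| "code d (Seq c1 c2) p = code d c1 p @ code d c2 (p + length (code d c1 p))"
| "code d (Cond b c1 c2) p =
   (let u = code_test b d; p2 = p + length u + 1; v2 = code d c2 p2;
     p1 = p2 + length v2 + 1; v1 = code d c1 p1
   in u @ [branch b d p1] @ v2 @ [JumpEq d d (p1 + length v1)] @ v1)"
| "code d (Loop b c) p =
   (let u = code_test b d; p1 = p + length u + 2; v = code d c p1
   in u @ [branch b d p1] @ [JumpEq d d (p1 + length v + 1)] @ v @ [JumpEq d d p])"

fun vars_exp :: "exp \<Rightarrow> nat set" where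
 "vars_exp (N c) = {}"
| "vars_exp (V x) = {x}"
| "vars_exp (Bin f a b) = vars_exp a \<union> vars_exp b"

fun vars_test :: "bexp \<Rightarrow> nat set" where
 "vars_test (Lt a b) = vars_exp a \<union> vars_exp b"
| "vars_test (Eq a b) = vars_exp a \<union> vars_exp b"

fun vars :: "com \<Rightarrow> nat set" where
 "vars Skip = {}"
| "vars (Assign x e) = insert x (vars_exp e)"
| "vars (Get x e) = insert x (vars_exp e)"
| "vars (Put e e') = vars_exp e \<union> vars_exp e'"
| "vars (Print e) = vars_exp e"
| "vars (Seq c1 c2) = vars c1 \<union> vars c2"
| "vars (Cond b c1 c2) = vars_test b \<union> vars c1 \<union> vars c2"
| "vars (Loop b c) = vars_test b \<union> vars c"

section \<open>Runs of the machine and code placed at an address\<close>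

definition reach :: "nat \<Rightarrow> program \<Rightarrow> ram_state \<Rightarrow> nat \<Rightarrow> ram_state \<Rightarrow> bool" where
 "reach w prog s t s' \<longleftrightarrow> ((\<lambda>r. Option.bind r (step w prog)) ^^ t) (Some s) = Some s'"

lemma reach_0 [simp]: "reach w prog s 0 s' \<longleftrightarrow> s' = s"
 by (auto simp: reach_def)

lemma reach_trans:
 "reach w prog s t s' \<Longrightarrow> reach w prog s' t' s'' \<Longrightarrow> reach w prog s (t + t') s''"
 unfolding reach_def by (subst add.commute) (simp add: funpow_add)

lemma reach_step: "step w prog s = Some s' \<Longrightarrow> reach w prog s (Suc 0) s'"
 by (simp add: reach_def)

definition code_at :: "program \<Rightarrow> nat \<Rightarrow> nat instr list \<Rightarrow> bool" where
 "code_at prog p cs \<longleftrightarrow> (\<forall>i<length cs. p + i < length prog \<and> prog ! (p + i) = cs ! i)"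

lemma code_at_append [simp]:
 "code_at prog p (xs @ ys) \<longleftrightarrow> code_at prog p xs \<and> code_at prog (p + length xs) ys"
proof
 assume *: "code_at prog p (xs @ ys)"
 have "p + length xs + i < length prog \<and> prog ! (p + length xs + i) = ys ! i"
  if "i < length ys" for i
  using *[unfolded code_at_def, rule_format, of "length xs + i"] that
  by (simp add: add.assoc)
 moreover have "p + i < length prog \<and> prog ! (p + i) = xs ! i" if "i < length xs" for i
  using *[unfolded code_at_def, rule_format, of i] that by (simp add: nth_append)
 ultimately show "code_at prog p xs \<and> code_at prog (p + length xs) ys"
  by (simp add: code_at_def)
next
 assume *: "code_at prog p xs \<and> code_at prog (p + length xs) ys"
 show "code_at prog p (xs @ ys)"
  unfolding code_at_def
 proof (intro allI impI)
  fix i assume "i < length (xs @ ys)"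
  then show "p + i < length prog \<and> prog ! (p + i) = (xs @ ys) ! i"
   using conjunct1[OF *, unfolded code_at_def, rule_format, of i]
    conjunct2[OF *, unfolded code_at_def, rule_format, of "i - length xs"]
   by (cases "i < length xs") (simp_all add: nth_append)
 qed
qed

lemma code_at_Cons [simp]:
 "code_at prog p (x # ys) \<longleftrightarrow>
   p < length prog \<and> prog ! p = x \<and> code_at prog (Suc p) ys"
 using code_at_append[of prog p "[x]" ys] by (simp add: code_at_def)

lemma code_at_Nil [simp]: "code_at prog p []"
 by (simp add: code_at_def)

locale word_bound =
 fixes w :: nat and B :: int
 assumes fits_bound: "\<bar>v\<bar> < B \<Longrightarrow> fits w v"
  and B_pos: "0 < B"
begin

text \<open>The valuation \<open>R\<close> is kept apart from the register file because earlier
  subexpressions have already changed scratch registers; agreement on the variables of the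
  expression suffices, and everything below \<open>d\<close> survives.\<close>

lemma code_exp_correct:
 assumes "safe B R e" "code_at prog (pc S) (code_exp e d)"
  "vars_exp e \<subseteq> {..<d}" "\<forall>x\<in>vars_exp e. reg S x = R x"
 shows "\<exists>R'. reach w prog S (length (code_exp e d))
   (S\<lparr>reg := R', pc := pc S + length (code_exp e d)\<rparr>) \<and>
  R' (operand e d) = aval R e \<and> (\<forall>x<d. R' x = reg S x)"
 using assms
proof (induction e arbitrary: d S)
 case (N c)
 have "reach w prog S (Suc 0) (S\<lparr>reg := (reg S)(d := c), pc := Suc (pc S)\<rparr>)"
  using N by (intro reach_step) (simp add: step_def set_reg_def fits_bound)
 then show ?case by (intro exI[of _ "(reg S)(d := c)"]) (auto simp: fun_upd_def)
next
 case (V x)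
 then show ?case by (intro exI[of _ "reg S"]) auto
next
 case (Bin f a b)
 let ?la = "length (code_exp a d)" and ?lb = "length (code_exp b (Suc d))"
 obtain R1 where 1: "reach w prog S ?la (S\<lparr>reg := R1, pc := pc S + ?la\<rparr>)"
   "R1 (operand a d) = aval R a" "\<forall>x<d. R1 x = reg S x"
  using Bin.IH(1)[of S d] Bin.prems by auto
 let ?S1 = "S\<lparr>reg := R1, pc := pc S + ?la\<rparr>"
 have "\<exists>R'. reach w prog ?S1 ?lb (?S1\<lparr>reg := R', pc := pc ?S1 + ?lb\<rparr>) \<and>
   R' (operand b (Suc d)) = aval R b \<and> (\<forall>x<Suc d. R' x = reg ?S1 x)"
  using Bin.prems 1 by (intro Bin.IH(2)) auto
 then obtain R2 where 2: "reach w prog ?S1 ?lb (S\<lparr>reg := R2, pc := pc S + ?la + ?lb\<rparr>)"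
   "R2 (operand b (Suc d)) = aval R b" "\<forall>x<Suc d. R2 x = R1 x"
  by auto
 \<comment> \<open>The left value sits in register \<open>d\<close> or in a variable register, both
   below the stack of the right operand.\<close>
 have "operand a d < Suc d"
  using Bin.prems(3) by (cases a) auto
 then have a: "R2 (operand a d) = aval R a"
  using 1 2 by auto
 let ?v = "binop f (aval R a) (aval R b)"
 let ?R3 = "R2(d := ?v)"
 let ?S2 = "S\<lparr>reg := R2, pc := pc S + ?la + ?lb\<rparr>"
 have "reach w prog ?S2 (Suc 0) (S\<lparr>reg := ?R3, pc := Suc (pc S + ?la + ?lb)\<rparr>)"
  using Bin.prems a 2(2)
  by (intro reach_step) (simp add: step_def set_reg_def fits_bound alu_binop)
 from reach_trans[OF 1(1) reach_trans[OF 2(1) this]]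
 show ?case
  using 1 2 by (intro exI[of _ ?R3]) (auto simp: add.assoc fun_upd_def)
qed

lemma operand_le: "vars_exp e \<subseteq> {..<d} \<Longrightarrow> operand e d \<le> d"
 by (cases e) auto

lemma code_exp2_correct:
 assumes "safe B R e" "safe B R e'"
  "code_at prog (pc S) (code_exp e d @ code_exp e' (Suc d))"
  "vars_exp e \<subseteq> {..<d}" "vars_exp e' \<subseteq> {..<d}" "\<forall>x<d. reg S x = R x"
 shows "\<exists>R'. reach w prog S (length (code_exp e d @ code_exp e' (Suc d)))
   (S\<lparr>reg := R', pc := pc S + length (code_exp e d @ code_exp e' (Suc d))\<rparr>) \<and>
  R' (operand e d) = aval R e \<and> R' (operand e' (Suc d)) = aval R e' \<and>
  (\<forall>x<d. R' x = R x)"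
proof -
 let ?la = "length (code_exp e d)" and ?lb = "length (code_exp e' (Suc d))"
 obtain R1 where 1: "reach w prog S ?la (S\<lparr>reg := R1, pc := pc S + ?la\<rparr>)"
   "R1 (operand e d) = aval R e" "\<forall>x<d. R1 x = reg S x"
  using code_exp_correct[of R e prog S d] assms by auto
 let ?S1 = "S\<lparr>reg := R1, pc := pc S + ?la\<rparr>"
 have "\<exists>R'. reach w prog ?S1 ?lb (?S1\<lparr>reg := R', pc := pc ?S1 + ?lb\<rparr>) \<and>
   R' (operand e' (Suc d)) = aval R e' \<and> (\<forall>x<Suc d. R' x = reg ?S1 x)"
  using assms 1 by (intro code_exp_correct) auto
 then obtain R2 where 2: "reach w prog ?S1 ?lb (S\<lparr>reg := R2, pc := pc S + ?la + ?lb\<rparr>)"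
   "R2 (operand e' (Suc d)) = aval R e'" "\<forall>x<Suc d. R2 x = R1 x"
  by auto
 show ?thesis
  using reach_trans[OF 1(1) 2(1)] 1 2 operand_le[OF assms(4)] assms(6)
  by (intro exI[of _ R2]) (auto simp: add.assoc less_Suc_eq_le)
qed

lemma test_code_correct:
 assumes "safe_test B R b" "code_at prog (pc S) (code_test b d @ [branch b d l])"
  "vars_test b \<subseteq> {..<d}" "\<forall>x<d. reg S x = R x"
 shows "\<exists>R'. reach w prog S (length (code_test b d) + 1)
   (S\<lparr>reg := R', pc := (if test R b then l else pc S + length (code_test b d) + 1)\<rparr>) \<and>
  (\<forall>x<d. R' x = R x)"
proof (cases b)
 case (Lt e e')
 let ?n = "length (code_exp e d @ code_exp e' (Suc d))"
 obtain R' where *: "reach w prog S ?n (S\<lparr>reg := R', pc := pc S + ?n\<rparr>)"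
   "R' (operand e d) = aval R e" "R' (operand e' (Suc d)) = aval R e'" "\<forall>x<d. R' x = R x"
  using code_exp2_correct[of R e e' prog S d] assms Lt by auto
 have "reach w prog (S\<lparr>reg := R', pc := pc S + ?n\<rparr>) (Suc 0)
   (S\<lparr>reg := R', pc := (if test R b then l else pc S + length (code_test b d) + 1)\<rparr>)"
  using assms Lt * by (intro reach_step) (auto simp: step_def jump_def add.assoc)
 from reach_trans[OF *(1) this] show ?thesis
  using *(4) Lt by (intro exI[of _ R']) auto
next
 case (Eq e e')
 let ?n = "length (code_exp e d @ code_exp e' (Suc d))"
 obtain R' where *: "reach w prog S ?n (S\<lparr>reg := R', pc := pc S + ?n\<rparr>)"
   "R' (operand e d) = aval R e" "R' (operand e' (Suc d)) = aval R e'" "\<forall>x<d. R' x = R x"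
  using code_exp2_correct[of R e e' prog S d] assms Eq by auto
 have "reach w prog (S\<lparr>reg := R', pc := pc S + ?n\<rparr>) (Suc 0)
   (S\<lparr>reg := R', pc := (if test R b then l else pc S + length (code_test b d) + 1)\<rparr>)"
  using assms Eq * by (intro reach_step) (auto simp: step_def jump_def add.assoc)
 from reach_trans[OF *(1) this] show ?thesis
  using *(4) Eq by (intro exI[of _ R']) auto
qed

text \<open>Scratch registers and the program counter are exactly what the source semantics does not
  see.\<close>

definition agree :: "nat \<Rightarrow> ram_state \<Rightarrow> ram_state \<Rightarrow> bool" where
 "agree d S s \<longleftrightarrow> (\<forall>x<d. reg S x = reg s x) \<and> mem S = mem s \<and> cells S = cells s \<and>
   printed S = printed s"

lemma reach_jump:
 assumes "pc S < length prog" "prog ! pc S = JumpEq d d l"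
 shows "reach w prog S (Suc 0) (S\<lparr>pc := l\<rparr>)"
 using assms by (intro reach_step) (simp add: step_def jump_def)

text \<open>A straight pass through the code executes every instruction at most once, and each loop
  iteration pays for one further pass; hence \<open>t + 1\<close> times the length of the code,
  which is a constant of the program.\<close>

lemma code_correct:
 assumes "big B c s t s'" "code_at prog (pc S) (code d c (pc S))" "vars c \<subseteq> {..<d}"
  "agree d S s"
 shows "\<exists>u S'. reach w prog S u S' \<and> u \<le> length (code d c (pc S)) * (t + 1) \<and>
  pc S' = pc S + length (code d c (pc S)) \<and> agree d S' s'"
 using assms
proof (induction arbitrary: S rule: big.induct)
 case (Skip s)
 then show ?case by (intro exI[of _ 0] exI[of _ S]) auto
next
 case (Assign s e x)
 let ?n = "length (code_exp e d)"
 obtain R1 where 1: "reach w prog S ?n (S\<lparr>reg := R1, pc := pc S + ?n\<rparr>)"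
   "R1 (operand e d) = aval (reg s) e" "\<forall>x<d. R1 x = reg S x"
  using code_exp_correct[of "reg s" e prog S d] Assign by (auto simp: agree_def)
 let ?R2 = "R1(Suc d := 0)"
 let ?R3 = "?R2(x := aval (reg s) e)"
 have 2: "reach w prog (S\<lparr>reg := R1, pc := pc S + ?n\<rparr>) (Suc 0)
   (S\<lparr>reg := ?R2, pc := Suc (pc S + ?n)\<rparr>)"
  using Assign B_pos by (intro reach_step) (simp add: step_def set_reg_def fits_bound)
 have "operand e d \<noteq> Suc d"
  using operand_le[of e d] Assign.prems by auto
 then have 3: "reach w prog (S\<lparr>reg := ?R2, pc := Suc (pc S + ?n)\<rparr>) (Suc 0)
   (S\<lparr>reg := ?R3, pc := Suc (Suc (pc S + ?n))\<rparr>)"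
  using Assign 1(2) by (intro reach_step) (simp add: step_def set_reg_def fits_bound)
 show ?case
  using reach_trans[OF 1(1) reach_trans[OF 2 3]] 1(3) Assign.prems
  by (intro exI[of _ "?n + (Suc 0 + Suc 0)"] exI conjI) (auto simp: agree_def)
next
 case (Get s e x)
 let ?n = "length (code_exp e d)"
 obtain R1 where 1: "reach w prog S ?n (S\<lparr>reg := R1, pc := pc S + ?n\<rparr>)"
   "R1 (operand e d) = aval (reg s) e" "\<forall>x<d. R1 x = reg S x"
  using code_exp_correct[of "reg s" e prog S d] Get by (auto simp: agree_def)
 let ?a = "nat (aval (reg s) e)"
 let ?S2 = "S\<lparr>reg := R1(x := mem s ?a), cells := max (cells s) (Suc ?a),
  pc := Suc (pc S + ?n)\<rparr>"
 have 2: "reach w prog (S\<lparr>reg := R1, pc := pc S + ?n\<rparr>) (Suc 0) ?S2"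
  using Get 1(2)
  by (intro reach_step) (simp add: step_def set_reg_def fits_bound agree_def touch_def Let_def)
 show ?case
  using reach_trans[OF 1(1) 2] 1(3) Get.prems
  by (intro exI[of _ "?n + Suc 0"] exI conjI) (auto simp: agree_def)
next
 case (Put s e e')
 let ?n = "length (code_exp e d @ code_exp e' (Suc d))"
 obtain R' where *: "reach w prog S ?n (S\<lparr>reg := R', pc := pc S + ?n\<rparr>)"
   "R' (operand e d) = aval (reg s) e" "R' (operand e' (Suc d)) = aval (reg s) e'"
   "\<forall>x<d. R' x = reg s x"
  using code_exp2_correct[of "reg s" e e' prog S d] Put by (auto simp: agree_def)
 let ?a = "nat (aval (reg s) e)"
 let ?S2 = "S\<lparr>reg := R', mem := (mem s)(?a := aval (reg s) e'),
  cells := max (cells s) (Suc ?a), pc := Suc (pc S + ?n)\<rparr>"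
 have 2: "reach w prog (S\<lparr>reg := R', pc := pc S + ?n\<rparr>) (Suc 0) ?S2"
  using Put *(2,3)
  by (intro reach_step)
    (simp add: step_def set_cell_def fits_bound agree_def touch_def add.assoc Let_def)
 show ?case
  using reach_trans[OF *(1) 2] *(4) Put.prems
  by (intro exI[of _ "?n + Suc 0"] exI conjI) (auto simp: agree_def)
next
 case (Print s e)
 let ?n = "length (code_exp e d)"
 obtain R1 where 1: "reach w prog S ?n (S\<lparr>reg := R1, pc := pc S + ?n\<rparr>)"
   "R1 (operand e d) = aval (reg s) e" "\<forall>x<d. R1 x = reg S x"
  using code_exp_correct[of "reg s" e prog S d] Print by (auto simp: agree_def)
 let ?S2 = "S\<lparr>reg := R1, printed := printed s @ [aval (reg s) e], pc := Suc (pc S + ?n)\<rparr>"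
 have 2: "reach w prog (S\<lparr>reg := R1, pc := pc S + ?n\<rparr>) (Suc 0) ?S2"
  using Print 1(2) by (intro reach_step) (simp add: step_def agree_def)
 show ?case
  using reach_trans[OF 1(1) 2] 1(3) Print.prems
  by (intro exI[of _ "?n + Suc 0"] exI conjI) (auto simp: agree_def)
next
 case (Seq c1 s t1 s' c2 t2 s'')
 let ?l1 = "length (code d c1 (pc S))"
 obtain u1 S1 where 1: "reach w prog S u1 S1" "u1 \<le> ?l1 * (t1 + 1)"
   "pc S1 = pc S + ?l1" "agree d S1 s'"
  using Seq.IH(1)[of S] Seq.prems by auto
 let ?l2 = "length (code d c2 (pc S1))"
 obtain u2 S2 where 2: "reach w prog S1 u2 S2" "u2 \<le> ?l2 * (t2 + 1)"
   "pc S2 = pc S1 + ?l2" "agree d S2 s''"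
  using Seq.IH(2)[of S1] Seq.prems 1 by auto
 have "u1 + u2 \<le> ?l1 * (t1 + t2 + 1) + ?l2 * (t1 + t2 + 1)"
  by (rule add_mono[OF order_trans[OF 1(2)] order_trans[OF 2(2)]]) auto
 then show ?case
  using reach_trans[OF 1(1) 2(1)] 1 2
  by (intro exI[of _ "u1 + u2"] exI[of _ S2]) (auto simp: algebra_simps)
next
 case (CondT s b c1 t s' c2)
 define l where "l = length (code_test b d)"
 define p2 where "p2 = pc S + l + 1"
 define l2 where "l2 = length (code d c2 p2)"
 define p1 where "p1 = p2 + l2 + 1"
 define l1 where "l1 = length (code d c1 p1)"
 have code: "code d (Cond b c1 c2) (pc S) =
   code_test b d @ [branch b d p1] @ code d c2 p2 @ [JumpEq d d (p1 + l1)] @ code d c1 p1"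
  by (simp add: Let_def p1_def p2_def l1_def l2_def l_def)
 obtain R1 where 1: "reach w prog S (l + 1) (S\<lparr>reg := R1, pc := p1\<rparr>)" "\<forall>x<d. R1 x = reg s x"
  using test_code_correct[of "reg s" b prog S d p1] CondT(1,2,4-) unfolding code
  by (auto simp: agree_def l_def)
 have "pc S + l + 1 + l2 + 1 = p1" by (simp add: p1_def p2_def)
 then have "code_at prog p1 (code d c1 p1)"
  using CondT.prems(1) unfolding code by (auto simp: p2_def l2_def l_def p1_def add_ac)
 then obtain u2 S2 where 2: "reach w prog (S\<lparr>reg := R1, pc := p1\<rparr>) u2 S2" "u2 \<le> l1 * (t + 1)"
   "pc S2 = p1 + l1" "agree d S2 s'"
  using CondT.IH[of "S\<lparr>reg := R1, pc := p1\<rparr>"] CondT.prems 1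
  by (auto simp: agree_def l1_def)
 have len: "length (code d (Cond b c1 c2) (pc S)) = l + l2 + l1 + 2"
  unfolding code by (simp add: l1_def l2_def l_def)
 show ?case
  using reach_trans[OF 1(1) 2(1)] 2 unfolding len
  by (intro exI[of _ "l + 1 + u2"] exI[of _ S2])
    (auto simp: algebra_simps p1_def p2_def)
next
 case (CondF s b c2 t s' c1)
 define l where "l = length (code_test b d)"
 define p2 where "p2 = pc S + l + 1"
 define l2 where "l2 = length (code d c2 p2)"
 define p1 where "p1 = p2 + l2 + 1"
 define l1 where "l1 = length (code d c1 p1)"
 have code: "code d (Cond b c1 c2) (pc S) =
   code_test b d @ [branch b d p1] @ code d c2 p2 @ [JumpEq d d (p1 + l1)] @ code d c1 p1"
  by (simp add: Let_def p1_def p2_def l1_def l2_def l_def)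
 obtain R1 where 1: "reach w prog S (l + 1) (S\<lparr>reg := R1, pc := p2\<rparr>)" "\<forall>x<d. R1 x = reg s x"
  using test_code_correct[of "reg s" b prog S d p1] CondF(1,2,4-) unfolding code
  by (auto simp: agree_def l_def p2_def)
 have "code_at prog p2 (code d c2 p2)"
  using CondF.prems(1) unfolding code by (auto simp: p2_def l2_def l_def p1_def add_ac)
 then obtain u2 S2 where 2: "reach w prog (S\<lparr>reg := R1, pc := p2\<rparr>) u2 S2" "u2 \<le> l2 * (t + 1)"
   "pc S2 = p2 + l2" "agree d S2 s'"
  using CondF.IH[of "S\<lparr>reg := R1, pc := p2\<rparr>"] CondF.prems 1
  by (auto simp: agree_def l2_def)
 have "reach w prog S2 (Suc 0) (S2\<lparr>pc := p1 + l1\<rparr>)"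
  using CondF.prems(1) 2(3) unfolding code
  by (intro reach_jump[of _ _ d]) (auto simp: p2_def l2_def l_def p1_def add_ac)
 note 3 = reach_trans[OF reach_trans[OF 1(1) 2(1)] this]
 have len: "length (code d (Cond b c1 c2) (pc S)) = l + l2 + l1 + 2"
  unfolding code by (simp add: l1_def l2_def l_def)
 show ?case
  using 3 2 unfolding len
  by (intro exI[of _ "l + 1 + u2 + Suc 0"] exI[of _ "S2\<lparr>pc := p1 + l1\<rparr>"])
    (auto simp: algebra_simps p1_def p2_def agree_def)
next
 case (LoopF s b c)
 define l where "l = length (code_test b d)"
 define p1 where "p1 = pc S + l + 2"
 define l1 where "l1 = length (code d c p1)"
 have code: "code d (Loop b c) (pc S) =
   code_test b d @ [branch b d p1] @ [JumpEq d d (p1 + l1 + 1)] @ code d c p1 @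
    [JumpEq d d (pc S)]"
  by (simp add: Let_def p1_def l1_def l_def)
 obtain R1 where 1: "reach w prog S (l + 1) (S\<lparr>reg := R1, pc := pc S + l + 1\<rparr>)"
   "\<forall>x<d. R1 x = reg s x"
  using test_code_correct[of "reg s" b prog S d p1] LoopF unfolding code
  by (auto simp: agree_def l_def)
 have "reach w prog (S\<lparr>reg := R1, pc := pc S + l + 1\<rparr>) (Suc 0)
   ((S\<lparr>reg := R1, pc := pc S + l + 1\<rparr>)\<lparr>pc := p1 + l1 + 1\<rparr>)"
  using LoopF.prems(1) unfolding code
  by (intro reach_jump[of _ _ d]) (auto simp: p1_def l_def l1_def)
 note 3 = reach_trans[OF 1(1) this]
 have len: "length (code d (Loop b c) (pc S)) = l + l1 + 3"
  unfolding code by (simp add: l1_def l_def)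
 show ?case
  using 3 1(2) LoopF.prems(3) unfolding len
  by (intro exI[of _ "l + 1 + Suc 0"]
     exI[of _ "S\<lparr>reg := R1, pc := p1 + l1 + 1\<rparr>"]) (auto simp: p1_def agree_def)
next
 case (LoopT s b c t1 s' t2 s'')
 define l where "l = length (code_test b d)"
 define p1 where "p1 = pc S + l + 2"
 define l1 where "l1 = length (code d c p1)"
 have code: "code d (Loop b c) (pc S) =
   code_test b d @ [branch b d p1] @ [JumpEq d d (p1 + l1 + 1)] @ code d c p1 @
    [JumpEq d d (pc S)]"
  by (simp add: Let_def p1_def l1_def l_def)
 obtain R1 where 1: "reach w prog S (l + 1) (S\<lparr>reg := R1, pc := p1\<rparr>)" "\<forall>x<d. R1 x = reg s x"
  using test_code_correct[of "reg s" b prog S d p1] LoopT(1,2,5-) unfolding code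
  by (auto simp: agree_def l_def)
 have "code_at prog p1 (code d c p1)"
  using LoopT.prems(1) unfolding code by (auto simp: p1_def l_def)
 then obtain u2 S2 where 2: "reach w prog (S\<lparr>reg := R1, pc := p1\<rparr>) u2 S2" "u2 \<le> l1 * (t1 + 1)"
   "pc S2 = p1 + l1" "agree d S2 s'"
  using LoopT.IH(1)[of "S\<lparr>reg := R1, pc := p1\<rparr>"] LoopT.prems 1
  by (auto simp: agree_def l1_def)
 let ?S3 = "S2\<lparr>pc := pc S\<rparr>"
 have "reach w prog S2 (Suc 0) ?S3"
  using LoopT.prems(1) 2(3) unfolding code
  by (intro reach_jump[of _ _ d]) (auto simp: p1_def l_def l1_def add_ac)
 note 3 = reach_trans[OF reach_trans[OF 1(1) 2(1)] this]
 obtain u4 S4 where 4: "reach w prog ?S3 u4 S4"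
   "u4 \<le> length (code d (Loop b c) (pc S)) * (t2 + 1)"
   "pc S4 = pc S + length (code d (Loop b c) (pc S))" "agree d S4 s''"
  using LoopT.IH(2)[of ?S3] LoopT.prems 2(4) by (auto simp: agree_def)
 have len: "length (code d (Loop b c) (pc S)) = l + l1 + 3"
  unfolding code by (simp add: l1_def l_def)
 \<comment> \<open>Together this is \<open>t1 + t2 + 2\<close> times the length; the iteration just
   executed accounts for the extra unit.\<close>
 have "l + 1 + u2 + Suc 0 + u4 \<le> (l + l1 + 3) * (t1 + 1) + (l + l1 + 3) * (t2 + 1)"
  using 2(2) 4(2) unfolding len by (auto simp: algebra_simps)
 then show ?case
  using reach_trans[OF 3 4(1)] 4 unfolding len
  by (intro exI[of _ "l + 1 + u2 + Suc 0 + u4"] exI[of _ S4]) (auto simp: algebra_simps)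
qed

end

subsection \<open>Weakest preconditions\<close>

text \<open>Total correctness: some terminating execution within the value bound satisfies
  \<open>Q\<close>. The postcondition also receives the iteration count, so one verification yields
  both function and running time.\<close>

definition wp :: "int \<Rightarrow> com \<Rightarrow> (nat \<Rightarrow> ram_state \<Rightarrow> bool) \<Rightarrow> ram_state \<Rightarrow> bool" where
 "wp B c Q s \<longleftrightarrow> (\<exists>t s'. big B c s t s' \<and> Q t s')"

lemma wp_mono: "wp B c P s \<Longrightarrow> (\<And>t s'. P t s' \<Longrightarrow> Q t s') \<Longrightarrow> wp B c Q s"
 by (auto simp: wp_def)

inductive_cases big_SkipE: "big B Skip s t s'"
inductive_cases big_AssignE: "big B (Assign x e) s t s'"
inductive_cases big_GetE: "big B (Get x e) s t s'"
inductive_cases big_PutE: "big B (Put e e') s t s'"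
inductive_cases big_PrintE: "big B (Print e) s t s'"
inductive_cases big_SeqE: "big B (Seq c1 c2) s t s'"
inductive_cases big_CondE: "big B (Cond b c1 c2) s t s'"

lemma wp_Skip: "wp B Skip Q s \<longleftrightarrow> Q 0 s"
 by (auto simp: wp_def intro: big.Skip elim: big_SkipE)

lemma wp_Assign: "wp B (Assign x e) Q s \<longleftrightarrow> safe B (reg s) e \<and> \<bar>aval (reg s) e\<bar> < B \<and>
  Q 0 (s\<lparr>reg := (reg s)(x := aval (reg s) e)\<rparr>)"
 by (auto simp: wp_def intro: big.Assign elim: big_AssignE)

lemma wp_Get: "wp B (Get x e) Q s \<longleftrightarrow> safe B (reg s) e \<and> 0 \<le> aval (reg s) e \<and>
  \<bar>mem s (nat (aval (reg s) e))\<bar> < B \<and>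
  Q 0 (s\<lparr>reg := (reg s)(x := mem s (nat (aval (reg s) e))),
   cells := max (cells s) (Suc (nat (aval (reg s) e)))\<rparr>)"
 by (auto simp: wp_def intro: big.Get elim: big_GetE)

lemma wp_Put: "wp B (Put e e') Q s \<longleftrightarrow> safe B (reg s) e \<and> safe B (reg s) e' \<and>
  0 \<le> aval (reg s) e \<and> \<bar>aval (reg s) e'\<bar> < B \<and>
  Q 0 (s\<lparr>mem := (mem s)(nat (aval (reg s) e) := aval (reg s) e'),
   cells := max (cells s) (Suc (nat (aval (reg s) e)))\<rparr>)"
 by (auto simp: wp_def intro: big.Put elim: big_PutE)

lemma wp_Print: "wp B (Print e) Q s \<longleftrightarrow> safe B (reg s) e \<and>
  Q 0 (s\<lparr>printed := printed s @ [aval (reg s) e]\<rparr>)"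
 by (auto simp: wp_def intro: big.Print elim: big_PrintE)

lemma wp_Seq: "wp B (Seq c1 c2) Q s \<longleftrightarrow>
  wp B c1 (\<lambda>t1. wp B c2 (\<lambda>t2. Q (t1 + t2))) s"
 unfolding wp_def by (blast intro: big.Seq elim: big_SeqE)

lemma wp_Cond: "wp B (Cond b c1 c2) Q s \<longleftrightarrow> safe_test B (reg s) b \<and>
  (if test (reg s) b then wp B c1 Q s else wp B c2 Q s)"
 by (auto simp: wp_def intro: big.CondT big.CondF elim: big_CondE)

lemmas wp_simps = wp_Skip wp_Assign wp_Get wp_Put wp_Print wp_Seq wp_Cond

text \<open>The invariant sees the iterations spent so far, so time bounds are part of it; the
  measure \<open>f\<close> gives termination. The induction on \<open>f s\<close> goes through
  because the elapsed time is generalised.\<close>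

lemma wp_Loop:
 fixes f :: "ram_state \<Rightarrow> nat"
 assumes "I 0 s"
  and safe: "\<And>t s. I t s \<Longrightarrow> safe_test B (reg s) b"
  and step: "\<And>t s. I t s \<Longrightarrow> test (reg s) b \<Longrightarrow>
   wp B c (\<lambda>t' s'. I (Suc (t + t')) s' \<and> f s' < f s) s"
  and exit: "\<And>t s. I t s \<Longrightarrow> \<not> test (reg s) b \<Longrightarrow> Q t s"
 shows "wp B (Loop b c) Q s"
proof -
 have "\<exists>t' s'. big B (Loop b c) s t' s' \<and> Q (t + t') s'" if "I t s" for t s
  using that
 proof (induction "f s" arbitrary: t s rule: less_induct)
  case less
  show ?case
  proof (cases "test (reg s) b")
   case True
   with step[OF less.prems] obtain t1 s1 where
    1: "big B c s t1 s1" "I (Suc (t + t1)) s1" "f s1 < f s"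
    by (auto simp: wp_def)
   from less.hyps[OF 1(3,2)] obtain t2 s2 where
    2: "big B (Loop b c) s1 t2 s2" "Q (Suc (t + t1) + t2) s2" by blast
   have "big B (Loop b c) s (Suc (t1 + t2)) s2"
    using safe[OF less.prems] True 1(1) 2(1) by (rule big.LoopT)
   then show ?thesis using 2(2) by (intro exI[of _ "Suc (t1 + t2)"] exI[of _ s2]) (simp add: add_ac)
  next
   case False
   then show ?thesis
    using exit[OF less.prems] safe[OF less.prems]
    by (intro exI[of _ 0] exI[of _ s]) (auto intro: big.LoopF)
  qed
 qed
 from this[OF assms(1)] show ?thesis by (simp add: wp_def)
qed

section \<open>The pseudosquare primality test\<close>

lemma Legendre_cases: "Legendre a p \<in> {-1, 0, 1}"
 by (auto simp: Legendre_def)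

lemma Legendre_eq_0_iff: "Legendre a p = 0 \<longleftrightarrow> p dvd a"
 by (auto simp: Legendre_def cong_0_iff)

text \<open>Turns congruences supplied by Euler's criterion into equations between symbols: two
  numbers of absolute value at most 1 differ by at most 2, less than the modulus.\<close>

lemma Legendre_cong_imp_eq:
 assumes "2 < (p::int)" "\<bar>a\<bar> \<le> 1" "\<bar>b\<bar> \<le> 1" "[a = b] (mod p)"
 shows "a = b"
proof -
 have "p dvd (a - b)" using assms(4) by (simp add: cong_iff_dvd_diff)
 moreover have "\<bar>a - b\<bar> < p" using assms by linarith
 ultimately show ?thesis
  using zdvd_not_zless[of "\<bar>a - b\<bar>" p] by (cases "a = b") auto
qed

lemma Legendre_abs_le: "\<bar>Legendre a p\<bar> \<le> 1"
 by (simp add: Legendre_def)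

lemma Legendre_mult:
 assumes "prime p" "2 < p"
 shows "Legendre (a * b) (int p) = Legendre a (int p) * Legendre b (int p)"
proof (rule Legendre_cong_imp_eq[of "int p"])
 have "[Legendre (a * b) p = (a * b) ^ ((p - 1) div 2)] (mod p)"
  by (rule euler_criterion[OF assms])
 also have "(a * b) ^ ((p - 1) div 2) = a ^ ((p - 1) div 2) * b ^ ((p - 1) div 2)"
  by (rule power_mult_distrib)
 also have "[a ^ ((p - 1) div 2) * b ^ ((p - 1) div 2) = Legendre a p * Legendre b p] (mod p)"
  by (intro cong_mult cong_sym[OF euler_criterion[OF assms]])
 finally show "[Legendre (a * b) p = Legendre a p * Legendre b p] (mod p)" .
 show "\<bar>Legendre a p * Legendre b p\<bar> \<le> 1"
  using Legendre_abs_le[of a p] Legendre_abs_le[of b p]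
  by (simp add: abs_mult mult_le_one)
qed (use assms Legendre_abs_le in auto)

text \<open>Gauss's lemma. Doubling the numbers up to \<open>h = (p - 1) / 2\<close> gives residues
  below \<open>p\<close> without any reduction, so the ones exceeding \<open>h\<close> come from the
  \<open>h - h div 2\<close> numbers above \<open>h div 2\<close>; the parity of this count depends
  on \<open>p mod 8\<close>.\<close>

lemma Legendre_2:
 assumes "prime p" "2 < p"
 shows "Legendre 2 (int p) = (if p mod 8 = 1 \<or> p mod 8 = 7 then 1 else -1)"
proof -
 have odd: "odd p" using assms prime_odd_nat by simp
 interpret G: GAUSS p 2
  using assms by unfold_locales (auto simp: cong_0_iff dest: zdvd_imp_le)
 define h where "h = (int p - 1) div 2"
 have p: "int p = 2 * h + 1" unfolding h_def using odd by presburger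
 have "G.C = (\<lambda>x. 2 * x) ` {0<..h}"
  unfolding G.C_def G.B_def G.A_def h_def[symmetric] image_image
  by (intro image_cong) (auto simp: p)
 then have "G.E = (\<lambda>x. 2 * x) ` {h div 2<..h}"
  unfolding G.E_def h_def[symmetric] by auto
 then have "card G.E = nat (h - h div 2)"
  by (simp add: card_image inj_on_def)
 then have L: "Legendre 2 p = (-1) ^ nat (h - h div 2)"
  using G.gauss_lemma by simp
 define j where "j = p div 8"
 have "(h = 4 * int j \<and> p mod 8 = 1) \<or> (h = 4 * int j + 1 \<and> p mod 8 = 3) \<or>
   (h = 4 * int j + 2 \<and> p mod 8 = 5) \<or> (h = 4 * int j + 3 \<and> p mod 8 = 7)"
  unfolding h_def j_def using odd by presburger
 then consider "h = 4 * int j" "p mod 8 = 1" | "h = 4 * int j + 1" "p mod 8 = 3"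
  | "h = 4 * int j + 2" "p mod 8 = 5" | "h = 4 * int j + 3" "p mod 8 = 7"
  by blast
 then show ?thesis
 proof cases
  case 1 then have "h - h div 2 = 2 * int j" by presburger
  also have "\<dots> = int (2 * j)" by simp
  finally have "nat (h - h div 2) = 2 * j" by (simp only: nat_int)
  then have "Legendre 2 p = (-1) ^ (2 * j)" using L by metis
  then show ?thesis using 1(2) by (simp add: power_mult)
 next
  case 2 then have "h - h div 2 = 1 + 2 * int j" by presburger
  also have "\<dots> = int (1 + 2 * j)" by simp
  finally have "nat (h - h div 2) = 1 + 2 * j" by (simp only: nat_int)
  then have "Legendre 2 p = (-1) ^ (1 + 2 * j)" using L by metis
  then show ?thesis using 2(2) by (simp add: power_mult)
 next
  case 3 then have "h - h div 2 = 1 + 2 * int j" by presburger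
  also have "\<dots> = int (1 + 2 * j)" by simp
  finally have "nat (h - h div 2) = 1 + 2 * j" by (simp only: nat_int)
  then have "Legendre 2 p = (-1) ^ (1 + 2 * j)" using L by metis
  then show ?thesis using 3(2) by (simp add: power_mult)
 next
  case 4 then have "h - h div 2 = 2 * (int j + 1)" by presburger
  also have "\<dots> = int (2 * (j + 1))" by simp
  finally have "nat (h - h div 2) = 2 * (j + 1)" by (simp only: nat_int)
  then have "Legendre 2 p = (-1) ^ (2 * (j + 1))" using L by metis
  then show ?thesis using 4(2) by (simp add: power_mult)
 qed
qed

lemma Legendre_reciprocity_1_mod_4:
 assumes "prime p" "2 < p" "prime q" "2 < q" "p \<noteq> q" "p mod 4 = 1"
 shows "Legendre (int p) (int q) = Legendre (int q) (int p)"
proof -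
 have "even ((p - 1) div 2)" using assms(6) by presburger
 then have "Legendre p q * Legendre q p = 1"
  using Quadratic_Reciprocity[OF assms(1-5)] by simp
 then show ?thesis
  using Legendre_cases[of p q] Legendre_cases[of q p] by auto
qed

section \<open>Least nonresidues and soundness of the test\<close>

text \<open>Symbol 0 counts as failure too, so prime divisors of \<open>L\<close> qualify and the
  minimum exists for every odd \<open>L > 1\<close>. For nonsquare \<open>L\<close> congruent to 1
  modulo 8 it measures how long \<open>L\<close> imitates a square.\<close>

definition least_nonresidue :: "nat \<Rightarrow> nat" where
 "least_nonresidue L = (LEAST q. prime q \<and> odd q \<and> Legendre (int L) (int q) \<noteq> 1)"

lemma least_nonresidue:
 assumes "1 < L" "odd L"
 shows "prime (least_nonresidue L)" "odd (least_nonresidue L)"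
  "Legendre (int L) (int (least_nonresidue L)) \<noteq> 1" "least_nonresidue L \<le> L"
proof -
 obtain q where q: "prime q" "q dvd L" using assms(1) prime_factor_nat[of L] by auto
 have "odd q" using q(2) assms(2) by (meson dvd_trans)
 moreover have "Legendre (int L) (int q) \<noteq> 1"
  using q Legendre_eq_0_iff[of "int L" "int q"] by simp
 ultimately have *: "prime q \<and> odd q \<and> Legendre (int L) (int q) \<noteq> 1" using q by simp
 from LeastI[of "\<lambda>q. prime q \<and> odd q \<and> Legendre (int L) (int q) \<noteq> 1", OF *]
 show "prime (least_nonresidue L)" "odd (least_nonresidue L)"
  "Legendre (int L) (int (least_nonresidue L)) \<noteq> 1"
  by (auto simp: least_nonresidue_def)
 have "least_nonresidue L \<le> q"
  unfolding least_nonresidue_def by (rule Least_le) (rule *)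
 also have "q \<le> L" using q assms by (simp add: dvd_imp_le)
 finally show "least_nonresidue L \<le> L" .
qed

lemma least_nonresidue_le:
 "prime q \<Longrightarrow> odd q \<Longrightarrow> Legendre (int L) (int q) \<noteq> 1 \<Longrightarrow> least_nonresidue L \<le> q"
 unfolding least_nonresidue_def by (rule Least_le) simp

text \<open>A base with value \<open>-1\<close> forces the full power of two in \<open>m - 1\<close> to divide \<open>R - 1\<close>.\<close>

lemma two_power_dvd_prime_minus_1:
 fixes R g s t :: nat
 assumes "prime R" "2 < R" "[int g ^ (2 ^ s * t) = -1] (mod int R)"
 shows "2 ^ Suc s dvd R - 1"
proof -
 let ?h = "g ^ t"
 have h: "[int ?h ^ (2 ^ s) = -1] (mod int R)"
  using assms(3) by (simp add: power_mult[symmetric] mult.commute)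
 have neq: "\<not> [(-1::int) = 1] (mod int R)"
  using Legendre_cong_imp_eq[of "int R" "-1" 1] assms(2) by auto
 have "[(int ?h ^ (2 ^ s))^2 = (-1)^2] (mod int R)" using h by (rule cong_pow)
 then have "[int (?h ^ (2 ^ Suc s)) = int 1] (mod int R)"
  by (simp add: power_mult[symmetric] mult_ac)
 then have 1: "[?h ^ (2 ^ Suc s) = 1] (mod R)" by (simp only: cong_int_iff)
 then have ord: "ord R ?h dvd 2 ^ Suc s" by (simp only: ord_divides)
 then obtain i where i: "i \<le> Suc s" "ord R ?h = 2 ^ i"
  using divides_primepow_nat[of 2 "ord R ?h" "Suc s"] by auto
 \<comment> \<open>The order of \<open>g^t\<close> divides \<open>2^(s+1)\<close>, but the
   \<open>2^s\<close>-th power of \<open>g^t\<close> is -1 and not 1.\<close>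
 have "i = Suc s"
 proof (rule ccontr)
  assume "i \<noteq> Suc s"
  then have "ord R ?h dvd 2 ^ s" using i by (simp add: le_imp_power_dvd)
  then have "[?h ^ (2 ^ s) = 1] (mod R)" by (simp only: ord_divides)
  then have "[int (?h ^ (2 ^ s)) = int 1] (mod int R)" by (simp only: cong_int_iff)
  then show False using h neq cong_trans cong_sym by (metis of_nat_1 of_nat_power)
 qed
 moreover have "ord R ?h dvd R - 1"
 proof -
  have "coprime R ?h"
  proof -
   have "[?h ^ (2 ^ Suc s) = 1] (mod R)" by (rule 1)
   then have "coprime (?h ^ (2 ^ Suc s)) R"
    using cong_imp_coprime cong_sym coprime_1_left by blast
   then show ?thesis by (simp add: coprime_commute)
  qed
  then have "[?h ^ (R - 1) = 1] (mod R)"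
   using fermat_theorem[of R ?h] assms(1)
   by (metis coprime_common_divisor_nat dvd_refl not_prime_unit nat_dvd_1_iff_1)
  then show ?thesis by (simp only: ord_divides)
 qed
 ultimately show ?thesis using i by simp
qed

text \<open>As \<open>(R - 1) / 2 = 2^s * u\<close>, the Euler power of \<open>q\<close> raised to
  \<open>t\<close> is the given power raised to \<open>u\<close>; the odd exponent \<open>t\<close>
  does not change a symbol.\<close>

lemma Legendre_from_power:
 fixes R q s t u :: nat and \<epsilon> :: int
 assumes "prime R" "2 < R" "[int q ^ (2 ^ s * t) = \<epsilon>] (mod int R)" "\<epsilon> \<in> {1, -1}"
  "odd t" "R - 1 = 2 ^ Suc s * u"
 shows "Legendre (int q) (int R) = \<epsilon> ^ u"
proof (rule Legendre_cong_imp_eq[of "int R"])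
 have half: "(R - 1) div 2 = 2 ^ s * u" using assms(6) by simp
 have eps: "\<epsilon> \<noteq> 0" "\<bar>\<epsilon>\<bar> \<le> 1" using assms(4) by auto
 have "Legendre (int q) R \<noteq> 0"
 proof
  assume "Legendre (int q) R = 0"
  then have "R dvd q" by (simp add: Legendre_eq_0_iff)
  then have "int R dvd int q ^ (2 ^ s * t)"
   using odd_pos[OF \<open>odd t\<close>] dvd_trans[OF _ dvd_power[of "2 ^ s * t" "int q"]] by simp
  then have "[\<epsilon> = 0] (mod int R)" using assms(3) by (metis cong_0_iff cong_sym cong_trans)
  then show False using Legendre_cong_imp_eq[of "int R" \<epsilon> 0] eps assms(2) by auto
 qed
 then have Lt: "Legendre (int q) R ^ t = Legendre (int q) R"
  using Legendre_cases[of q R] \<open>odd t\<close> by auto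
 have "[Legendre (int q) R ^ t = (int q ^ (2 ^ s * u)) ^ t] (mod R)"
  using euler_criterion[OF assms(1,2), of "int q"] unfolding half by (rule cong_pow)
 also have "(int q ^ (2 ^ s * u)) ^ t = (int q ^ (2 ^ s * t)) ^ u"
  by (simp add: power_mult[symmetric] mult_ac)
 also have "[(int q ^ (2 ^ s * t)) ^ u = \<epsilon> ^ u] (mod R)"
  using assms(3) by (rule cong_pow)
 finally show "[Legendre (int q) R = \<epsilon> ^ u] (mod R)" unfolding Lt .
 show "\<bar>\<epsilon> ^ u\<bar> \<le> 1" using eps by (simp add: power_abs power_le_one)
qed (use assms Legendre_abs_le in auto)

text \<open>The complementary divisor is above 1 and therefore has a prime factor above
  \<open>y\<close>. This confines the offending divisors in the test to
  \<open>n div y\<close>.\<close>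

lemma rough_cofactor:
 fixes m L y :: nat
 assumes "\<And>q. prime q \<Longrightarrow> q dvd m \<Longrightarrow> y < q" "L dvd m" "L \<noteq> m" "0 < m" "m \<le> n" "0 < y"
 shows "L \<le> n div y"
proof -
 obtain c where c: "m = L * c" using assms(2) by blast
 then have "c \<noteq> 1" "c \<noteq> 0" using assms by auto
 then obtain q where q: "prime q" "q dvd c" using prime_factor_nat by blast
 then have "y < q" using assms(1)[of q] c by auto
 also have "q \<le> c" using q \<open>c \<noteq> 0\<close> by (simp add: dvd_imp_le)
 finally have "L * y \<le> n" using c assms(5) by (metis less_imp_le mult_le_mono2 order_trans)
 then show ?thesis using assms(6) by (simp add: less_eq_div_iff_mult_less_eq)
qed

lemma mod_minus_1_cong:
 fixes m v R :: nat
 assumes "v mod m = m - 1" "R dvd m" "0 < m"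
 shows "[int v = -1] (mod int R)"
proof -
 have "v + 1 = m * (v div m) + m"
  using div_mult_mod_eq[of v m] assms by (simp add: mult.commute)
 then have "m dvd v + 1" by simp
 then have "R dvd v + 1" using assms(2) dvd_trans by blast
 then have "int R dvd int (v + 1)" by presburger
 then show ?thesis by (simp add: cong_iff_dvd_diff add.commute)
qed

lemma mod_m_pm1_cong:
 fixes m v R :: nat
 assumes "v mod m \<in> {1, m - 1}" "R dvd m" "0 < m"
 shows "\<exists>\<epsilon>\<in>{1, -1::int}. [int v = \<epsilon>] (mod int R)"
proof (cases "v mod m = 1")
 case True
 then have "v = m * (v div m) + 1" using div_mult_mod_eq[of v m] by (simp add: mult.commute)
 then have "int v = int m * int (v div m) + 1" by (metis of_nat_1 of_nat_add of_nat_mult)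
 then have "int v - 1 = int m * int (v div m)" by simp
 then have "int m dvd int v - 1" by simp
 then have "int R dvd int v - 1" using assms(2) by (metis dvd_trans int_dvd_int_iff)
 then show ?thesis by (auto simp: cong_iff_dvd_diff)
next
 case False
 then show ?thesis using mod_minus_1_cong[of v m R] assms by auto
qed

text \<open>Write \<open>m - 1 = 2^(s+1) * t\<close> with \<open>t\<close> odd. The base
  \<open>q0\<close> forces \<open>R - 1 = 2^(s+1) * u\<close> for every prime factor
  \<open>R\<close>, and the symbol of a small \<open>q\<close> modulo \<open>R\<close> is a sign
  depending only on \<open>q\<close>, raised to \<open>u\<close>. If \<open>u\<close> is even, all
  small primes are residues modulo \<open>R\<close>; if \<open>u\<close> is odd for two prime
  factors, all small primes have equal symbols modulo both. So either \<open>R\<close> or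
  \<open>R1 * R2\<close> is a pseudosquare candidate up to \<open>n div y\<close> whose least
  nonresidue is too large. What remains is a prime power, whose exponent is at most \<open>K\<close>
  since its prime exceeds \<open>y\<close>.\<close>

theorem pseudosquare_test_sound:
 fixes m y K n b q0 :: nat
 assumes m: "1 < m" "odd m" "m \<le> n" "n \<le> y ^ K" "0 < y"
  and rough: "\<And>q. prime q \<Longrightarrow> q dvd m \<Longrightarrow> y < q"
  and no_power: "\<And>e a. 2 \<le> e \<Longrightarrow> e \<le> K \<Longrightarrow> m \<noteq> a ^ e"
  and b: "2 \<le> b" "\<And>L. 1 < L \<Longrightarrow> L \<le> n div y \<Longrightarrow> \<not> is_square L \<Longrightarrow> L mod 8 = 1 \<Longrightarrow>
   least_nonresidue L \<le> b"
  and q0: "q0 ^ ((m - 1) div 2) mod m = m - 1"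
  and bases: "\<And>q. 2 \<le> q \<Longrightarrow> q \<le> b \<Longrightarrow> q < m \<Longrightarrow> q ^ ((m - 1) div 2) mod m \<in> {1, m - 1}"
 shows "prime m"
proof (rule ccontr)
 assume np: "\<not> prime m"
 have "m - 1 \<noteq> 0" "even (m - 1)" using m by auto
 then obtain s' t where st': "m - 1 = 2 ^ s' * t" "odd t"
  using multiplicity_decompose'[of "m - 1" 2] by (metis nat_dvd_1_iff_1 numeral_eq_one_iff semiring_norm(85))
 with \<open>even (m - 1)\<close> obtain s where s: "s' = Suc s" by (cases s') auto
 note st = st'[unfolded s]
 have half: "(m - 1) div 2 = 2 ^ s * t" using st by simp
 have R: "2 < R" "R < m" "R \<le> n div y" "y < R" if "prime R" "R dvd m" for R
 proof -
  show "2 < R" using that m prime_ge_2_nat[of R] by (cases "R = 2") auto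
  have "R \<noteq> m" using that np by auto
  then show "R < m" using that m by (simp add: dvd_imp_le le_neq_implies_less)
  show "R \<le> n div y" using rough_cofactor[OF rough that(2) \<open>R \<noteq> m\<close>] m by auto
  show "y < R" using rough that by auto
 qed
 \<comment> \<open>Otherwise some prime factor \<open>R\<close> of \<open>m\<close> is itself one of
   the bases; its Euler power is divisible by \<open>R\<close> and cannot be 1 or -1 modulo
   \<open>R\<close>.\<close>
 have big_m: "b < m"
 proof (rule ccontr)
  assume "\<not> b < m"
  obtain R where r: "prime R" "R dvd m" using m prime_factor_nat[of m] by auto
  have "R ^ ((m - 1) div 2) mod m \<in> {1, m - 1}"
   using bases[of R] R[OF r] \<open>\<not> b < m\<close> by auto
  then obtain \<epsilon> where e: "\<epsilon> \<in> {1, -1::int}" "[int (R ^ ((m - 1) div 2)) = \<epsilon>] (mod int R)"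
   using mod_m_pm1_cong[of "R ^ ((m - 1) div 2)" m R] r m by auto
  have "Legendre (int R) (int R) = \<epsilon> ^ ((R - 1) div 2 ^ Suc s)" if "2 ^ Suc s dvd R - 1"
   using Legendre_from_power[of R R s t \<epsilon>] R[OF r] r e st that unfolding half by auto
  moreover have "[int (q0 ^ (2 ^ s * t)) = -1] (mod int R)"
   using mod_minus_1_cong[of "q0 ^ (2 ^ s * t)" m R] q0 half r m by simp
  ultimately have "Legendre (int R) (int R) \<noteq> 0"
   using two_power_dvd_prime_minus_1[of R q0 s t] R[OF r] r e by auto
  then show False by (simp add: Legendre_eq_0_iff)
 qed
 have u: "\<exists>u. R - 1 = 2 ^ Suc s * u" if "prime R" "R dvd m" for R
 proof -
  have "[int q0 ^ (2 ^ s * t) = -1] (mod int R)"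
   using mod_minus_1_cong[of "q0 ^ (2 ^ s * t)" m R] q0 half that m by simp
  then show ?thesis using two_power_dvd_prime_minus_1[of R q0 s t] R that by (auto elim: dvdE)
 qed
 \<comment> \<open>The sign is read off modulo \<open>m\<close>, so one choice serves all prime
   factors at once; this is what ties different factors together.\<close>
 have "\<exists>\<epsilon>. \<forall>q. 2 \<le> q \<and> q \<le> b \<longrightarrow> \<epsilon> q \<in> {1, -1::int} \<and>
   (\<forall>R. prime R \<and> R dvd m \<longrightarrow> [int q ^ (2 ^ s * t) = \<epsilon> q] (mod int R))"
 proof (rule choice, rule allI)
  fix q
  show "\<exists>e. 2 \<le> q \<and> q \<le> b \<longrightarrow> e \<in> {1, -1::int} \<and>
   (\<forall>R. prime R \<and> R dvd m \<longrightarrow> [int q ^ (2 ^ s * t) = e] (mod int R))"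
  proof (cases "2 \<le> q \<and> q \<le> b")
   case True
   then have "q ^ (2 ^ s * t) mod m \<in> {1, m - 1}" using bases[of q] big_m half by auto
   then obtain e where e: "e \<in> {1, -1::int}" "[int (q ^ (2 ^ s * t)) = e] (mod int m)"
    using mod_m_pm1_cong[of "q ^ (2 ^ s * t)" m m] m by auto
   have "[int q ^ (2 ^ s * t) = e] (mod int R)" if "R dvd m" for R
    using cong_dvd_modulus[OF e(2), of "int R"] that by simp
   then show ?thesis using e(1) by blast
  qed auto
 qed
 then obtain \<epsilon> where \<epsilon>: "\<And>q. 2 \<le> q \<Longrightarrow> q \<le> b \<Longrightarrow> \<epsilon> q \<in> {1, -1::int}"
  "\<And>q R. 2 \<le> q \<Longrightarrow> q \<le> b \<Longrightarrow> prime R \<Longrightarrow> R dvd m \<Longrightarrow> [int q ^ (2 ^ s * t) = \<epsilon> q] (mod int R)"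
  by blast
 have Leg: "Legendre (int q) (int R) = \<epsilon> q ^ u"
  if "2 \<le> q" "q \<le> b" "prime R" "R dvd m" "R - 1 = 2 ^ Suc s * u" for q R u
  using Legendre_from_power[of R q s t "\<epsilon> q" u] R[OF that(3,4)] \<epsilon>[OF that(1,2)] that st by auto
 \<comment> \<open>An even \<open>u\<close> makes \<open>R\<close> congruent to 1 modulo 4, the
   symbol of 2 lifts this to modulo 8, and reciprocity turns small residues modulo \<open>R\<close>
   into \<open>R\<close> being a residue modulo each small odd prime.\<close>
 have no_even: "odd u" if r: "prime R" "R dvd m" "R - 1 = 2 ^ Suc s * u" for R u
 proof
  assume "even u"
  then obtain v where v: "u = 2 * v" by blast
  have L1: "Legendre (int q) (int R) = 1" if "2 \<le> q" "q \<le> b" for q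
   using Leg[OF that r] \<epsilon>(1)[OF that] \<open>even u\<close> by auto
  have "R = 4 * (2 ^ s * v) + 1" using r(3) v R[OF r(1,2)] by auto
  then have mod4: "R mod 4 = 1" by presburger
  have "Legendre 2 (int R) = 1" using L1[of 2] b(1) by simp
  then have "R mod 8 = 1 \<or> R mod 8 = 7"
   using Legendre_2[OF r(1)] R[OF r(1,2)] by (auto split: if_splits)
  then have mod8: "R mod 8 = 1" using mod4 by presburger
  have "\<not> is_square R" using r(1) by (auto simp: is_nth_power_def prime_power_iff)
  then have "least_nonresidue R \<le> b" using b(2)[of R] R[OF r(1,2)] mod8 by auto
  moreover have "odd R" using mod8 by presburger
  moreover note ln = least_nonresidue[of R]
  ultimately have q: "prime (least_nonresidue R)" "odd (least_nonresidue R)"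
   "Legendre (int R) (int (least_nonresidue R)) \<noteq> 1" "least_nonresidue R \<le> b"
   using R[OF r(1,2)] by auto
  have "2 < least_nonresidue R" using q(1,2) prime_ge_2_nat[OF q(1)]
   by (cases "least_nonresidue R = 2") auto
  moreover have "Legendre (int (least_nonresidue R)) (int R) = 1" using L1 q calculation by auto
  moreover have "least_nonresidue R \<noteq> R"
   using calculation(2) Legendre_eq_0_iff[of "int R" "int R"] by auto
  ultimately show False
   using Legendre_reciprocity_1_mod_4[of R "least_nonresidue R"] r(1) q R[OF r(1,2)] mod4 by auto
 qed
 obtain R1 where r1: "prime R1" "R1 dvd m" using m prime_factor_nat[of m] by auto
 have "\<exists>R2. prime R2 \<and> R2 dvd m \<and> R2 \<noteq> R1"
 proof (rule ccontr)
  assume *: "\<not> ?thesis"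
  have "m \<noteq> 0" using m(1) by simp
  then have "prime_factors m = {p. prime p \<and> p dvd m}" by (rule prime_factors_dvd)
  also have "\<dots> = {R1}" using r1 * by blast
  finally have "prime_factors m = {R1}" .
  define e where "e = multiplicity R1 m"
  have "(\<Prod>p\<in>prime_factors m. p ^ multiplicity p m) = normalize m"
   using prod_prime_factors[of m] m(1) by simp
  then have e: "m = R1 ^ e" unfolding \<open>prime_factors m = {R1}\<close> e_def by simp
  then have "e \<noteq> 0" "e \<noteq> 1" using m np r1 by auto
  \<comment> \<open>A prime power with exponent above \<open>K\<close> and base above
    \<open>y\<close> would exceed \<open>y ^ K\<close> and hence \<open>n\<close>.\<close>
  moreover have "e \<le> K"
  proof (rule ccontr)
   assume "\<not> e \<le> K"
   moreover have "K \<noteq> 0" using m by (cases K) auto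
   then have "y ^ K < R1 ^ K" using R[OF r1] by (intro power_strict_mono) auto
   moreover have "R1 ^ K \<le> R1 ^ e" using calculation(1) R[OF r1] by (intro power_increasing) auto
   ultimately have "y ^ K < R1 ^ e" by linarith
   then show False using e m by linarith
  qed
  ultimately show False using no_power[of e R1] e by auto
 qed
 then obtain R2 where r2: "prime R2" "R2 dvd m" "R2 \<noteq> R1" by blast
 obtain u1 u2 where u1: "R1 - 1 = 2 ^ Suc s * u1" and u2: "R2 - 1 = 2 ^ Suc s * u2"
  using u r1 r2 by meson
 have odd12: "odd u1" "odd u2" using no_even r1 r2 u1 u2 by auto
 have R12: "R1 = 2 ^ Suc s * u1 + 1" "R2 = 2 ^ Suc s * u2 + 1"
  using u1 u2 R[OF r1] R[OF r2(1,2)] by auto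
 let ?L = "R1 * R2"
 have "coprime R1 R2" using r1 r2 by (simp add: primes_coprime)
 then have "?L dvd m" using r1 r2 divides_mult by blast
 \<comment> \<open>Parity separates them: \<open>R1 * R2 - 1\<close> is \<open>2^(s+1)\<close> times
   \<open>u1 + u2 + 2^(s+1) * u1 * u2\<close>, an even number for odd \<open>u1\<close> and
   \<open>u2\<close>, whereas \<open>t\<close> is odd.\<close>
 moreover have "?L \<noteq> m"
 proof
  assume "?L = m"
  then have "2 ^ Suc s * t + 1 = ?L" using st m by simp
  also have "?L = 2 ^ Suc s * (u1 + u2 + 2 ^ Suc s * u1 * u2) + 1"
   unfolding R12 by (simp add: algebra_simps)
  finally have "2 ^ Suc s * t = 2 ^ Suc s * (u1 + u2 + 2 ^ Suc s * u1 * u2)" by linarith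
  then have "t = u1 + u2 + 2 ^ Suc s * u1 * u2" by simp
  then show False using odd12 st(2) by simp
 qed
 ultimately have Ln: "?L \<le> n div y" using rough_cofactor[of m y ?L n, OF rough] m by auto
 have eqL: "Legendre (int q) (int R1) = Legendre (int q) (int R2)"
  "Legendre (int q) (int R1) \<noteq> 0" if "2 \<le> q" "q \<le> b" for q
  using Leg[OF that r1 u1] Leg[OF that r2(1,2) u2] \<epsilon>(1)[OF that] odd12 by auto
 \<comment> \<open>For \<open>s = 0\<close> both factors are 3 modulo 4 because \<open>u1\<close>
   and \<open>u2\<close> are odd; for \<open>s > 0\<close> both are 1.\<close>
 have mod4: "R1 mod 4 = R2 mod 4"
 proof (cases s)
  case 0
  then show ?thesis unfolding R12 using odd12 by (auto elim!: oddE)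
 next
  case (Suc s'')
  then have "R1 = 4 * (2 ^ s'' * u1) + 1" "R2 = 4 * (2 ^ s'' * u2) + 1" unfolding R12 by auto
  then show ?thesis by presburger
 qed
 have "Legendre 2 (int R1) = Legendre 2 (int R2)" using eqL(1)[of 2] b(1) by simp
 then have 78: "(R1 mod 8 = 1 \<or> R1 mod 8 = 7) = (R2 mod 8 = 1 \<or> R2 mod 8 = 7)"
  using Legendre_2[OF r1(1)] Legendre_2[OF r2(1)] R[OF r1] R[OF r2(1,2)]
  by (auto split: if_splits)
 have odd_r: "odd R1" "odd R2" unfolding R12 by auto
 have odd_mod8: "R mod 8 = 1 \<or> R mod 8 = 3 \<or> R mod 8 = 5 \<or> R mod 8 = 7" if "odd R" for R :: nat
  using that by presburger
 have "R1 mod 8 mod 4 = R2 mod 8 mod 4" using mod4 by (simp add: mod_mod_cancel)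
 \<comment> \<open>Equal classes modulo 4 and equal symbols of 2 leave only equal classes modulo 8;
   since odd squares are 1 modulo 8, so is \<open>R1 * R2\<close>.\<close>
 then have mod8: "R1 mod 8 = R2 mod 8"
  using 78 odd_mod8[OF odd_r(1)] odd_mod8[OF odd_r(2)] by auto
 have L8: "?L mod 8 = 1"
 proof -
  have "?L mod 8 = ((R1 mod 8) * (R2 mod 8)) mod 8" by (simp add: mod_mult_eq)
  then show ?thesis using mod8 odd_mod8[OF odd_r(1)] by auto
 qed
 have nsq: "\<not> is_square ?L"
 proof
  assume "is_square ?L"
  then obtain z where z: "?L = z ^ 2" by (auto elim: is_nth_powerE)
  then have "R1 dvd z" using r1(1) by (metis dvd_triv_left prime_dvd_power)
  then have "R1 * R1 dvd R1 * R2" unfolding z power2_eq_square by (rule mult_dvd_mono) fact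
  then have "R1 dvd R2" using r1(1) by (auto simp: prime_gt_0_nat)
  then show False using r1 r2 primes_dvd_imp_eq[of R1 R2] by simp
 qed
 have L1: "1 < ?L" using R[OF r1] R[OF r2(1,2)] less_1_mult[of R1 R2] by linarith
 define q where "q = least_nonresidue ?L"
 have q: "prime q" "odd q" "Legendre (int ?L) (int q) \<noteq> 1" "q \<le> b"
  using least_nonresidue[of ?L] b(2)[OF L1 Ln nsq L8] L1 odd_r by (auto simp: q_def)
 have q2: "2 < q" using q(1,2) prime_ge_2_nat[OF q(1)] by (cases "q = 2") auto
 have neq: "R1 \<noteq> q" "R2 \<noteq> q"
  using eqL[of q] q q2 Legendre_eq_0_iff[of "int R1" "int R1"] Legendre_eq_0_iff[of "int R2" "int R2"]
  by auto
 \<comment> \<open>The signs in the two reciprocity laws agree, since only the classes of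
   \<open>R1\<close> and \<open>R2\<close> modulo 4 enter.\<close>
 have par: "(-1::int) ^ ((R1 - 1) div 2 * ((q - 1) div 2)) = (-1) ^ ((R2 - 1) div 2 * ((q - 1) div 2))"
 proof -
  have "even ((R - 1) div 2) \<longleftrightarrow> R mod 4 = 1" if "odd R" for R :: nat
   using that by presburger
  then have "even ((R1 - 1) div 2) = even ((R2 - 1) div 2)" using mod4 odd_r by simp
  then show ?thesis by (simp add: minus_one_power_iff)
 qed
 have "Legendre R1 q * Legendre q R1 = Legendre R2 q * Legendre q R2"
  using Quadratic_Reciprocity[OF r1(1) _ q(1) q2 neq(1)] Quadratic_Reciprocity[OF r2(1) _ q(1) q2 neq(2)]
   R[OF r1] R[OF r2(1,2)] par by simp
 then have "Legendre R1 q = Legendre R2 q" using eqL[of q] q q2 by simp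
 moreover have "Legendre R1 q \<noteq> 0"
  using neq q r1 by (auto simp: Legendre_eq_0_iff dest: primes_dvd_imp_eq)
 moreover have "Legendre (int ?L) (int q) = Legendre R1 q * Legendre R2 q"
  using Legendre_mult[OF q(1) q2, of "int R1" "int R2"] by simp
 ultimately have "Legendre (int ?L) (int q) = 1" using Legendre_cases[of "int R2" "int q"] by auto
 then show False using q(3) by simp
qed

section \<open>Primes pass the test\<close>

text \<open>Euler's criterion for the natural remainders that the program computes; the value -1
  appears as \<open>m - 1\<close>.\<close>

lemma power_half_mod_prime:
 assumes "prime m" "2 < m"
 shows "Legendre (int q) (int m) = 1 \<Longrightarrow> q ^ ((m - 1) div 2) mod m = 1"
  and "Legendre (int q) (int m) = -1 \<Longrightarrow> q ^ ((m - 1) div 2) mod m = m - 1"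
  and "q ^ ((m - 1) div 2) mod m = 1 \<Longrightarrow> Legendre (int q) (int m) = 1"
proof -
 have e: "[Legendre (int q) (int m) = int (q ^ ((m - 1) div 2))] (mod int m)"
  using euler_criterion[OF assms, of "int q"] by simp
 { assume "Legendre (int q) (int m) = 1"
  then have "[q ^ ((m - 1) div 2) = 1] (mod m)"
   using e cong_int_iff by (metis cong_sym of_nat_1)
  then show "q ^ ((m - 1) div 2) mod m = 1" using assms by (simp add: unique_euclidean_semiring_class.cong_def) }
 { assume "Legendre (int q) (int m) = -1"
  then have "[int (m - 1) = int (q ^ ((m - 1) div 2))] (mod int m)"
   using e assms(2) cong_trans[of "int (m - 1)" "-1"]
   by (simp add: cong_iff_dvd_diff of_nat_diff)
  then have "[m - 1 = q ^ ((m - 1) div 2)] (mod m)" by (simp only: cong_int_iff)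
  then show "q ^ ((m - 1) div 2) mod m = m - 1" using assms by (simp add: unique_euclidean_semiring_class.cong_def) }
 { assume "q ^ ((m - 1) div 2) mod m = 1"
  then have "[q ^ ((m - 1) div 2) = 1] (mod m)" using assms by (simp add: unique_euclidean_semiring_class.cong_def)
  then have "[int (q ^ ((m - 1) div 2)) = 1] (mod int m)" by (metis cong_int_iff of_nat_1)
  then have "[Legendre (int q) (int m) = 1] (mod int m)" using e cong_trans by blast
  then show "Legendre (int q) (int m) = 1"
   using Legendre_cong_imp_eq[of "int m" _ 1] Legendre_abs_le assms(2) by auto }
qed

lemma power_half_mod_prime_cases:
 assumes "prime m" "2 < m" "0 < q" "q < m"
 shows "q ^ ((m - 1) div 2) mod m \<in> {1, m - 1}"
proof -
 have "Legendre (int q) (int m) \<noteq> 0" using assms by (auto simp: Legendre_eq_0_iff dest: dvd_imp_le)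
 then consider "Legendre (int q) (int m) = 1" | "Legendre (int q) (int m) = -1"
  using Legendre_cases[of "int q" "int m"] by auto
 then show ?thesis
  by cases (use power_half_mod_prime(1,2)[OF assms(1,2), of q] in blast)+
qed

text \<open>A priori the least nonresidue might be \<open>m\<close> itself, where the symbol is 0. A
  primitive root of \<open>m\<close> is a nonresidue, so some prime factor of its remainder is one;
  that prime is below \<open>m\<close>, odd because 2 is a residue modulo \<open>m\<close>, and by
  reciprocity bounds \<open>least_nonresidue m\<close>.\<close>

lemma prime_1_mod_8_nonresidue:
 assumes "prime m" "m mod 8 = 1"
 shows "Legendre (int (least_nonresidue m)) (int m) = -1"
proof -
 have m2: "2 < m" "odd m" "m mod 4 = 1"
  using assms prime_gt_1_nat[OF assms(1)] by presburger+
 obtain g where g: "residue_primroot m g"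
  using prime_primitive_root_exists[OF prime_gt_1_nat[OF assms(1)] assms(1)] by blast
 have g0: "coprime m g" "ord m g = m - 1"
  using g assms(1) by (auto simp: residue_primroot_def totient_prime)
 have notall: "\<not> (\<forall>q. prime q \<and> q dvd (g mod m) \<longrightarrow> Legendre (int q) (int m) = 1)"
 proof
  assume *: "\<forall>q. prime q \<and> q dvd (g mod m) \<longrightarrow> Legendre (int q) (int m) = 1"
  \<comment> \<open>If all prime factors are residues, multiplicativity carries this to every
    divisor, in particular to the primitive root itself, against its order.\<close>
  have "h \<noteq> 0 \<longrightarrow> h dvd g mod m \<longrightarrow> Legendre (int h) (int m) = 1" for h
  proof (induction h rule: prime_divisors_induct)
   case zero
   then show ?case by simp
  next
   case (unit x)
   have "QuadRes (int m) 1" unfolding QuadRes_def by (rule exI[of _ 1]) simp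
   then show ?case using unit m2 by (simp add: Legendre_def unique_euclidean_semiring_class.cong_def)
  next
   case (factor p x)
   show ?case
   proof (intro impI)
    assume px: "p * x \<noteq> 0" "p * x dvd g mod m"
    then have "Legendre (int x) (int m) = 1" "Legendre (int p) (int m) = 1"
     using factor * dvd_mult_left[of p x] dvd_mult_right[of p x] by auto
    then show "Legendre (int (p * x)) (int m) = 1"
     using Legendre_mult[OF assms(1) m2(1), of "int p" "int x"] by simp
   qed
  qed
  moreover have "g mod m \<noteq> 0"
  proof
   assume "g mod m = 0" then have "m dvd g" by auto
   then show False using g0(1) m2 by (metis coprime_absorb_left not_prime_unit assms(1))
  qed
  ultimately have "Legendre (int (g mod m)) (int m) = 1" by auto
  then have "(g mod m) ^ ((m - 1) div 2) mod m = 1" by (rule power_half_mod_prime(1)[OF assms(1) m2(1)])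
  then have "[g ^ ((m - 1) div 2) = 1] (mod m)" using m2 by (simp add: unique_euclidean_semiring_class.cong_def power_mod)
  then have "m - 1 dvd (m - 1) div 2" unfolding ord_divides g0(2)[symmetric] by simp
  moreover have "0 < (m - 1) div 2" "(m - 1) div 2 < m - 1" using m2 by auto
  ultimately show False by (auto dest: dvd_imp_le)
 qed
 then obtain q where q: "prime q" "q dvd g mod m" "Legendre (int q) (int m) \<noteq> 1" by blast
 have q2: "q \<noteq> 2" using q(3) Legendre_2[OF assms(1) m2(1)] assms(2) by auto
 then have q3: "2 < q" "odd q" using prime_ge_2_nat[OF q(1)] prime_odd_nat[OF q(1)] by auto
 have "g mod m \<noteq> 0"
 proof
  assume "g mod m = 0" then have "m dvd g" by auto
  then show False using g0(1) m2 by (metis coprime_absorb_left not_prime_unit assms(1))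
 qed
 then have qm: "q < m" using q(2) m2 by (metis dvd_imp_le gr0I le_less_trans mod_less_divisor less_trans zero_less_numeral)
 have "Legendre (int m) (int q) \<noteq> 1"
  using Legendre_reciprocity_1_mod_4[OF assms(1) m2(1) q(1) q3(1)] qm m2 q(3) by auto
 then have "least_nonresidue m \<le> q" using least_nonresidue_le q q3 by blast
 then have rm: "least_nonresidue m < m" using qm by simp
 define r where "r = least_nonresidue m"
 have r: "prime r" "odd r" "Legendre (int m) (int r) \<noteq> 1" "r < m"
  using least_nonresidue[of m] m2 rm by (auto simp: r_def)
 have r2: "2 < r" using r(1,2) prime_ge_2_nat[OF r(1)] by (cases "r = 2") auto
 have "Legendre (int m) (int r) = Legendre (int r) (int m)"
  using Legendre_reciprocity_1_mod_4[OF assms(1) m2(1) r(1) r2] r m2 by auto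
 moreover have "Legendre (int r) (int m) \<noteq> 0" using r by (auto simp: Legendre_eq_0_iff prime_gt_0_nat dest: dvd_imp_le)
 ultimately show ?thesis using r Legendre_cases[of "int r" "int m"] unfolding r_def by auto
qed

text \<open>A base that is a nonresidue whenever \<open>m\<close> is prime: 2 in class 5 modulo 8,
  and -1, that is \<open>m - 1\<close>, in classes 3 and 7. In class 1 both are residues and a
  search is required.\<close>

definition witness_base :: "nat \<Rightarrow> nat" where
 "witness_base m = (if m mod 8 = 1 then least_nonresidue m else if m mod 8 = 5 then 2 else m - 1)"

lemma witness_base_prime:
 assumes "prime m" "2 < m"
 shows "witness_base m ^ ((m - 1) div 2) mod m = m - 1"
proof -
 have "odd m" using assms prime_odd_nat by auto
 then have "m mod 8 = 1 \<or> m mod 8 = 5 \<or> m mod 8 = 3 \<or> m mod 8 = 7" by presburger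
 then consider "m mod 8 = 1" | "m mod 8 = 5" | "m mod 8 = 3 \<or> m mod 8 = 7" by blast
 then show ?thesis
 proof cases
  case 1
  then show ?thesis
   using power_half_mod_prime(2)[OF assms prime_1_mod_8_nonresidue[OF assms(1) 1]]
   by (simp add: witness_base_def)
 next
  case 2
  then show ?thesis
   using Legendre_2[OF assms] power_half_mod_prime(2)[OF assms, of 2] by (simp add: witness_base_def)
 next
  case 3
  then have odd: "odd ((m - 1) div 2)" by presburger
  have "[int (m - 1) = -1] (mod int m)" using assms by (simp add: cong_iff_dvd_diff of_nat_diff)
  then have "[int (m - 1) ^ ((m - 1) div 2) = (-1) ^ ((m - 1) div 2)] (mod int m)" by (rule cong_pow)
  then have "[int (m - 1) ^ ((m - 1) div 2) = -1] (mod int m)" using odd by simp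
  moreover have "[-1 = int (m - 1)] (mod int m)" using assms by (simp add: cong_iff_dvd_diff of_nat_diff)
  ultimately have "[int ((m - 1) ^ ((m - 1) div 2)) = int (m - 1)] (mod int m)"
   using cong_trans by fastforce
  then have "[(m - 1) ^ ((m - 1) div 2) = m - 1] (mod m)" by (simp only: cong_int_iff)
  then show ?thesis using 3 assms by (auto simp: witness_base_def unique_euclidean_semiring_class.cong_def)
 qed
qed

section \<open>Elementary estimates for primes\<close>

lemma prod_primes_dvd:
 assumes "finite A" "\<And>p. p \<in> A \<Longrightarrow> prime p \<and> p dvd (n::nat)"
 shows "\<Prod>A dvd n"
 using assms
proof (induction A rule: finite_induct)
 case (insert q A)
 have "coprime q (\<Prod>A)"
  by (rule prod_coprime_right) (use insert in \<open>auto intro: primes_coprime\<close>)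
 then show ?case using insert by (auto intro: divides_mult)
qed auto

text \<open>With \<open>N = 2^j\<close>, the primes in the interval divide the central binomial
  coefficient, which is at most \<open>4^N\<close>; each of them exceeds \<open>2^j\<close>, so it
  suffices to compare exponents of 2.\<close>

lemma card_primes_dyadic: "j * card {p::nat. prime p \<and> 2 ^ j < p \<and> p \<le> 2 * 2 ^ j} \<le> 2 * 2 ^ j"
proof -
 let ?N = "2 ^ j :: nat"
 let ?A = "{p. prime p \<and> ?N < p \<and> p \<le> 2 * ?N}"
 have fin: "finite ?A" by (rule finite_subset[of _ "{..2 * ?N}"]) auto
 have "\<Prod>?A dvd (2 * ?N choose ?N)"
 proof (rule prod_primes_dvd[OF fin])
  fix p assume p: "p \<in> ?A"
  have "fact ?N * fact ?N * (2 * ?N choose ?N) = (fact (2 * ?N) :: nat)"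
   using binomial_fact_lemma[of ?N "2 * ?N"] by (simp add: mult_2)
  moreover have "p dvd fact (2 * ?N)" "\<not> p dvd fact ?N"
   using p by (auto simp: prime_dvd_fact_iff)
  ultimately show "prime p \<and> p dvd (2 * ?N choose ?N)"
   using p by (metis (no_types, lifting) mem_Collect_eq prime_dvd_mult_iff)
 qed
 then have "\<Prod>?A \<le> (2 * ?N choose ?N)" by (intro dvd_imp_le) auto
 also have "\<dots> \<le> 2 ^ (2 * ?N)" by (rule binomial_le_pow2)
 finally have 1: "\<Prod>?A \<le> 2 ^ (2 * ?N)" .
 have "(2::nat) ^ (j * card ?A) = (\<Prod>p\<in>?A. ?N)" by (simp add: power_mult)
 also have "\<dots> \<le> \<Prod>?A" by (rule prod_mono) auto
 finally have "(2::nat) ^ (j * card ?A) \<le> 2 ^ (2 * ?N)" using 1 by linarith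
 then show ?thesis by (simp only: power_increasing_iff)
qed

text \<open>The dyadic interval above \<open>2^j\<close> contributes at most \<open>2 / j\<close>,
  its number of primes divided by its lower end; the term \<open>1/2\<close> is the prime 2.\<close>

lemma sum_prime_reciprocals_pow2:
 "(\<Sum>p | prime p \<and> p \<le> 2 ^ Suc J. 1 / real p) \<le> 1 / 2 + 2 * harm J"
proof (induction J)
 case 0
 have "{p::nat. prime p \<and> p \<le> 2} = {2}" by (auto dest: prime_ge_2_nat intro: le_antisym)
 then show ?case by (simp add: harm_def)
next
 case (Suc J)
 let ?N = "2 ^ Suc J :: nat"
 let ?A = "{p. prime p \<and> ?N < p \<and> p \<le> 2 * ?N}"
 have fin: "finite ?A" by (rule finite_subset[of _ "{..2 * ?N}"]) auto
 have split: "{p. prime p \<and> p \<le> 2 ^ Suc (Suc J)} = {p. prime p \<and> p \<le> ?N} \<union> ?A" by auto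
 have "(\<Sum>p\<in>?A. 1 / real p) \<le> (\<Sum>p\<in>?A. 1 / real ?N)"
 proof (intro sum_mono divide_left_mono)
  fix p assume "p \<in> ?A"
  then have "?N \<le> p" "0 < p" by auto
  then show "real ?N \<le> real p" "0 < real p * real ?N" by (simp_all only: of_nat_le_iff) auto
 qed auto
 also have "\<dots> = real (card ?A) / real ?N" by simp
 also have "\<dots> \<le> 2 / real (Suc J)"
 proof -
  have "real (Suc J * card ?A) \<le> real (2 * ?N)"
   using card_primes_dyadic[of "Suc J"] by (simp only: of_nat_le_iff)
  then show ?thesis by (simp add: field_simps)
 qed
 also have "\<dots> = 2 * inverse (real (Suc J))" by (simp add: field_simps)
 finally have A: "(\<Sum>p\<in>?A. 1 / real p) \<le> 2 * inverse (real (Suc J))" .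
 have "(\<Sum>p | prime p \<and> p \<le> 2 ^ Suc (Suc J). 1 / real p) =
   (\<Sum>p | prime p \<and> p \<le> ?N. 1 / real p) + (\<Sum>p\<in>?A. 1 / real p)"
  unfolding split by (rule sum.union_disjoint) (use fin in auto)
 then show ?case using Suc A by (simp add: harm_Suc algebra_simps)
qed

lemma harm_le_ln: "0 < n \<Longrightarrow> harm n \<le> 1 + ln (real n)"
proof -
 assume "0 < n"
 then obtain m where m: "n = Suc m" by (cases n) auto
 have "harm (Suc m) - ln (real (Suc m)) \<le> (harm (Suc 0) - ln (real (Suc 0)) :: real)"
  using decseqD[OF decseq_harm_diff_ln, of 0 m] by simp
 then show ?thesis using m by (simp add: harm_def)
qed

text \<open>Mertens' bound up to a constant factor: the harmonic number of the binary logarithm of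
  \<open>x\<close> is about \<open>ln (ln x)\<close>. The additive constants sum to
  \<open>1/2 + 2 + 2\<close>, rounded up to 5.\<close>

lemma sum_prime_reciprocals_le:
 fixes x :: real
 assumes "4 \<le> x"
 shows "(\<Sum>p | prime p \<and> real p \<le> x. 1 / real p) \<le> 2 * ln (ln x) + 5"
proof -
 define J where "J = nat \<lfloor>log 2 x\<rfloor>"
 have "log 2 4 \<le> log 2 x" using assms by simp
 moreover have "log 2 4 = (2::real)" using log_pow_cancel[of 2 2] by simp
 ultimately have l2: "2 \<le> log 2 x" by simp
 have J: "real J \<le> log 2 x" "log 2 x < real J + 1" "0 < J" unfolding J_def using l2 by linarith+
 have "x = 2 powr log 2 x" using assms by simp
 also have "\<dots> \<le> 2 powr (real (Suc J))" using J by (intro powr_mono) auto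
 finally have xJ: "x \<le> 2 ^ Suc J" by (simp only: powr_realpow)
 have "(\<Sum>p | prime p \<and> real p \<le> x. 1 / real p) \<le> (\<Sum>p | prime p \<and> p \<le> 2 ^ Suc J. 1 / real p)"
 proof (rule sum_mono2)
  show "{p. prime p \<and> real p \<le> x} \<subseteq> {p. prime p \<and> p \<le> 2 ^ Suc J}"
  proof safe
   fix p assume "real p \<le> x"
   then have "real p \<le> real (2 ^ Suc J)" using xJ by simp
   then show "p \<le> 2 ^ Suc J" by (simp only: of_nat_le_iff)
  qed
 qed auto
 also have "\<dots> \<le> 1 / 2 + 2 * harm J" by (rule sum_prime_reciprocals_pow2)
 also have "\<dots> \<le> 1 / 2 + 2 * (1 + ln (real J))" using harm_le_ln[OF J(3)] by simp
 finally have 1: "(\<Sum>p | prime p \<and> real p \<le> x. 1 / real p) \<le> 1 / 2 + 2 * (1 + ln (real J))" .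
 have "ln (real J) \<le> ln (log 2 x)" using J by simp
 also have "log 2 x = ln x / ln 2" by (simp add: log_def)
 also have "ln (ln x / ln 2) = ln (ln x) - ln (ln 2)"
  using assms ln_div[of "ln x" "ln 2"] by simp
 finally have 2: "ln (real J) \<le> ln (ln x) - ln (ln 2)" .
 have "- ln (ln 2) \<le> (1::real)"
 proof -
  have "exp (-1) \<le> (1 / 2 :: real)" using exp_ge_add_one_self[of 1] by (simp add: exp_minus field_simps)
  also have "1 / 2 \<le> ln (2::real)" using ln_2_less_1 ln_le_minus_one[of "1/2::real"] by (simp add: ln_div)
  finally have "ln (exp (-1)) \<le> ln (ln (2::real))" by (subst ln_le_cancel_iff) auto
  then show ?thesis by simp
 qed
 moreover have "S \<le> 2 * a + 5" if "S \<le> 1 / 2 + 2 * (1 + c)" "c \<le> a - b" "- b \<le> 1"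
  for S a b c :: real
  using that by simp
 ultimately show ?thesis using 1 2 by blast
qed

text \<open>Integers up to \<open>X\<close> with all prime factors in a set: those divisible by a new prime \<open>p\<close>
 contribute at most \<open>1/p\<close> times the whole, which gives Euler's bound without infinite series.\<close>

lemma sum_reciprocals_smooth_le:
 fixes Q :: "nat set"
 assumes "finite Q" "\<And>p. p \<in> Q \<Longrightarrow> prime p"
 shows "(\<Prod>p\<in>Q. 1 - 1 / real p) * (\<Sum>m | m \<in> {1..X} \<and> prime_factors m \<subseteq> Q. 1 / real m) \<le> 1"
 using assms
proof (induction Q rule: finite_induct)
 case empty
 have "{m. m \<in> {1..X} \<and> prime_factors m \<subseteq> {}} \<subseteq> {1}"
  by (auto simp: prime_factorization_empty_iff)
 then have "(\<Sum>m | m \<in> {1..X} \<and> prime_factors m \<subseteq> {}. 1 / real m) \<le> (\<Sum>m\<in>{1}. 1 / real m)"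
  by (intro sum_mono2) auto
 then show ?case by simp
next
 case (insert p Q)
 let ?S = "\<lambda>Q. {m. m \<in> {1..X} \<and> prime_factors m \<subseteq> Q}"
 let ?f = "\<lambda>Q. \<Sum>m\<in>?S Q. 1 / real m"
 have p: "prime p" "1 < p" using insert prime_gt_1_nat by auto
 have fin: "finite (?S Q)" for Q by (rule finite_subset[of _ "{1..X}"]) auto
 have sub: "?S (insert p Q) \<subseteq> ?S Q \<union> (\<lambda>m. p * m) ` ?S (insert p Q)"
 proof
  fix m assume m: "m \<in> ?S (insert p Q)"
  show "m \<in> ?S Q \<union> (\<lambda>m. p * m) ` ?S (insert p Q)"
  proof (cases "p dvd m")
   case True
   then obtain m' where m': "m = p * m'" by blast
   have "m' \<noteq> 0" using m m' by auto
   then have "prime_factors m' \<subseteq> prime_factors m"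
    using m' m by (intro dvd_prime_factors) auto
   moreover have "m' \<le> X"
   proof -
    have "m' \<le> p * m'" using p by simp
    also have "\<dots> \<le> X" using m m' by simp
    finally show ?thesis .
   qed
   ultimately have "m' \<in> ?S (insert p Q)" using m \<open>m' \<noteq> 0\<close> by auto
   then show ?thesis using m' by blast
  next
   case False
   then have "p \<notin> prime_factors m" by (auto simp: in_prime_factors_iff)
   then show ?thesis using m by auto
  qed
 qed
 have "?f (insert p Q) \<le> (\<Sum>m\<in>?S Q \<union> (\<lambda>m. p * m) ` ?S (insert p Q). 1 / real m)"
  by (rule sum_mono2) (use fin sub in auto)
 also have "\<dots> \<le> ?f Q + (\<Sum>m\<in>(\<lambda>m. p * m) ` ?S (insert p Q). 1 / real m)"
  using fin[of Q] fin[of "insert p Q"] by (subst sum_Un) (auto intro!: sum_nonneg)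
 also have "(\<Sum>m\<in>(\<lambda>m. p * m) ` ?S (insert p Q). 1 / real m) = (\<Sum>m\<in>?S (insert p Q). 1 / real (p * m))"
  by (subst sum.reindex) (use p in \<open>auto simp: inj_on_def\<close>)
 also have "\<dots> = 1 / real p * ?f (insert p Q)" by (simp add: sum_distrib_left)
 finally have *: "(1 - 1 / real p) * ?f (insert p Q) \<le> ?f Q" by (simp add: algebra_simps)
 have pos: "0 \<le> (\<Prod>p\<in>Q. 1 - 1 / real p)"
 proof (intro prod_nonneg)
  fix q assume "q \<in> Q"
  then have "1 < q" using insert prime_gt_1_nat by auto
  then show "0 \<le> 1 - 1 / real q" by simp
 qed
 have "(\<Prod>p\<in>insert p Q. 1 - 1 / real p) * ?f (insert p Q) =
   (\<Prod>p\<in>Q. 1 - 1 / real p) * ((1 - 1 / real p) * ?f (insert p Q))"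
  using insert by simp
 also have "\<dots> \<le> (\<Prod>p\<in>Q. 1 - 1 / real p) * ?f Q" by (rule mult_left_mono[OF * pos])
 also have "\<dots> \<le> 1" using insert by auto
 finally show ?case .
qed

text \<open>With all primes up to \<open>x\<close> in the set, every integer up to \<open>x\<close>
  is counted, so the sum in Euler's bound is a harmonic number and at least
  \<open>ln x\<close>.\<close>

lemma prod_one_minus_prime_reciprocals_le:
 assumes "1 \<le> x"
 shows "(\<Prod>p | prime p \<and> p \<le> x. 1 - 1 / real p) * ln (real x) \<le> 1"
proof -
 let ?Q = "{p. prime p \<and> p \<le> x}"
 have fin: "finite ?Q" by (rule finite_subset[of _ "{..x}"]) auto
 have "{m. m \<in> {1..x} \<and> prime_factors m \<subseteq> ?Q} = {1..x}"
  by (auto simp: in_prime_factors_iff dest!: dvd_imp_le)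
 then have "(\<Sum>m | m \<in> {1..x} \<and> prime_factors m \<subseteq> ?Q. 1 / real m) = harm x"
  by (simp add: harm_def inverse_eq_divide)
 with sum_reciprocals_smooth_le[OF fin, of x] have "(\<Prod>p\<in>?Q. 1 - 1 / real p) * harm x \<le> 1" by simp
 moreover have "ln (real x) \<le> ln (real x + 1)" using assms by simp
 then have "ln (real x) \<le> harm x" using ln_le_harm[of x] by linarith
 moreover have "0 \<le> (\<Prod>p\<in>?Q. 1 - 1 / real p)"
  by (intro prod_nonneg) (auto dest!: prime_gt_1_nat)
 ultimately show ?thesis using mult_left_mono by (meson order_trans)
qed

text \<open>Bernoulli's inequality compares \<open>1 - k/p\<close> with the \<open>k\<close>-th
  power of \<open>1 - 1/p\<close>. The primes up to \<open>p0\<close>, where \<open>1 - k/p\<close>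
  may be negative, are left out at the price of a factor that depends on \<open>p0\<close> and
  \<open>k\<close> only.\<close>

lemma prod_one_minus_k_le:
 assumes "k \<le> p0" "2 \<le> x"
 shows "(\<Prod>p | prime p \<and> p0 < p \<and> p \<le> x. 1 - real k / real p) \<le>
  (1 / ((\<Prod>p | prime p \<and> p \<le> p0. 1 - 1 / real p) * ln (real x))) ^ k"
proof -
 let ?A = "{p. prime p \<and> p \<le> p0}" and ?B = "{p. prime p \<and> p0 < p \<and> p \<le> x}"
 let ?f = "\<lambda>p. 1 - 1 / real p"
 have finA: "finite ?A" by (rule finite_subset[of _ "{..p0}"]) auto
 have finB: "finite ?B" by (rule finite_subset[of _ "{..x}"]) auto
 have pos: "0 < prod ?f S" if "\<And>p. p \<in> S \<Longrightarrow> prime p" for S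
 proof (rule prod_pos)
  fix p assume "p \<in> S"
  then have "1 < p" using that prime_gt_1_nat by auto
  then show "0 < ?f p" by simp
 qed
 have "(\<Prod>p\<in>?B. 1 - real k / real p) \<le> (\<Prod>p\<in>?B. ?f p ^ k)"
 proof (rule prod_mono, safe)
  fix p assume p: "prime p" "p0 < p"
  then have "0 < p" "k \<le> p" using assms by auto
  then show "0 \<le> 1 - real k / real p" by (simp add: field_simps)
  have "1 + real k * (- (1 / real p)) \<le> (1 + (- (1 / real p))) ^ k"
   using \<open>0 < p\<close> by (intro Bernoulli_inequality) auto
  then show "1 - real k / real p \<le> ?f p ^ k" by simp
 qed
 also have "\<dots> = (prod ?f ?B) ^ k" by (simp add: prod_power_distrib)
 also have "\<dots> \<le> (1 / (prod ?f ?A * ln (real x))) ^ k"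
 proof (rule power_mono)
  show "prod ?f ?B \<le> 1 / (prod ?f ?A * ln (real x))"
  proof (cases "p0 \<le> x")
   case True
   then have "{p. prime p \<and> p \<le> x} = ?A \<union> ?B" by auto
   then have "(\<Prod>p | prime p \<and> p \<le> x. ?f p) = prod ?f ?A * prod ?f ?B"
    by (simp only:) (rule prod.union_disjoint[OF finA finB], auto)
   then have "prod ?f ?A * prod ?f ?B * ln (real x) \<le> 1"
    using prod_one_minus_prime_reciprocals_le[of x] assms by simp
   moreover have "0 < prod ?f ?A * ln (real x)" using pos[of ?A] assms by auto
   ultimately show ?thesis by (simp add: field_simps)
  next
   case False
   \<comment> \<open>The product is empty here, and the right-hand side is at least 1 because
     passing from \<open>x\<close> to \<open>p0\<close> only makes the product in the denominator
     smaller.\<close>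
   then have B: "?B = {}" by auto
   let ?C = "{p. prime p \<and> p \<le> x}" and ?D = "{p. prime p \<and> x < p \<and> p \<le> p0}"
   have "?A = ?C \<union> ?D" using False by auto
   moreover have "finite ?C" "finite ?D" by (rule finite_subset[of _ "{..p0}"], use False in auto)+
   ultimately have "prod ?f ?A = prod ?f ?C * prod ?f ?D"
    by (simp only:) (rule prod.union_disjoint, auto)
   moreover have "prod ?f ?D \<le> 1" by (rule prod_le_1) (auto dest!: prime_gt_1_nat)
   ultimately have "prod ?f ?A \<le> prod ?f ?C" using pos[of ?C] by (simp add: mult_left_le)
   then have "prod ?f ?A * ln (real x) \<le> prod ?f ?C * ln (real x)"
    using assms by (intro mult_right_mono) auto
   also have "\<dots> \<le> 1" using prod_one_minus_prime_reciprocals_le[of x] assms by simp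
   finally have "prod ?f ?A * ln (real x) \<le> 1" .
   moreover have "0 < prod ?f ?A * ln (real x)" using pos[of ?A] assms by auto
   ultimately show ?thesis unfolding B by (simp add: field_simps)
  qed
 qed (use pos[of ?B] in auto)
 finally show ?thesis .
qed

text \<open>The Leibniz harmonic triangle \<open>a! b! / (a + b + 1)!\<close> shows that every common multiple of
 \<open>1, \<dots>, 2m + 1\<close> is at least \<open>4^m\<close>.\<close>

lemma leibniz_triangle_integral:
 fixes D n :: nat
 assumes "\<And>j. 1 \<le> j \<Longrightarrow> j \<le> n \<Longrightarrow> j dvd D" "a + b + 1 \<le> n"
 shows "real D * (fact a * fact b / fact (a + b + 1)) \<in> \<int>"
 using assms(2)
proof (induction b arbitrary: a)
 case 0
 then obtain z where "D = (a + 1) * z" using assms(1)[of "a + 1"] by (auto elim: dvdE)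
 moreover have "fact (a + 1) = (real a + 1) * fact a" "real a + 1 \<noteq> 0" by auto
 ultimately have "real D * (fact a * fact 0 / fact (a + 0 + 1)) = real z"
  by (simp del: fact_Suc add: divide_simps) (simp add: algebra_simps)
 then show ?case by simp
next
 case (Suc b)
 \<comment> \<open>The triangle rule: an entry is the difference of two entries with smaller
   \<open>b\<close>, so integrality propagates from the edge \<open>b = 0\<close>.\<close>
 have "fact a * fact (Suc b) / fact (a + Suc b + 1) =
   fact a * fact b / fact (a + b + 1) - fact (Suc a) * fact b / (fact (Suc a + b + 1) :: real)"
  by (simp add: divide_simps) (simp add: algebra_simps)
 then have "real D * (fact a * fact (Suc b) / fact (a + Suc b + 1)) =
   real D * (fact a * fact b / fact (a + b + 1)) - real D * (fact (Suc a) * fact b / fact (Suc a + b + 1))"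
  by (simp only: right_diff_distrib)
 moreover have "real D * (fact a * fact b / fact (a + b + 1)) \<in> \<int>" using Suc by simp
 moreover have "real D * (fact (Suc a) * fact b / fact (Suc a + b + 1)) \<in> \<int>" using Suc.IH[of "Suc a"] Suc.prems by simp
 ultimately show ?case by (metis Ints_diff)
qed

lemma common_multiple_ge:
 fixes D m :: nat
 assumes "\<And>j. 1 \<le> j \<Longrightarrow> j \<le> 2 * m + 1 \<Longrightarrow> j dvd D" "0 < D"
 shows "4 ^ m \<le> D"
proof -
 let ?v = "real D * (fact m * fact m / fact (m + m + 1))"
 have "?v \<in> \<int>" by (rule leibniz_triangle_integral[of "2 * m + 1"]) (use assms in auto)
 moreover have "0 < ?v" using assms(2) by simp
 \<comment> \<open>A positive integer is at least 1; at the middle entry this says that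
   \<open>D\<close> is at least \<open>(2m + 1)\<close> times the central binomial
   coefficient.\<close>
 ultimately have v1: "1 \<le> ?v"
  by (metis Ints_cases of_int_0_less_iff of_int_1_le_iff zless_imp_add1_zle add_0)
 have "real (2 * m choose m) * (fact m * fact m) = fact (2 * m)"
  using binomial_fact[of m "2 * m", where 'a = real] by (simp add: field_simps)
 then have "fact (m + m + 1) = real (2 * m + 1) * real (2 * m choose m) * (fact m * fact m)"
  by (simp add: mult_2[symmetric] mult.assoc)
 then have "?v = real D / (real (2 * m + 1) * real (2 * m choose m))" by simp
 moreover have "0 < real (2 * m + 1) * real (2 * m choose m)" by simp
 ultimately have "real (2 * m + 1) * real (2 * m choose m) \<le> real D"
  using v1 by (simp add: le_divide_eq)
 moreover have "4 ^ m \<le> real (2 * m + 1) * real (2 * m choose m)"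
 proof (cases "m = 0")
  case False
  then have "4 ^ m / (2 * real m) \<le> real (2 * m choose m)" using central_binomial_lower_bound[of m] by simp
  then have "4 ^ m \<le> 2 * real m * real (2 * m choose m)" using False by (simp add: field_simps)
  also have "\<dots> \<le> real (2 * m + 1) * real (2 * m choose m)" by (intro mult_right_mono) auto
  finally show ?thesis .
 qed simp
 ultimately have "4 ^ m \<le> real D" by linarith
 then have "real (4 ^ m) \<le> real D" by (simp only: of_nat_power of_nat_numeral)
 then show ?thesis by (simp only: of_nat_le_iff)
qed

text \<open>The product of the largest prime powers up to \<open>x\<close> is the least common
  multiple of \<open>1, ..., x\<close>, and each of its factors is at most \<open>x\<close>.\<close>

lemma chebyshev_lower:
 fixes x m :: nat
 assumes "2 * m + 1 \<le> x"
 shows "4 ^ m \<le> x ^ card {p. prime p \<and> p \<le> x}"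
proof -
 let ?Q = "{p. prime p \<and> p \<le> x}"
 have fin: "finite ?Q" by (rule finite_subset[of _ "{..x}"]) auto
 define e where "e p = (GREATEST i. p ^ i \<le> x)" for p
 have e: "p ^ e p \<le> x" "p ^ i \<le> x \<Longrightarrow> i \<le> e p" if "prime p" for p i
 proof -
  have bd: "i \<le> x" if "p ^ i \<le> x" for i
  proof -
   have "i < 2 ^ i" by (rule less_exp)
   also have "\<dots> \<le> p ^ i" using prime_ge_2_nat[OF \<open>prime p\<close>] by (rule power_mono) auto
   finally show ?thesis using that by simp
  qed
  have "p ^ 0 \<le> x" using assms by simp
  from GreatestI_nat[where P = "\<lambda>i. p ^ i \<le> x", OF this bd] show "p ^ e p \<le> x" by (simp add: e_def)
  assume "p ^ i \<le> x"
  from Greatest_le_nat[where P = "\<lambda>i. p ^ i \<le> x", OF this bd] show "i \<le> e p" by (simp add: e_def)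
 qed
 let ?D = "\<Prod>p\<in>?Q. p ^ e p"
 have "j dvd ?D" if j: "1 \<le> j" "j \<le> 2 * m + 1" for j
 proof -
  have "j = (\<Prod>p\<in>prime_factors j. p ^ multiplicity p j)"
   using prod_prime_factors[of j] j by simp
  also have "\<dots> dvd (\<Prod>p\<in>prime_factors j. p ^ e p)"
  proof (rule prod_dvd_prod, rule le_imp_power_dvd)
   fix p assume p: "p \<in> prime_factors j"
   have "p ^ multiplicity p j \<le> j" using j by (intro dvd_imp_le multiplicity_dvd) auto
   then show "multiplicity p j \<le> e p" using e(2)[of p] p j assms by (auto simp: in_prime_factors_iff)
  qed
  also have "\<dots> dvd ?D"
  proof (rule prod_dvd_prod_subset[OF fin])
   show "prime_factors j \<subseteq> ?Q"
    using j assms by (auto simp: in_prime_factors_iff dest!: dvd_imp_le)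
  qed
  finally show ?thesis .
 qed
 then have "4 ^ m \<le> ?D" by (rule common_multiple_ge) (auto simp: prod_pos prime_gt_0_nat)
 also have "?D \<le> (\<Prod>p\<in>?Q. x)" by (rule prod_mono) (use e in auto)
 finally show ?thesis by simp
qed

section \<open>Consequences of Conjecture A\<close>

text \<open>The witness \<open>(8 * p!)^2 + 1\<close> is 1 modulo 8 and modulo every prime up to
  \<open>p\<close>, and lies strictly between consecutive squares. So the \<open>LEAST\<close> in
  \<open>pseudosquare\<close> is attained.\<close>

lemma pseudosquare_exists:
 "\<exists>L. 0 < L \<and> \<not> is_square L \<and> [L = 1] (mod 8) \<and>
   (\<forall>q. prime q \<and> odd q \<and> q \<le> p \<longrightarrow> Legendre (int L) (int q) = 1)"
proof -
 define Q :: nat where "Q = 8 * fact p"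
 let ?L = "Q ^ 2 + 1"
 have nsq: "\<not> is_square ?L"
 proof
  assume "is_square ?L"
  then obtain z where z: "?L = z ^ 2" by (auto elim: is_nth_powerE)
  then have "Q ^ 2 < z ^ 2" by linarith
  then have "Q < z" by (rule power_less_imp_less_base) simp
  then have "(Q + 1) ^ 2 \<le> z ^ 2" by (intro power_mono) auto
  then have "Q = 0" unfolding z[symmetric] by (simp add: power2_eq_square)
  then show False by (simp add: Q_def)
 qed
 have "Legendre (int ?L) (int q) = 1" if "prime q" "odd q" "q \<le> p" for q
 proof -
  have "q dvd Q" using that dvd_fact[of q p] prime_gt_0_nat[of q] by (auto simp: Q_def)
  then have "[int ?L = 1] (mod int q)"
   by (simp add: cong_iff_dvd_diff power2_eq_square)
  moreover have "QuadRes (int q) (int ?L)"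
   unfolding QuadRes_def using calculation by (intro exI[of _ 1]) (simp add: cong_sym)
  moreover have "\<not> [int ?L = 0] (mod int q)"
  proof
   assume "[int ?L = 0] (mod int q)"
   then have "[1 = (0::int)] (mod int q)" using calculation(1) cong_sym cong_trans by blast
   then show False using prime_gt_1_nat[OF that(1)] by (simp add: cong_0_iff)
  qed
  ultimately show ?thesis by (simp add: Legendre_def)
 qed
 moreover have "[?L = 1] (mod 8)"
  by (rule cong_sym, rule cong_add_rcancel_0_nat[THEN iffD2, THEN cong_sym])
    (simp add: Q_def cong_0_iff power_mult_distrib)
 ultimately show ?thesis using nsq by (intro exI[of _ ?L]) auto
qed

lemma pseudosquare_properties:
 "0 < pseudosquare p" "\<not> is_square (pseudosquare p)" "[pseudosquare p = 1] (mod 8)"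
 "prime q \<Longrightarrow> odd q \<Longrightarrow> q \<le> p \<Longrightarrow> Legendre (int (pseudosquare p)) (int q) = 1"
 using LeastI_ex[OF pseudosquare_exists[of p]] unfolding pseudosquare_def[symmetric] by blast+

lemma pseudosquare_le:
 assumes "0 < L" "\<not> is_square L" "[L = 1] (mod 8)"
  "\<And>q. prime q \<Longrightarrow> odd q \<Longrightarrow> q \<le> p \<Longrightarrow> Legendre (int L) (int q) = 1"
 shows "pseudosquare p \<le> L"
 unfolding pseudosquare_def by (rule Least_le) (use assms in blast)

lemma pseudosquare_mono: "p \<le> q \<Longrightarrow> pseudosquare p \<le> pseudosquare q"
 by (rule pseudosquare_le) (use pseudosquare_properties in auto)

text \<open>A prime divisor of the pseudosquare gives symbol 0 and therefore exceeds
  \<open>p\<close>. Consequently only finitely many primes have a pseudosquare up to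
  \<open>n\<close>, and there is a largest one.\<close>

lemma pseudosquare_gt: "p < pseudosquare p"
proof -
 let ?L = "pseudosquare p"
 have "?L \<noteq> 1" using pseudosquare_properties(2)[of p] by (metis is_nth_power_1)
 then obtain q where q: "prime q" "q dvd ?L" using prime_factor_nat by blast
 have "odd ?L" using pseudosquare_properties(3)[of p] by (simp add: unique_euclidean_semiring_class.cong_def) presburger
 then have "odd q" using q by (meson dvd_trans)
 have "Legendre (int ?L) (int q) = 0" using q by (simp add: Legendre_eq_0_iff)
 then have "p < q" using pseudosquare_properties(4)[OF q(1) \<open>odd q\<close>, of p] by (cases "q \<le> p") auto
 also have "q \<le> ?L" using q pseudosquare_properties(1)[of p] by (simp add: dvd_imp_le)
 finally show ?thesis .
qed

section \<open>From Conjecture A to least nonresidues\<close>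

definition pseudosquare_candidate :: "nat \<Rightarrow> bool" where
 "pseudosquare_candidate L \<longleftrightarrow> 1 < L \<and> \<not> is_square L \<and> L mod 8 = 1"

text \<open>If \<open>r\<close> is the largest prime below the least nonresidue of \<open>L\<close>,
  then \<open>L\<close> meets all conditions on \<open>pseudosquare r\<close>, so Conjecture A
  bounds \<open>r\<close>. It does not speak of the next prime, the least nonresidue itself; hence
  the statement counts the primes below it.\<close>

lemma previous_prime_bound:
 assumes "conjecture_A"
 shows "\<exists>C>0. \<forall>n L. pseudosquare_candidate L \<and> L \<le> n \<longrightarrow>
  real (card {p. prime p \<and> p < least_nonresidue L}) \<le> C * (ln (real n) * ln (ln (real n)))"
proof -
 obtain C where C: "\<And>n p. prime p \<Longrightarrow> pseudosquare p \<le> n \<Longrightarrow>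
   (\<And>q. prime q \<Longrightarrow> pseudosquare q \<le> n \<Longrightarrow> pseudosquare q \<le> pseudosquare p) \<Longrightarrow>
   real p \<le> C * (ln (real n) * ln (ln (real n)))"
  using assms unfolding conjecture_A_def by blast
 have "real (card {p. prime p \<and> p < least_nonresidue L}) \<le> C * (ln (real n) * ln (ln (real n))) \<and>
   0 < ln (real n) * ln (ln (real n))"
  if L: "pseudosquare_candidate L" "L \<le> n" for n L
 proof -
  let ?q = "least_nonresidue L"
  have L': "1 < L" "\<not> is_square L" "L mod 8 = 1" using L by (auto simp: pseudosquare_candidate_def)
  then have "odd L" by presburger
  note q = least_nonresidue[OF L'(1) this]
  have q2: "2 < ?q" using q(1,2) prime_ge_2_nat[OF q(1)] by (cases "?q = 2") auto
  let ?R = "{p. prime p \<and> p < ?q}"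
  have finR: "finite ?R" by (rule finite_subset[of _ "{..<?q}"]) auto
  have "2 \<in> ?R" using q2 two_is_prime_nat by simp
  then have neR: "?R \<noteq> {}" by blast
  define r where "r = Max ?R"
  have r: "prime r" "r < ?q" using Max_in[OF finR neR] unfolding r_def by auto
  have "pseudosquare r \<le> L"
  proof (rule pseudosquare_le)
   show "[L = 1] (mod 8)" using L' by (simp add: unique_euclidean_semiring_class.cong_def)
   fix p assume p: "prime p" "odd p" "p \<le> r"
   show "Legendre (int L) (int p) = 1"
    using least_nonresidue_le[OF p(1,2)] p(3) r(2) by (metis le_less_trans not_less)
  qed (use L' in auto)
  then have rn: "pseudosquare r \<le> n" using L by simp
  let ?S = "{p. prime p \<and> pseudosquare p \<le> n}"
  have finS: "finite ?S" "?S \<noteq> {}"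
   using rn r pseudosquare_gt by (auto intro!: finite_subset[of ?S "{..n}"] intro: less_imp_le less_le_trans)
  \<comment> \<open>Conjecture A concerns a prime whose pseudosquare is the largest up to
    \<open>n\<close>; by monotonicity the largest prime in \<open>?S\<close> is one, and
    \<open>r\<close> is at most that prime.\<close>
  define m where "m = Max ?S"
  have m: "prime m" "pseudosquare m \<le> n" using Max_in[OF finS] unfolding m_def by auto
  have "real m \<le> C * (ln (real n) * ln (ln (real n)))"
  proof (rule C[OF m])
   fix p assume p: "prime p" "pseudosquare p \<le> n"
   then have "p \<le> m" unfolding m_def using finS by (intro Max_ge) auto
   then show "pseudosquare p \<le> pseudosquare m" by (rule pseudosquare_mono)
  qed
  moreover have "r \<le> m" unfolding m_def using finS rn r by (intro Max_ge) auto
  moreover have "card ?R \<le> card {1..r}"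
  proof (rule card_mono)
   show "?R \<subseteq> {1..r}" using finR unfolding r_def by (auto simp: Suc_le_eq prime_gt_0_nat)
  qed simp
  moreover have "4 \<le> n"
  proof -
   have "L \<noteq> 1" "L mod 8 = 1" using L' by auto
   then have "9 \<le> L" using L'(1) by presburger
   then show ?thesis using L by simp
  qed
  then have "exp 1 < real n" using exp_le by linarith
  then have "1 < ln (real n)" by (metis exp_less_cancel_iff exp_ln less_trans exp_gt_zero)
  then have "0 < ln (real n) * ln (ln (real n))" by simp
  ultimately show ?thesis by simp
 qed
 then have "\<forall>n L. pseudosquare_candidate L \<and> L \<le> n \<longrightarrow>
  real (card {p. prime p \<and> p < least_nonresidue L}) \<le> max C 1 * (ln (real n) * ln (ln (real n)))"
  by (meson max.cobounded1 mult_right_mono less_imp_le order_trans)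
 then show ?thesis by (intro exI[of _ "max C 1"]) auto
qed

lemma ln_le_powr_eighth: "1 \<le> (x::real) \<Longrightarrow> ln x \<le> 8 * x powr (1 / 8)"
proof -
 assume x: "1 \<le> x"
 have "ln (x powr (1 / 8)) \<le> x powr (1 / 8)"
  using ln_le_minus_one[of "x powr (1 / 8)"] x by simp
 then show ?thesis using x by (simp add: ln_powr)
qed

text \<open>Let \<open>l = ln n\<close> and let \<open>x\<close> be one less than the least
  nonresidue. Chebyshev's bound controls \<open>x\<close> by its number of primes up to a factor
  \<open>ln x\<close>. Replacing \<open>ln l\<close> and \<open>ln x\<close> by multiples of eighth
  powers bounds \<open>x\<close> by a constant times \<open>l^(9/8) * x^(1/8)\<close>; solving for
  \<open>x\<close> gives the exponent \<open>9/8 * 8/7 = 9/7\<close>.\<close>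

lemma least_nonresidue_bound:
 assumes "conjecture_A"
 shows "\<exists>C>0. \<forall>n L. pseudosquare_candidate L \<and> L \<le> n \<longrightarrow>
  real (least_nonresidue L) \<le> C * ln (real n) powr (9 / 7)"
proof -
 obtain C where C: "C > 0" "\<And>n L. pseudosquare_candidate L \<Longrightarrow> L \<le> n \<Longrightarrow>
  real (card {p. prime p \<and> p < least_nonresidue L}) \<le> C * (ln (real n) * ln (ln (real n)))"
  using previous_prime_bound[OF assms] by blast
 define C' where "C' = (128 * C + 4) powr (8 / 7) + 1"
 have "real (least_nonresidue L) \<le> C' * ln (real n) powr (9 / 7)"
  if L: "pseudosquare_candidate L" "L \<le> n" for n L
 proof -
  define x where "x = least_nonresidue L - 1"
  define l where "l = ln (real n)"
  have L': "1 < L" "\<not> is_square L" "L mod 8 = 1" using L by (auto simp: pseudosquare_candidate_def)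
  then have "odd L" by presburger
  note q = least_nonresidue[OF L'(1) this]
  have q2: "2 < least_nonresidue L" using q(1,2) prime_ge_2_nat[OF q(1)] by (cases "least_nonresidue L = 2") auto
  have "9 \<le> L" using L'(1,3) by presburger
  then have "4 \<le> n" using L by simp
  then have "exp 1 < real n" using exp_le by linarith
  then have l1: "1 < l" unfolding l_def by (metis exp_less_cancel_iff exp_ln less_trans exp_gt_zero)
  have x2: "2 \<le> x" using q2 by (simp add: x_def)
  have set: "{p. prime p \<and> p \<le> x} = {p. prime p \<and> p < least_nonresidue L}"
   using q2 by (auto simp: x_def)
  define m where "m = (x - 1) div 2"
  have "4 ^ m \<le> x ^ card {p. prime p \<and> p \<le> x}" by (rule chebyshev_lower) (use x2 in \<open>auto simp: m_def\<close>)
  then have "real (4 ^ m) \<le> real (x ^ card {p. prime p \<and> p \<le> x})" by (simp only: of_nat_le_iff)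
  then have "ln (4 ^ m) \<le> ln (real x ^ card {p. prime p \<and> p \<le> x})"
   using x2 by (subst ln_le_cancel_iff) auto
  then have "real m * ln 4 \<le> real (card {p. prime p \<and> p \<le> x}) * ln (real x)"
   using x2 by (simp add: ln_realpow)
  moreover have "real (card {p. prime p \<and> p \<le> x}) * ln (real x) \<le> C * (l * ln l) * ln (real x)"
   using C(2)[OF L] x2 unfolding set l_def by (intro mult_right_mono) auto
  moreover have "1 \<le> ln (4::real)"
  proof -
   have "exp 1 \<le> (4::real)" using exp_le by linarith
   then show ?thesis by (simp add: ln_ge_iff)
  qed
  then have "real m * 1 \<le> real m * ln 4" by (intro mult_left_mono) auto
  ultimately have m1: "real m \<le> C * (l * ln l) * ln (real x)" by linarith
  have "x \<le> 2 * m + 2" unfolding m_def by presburger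
  then have "real x \<le> 2 * real m + 2" by linarith
  also have "\<dots> \<le> 2 * (C * (l * ln l) * ln (real x)) + 2" using m1 by simp
  also have "\<dots> \<le> 2 * (C * (l * (8 * l powr (1/8))) * (8 * real x powr (1/8))) + 2 * (l * l powr (1/8)) * real x powr (1/8)"
  proof (intro add_mono mult_left_mono mult_mono)
   show "ln l \<le> 8 * l powr (1/8)" using l1 by (intro ln_le_powr_eighth) auto
   show "ln (real x) \<le> 8 * real x powr (1/8)" using x2 by (intro ln_le_powr_eighth) auto
   have "1 \<le> l powr (1/8)" using l1 by (simp add: ge_one_powr_ge_zero)
   then have "1 \<le> l * l powr (1/8)" using mult_mono[of 1 l 1 "l powr (1/8)"] l1 by simp
   moreover have "1 \<le> real x powr (1/8)" using x2 by (simp add: ge_one_powr_ge_zero)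
   ultimately have "1 \<le> (l * l powr (1/8)) * real x powr (1/8)" using mult_mono[of 1 "l * l powr (1/8)" 1] by auto
   then show "2 \<le> 2 * (l * l powr (1/8)) * real x powr (1/8)" by simp
  qed (use l1 x2 C(1) in auto)
  also have "\<dots> \<le> (128 * C + 4) * (l * l powr (1/8)) * real x powr (1/8)"
   using l1 by (simp add: algebra_simps)
  also have "l * l powr (1/8) = l powr (9/8)" using l1 powr_mult_base[of l "1/8"] by simp
  finally have 1: "real x \<le> (128 * C + 4) * l powr (9/8) * real x powr (1/8)" .
  have "real x powr (7/8) * real x powr (1/8) = real x" using x2 by (simp add: powr_add[symmetric])
  then have "real x powr (7/8) * real x powr (1/8) \<le> (128 * C + 4) * l powr (9/8) * real x powr (1/8)" using 1 by simp
  then have "real x powr (7/8) \<le> (128 * C + 4) * l powr (9/8)" using x2 by simp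
  then have "(real x powr (7/8)) powr (8/7) \<le> ((128 * C + 4) * l powr (9/8)) powr (8/7)"
   by (intro powr_mono2) auto
  then have "real x \<le> (128 * C + 4) powr (8/7) * l powr (9/7)"
   using x2 C(1) by (simp add: powr_powr powr_mult)
  moreover have "1 \<le> l powr (9/7)" using l1 by (simp add: ge_one_powr_ge_zero)
  moreover have "real (least_nonresidue L) = real x + 1" using q2 by (simp add: x_def)
  ultimately show ?thesis unfolding C'_def l_def[symmetric] by (simp add: algebra_simps)
 qed
 moreover have "C' > 0" unfolding C'_def by (simp add: add_nonneg_pos)
 ultimately show ?thesis by blast
qed

section \<open>Brun's pure sieve\<close>

lemma card_periodic_shift:
 fixes d :: nat and u :: int
 assumes "0 < d" "\<And>x. R (x mod int d) = R x"
 shows "card {x \<in> {u..<u + int d}. R x} = card {x \<in> {0..<int d}. R x}"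
proof (rule bij_betw_same_card[of "\<lambda>x. x mod int d"])
 have inj: "inj_on (\<lambda>x. x mod int d) {u..<u + int d}"
 proof (rule inj_onI)
  fix x y assume *: "x \<in> {u..<u + int d}" "y \<in> {u..<u + int d}" "x mod int d = y mod int d"
  then have "int d dvd x - y" by (simp add: mod_eq_dvd_iff)
  moreover have "\<bar>x - y\<bar> < int d" using * by auto
  ultimately show "x = y" using zdvd_not_zless[of "\<bar>x - y\<bar>" "int d"] by (cases "x = y") auto
 qed
 have "(\<lambda>x. x mod int d) ` {u..<u + int d} = {0..<int d}"
 proof (rule card_subset_eq)
  show "card ((\<lambda>x. x mod int d) ` {u..<u + int d}) = card {0..<int d}"
   using inj by (simp add: card_image)
 qed (use assms(1) in auto)
 then have surj: "\<exists>x\<in>{u..<u + int d}. y = x mod int d" if "y \<in> {0..<int d}" for y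
  using that by (metis imageE)
 show "bij_betw (\<lambda>x. x mod int d) {x \<in> {u..<u + int d}. R x} {x \<in> {0..<int d}. R x}"
 proof (rule bij_betw_imageI)
  show "(\<lambda>x. x mod int d) ` {x \<in> {u..<u + int d}. R x} = {x \<in> {0..<int d}. R x}"
  proof safe
   fix y assume y: "y \<in> {0..<int d}" "R y"
   then obtain x where "x \<in> {u..<u + int d}" "y = x mod int d" using surj by blast
   then show "y \<in> (\<lambda>x. x mod int d) ` {x \<in> {u..<u + int d}. R x}" using y assms(2) by auto
  qed (use assms in auto)
 qed (use inj in \<open>auto intro: inj_on_subset\<close>)
qed

lemma card_crt_product:
 fixes d e :: nat
 assumes "coprime d e" "0 < d" "0 < e" "\<And>x. R (x mod int d) = R x" "\<And>x. T (x mod int e) = T x"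
 shows "card {x \<in> {0..<int (d * e)}. R x \<and> T x} =
  card {x \<in> {0..<int d}. R x} * card {x \<in> {0..<int e}. T x}"
proof -
 let ?f = "\<lambda>x. (x mod int d, x mod int e)"
 have inj: "inj_on ?f {0..<int (d * e)}"
 proof (rule inj_onI)
  fix x y assume *: "x \<in> {0..<int (d * e)}" "y \<in> {0..<int (d * e)}" "?f x = ?f y"
  then have "int d dvd x - y" "int e dvd x - y" by (auto simp: mod_eq_dvd_iff)
  then have "int d * int e dvd x - y" using assms(1) by (intro divides_mult) auto
  moreover have "\<bar>x - y\<bar> < int d * int e" using * by auto
  ultimately show "x = y" using zdvd_not_zless[of "\<bar>x - y\<bar>" "int d * int e"] by (cases "x = y") auto
 qed
 have im: "?f ` {0..<int (d * e)} = {0..<int d} \<times> {0..<int e}"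
 proof (rule card_subset_eq)
  show "card (?f ` {0..<int (d * e)}) = card ({0..<int d} \<times> {0..<int e})"
   using inj by (simp add: card_image card_cartesian_product nat_mult_distrib)
 qed (use assms in auto)
 have "bij_betw ?f {x \<in> {0..<int (d * e)}. R x \<and> T x}
   ({x \<in> {0..<int d}. R x} \<times> {x \<in> {0..<int e}. T x})"
 proof (rule bij_betw_imageI)
  show "?f ` {x \<in> {0..<int (d * e)}. R x \<and> T x} = {x \<in> {0..<int d}. R x} \<times> {x \<in> {0..<int e}. T x}"
  proof (intro equalityI subsetI)
   fix z assume "z \<in> ?f ` {x \<in> {0..<int (d * e)}. R x \<and> T x}"
   then show "z \<in> {x \<in> {0..<int d}. R x} \<times> {x \<in> {0..<int e}. T x}" using assms by auto
  next
   fix z assume z: "z \<in> {x \<in> {0..<int d}. R x} \<times> {x \<in> {0..<int e}. T x}"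
   then have "z \<in> ?f ` {0..<int (d * e)}" unfolding im by auto
   then obtain x where x: "x \<in> {0..<int (d * e)}" "z = ?f x" by blast
   then have "R x" "T x" using z assms(4,5) by auto
   then show "z \<in> ?f ` {x \<in> {0..<int (d * e)}. R x \<and> T x}" using x by blast
  qed
 qed (use inj in \<open>auto intro: inj_on_subset\<close>)
 then show ?thesis by (simp add: bij_betw_same_card card_cartesian_product)
qed

lemma mod_prod_periodic:
 fixes Q :: "nat set" and R :: "nat \<Rightarrow> int \<Rightarrow> bool"
 assumes "finite Q" "\<And>p x. p \<in> Q \<Longrightarrow> R p (x mod int p) = R p x"
 shows "(\<forall>p\<in>Q. R p (x mod int (\<Prod>Q))) = (\<forall>p\<in>Q. R p x)"
proof -
 have "R p (x mod int (\<Prod>Q)) = R p x" if "p \<in> Q" for p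
 proof -
  have "int p dvd int (\<Prod>Q)" using dvd_prodI[OF assms(1) that, of id] by (simp only: int_dvd_int_iff id_apply) simp
  then have "x mod int (\<Prod>Q) mod int p = x mod int p" by (rule mod_mod_cancel)
  then show ?thesis using assms(2)[OF that] by metis
 qed
 then show ?thesis by blast
qed

text \<open>The Chinese remainder theorem, one prime at a time: over a full period the local
  conditions are independent, wherever the period starts.\<close>

lemma card_crt:
 fixes Q :: "nat set" and R :: "nat \<Rightarrow> int \<Rightarrow> bool" and u :: int
 assumes "finite Q" "\<And>p. p \<in> Q \<Longrightarrow> prime p" "\<And>p x. p \<in> Q \<Longrightarrow> R p (x mod int p) = R p x"
 shows "card {x \<in> {u..<u + int (\<Prod>Q)}. \<forall>p\<in>Q. R p x} = (\<Prod>p\<in>Q. card {x \<in> {0..<int p}. R p x})"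
proof -
 have pos: "0 < \<Prod>Q" using assms(2) by (auto intro!: prod_pos simp: prime_gt_0_nat)
 have "card {x \<in> {0..<int (\<Prod>Q)}. \<forall>p\<in>Q. R p x} = (\<Prod>p\<in>Q. card {x \<in> {0..<int p}. R p x})"
  using assms
 proof (induction Q rule: finite_induct)
  case empty
  have "{x. x = (0::int)} = {0}" by auto
  moreover have "{x \<in> {0..<int (\<Prod>({}::nat set))}. \<forall>p\<in>{}. R p x} = {0}" by auto
  ultimately show ?case by simp
 next
  case (insert q Q)
  have cop: "coprime q (\<Prod>Q)"
   by (rule prod_coprime_right) (use insert in \<open>auto intro: primes_coprime\<close>)
  have "0 < \<Prod>Q" using insert by (auto intro!: prod_pos simp: prime_gt_0_nat)
  then have "card {x \<in> {0..<int (q * \<Prod>Q)}. R q x \<and> (\<forall>p\<in>Q. R p x)} =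
    card {x \<in> {0..<int q}. R q x} * card {x \<in> {0..<int (\<Prod>Q)}. \<forall>p\<in>Q. R p x}"
   using cop insert prime_gt_0_nat mod_prod_periodic[of Q R]
   by (intro card_crt_product) auto
  then show ?case using insert by simp
 qed
 moreover have "card {x \<in> {u..<u + int (\<Prod>Q)}. \<forall>p\<in>Q. R p x} = card {x \<in> {0..<int (\<Prod>Q)}. \<forall>p\<in>Q. R p x}"
  by (rule card_periodic_shift[OF pos]) (rule mod_prod_periodic[of Q R, OF assms(1)], rule assms(3))
 ultimately show ?thesis by simp
qed

text \<open>\<open>H\<close> lies between \<open>q\<close> and \<open>q + 1\<close> periods, so
  count and main term both lie between \<open>q * c\<close> and \<open>(q + 1) * c\<close>.\<close>

lemma card_periodic_interval:
 fixes d H :: nat and u :: int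
 assumes "0 < d" "\<And>x. R (x mod int d) = R x"
 defines "c \<equiv> card {x \<in> {0..<int d}. R x}"
 shows "\<bar>real (card {x \<in> {u..<u + int H}. R x}) - real H * (real c / real d)\<bar> \<le> real c"
proof -
 have split: "{x \<in> {u..<z}. R x} = {x \<in> {u..<v}. R x} \<union> {x \<in> {v..<v + e}. R x}"
  if "u \<le> v" "z = v + e" "0 \<le> e" for u v z e
  using that by auto
 have mult: "card {x \<in> {u..<u + int (q * d)}. R x} = q * c" for q u
 proof (induction q)
  case (Suc q)
  have "{x \<in> {u..<u + int (Suc q * d)}. R x} =
    {x \<in> {u..<u + int (q * d)}. R x} \<union> {x \<in> {u + int (q * d)..<u + int (q * d) + int d}. R x}"
   by (rule split) auto
  moreover have "card \<dots> = card {x \<in> {u..<u + int (q * d)}. R x} +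
    card {x \<in> {u + int (q * d)..<u + int (q * d) + int d}. R x}"
   by (intro card_Un_disjoint finite_Collect_conjI disjI1) auto
  ultimately show ?case using Suc card_periodic_shift[of d R, OF assms(1,2)] by (simp add: c_def)
 qed simp
 define q where "q = H div d"
 have "H = q * d + H mod d" "H mod d < d" using assms(1) by (simp_all add: q_def)
 then have H: "q * d \<le> H" "H \<le> Suc q * d" by (metis le_add1, simp)
 let ?N = "card {x \<in> {u..<u + int H}. R x}"
 have le: "int (q * d) \<le> int H" "int H \<le> int (Suc q * d)" using H by (simp_all only: of_nat_le_iff)
 have fin: "finite {x \<in> {u..<v}. R x}" for v by (rule finite_subset[of _ "{u..<v}"]) auto
 have "q * c \<le> ?N" unfolding mult[of u q, symmetric]
  by (rule card_mono[OF fin]) (use le in auto)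
 moreover have "?N \<le> Suc q * c" unfolding mult[of u "Suc q", symmetric]
  by (rule card_mono[OF fin]) (use le in auto)
 ultimately have N: "real q * real c \<le> real ?N" "real ?N \<le> (real q + 1) * real c"
  by (metis of_nat_le_iff of_nat_mult, metis of_nat_le_iff of_nat_mult of_nat_Suc add.commute)
 have "real q * real d \<le> real H" "real H \<le> (real q + 1) * real d"
  using H by (metis of_nat_le_iff of_nat_mult, metis of_nat_le_iff of_nat_mult of_nat_Suc add.commute)
 then have "real q \<le> real H / real d" "real H / real d \<le> real q + 1" using assms(1) by (simp_all add: field_simps)
 then have "real q * real c \<le> real H / real d * real c" "real H / real d * real c \<le> (real q + 1) * real c"
  by (simp_all only: mult_right_mono of_nat_0_le_iff)
 moreover have "real H * (real c / real d) = real H / real d * real c" by simp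
 ultimately show ?thesis using N unfolding abs_le_iff by (simp only: distrib_right mult_1) linarith
qed

section \<open>Truncated inclusion-exclusion\<close>

text \<open>The alternating sum of binomial coefficients up to \<open>r\<close> collapses to
  \<open>(-1)^r\<close> times \<open>card A - 1\<close> choose \<open>r\<close>, which is
  nonnegative for even \<open>r\<close> and nonempty \<open>A\<close>; for empty \<open>A\<close>
  only the empty set contributes.\<close>

lemma bonferroni:
 fixes A :: "'a set"
 assumes "finite A" "even r"
 shows "of_bool (A = {}) \<le> (\<Sum>D | D \<subseteq> A \<and> card D \<le> r. (-1::real) ^ card D)"
proof -
 let ?S = "{D. D \<subseteq> A \<and> card D \<le> r}"
 have fin: "finite ?S" by (rule finite_subset[of _ "Pow A"]) (use assms in auto)
 have "(\<Sum>D\<in>?S. (-1::real) ^ card D) = (\<Sum>j\<le>r. \<Sum>D | D \<in> ?S \<and> card D = j. (-1) ^ card D)"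
  by (rule sum.group[symmetric]) (use fin in auto)
 also have "\<dots> = (\<Sum>j\<le>r. real (card A choose j) * (-1) ^ j)"
 proof (rule sum.cong)
  fix j assume "j \<in> {..r}"
  then have "{D \<in> ?S. card D = j} = {D. D \<subseteq> A \<and> card D = j}" by auto
  then have "(\<Sum>D | D \<in> ?S \<and> card D = j. (-1::real) ^ card D) = (\<Sum>D | D \<subseteq> A \<and> card D = j. (-1) ^ j)"
   by (intro sum.cong) auto
  then show "(\<Sum>D | D \<in> ?S \<and> card D = j. (-1::real) ^ card D) = real (card A choose j) * (-1) ^ j"
   using n_subsets[OF assms(1), of j] by simp
 qed simp
 also have "\<dots> = (\<Sum>j\<le>r. (real (card A) gchoose j) * (-1) ^ j)" by (simp add: binomial_gbinomial)
 also have "\<dots> = (-1) ^ r * ((real (card A) - 1) gchoose r)" by (rule gbinomial_sum_lower_neg)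
 also have "\<dots> = (real (card A) - 1) gchoose r" using assms(2) by simp
 finally have *: "(\<Sum>D\<in>?S. (-1::real) ^ card D) = (real (card A) - 1) gchoose r" .
 show ?thesis
 proof (cases "A = {}")
  case True
  then have "?S = {{}}" by auto
  then show ?thesis using True by simp
 next
  case False
  then have "real (card A) - 1 = real (card A - 1)" using assms(1) by (simp add: of_nat_diff Suc_le_eq card_gt_0_iff)
  then have "(real (card A) - 1) gchoose r = real (card A - 1 choose r)" by (simp only: binomial_gbinomial)
  then show ?thesis using * False by simp
 qed
qed

lemma sum_Pow_prod: "finite A \<Longrightarrow> (\<Sum>D\<in>Pow A. prod f D) = (\<Prod>x\<in>A. 1 + f x :: real)"
 using prod_add[of A f "\<lambda>_. 1"] by (simp add: add.commute)

lemma prod_one_plus_le_exp: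
 assumes "\<And>x. x \<in> A \<Longrightarrow> 0 \<le> f x"
 shows "(\<Prod>x\<in>A. 1 + f x :: real) \<le> exp (\<Sum>x\<in>A. f x)"
proof (cases "finite A")
 case True
 have "(\<Prod>x\<in>A. 1 + f x) \<le> (\<Prod>x\<in>A. exp (f x))"
  by (rule prod_mono) (use assms in \<open>auto simp: add_nonneg_nonneg exp_ge_add_one_self\<close>)
 then show ?thesis using True by (simp add: exp_sum)
qed auto

text \<open>Rankin's trick: each set with more than \<open>r\<close> elements is weighted by
  \<open>exp (card D - r)\<close>, which is at least 1, after which the sum may run over all subsets
  and factors into a product.\<close>

lemma rankin_large_subsets:
 assumes "finite Q" "\<And>p. p \<in> Q \<Longrightarrow> 0 \<le> f p"
 shows "(\<Sum>D | D \<subseteq> Q \<and> r < card D. \<Prod>p\<in>D. f p) \<le> exp (- real r + exp 1 * (\<Sum>p\<in>Q. f p))"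
proof -
 have nn: "0 \<le> (\<Prod>p\<in>D. f p)" if "D \<subseteq> Q" for D
  using that assms by (auto intro!: prod_nonneg)
 have "(\<Sum>D | D \<subseteq> Q \<and> r < card D. \<Prod>p\<in>D. f p) \<le>
   (\<Sum>D | D \<subseteq> Q \<and> r < card D. exp (- real r) * (\<Prod>p\<in>D. exp 1 * f p))"
 proof (rule sum_mono)
  fix D assume D: "D \<in> {D. D \<subseteq> Q \<and> r < card D}"
  have "(\<Prod>p\<in>D. exp 1 * f p) = exp 1 ^ card D * (\<Prod>p\<in>D. f p)" by (simp add: prod.distrib)
  also have "exp 1 ^ card D = exp (real (card D))" by (simp add: exp_of_nat_mult[symmetric])
  finally have "exp (- real r) * (\<Prod>p\<in>D. exp 1 * f p) = exp (real (card D) - real r) * (\<Prod>p\<in>D. f p)"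
   by (simp add: exp_diff exp_minus field_simps)
  moreover have "1 \<le> exp (real (card D) - real r)" using D by simp
  ultimately show "(\<Prod>p\<in>D. f p) \<le> exp (- real r) * (\<Prod>p\<in>D. exp 1 * f p)"
   using nn[of D] D mult_right_mono[of 1 "exp (real (card D) - real r)" "\<Prod>p\<in>D. f p"] by simp
 qed
 also have "\<dots> \<le> (\<Sum>D\<in>Pow Q. exp (- real r) * (\<Prod>p\<in>D. exp 1 * f p))"
  by (rule sum_mono2) (use assms in \<open>auto intro!: mult_nonneg_nonneg prod_nonneg\<close>)
 also have "\<dots> = exp (- real r) * (\<Prod>p\<in>Q. 1 + exp 1 * f p)"
  using sum_Pow_prod[OF assms(1), of "\<lambda>p. exp 1 * f p"] by (simp add: sum_distrib_left[symmetric])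
 also have "\<dots> \<le> exp (- real r) * exp (\<Sum>p\<in>Q. exp 1 * f p)"
  by (intro mult_left_mono prod_one_plus_le_exp) (use assms in auto)
 also have "\<dots> = exp (- real r + exp 1 * (\<Sum>p\<in>Q. f p))" by (simp only: exp_add sum_distrib_left)
 finally show ?thesis .
qed

text \<open>Rankin's trick from the other side: the weight \<open>Y^(r - card D)\<close> is at least
  1 on sets of at most \<open>r\<close> elements; with \<open>Y^r\<close> pulled out, the sum over
  all subsets is a product below \<open>exp 1\<close>.\<close>

lemma rankin_small_subsets:
 assumes "finite Q" "\<And>p. p \<in> Q \<Longrightarrow> 0 \<le> f p" "1 \<le> (Y::real)" "(\<Sum>p\<in>Q. f p) \<le> Y"
 shows "(\<Sum>D | D \<subseteq> Q \<and> card D \<le> r. \<Prod>p\<in>D. f p) \<le> exp 1 * Y ^ r"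
proof -
 have "(\<Sum>D | D \<subseteq> Q \<and> card D \<le> r. \<Prod>p\<in>D. f p) \<le>
   (\<Sum>D | D \<subseteq> Q \<and> card D \<le> r. Y ^ r * (\<Prod>p\<in>D. f p / Y))"
 proof (rule sum_mono)
  fix D assume D: "D \<in> {D. D \<subseteq> Q \<and> card D \<le> r}"
  have "Y ^ r * (\<Prod>p\<in>D. f p / Y) = Y ^ r / Y ^ card D * (\<Prod>p\<in>D. f p)" by (simp add: prod_dividef)
  also have "Y ^ r / Y ^ card D = Y ^ (r - card D)" using D assms(3) by (simp add: power_diff)
  finally have "Y ^ r * (\<Prod>p\<in>D. f p / Y) = Y ^ (r - card D) * (\<Prod>p\<in>D. f p)" .
  moreover have "1 \<le> Y ^ (r - card D)" using assms(3) by simp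
  moreover have "0 \<le> (\<Prod>p\<in>D. f p)" using D assms by (auto intro!: prod_nonneg)
  ultimately show "(\<Prod>p\<in>D. f p) \<le> Y ^ r * (\<Prod>p\<in>D. f p / Y)"
   using mult_right_mono[of 1 "Y ^ (r - card D)" "\<Prod>p\<in>D. f p"] by simp
 qed
 also have "\<dots> \<le> (\<Sum>D\<in>Pow Q. Y ^ r * (\<Prod>p\<in>D. f p / Y))"
  by (rule sum_mono2) (use assms in \<open>auto intro!: mult_nonneg_nonneg prod_nonneg\<close>)
 also have "\<dots> = Y ^ r * (\<Prod>p\<in>Q. 1 + f p / Y)"
  using sum_Pow_prod[OF assms(1), of "\<lambda>p. f p / Y"] by (simp add: sum_distrib_left[symmetric])
 also have "\<dots> \<le> Y ^ r * exp (\<Sum>p\<in>Q. f p / Y)"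
  by (intro mult_left_mono prod_one_plus_le_exp) (use assms in auto)
 also have "\<dots> \<le> Y ^ r * exp 1"
  using assms by (intro mult_left_mono) (auto simp: sum_divide_distrib[symmetric] divide_le_eq)
 finally show ?thesis by (simp add: mult.commute)
qed

text \<open>Bonferroni's inequality is applied at each position and the sums are exchanged.
  Completing the main terms to all subsets of \<open>Q\<close> gives the Euler product, with a tail
  bounded by \<open>rankin_large_subsets\<close>. The error for a set \<open>D\<close> is
  \<open>k^(card D)\<close>, and \<open>rankin_small_subsets\<close> sums these errors;
  \<open>Y\<close> bounds their total weight \<open>k * card Q\<close>.\<close>

theorem brun_sieve:
 fixes Q :: "nat set" and Z :: "nat \<Rightarrow> int \<Rightarrow> bool" and u :: int and H k r :: nat
 assumes Q: "finite Q" "\<And>p. p \<in> Q \<Longrightarrow> prime p"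
  and per: "\<And>p x. p \<in> Q \<Longrightarrow> Z p (x mod int p) = Z p x"
  and c: "\<And>p. p \<in> Q \<Longrightarrow> card {x \<in> {0..<int p}. Z p x} = k"
  and r: "even r" and Y: "1 \<le> Y" "real k * real (card Q) \<le> Y"
 shows "real (card {x \<in> {u..<u + int H}. \<forall>p\<in>Q. \<not> Z p x}) \<le>
  real H * ((\<Prod>p\<in>Q. 1 - real k / real p) + exp (- real r + exp 1 * (\<Sum>p\<in>Q. real k / real p)))
   + exp 1 * Y ^ r"
proof -
 let ?I = "{u..<u + int H}"
 let ?S = "{D. D \<subseteq> Q \<and> card D \<le> r}"
 let ?g = "\<lambda>D. \<Prod>p\<in>D. real k / real p"
 define A where "A D = card {x \<in> ?I. \<forall>p\<in>D. Z p x}" for D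
 have finS: "finite ?S" by (rule finite_subset[of _ "Pow Q"]) (use Q in auto)
 have AD: "\<bar>real (A D) - real H * ?g D\<bar> \<le> (\<Prod>p\<in>D. real k)" if "D \<subseteq> Q" for D
 proof -
  have finD: "finite D" using that Q(1) finite_subset by blast
  have pos: "0 < \<Prod>D" using that Q(2) by (auto intro!: prod_pos simp: prime_gt_0_nat)
  have perD: "(\<forall>p\<in>D. Z p (x mod int (\<Prod>D))) = (\<forall>p\<in>D. Z p x)" for x
   by (rule mod_prod_periodic[OF finD]) (use per that in auto)
  have "card {x \<in> {0..<int (\<Prod>D)}. \<forall>p\<in>D. Z p x} = (\<Prod>p\<in>D. card {x \<in> {0..<int p}. Z p x})"
   using card_crt[of D Z 0, OF finD] Q(2) per subsetD[OF that] by simp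
  also have "\<dots> = (\<Prod>p\<in>D. k)" using c that by (intro prod.cong) auto
  finally have "card {x \<in> {0..<int (\<Prod>D)}. \<forall>p\<in>D. Z p x} = (\<Prod>p\<in>D. k)" .
  with card_periodic_interval[of "\<Prod>D" "\<lambda>x. \<forall>p\<in>D. Z p x" u H, OF pos perD]
  have "\<bar>real (A D) - real H * (real (\<Prod>p\<in>D. k) / real (\<Prod>D))\<bar> \<le> real (\<Prod>p\<in>D. k)"
   by (simp add: A_def)
  then show ?thesis by (simp add: prod_dividef del: prod_constant)
 qed
 have "real (card {x \<in> ?I. \<forall>p\<in>Q. \<not> Z p x}) = (\<Sum>x\<in>?I. of_bool ({p \<in> Q. Z p x} = {}))"
  by (subst sum_of_bool_eq) (auto intro!: arg_cong[where f = card])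
 also have "\<dots> \<le> (\<Sum>x\<in>?I. \<Sum>D | D \<subseteq> {p \<in> Q. Z p x} \<and> card D \<le> r. (-1) ^ card D)"
  by (intro sum_mono bonferroni) (use Q r in auto)
 also have "\<dots> = (\<Sum>x\<in>?I. \<Sum>D\<in>?S. (-1) ^ card D * of_bool (\<forall>p\<in>D. Z p x))"
 proof (rule sum.cong[OF refl])
  fix x
  have "{D. D \<subseteq> {p \<in> Q. Z p x} \<and> card D \<le> r} = {D \<in> ?S. \<forall>p\<in>D. Z p x}" by auto
  then have "(\<Sum>D | D \<subseteq> {p \<in> Q. Z p x} \<and> card D \<le> r. (-1::real) ^ card D) =
    (\<Sum>D\<in>?S. if \<forall>p\<in>D. Z p x then (-1) ^ card D else 0)"
   using sum.inter_filter[OF finS, of "\<lambda>D. (-1::real) ^ card D" "\<lambda>D. \<forall>p\<in>D. Z p x"] by simp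
  also have "\<dots> = (\<Sum>D\<in>?S. (-1) ^ card D * of_bool (\<forall>p\<in>D. Z p x))"
   by (intro sum.cong) auto
  finally show "(\<Sum>D | D \<subseteq> {p \<in> Q. Z p x} \<and> card D \<le> r. (-1::real) ^ card D) =
    (\<Sum>D\<in>?S. (-1) ^ card D * of_bool (\<forall>p\<in>D. Z p x))" .
 qed
 also have "\<dots> = (\<Sum>D\<in>?S. \<Sum>x\<in>?I. (-1) ^ card D * of_bool (\<forall>p\<in>D. Z p x))" by (rule sum.swap)
 also have "\<dots> = (\<Sum>D\<in>?S. (-1) ^ card D * real (A D))"
  by (intro sum.cong) (auto simp: A_def sum_distrib_left[symmetric] sum_of_bool_eq Int_def)
 also have "\<dots> \<le> (\<Sum>D\<in>?S. real H * ((-1) ^ card D * ?g D) + (\<Prod>p\<in>D. real k))"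
 proof (rule sum_mono)
  fix D assume D: "D \<in> ?S"
  have "(-1) ^ card D * real (A D) - real H * ((-1) ^ card D * ?g D) = (-1) ^ card D * (real (A D) - real H * ?g D)"
   by (simp add: algebra_simps)
  also have "\<dots> \<le> \<bar>(-1) ^ card D * (real (A D) - real H * ?g D)\<bar>" by simp
  also have "\<dots> = \<bar>real (A D) - real H * ?g D\<bar>" by (simp add: abs_mult power_abs)
  also have "\<dots> \<le> (\<Prod>p\<in>D. real k)" using AD D by auto
  finally show "(-1) ^ card D * real (A D) \<le> real H * ((-1) ^ card D * ?g D) + (\<Prod>p\<in>D. real k)" by linarith
 qed
 also have "\<dots> = real H * (\<Sum>D\<in>?S. (-1) ^ card D * ?g D) + (\<Sum>D\<in>?S. \<Prod>p\<in>D. real k)"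
  by (simp only: sum.distrib sum_distrib_left)
 also have "\<dots> \<le> real H * ((\<Prod>p\<in>Q. 1 - real k / real p) + exp (- real r + exp 1 * (\<Sum>p\<in>Q. real k / real p)))
   + exp 1 * Y ^ r"
 proof (intro add_mono mult_left_mono)
  let ?L = "{D. D \<subseteq> Q \<and> r < card D}"
  have finL: "finite ?L" by (rule finite_subset[of _ "Pow Q"]) (use Q in auto)
  have "(\<Prod>p\<in>Q. 1 - real k / real p) = (\<Sum>D\<in>Pow Q. \<Prod>p\<in>D. - (real k / real p))"
   using sum_Pow_prod[OF Q(1), of "\<lambda>p. - (real k / real p)"] by simp
  also have "\<dots> = (\<Sum>D\<in>Pow Q. (-1) ^ card D * ?g D)"
   by (intro sum.cong refl) (simp add: prod_uminus)
  also have "Pow Q = ?S \<union> ?L" by auto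
  also have "(\<Sum>D\<in>?S \<union> ?L. (-1) ^ card D * ?g D) =
    (\<Sum>D\<in>?S. (-1) ^ card D * ?g D) + (\<Sum>D\<in>?L. (-1) ^ card D * ?g D)"
   by (rule sum.union_disjoint) (use finS finL in auto)
  finally have "(\<Sum>D\<in>?S. (-1) ^ card D * ?g D) =
    (\<Prod>p\<in>Q. 1 - real k / real p) + (\<Sum>D\<in>?L. - ((-1) ^ card D * ?g D))"
   by (simp add: sum_negf)
  also have "(\<Sum>D\<in>?L. - ((-1) ^ card D * ?g D)) \<le> (\<Sum>D\<in>?L. ?g D)"
  proof (rule sum_mono)
   fix D
   have "- ((-1) ^ card D * ?g D) \<le> \<bar>(-1) ^ card D * ?g D\<bar>" by simp
   also have "\<dots> = ?g D" by (simp add: abs_mult power_abs abs_prod)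
   finally show "- ((-1) ^ card D * ?g D) \<le> ?g D" .
  qed
  also have "(\<Sum>D\<in>?L. ?g D) \<le> exp (- real r + exp 1 * (\<Sum>p\<in>Q. real k / real p))"
   by (rule rankin_large_subsets[OF Q(1)]) auto
  finally show "(\<Sum>D\<in>?S. (-1) ^ card D * ?g D) \<le> (\<Prod>p\<in>Q. 1 - real k / real p) +
    exp (- real r + exp 1 * (\<Sum>p\<in>Q. real k / real p))" by simp
  show "(\<Sum>D\<in>?S. \<Prod>p\<in>D. real k) \<le> exp 1 * Y ^ r"
   by (rule rankin_small_subsets[OF Q(1)]) (use Y in \<open>auto simp: mult.commute\<close>)
 qed auto
 finally show ?thesis .
qed

section \<open>Linear forms\<close>

text \<open>The strict inequality suits the wheel loop, whose next candidate \<open>m\<close> has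
  not been multiplied in yet.\<close>

abbreviation primorial :: "nat \<Rightarrow> nat" where
 "primorial m \<equiv> \<Prod>{p. prime p \<and> p < m}"

locale linear_forms =
 fixes k :: nat and a b :: "nat \<Rightarrow> int"
 assumes k_pos: "0 < k"
  and a_pos: "\<And>i. i < k \<Longrightarrow> 0 < a i"
  and distinct_forms: "\<And>i j. i < k \<Longrightarrow> j < k \<Longrightarrow> i \<noteq> j \<Longrightarrow> (a i, b i) \<noteq> (a j, b j)"
begin

definition form :: "nat \<Rightarrow> int \<Rightarrow> int" where
 "form i x = a i * x + b i"

definition hits :: "nat \<Rightarrow> int \<Rightarrow> bool" where
 "hits p x \<longleftrightarrow> (\<exists>i<k. int p dvd form i x)"

abbreviation avoids_below :: "nat \<Rightarrow> int \<Rightarrow> bool" where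
 "avoids_below m x \<equiv> \<forall>p. prime p \<and> p < m \<longrightarrow> \<not> hits p x"

abbreviation avoids_upto :: "nat \<Rightarrow> int \<Rightarrow> bool" where
 "avoids_upto y x \<equiv> \<forall>p. prime p \<and> p \<le> y \<longrightarrow> \<not> hits p x"

lemma form_mod: "int p dvd form i (x mod int p) \<longleftrightarrow> int p dvd form i x"
proof -
 have "form i x - form i (x mod int p) = a i * (x - x mod int p)" by (simp add: form_def algebra_simps)
 moreover have "int p dvd x - x mod int p" by (simp add: minus_mod_eq_mult_div)
 ultimately have "int p dvd form i x - form i (x mod int p)" by simp
 then show ?thesis by (metis diff_add_cancel dvd_add_right_iff)
qed

lemma hits_mod: "hits p (x mod int p) = hits p x"
 by (simp add: hits_def form_mod)

definition nonproportional :: bool where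
 "nonproportional \<longleftrightarrow> (\<forall>i<k. \<forall>j<k. i \<noteq> j \<longrightarrow> a i * b j \<noteq> a j * b i)"

text \<open>Two distinct proportional forms cannot both be primitive, so one of them has a fixed prime
 divisor.\<close>

lemma proportional_fixed_divisor:
 assumes "\<not> nonproportional"
 shows "\<exists>q. prime q \<and> (\<forall>x. hits q x)"
proof -
 obtain i j where ij: "i < k" "j < k" "i \<noteq> j" "a i * b j = a j * b i"
  using assms by (auto simp: nonproportional_def)
 have "\<not> (coprime (a i) (b i) \<and> coprime (a j) (b j))"
 proof
  assume c: "coprime (a i) (b i) \<and> coprime (a j) (b j)"
  have "a i dvd a j * b i" "a j dvd a i * b j" using ij(4) by (metis dvd_triv_left)+
  then have "a i dvd a j" "a j dvd a i" using c by (auto simp: coprime_dvd_mult_left_iff)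
  then have eq: "a i = a j" using a_pos[OF ij(1)] a_pos[OF ij(2)] by (simp add: zdvd_antisym_nonneg)
  then have "b i = b j" using ij(4) a_pos[OF ij(1)] by simp
  then show False using distinct_forms[OF ij(1-3)] eq by simp
 qed
 then obtain l where l: "l < k" "\<not> coprime (a l) (b l)" using ij by blast
 then have "\<bar>gcd (a l) (b l)\<bar> \<noteq> 1" by (simp add: coprime_iff_gcd_eq_1)
 then obtain q :: int where "prime q" "q dvd gcd (a l) (b l)"
  using prime_factor_int by blast
 then have q: "prime q" "q dvd a l" "q dvd b l" by auto
 have "hits (nat q) x" for x
  unfolding hits_def form_def using q l prime_ge_0_int[OF q(1)] by (auto intro!: exI[of _ l])
 moreover have "prime (nat q)" using q(1) by (simp only: prime_int_nat_transfer)
 ultimately show ?thesis by blast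
qed

text \<open>A prime above this bound exceeds \<open>k\<close> and divides neither a leading
  coefficient nor a nonzero determinant of two forms.\<close>

definition exceptional_bound :: nat where
 "exceptional_bound = k + (\<Sum>i<k. nat (a i)) + (\<Sum>i<k. \<Sum>j<k. nat \<bar>a i * b j - a j * b i\<bar>)"

text \<open>Each form has exactly one root modulo \<open>p\<close>; a common root of two forms would
  make \<open>p\<close> divide their determinant.\<close>

lemma card_hits:
 assumes "prime p" "exceptional_bound < p" nonproportional
 shows "card {x \<in> {0..<int p}. hits p x} = k"
proof -
 have ai: "\<not> int p dvd a i" if "i < k" for i
 proof
  assume "int p dvd a i"
  then have "int p \<le> a i" using a_pos[OF that] by (simp add: zdvd_imp_le)
  moreover have "nat (a i) \<le> (\<Sum>i<k. nat (a i))" using that by (intro member_le_sum) auto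
  ultimately show False using assms(2) by (simp add: exceptional_bound_def)
 qed
 have det: "\<not> int p dvd a i * b j - a j * b i" if "i < k" "j < k" "i \<noteq> j" for i j
 proof
  assume "int p dvd a i * b j - a j * b i"
  moreover have "a i * b j - a j * b i \<noteq> 0" using assms(3) that by (auto simp: nonproportional_def)
  ultimately have "int p \<le> \<bar>a i * b j - a j * b i\<bar>"
   using dvd_imp_le_int[of "a i * b j - a j * b i" "int p"] by simp
  moreover have "nat \<bar>a i * b j - a j * b i\<bar> \<le> (\<Sum>j<k. nat \<bar>a i * b j - a j * b i\<bar>)"
   using that by (intro member_le_sum) auto
  moreover have "(\<Sum>j<k. nat \<bar>a i * b j - a j * b i\<bar>) \<le> (\<Sum>i<k. \<Sum>j<k. nat \<bar>a i * b j - a j * b i\<bar>)"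
   using that by (intro member_le_sum[where f = "\<lambda>i. \<Sum>j<k. nat \<bar>a i * b j - a j * b i\<bar>"]) auto
  ultimately show False using assms(2) by (simp add: exceptional_bound_def)
 qed
 have ex1: "\<exists>x\<in>{0..<int p}. int p dvd form i x" if "i < k" for i
 proof -
  have "coprime (a i) (int p)" using ai[OF that] assms(1) by (simp add: prime_imp_coprime coprime_commute)
  then obtain x where x: "[a i * x = 1] (mod int p)" using cong_solve_coprime_int by blast
  have "[a i * x * (- b i) = 1 * (- b i)] (mod int p)" using x by (rule cong_scalar_right)
  then have "int p dvd form i (x * (- b i))" by (simp add: form_def cong_iff_dvd_diff algebra_simps)
  then have "int p dvd form i ((x * (- b i)) mod int p)" by (simp only: form_mod)
  moreover have "(x * (- b i)) mod int p \<in> {0..<int p}" using prime_gt_0_nat[OF assms(1)] by simp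
  ultimately show ?thesis by blast
 qed
 then have "\<forall>i\<in>{..<k}. \<exists>x. x \<in> {0..<int p} \<and> int p dvd form i x" by blast
 then obtain \<rho> where \<rho>: "\<And>i. i < k \<Longrightarrow> \<rho> i \<in> {0..<int p}" "\<And>i. i < k \<Longrightarrow> int p dvd form i (\<rho> i)"
  by (auto dest!: bchoice)
 have uniq: "x = \<rho> i" if "i < k" "x \<in> {0..<int p}" "int p dvd form i x" for i x
 proof -
  have "int p dvd form i x - form i (\<rho> i)" using that \<rho> by simp
  then have "int p dvd a i * (x - \<rho> i)" by (simp add: form_def algebra_simps)
  then have "int p dvd x - \<rho> i" using ai[OF that(1)] assms(1) by (simp add: prime_dvd_mult_iff)
  moreover have "\<bar>x - \<rho> i\<bar> < int p" using that \<rho>(1)[OF that(1)] by auto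
  ultimately show ?thesis using zdvd_not_zless[of "\<bar>x - \<rho> i\<bar>" "int p"] by (cases "x = \<rho> i") auto
 qed
 have "{x \<in> {0..<int p}. hits p x} = \<rho> ` {..<k}"
 proof (intro equalityI subsetI)
  fix x assume "x \<in> {x \<in> {0..<int p}. hits p x}"
  then obtain i where "i < k" "x \<in> {0..<int p}" "int p dvd form i x" by (auto simp: hits_def)
  then show "x \<in> \<rho> ` {..<k}" using uniq by blast
 qed (use \<rho> in \<open>auto simp: hits_def\<close>)
 moreover have "inj_on \<rho> {..<k}"
 proof (rule inj_onI)
  fix i j assume ij: "i \<in> {..<k}" "j \<in> {..<k}" "\<rho> i = \<rho> j"
  show "i = j"
  proof (rule ccontr)
   assume "i \<noteq> j"
   have "int p dvd a i * form j (\<rho> i) - a j * form i (\<rho> i)" using \<rho>(2)[of i] \<rho>(2)[of j] ij by (auto intro!: dvd_diff dvd_mult)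
   also have "a i * form j (\<rho> i) - a j * form i (\<rho> i) = a i * b j - a j * b i" by (simp add: form_def algebra_simps)
   finally show False using det[of i j] ij \<open>i \<noteq> j\<close> by auto
  qed
 qed
 ultimately show ?thesis by (simp add: card_image)
qed

lemma card_not_hits:
 assumes "0 < p"
 shows "card {x \<in> {0..<int p}. \<not> hits p x} = p - card {x \<in> {0..<int p}. hits p x}"
proof -
 have "{x \<in> {0..<int p}. \<not> hits p x} = {0..<int p} - {x \<in> {0..<int p}. hits p x}" by auto
 also have "card \<dots> = card {0..<int p} - card {x \<in> {0..<int p}. hits p x}"
  by (rule card_Diff_subset) (auto intro: finite_subset[of _ "{0..<int p}"])
 finally show ?thesis by simp
qed

section \<open>Density of positions that survive sieving\<close>

text \<open>By the Chinese remainder theorem the count is an exact product, to which every prime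
  above \<open>exceptional_bound\<close> contributes \<open>p - k\<close>. Proportional forms have a
  fixed prime divisor \<open>q\<close>, so the count vanishes for \<open>m\<close> beyond
  \<open>q\<close>, and the finitely many smaller \<open>m\<close> are absorbed by the
  constant.\<close>

lemma wheel_density:
 "\<exists>C>0. \<forall>m\<ge>3. \<forall>u. real (card {x \<in> {u..<u + int (primorial m)}. avoids_below m x})
  \<le> C * real (primorial m) * (1 / ln (real (m - 1))) ^ k"
proof (cases nonproportional)
 case False
 then obtain q where q: "prime q" "\<And>x. hits q x" using proportional_fixed_divisor by blast
 \<comment> \<open>Large enough to outweigh the power of \<open>1 / ln (m - 1)\<close> for all
   \<open>m\<close> up to \<open>q\<close>.\<close>
 let ?C = "(1 + ln (real q + 1)) ^ k"
 have "real (card {x \<in> {u..<u + int (primorial m)}. avoids_below m x})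
  \<le> ?C * real (primorial m) * (1 / ln (real (m - 1))) ^ k" if "3 \<le> m" for m u
 proof (cases "q < m")
  case True
  then have "{x \<in> {u..<u + int (primorial m)}. avoids_below m x} = {}"
   using q by auto
  moreover have "0 \<le> ?C * real (primorial m) * (1 / ln (real (m - 1))) ^ k"
  proof (intro mult_nonneg_nonneg zero_le_power of_nat_0_le_iff)
   show "0 \<le> 1 + ln (real q + 1)" using ln_ge_zero[of "real q + 1"] by simp
   show "0 \<le> 1 / ln (real (m - 1))" using that by simp
  qed
  ultimately show ?thesis by (simp only: card.empty of_nat_0)
 next
  case F: False
  have l: "0 < ln (real (m - 1))" using that by simp
  have "ln (real (m - 1)) \<le> 1 + ln (real q + 1)"
  proof -
   have "ln (real (m - 1)) \<le> ln (real q + 1)" using F that by (subst ln_le_cancel_iff) auto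
   then show ?thesis by simp
  qed
  then have "1 ^ k \<le> ((1 + ln (real q + 1)) * (1 / ln (real (m - 1)))) ^ k"
   using l by (intro power_mono) (auto simp: field_simps)
  then have 1: "1 \<le> ?C * (1 / ln (real (m - 1))) ^ k" by (simp only: power_mult_distrib power_one)
  have "card {x \<in> {u..<u + int (primorial m)}. avoids_below m x} \<le>
    card {u..<u + int (primorial m)}" by (rule card_mono) auto
  then have "real (card {x \<in> {u..<u + int (primorial m)}. avoids_below m x}) \<le>
    real (primorial m) * 1" by (simp del: of_nat_prod)
  also have "\<dots> \<le> real (primorial m) * (?C * (1 / ln (real (m - 1))) ^ k)"
   by (intro mult_left_mono 1 of_nat_0_le_iff)
  finally show ?thesis by (simp only: mult_ac)
 qed
 moreover have "0 < ?C" using ln_ge_zero[of "real q + 1"] by (intro zero_less_power) linarith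
 ultimately show ?thesis by blast
next
 case True
 let ?e = exceptional_bound
 define c0 where "c0 = (\<Prod>p | prime p \<and> p \<le> ?e. 1 - 1 / real p)"
 have c0: "0 < c0" unfolding c0_def
 proof (rule prod_pos)
  fix p assume "p \<in> {p. prime p \<and> p \<le> ?e}"
  then have "1 < p" using prime_gt_1_nat by auto
  then show "0 < 1 - 1 / real p" by simp
 qed
 have "real (card {x \<in> {u..<u + int (primorial m)}. avoids_below m x})
  \<le> (1 / c0) ^ k * real (primorial m) * (1 / ln (real (m - 1))) ^ k" if m: "3 \<le> m" for m u
 proof -
  let ?Q = "{p. prime p \<and> p < m}" and ?B = "{p. prime p \<and> ?e < p \<and> p \<le> m - 1}"
  have fin: "finite ?Q" by (rule finite_subset[of _ "{..<m}"]) auto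
  have sub: "?B \<subseteq> ?Q" using m by auto
  let ?c = "\<lambda>p. card {x \<in> {0..<int p}. \<not> hits p x}"
  have "card {x \<in> {u..<u + int (\<Prod>?Q)}. \<forall>p\<in>?Q. \<not> hits p x} = prod ?c ?Q"
   by (rule card_crt[OF fin]) (auto simp: hits_mod)
  moreover have "{x \<in> {u..<u + int (\<Prod>?Q)}. \<forall>p\<in>?Q. \<not> hits p x} =
    {x \<in> {u..<u + int (\<Prod>?Q)}. avoids_below m x}" by auto
  ultimately have "real (card {x \<in> {u..<u + int (\<Prod>?Q)}. avoids_below m x}) =
    (\<Prod>p\<in>?Q. real (?c p))" by simp
  also have "\<dots> = (\<Prod>p\<in>?Q. real p * (real (?c p) / real p))"
   by (intro prod.cong) (auto simp: prime_gt_0_nat)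
  also have "\<dots> = real (\<Prod>?Q) * (\<Prod>p\<in>?Q. real (?c p) / real p)" by (simp only: prod.distrib of_nat_prod)
  finally have card: "real (card {x \<in> {u..<u + int (\<Prod>?Q)}. avoids_below m x}) =
    real (\<Prod>?Q) * (\<Prod>p\<in>?Q. real (?c p) / real p)" .
  have "(\<Prod>p\<in>?Q. real (?c p) / real p) = (\<Prod>p\<in>?Q - ?B. real (?c p) / real p) * (\<Prod>p\<in>?B. real (?c p) / real p)"
   by (rule prod.subset_diff[OF sub fin])
  also have "\<dots> \<le> 1 * (\<Prod>p\<in>?B. real (?c p) / real p)"
  proof (intro mult_right_mono prod_le_1)
   fix p assume "p \<in> ?Q - ?B"
   then have "0 < p" by (auto simp: prime_gt_0_nat)
   then have "?c p \<le> p" using card_not_hits[of p] by simp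
   then show "0 \<le> real (?c p) / real p \<and> real (?c p) / real p \<le> 1" using \<open>0 < p\<close> by simp
  qed (auto intro!: prod_nonneg)
  also have "1 * (\<Prod>p\<in>?B. real (?c p) / real p) = (\<Prod>p\<in>?B. 1 - real k / real p)"
   unfolding mult_1
  proof (rule prod.cong[OF refl])
   fix p assume p: "p \<in> ?B"
   then have "?c p = p - k" using card_not_hits[of p] card_hits[of p] True by (simp add: prime_gt_0_nat)
   moreover have "k \<le> p" "0 < p" using p by (auto simp: exceptional_bound_def)
   ultimately show "real (?c p) / real p = 1 - real k / real p" by (simp add: of_nat_diff field_simps)
  qed
  also have "\<dots> \<le> (1 / (c0 * ln (real (m - 1)))) ^ k"
   unfolding c0_def using prod_one_minus_k_le[of k ?e "m - 1"] m by (simp add: exceptional_bound_def)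
  finally have "real (\<Prod>?Q) * (\<Prod>p\<in>?Q. real (?c p) / real p) \<le>
    real (\<Prod>?Q) * (1 / (c0 * ln (real (m - 1)))) ^ k"
   by (intro mult_left_mono of_nat_0_le_iff)
  also have "\<dots> = (1 / c0) ^ k * real (\<Prod>?Q) * (1 / ln (real (m - 1))) ^ k"
   by (simp add: power_divide power_mult_distrib del: of_nat_prod)
  finally show ?thesis unfolding card .
 qed
 moreover have "0 < (1 / c0) ^ k" using c0 by simp
 ultimately show ?thesis by blast
qed

end

context linear_forms
begin

text \<open>Let \<open>l = ln n\<close> and \<open>L = ln l\<close>. Sieving up to \<open>y\<close>
  is relaxed to sieving up to a \<open>z\<close> of about \<open>exp (l / (36 * k * L))\<close>,
  because Brun's pure sieve has to be truncated at a level \<open>r\<close> of about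
  \<open>7 * k * L\<close> and its error \<open>(k * z)^r\<close> must stay below a power of
  \<open>n\<close>. The smaller \<open>z\<close> costs a factor \<open>L\<close> per logarithm,
  whence the power of \<open>L / l\<close>.\<close>

lemma survivors_bound_nonproportional:
 assumes nonproportional
 shows "\<exists>C>0. \<forall>(n::nat) u y. real K + 17 \<le> ln (ln (real n)) \<and>
   real (72 * k + 36 * k\<^sup>2 + 2 * k + 2) * ln (ln (real n)) \<le> ln (real n) \<and> n \<le> y ^ K \<longrightarrow>
  real (card {x \<in> {u..<u + int n}. avoids_upto y x})
   \<le> C * real n * (ln (ln (real n)) / ln (real n)) ^ k"
proof -
 let ?e = exceptional_bound
 define c0 where "c0 = (\<Prod>p | prime p \<and> p \<le> ?e. 1 - 1 / real p)"
 have c0: "0 < c0" unfolding c0_def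
 proof (rule prod_pos)
  fix p assume "p \<in> {p. prime p \<and> p \<le> ?e}"
  then have "1 < p" using prime_gt_1_nat by auto
  then show "0 < 1 - 1 / real p" by simp
 qed
 \<comment> \<open>Chosen so that \<open>9 * k * L * v = l / 4\<close>, where
   \<open>9 * k * L\<close> bounds \<open>r\<close> and \<open>v = l / (c1 * L)\<close> bounds
   \<open>ln z\<close>.\<close>
 define c1 where "c1 = 36 * real k"
 have k1: "1 \<le> real k" using k_pos by simp
 have c1: "36 \<le> c1" using k1 by (simp add: c1_def)
 define C where "C = (2 * c1 / c0) ^ k + 2"
 have C: "0 < C" unfolding C_def using c0 c1 by (intro add_nonneg_pos zero_le_power) auto
 have "real (card {x \<in> {u..<u + int n}. avoids_upto y x})
   \<le> C * real n * (ln (ln (real n)) / ln (real n)) ^ k"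
  if L17': "real K + 17 \<le> ln (ln (real n))"
   and Ll': "real (72 * k + 36 * k\<^sup>2 + 2 * k + 2) * ln (ln (real n)) \<le> ln (real n)"
   and y: "n \<le> y ^ K" for n u y
 proof -
  define l where "l = ln (real n)"
  define L where "L = ln l"
  have LK: "real K + 17 \<le> L" using L17' by (simp add: L_def l_def)
  then have L1: "17 \<le> L" by linarith
  have Ll: "(72 * real k + 36 * (real k)\<^sup>2 + 2 * real k + 2) * L \<le> l"
   using Ll' by (simp add: L_def l_def add_ac)
  have A: "72 * real k * L \<le> l" "36 * (real k)\<^sup>2 * L \<le> l" "(2 * real k + 2) * L \<le> l"
  proof -
   have "72 * real k * L \<le> (72 * real k + 36 * (real k)\<^sup>2 + 2 * real k + 2) * L"
    "36 * (real k)\<^sup>2 * L \<le> (72 * real k + 36 * (real k)\<^sup>2 + 2 * real k + 2) * L"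
    "(2 * real k + 2) * L \<le> (72 * real k + 36 * (real k)\<^sup>2 + 2 * real k + 2) * L"
    using L1 by (intro mult_right_mono; simp)+
   then show "72 * real k * L \<le> l" "36 * (real k)\<^sup>2 * L \<le> l" "(2 * real k + 2) * L \<le> l"
    using Ll by linarith+
  qed
  have "72 * 17 \<le> 72 * real k * L" using k1 L1 mult_mono[of 72 "72 * real k" 17 L] by simp
  then have l1: "72 * 17 \<le> l" using A(1) by linarith
  have n0: "0 < real n" using l1 unfolding l_def by (cases "n = 0") auto
  have n_exp: "real n = exp l" using n0 by (simp add: l_def)
  have c1L: "0 < c1 * L" using c1 L1 by simp
  define v where "v = l / (c1 * L)"
  have v2: "2 \<le> v" unfolding v_def using c1L A(1) by (simp add: le_divide_eq c1_def)
  have vl: "v \<le> l"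
  proof -
   have "1 \<le> c1 * L" using mult_mono[of 1 c1 1 L] c1 L1 by simp
   then show ?thesis unfolding v_def using l1 c1L by (simp add: divide_le_eq mult_left_le)
  qed
  define z where "z = nat \<lfloor>exp v\<rfloor>"
  have ev: "4 \<le> exp v"
  proof -
   have "(2::real) * 2 \<le> exp 1 * exp 1"
    using exp_ge_add_one_self[of 1] by (intro mult_mono) auto
   also have "\<dots> = exp 2" by (simp add: exp_add[symmetric])
   also have "\<dots> \<le> exp v" using v2 by simp
   finally show ?thesis by simp
  qed
  have z: "real z \<le> exp v" "exp v - 1 \<le> real z" "4 \<le> z" unfolding z_def using ev by linarith+
  have lnz: "v / 2 \<le> ln (real z)"
  proof -
   define w where "w = exp (v / 2)"
   have w2: "w * w = exp v" by (simp add: w_def exp_add[symmetric])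
   have "2 \<le> w"
   proof (rule ccontr)
    assume "\<not> 2 \<le> w"
    then have "w * w < 2 * 2" by (intro mult_strict_mono) (auto simp: w_def)
    then show False using ev w2 by simp
   qed
   then have "w \<le> w * w - 1" using mult_right_mono[of 2 w w] by linarith
   then have "w \<le> real z" using z(2) w2 by linarith
   then have "ln w \<le> ln (real z)" by (subst ln_le_cancel_iff) (use z in \<open>auto simp: w_def\<close>)
   then show ?thesis by (simp add: w_def)
  qed
  \<comment> \<open>As \<open>K < L\<close>, the \<open>K\<close>-th power of \<open>exp v\<close>
    is smaller than \<open>n\<close>, while that of \<open>y\<close> is not.\<close>
  have zy: "z \<le> y"
  proof (rule ccontr)
   assume "\<not> z \<le> y"
   then have "y ^ K \<le> z ^ K" by (intro power_mono) auto
   then have "real n \<le> real z ^ K" using y by (metis of_nat_le_iff of_nat_power order_trans)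
   also have "\<dots> \<le> exp v ^ K" using z by (intro power_mono) auto
   also have "\<dots> = exp (real K * v)" by (simp add: exp_of_nat_mult)
   finally have "l \<le> real K * v" unfolding n_exp by simp
   then have "l * (c1 * L) \<le> real K * l" unfolding v_def using c1L by (simp add: field_simps)
   then have "c1 * L \<le> real K" using l1 by (simp add: mult.commute)
   moreover have "L \<le> c1 * L" using c1 L1 by simp
   ultimately show False using LK by linarith
  qed
  \<comment> \<open>The tail exponent gains at most
    \<open>3 * k * (2 * L + 5) = 6 * k * L + 15 * k\<close>, since \<open>exp 1\<close> is at most
    3; one more \<open>k * L\<close> in \<open>r\<close> leaves
    \<open>exp (- k * L) = l^(-k)\<close>. Halving and doubling makes \<open>r\<close> even.\<close>
  define g where "g = (7 * real k * L + 15 * real k) / 2"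
  define r where "r = 2 * nat \<lceil>g\<rceil>"
  have "0 \<le> g" unfolding g_def using k1 L1 by simp
  then have "g \<le> real (nat \<lceil>g\<rceil>)" "real (nat \<lceil>g\<rceil>) \<le> g + 1" by linarith+
  then have "2 * g \<le> real r" "real r \<le> 2 * g + 2" by (simp_all add: r_def)
  moreover have "2 * g = 7 * real k * L + 15 * real k" by (simp add: g_def)
  ultimately have r1: "7 * real k * L + 15 * real k \<le> real r" "real r \<le> 7 * real k * L + 15 * real k + 2"
   by simp_all
  have r2: "real r \<le> 9 * real k * L"
  proof -
   have "17 * real k \<le> 2 * real k * L" using k1 L1 mult_left_mono[of 17 "2 * L" "real k"] by simp
   then show ?thesis using r1(2) k1 by linarith
  qed
  \<comment> \<open>Exceptional primes are left out as well, so that every prime used removes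
    exactly \<open>k\<close> classes.\<close>
  let ?Q = "{p. prime p \<and> ?e < p \<and> p \<le> z}"
  have fin: "finite ?Q" by (rule finite_subset[of _ "{..z}"]) auto
  have cQ: "card ?Q \<le> z"
  proof -
   have "card ?Q \<le> card {1..z}" by (rule card_mono) (auto simp: Suc_le_eq prime_gt_0_nat)
   then show ?thesis by simp
  qed
  have Y: "1 \<le> real k * real z" "real k * real (card ?Q) \<le> real k * real z"
  proof -
   show "1 \<le> real k * real z" using k1 z(3) mult_mono[of 1 "real k" 1 "real z"] by simp
   show "real k * real (card ?Q) \<le> real k * real z" using cQ by (intro mult_left_mono) auto
  qed
  have sub: "{x \<in> {u..<u + int n}. avoids_upto y x} \<subseteq>
    {x \<in> {u..<u + int n}. \<forall>p\<in>?Q. \<not> hits p x}" using zy by auto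
  have "real (card {x \<in> {u..<u + int n}. avoids_upto y x}) \<le>
    real (card {x \<in> {u..<u + int n}. \<forall>p\<in>?Q. \<not> hits p x})"
  proof -
   have "finite {x \<in> {u..<u + int n}. \<forall>p\<in>?Q. \<not> hits p x}"
    by (rule finite_subset[of _ "{u..<u + int n}"]) auto
   from card_mono[OF this sub] show ?thesis by (simp only: of_nat_le_iff)
  qed
  also have "\<dots> \<le> real n * ((\<Prod>p\<in>?Q. 1 - real k / real p) +
    exp (- real r + exp 1 * (\<Sum>p\<in>?Q. real k / real p))) + exp 1 * (real k * real z) ^ r"
   by (rule brun_sieve[OF fin]) (use assms card_hits hits_mod Y in \<open>auto simp: r_def\<close>)
  also have "\<dots> \<le> real n * ((2 * c1 / c0) ^ k * (L / l) ^ k + (L / l) ^ k) + real n * (L / l) ^ k"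
  proof (intro add_mono mult_left_mono)
   have "(\<Prod>p\<in>?Q. 1 - real k / real p) \<le> (1 / (c0 * ln (real z))) ^ k"
    unfolding c0_def using z(3) by (intro prod_one_minus_k_le) (auto simp: exceptional_bound_def)
   also have "\<dots> \<le> (2 * c1 / c0 * (L / l)) ^ k"
   proof (rule power_mono)
    have "1 / (c0 * ln (real z)) \<le> 1 / (c0 * (v / 2))"
     using lnz v2 c0 by (intro divide_left_mono mult_left_mono mult_pos_pos) auto
    also have "\<dots> = 2 * c1 / c0 * (L / l)" unfolding v_def using c1 L1 l1 c0 by (simp add: field_simps)
    finally show "1 / (c0 * ln (real z)) \<le> 2 * c1 / c0 * (L / l)" .
    show "0 \<le> 1 / (c0 * ln (real z))" using c0 z(3) by simp
   qed
   finally show "(\<Prod>p\<in>?Q. 1 - real k / real p) \<le> (2 * c1 / c0) ^ k * (L / l) ^ k"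
    by (simp only: power_mult_distrib)
   have lk: "exp (- (real k * L)) \<le> (L / l) ^ k"
   proof -
    have "exp (- (real k * L)) = (exp (- L)) ^ k" by (simp add: exp_of_nat_mult[symmetric])
    also have "exp (- L) = 1 / l" using l1 by (simp add: L_def exp_minus field_simps)
    also have "(1 / l) ^ k \<le> (L / l) ^ k" using L1 l1 by (intro power_mono divide_right_mono) auto
    finally show ?thesis .
   qed
   have "(\<Sum>p\<in>?Q. real k / real p) = real k * (\<Sum>p\<in>?Q. 1 / real p)" by (simp add: sum_distrib_left)
   also have "\<dots> \<le> real k * (\<Sum>p | prime p \<and> real p \<le> exp v. 1 / real p)"
   proof (intro mult_left_mono sum_mono2)
    show "finite {p. prime p \<and> real p \<le> exp v}"
     by (rule finite_subset[of _ "{..z}"]) (auto simp: z_def le_nat_floor)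
    show "?Q \<subseteq> {p. prime p \<and> real p \<le> exp v}" using z(1) by (auto intro: order_trans[OF of_nat_mono])
   qed auto
   also have "\<dots> \<le> real k * (2 * ln (ln (exp v)) + 5)"
    by (intro mult_left_mono sum_prime_reciprocals_le ev) auto
   also have "\<dots> \<le> real k * (2 * L + 5)"
   proof -
    have "ln v \<le> L" unfolding L_def using vl v2 l1 by (subst ln_le_cancel_iff) auto
    then show ?thesis by (intro mult_left_mono) auto
   qed
   finally have U: "(\<Sum>p\<in>?Q. real k / real p) \<le> real k * (2 * L + 5)" .
   have "exp 1 * (\<Sum>p\<in>?Q. real k / real p) \<le> 3 * (real k * (2 * L + 5))"
    using U exp_le by (intro mult_mono) (auto intro!: sum_nonneg)
   then have "- real r + exp 1 * (\<Sum>p\<in>?Q. real k / real p) \<le> - (real k * L)"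
    using r1(1) by (simp add: algebra_simps)
   then show "exp (- real r + exp 1 * (\<Sum>p\<in>?Q. real k / real p)) \<le> (L / l) ^ k"
    using lk by (meson exp_le_cancel_iff order_trans)
   have "(real k * real z) ^ r = exp (real r * ln (real k * real z))"
    using Y(1) by (simp add: exp_of_nat_mult)
   also have "\<dots> \<le> exp (l / 2)"
   proof -
    have "ln (real k * real z) = ln (real k) + ln (real z)" using k1 z(3) by (simp add: ln_mult)
    also have "ln (real z) \<le> v"
    proof -
     have "ln (real z) \<le> ln (exp v)" using z by (subst ln_le_cancel_iff) auto
     then show ?thesis by simp
    qed
    also have "ln (real k) \<le> real k" using ln_le_minus_one[of "real k"] k1 by linarith
    finally have "ln (real k * real z) \<le> real k + v" by simp
    then have "real r * ln (real k * real z) \<le> (9 * real k * L) * (real k + v)"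
     using r2 Y(1) L1 by (intro mult_mono) auto
    also have "\<dots> = 9 * (real k)\<^sup>2 * L + 9 * real k * L * v"
     by (simp add: algebra_simps power2_eq_square)
    also have "9 * real k * L * v = l / 4" unfolding v_def c1_def using k1 L1 by (simp add: field_simps)
    also have "9 * (real k)\<^sup>2 * L \<le> l / 4" using A(2) by simp
    finally show ?thesis by simp
   qed
   finally have "exp 1 * (real k * real z) ^ r \<le> exp 1 * exp (l / 2)" by simp
   also have "\<dots> = exp (1 + l / 2)" by (simp add: exp_add)
   \<comment> \<open>The error is about the square root of \<open>n\<close>, which leaves room for
     the factor \<open>l^(-k)\<close>.\<close>
   also have "\<dots> \<le> exp (l + - (real k * L))"
   proof -
    have "(2 * real k + 2) * L = 2 * (real k * L) + 2 * L" by (simp add: algebra_simps)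
    then show ?thesis using A(3) L1 by simp
   qed
   also have "\<dots> = real n * exp (- (real k * L))" by (simp only: exp_add n_exp)
   also have "\<dots> \<le> real n * (L / l) ^ k" by (intro mult_left_mono lk) auto
   finally show "exp 1 * (real k * real z) ^ r \<le> real n * (L / l) ^ k" .
  qed auto
  also have "\<dots> = C * real n * (L / l) ^ k" by (simp add: C_def algebra_simps)
  finally show ?thesis by (simp only: L_def l_def)
 qed
 then show ?thesis using C by blast
qed

text \<open>In the nonproportional case the explicit thresholds hold for large \<open>n\<close>.
  Otherwise the fixed prime divisor is eventually at most \<open>y\<close>, and nothing
  survives.\<close>

lemma survivors_bound:
 assumes "0 < K"
 shows "\<exists>C>0. \<forall>\<^sub>F n in sequentially. \<forall>u y. n \<le> y ^ K \<longrightarrow>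
  real (card {x \<in> {u..<u + int n}. avoids_upto y x})
   \<le> C * real n * (ln (ln (real n)) / ln (real n)) ^ k"
proof (cases nonproportional)
 case True
 have "0 < real (72 * k + 36 * k\<^sup>2 + 2 * k + 2)" by (simp only: of_nat_0_less_iff)
 then have ev: "\<forall>\<^sub>F n::nat in sequentially. real (72 * k + 36 * k\<^sup>2 + 2 * k + 2) * ln (ln (real n)) \<le> ln (real n)"
  by real_asymp
 have ev2: "\<forall>\<^sub>F n::nat in sequentially. real K + 17 \<le> ln (ln (real n))" by real_asymp
 from survivors_bound_nonproportional[OF True, of K] obtain C where C: "C > 0"
  "\<forall>(n::nat) u y. real K + 17 \<le> ln (ln (real n)) \<and>
   real (72 * k + 36 * k\<^sup>2 + 2 * k + 2) * ln (ln (real n)) \<le> ln (real n) \<and> n \<le> y ^ K \<longrightarrow>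
  real (card {x \<in> {u..<u + int n}. avoids_upto y x})
   \<le> C * real n * (ln (ln (real n)) / ln (real n)) ^ k" by (elim exE conjE)
 have "\<forall>\<^sub>F n in sequentially. \<forall>u y. n \<le> y ^ K \<longrightarrow>
  real (card {x \<in> {u..<u + int n}. avoids_upto y x})
   \<le> C * real n * (ln (ln (real n)) / ln (real n)) ^ k"
  using ev ev2 by eventually_elim (use C(2) in blast)
 then show ?thesis using C(1) by blast
next
 case False
 then obtain q where q: "prime q" "\<And>x. hits q x" using proportional_fixed_divisor by blast
 have "\<forall>\<^sub>F n::nat in sequentially. 1 \<le> ln (ln (real n))" by real_asymp
 moreover have "\<forall>\<^sub>F n::nat in sequentially. q ^ K < n" by (rule eventually_gt_at_top)
 ultimately have "\<forall>\<^sub>F n in sequentially. \<forall>u y. n \<le> y ^ K \<longrightarrow>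
  real (card {x \<in> {u..<u + int n}. avoids_upto y x})
   \<le> 1 * real n * (ln (ln (real n)) / ln (real n)) ^ k"
 proof eventually_elim
  case (elim n)
  show ?case
  proof (intro allI impI)
   fix u y assume "n \<le> y ^ K"
   have "q \<le> y"
   proof (rule ccontr)
    assume "\<not> q \<le> y"
    then have "y ^ K \<le> q ^ K" by (intro power_mono) auto
    then show False using elim(2) \<open>n \<le> y ^ K\<close> by simp
   qed
   then have "{x \<in> {u..<u + int n}. avoids_upto y x} = {}" using q by auto
   moreover have "0 \<le> ln (real n)"
    using elim(1) by (cases "n = 0") auto
   ultimately show "real (card {x \<in> {u..<u + int n}. avoids_upto y x})
     \<le> 1 * real n * (ln (ln (real n)) / ln (real n)) ^ k"
    using elim(1) by (simp only: card.empty of_nat_0) (intro mult_nonneg_nonneg zero_le_power divide_nonneg_nonneg; simp)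
  qed
 qed
 then show ?thesis by (intro exI[of _ 1]) simp
qed

end

section \<open>Asymptotic estimates\<close>

lemma ln_power_le_powr:
 fixes c e :: real
 assumes "0 < e"
 shows "\<forall>\<^sub>F x in at_top. c * ln x ^ j \<le> x powr e"
proof -
 have "((\<lambda>x::real. ln x ^ j / x powr e) \<longlongrightarrow> 0) at_top"
  using assms by real_asymp
 then have "((\<lambda>x::real. c * (ln x ^ j / x powr e)) \<longlongrightarrow> c * 0) at_top" by (intro tendsto_mult tendsto_const)
 then have "\<forall>\<^sub>F x in at_top. c * (ln x ^ j / x powr e) < 1" by (auto dest: order_tendstoD(2)[of _ _ _ 1])
 moreover have "\<forall>\<^sub>F x::real in at_top. 0 < x" by (rule eventually_gt_at_top)
 ultimately show ?thesis
 proof eventually_elim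
  case (elim x)
  then show ?case by (simp add: field_simps)
 qed
qed

lemma eventually_nat_real: "\<forall>\<^sub>F x in at_top. P x \<Longrightarrow> \<forall>\<^sub>F n::nat in sequentially. P (real n)"
 using filterlim_real_sequentially by (simp add: filterlim_iff)

lemma eventually_nat_ln: "\<forall>\<^sub>F x in at_top. P x \<Longrightarrow> \<forall>\<^sub>F n::nat in sequentially. P (ln (real n))"
proof -
 assume P: "\<forall>\<^sub>F x in at_top. P x"
 have "filterlim (\<lambda>n. ln (real n)) at_top sequentially"
  by (rule filterlim_compose[OF ln_at_top filterlim_real_sequentially])
 then show ?thesis using P by (simp add: filterlim_iff)
qed

lemma loglog_power_le_log: "0 < e \<Longrightarrow> \<forall>\<^sub>F n::nat in sequentially. c * ln (ln (real n)) ^ j \<le> ln (real n) powr e"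
 by (rule eventually_nat_ln[where P = "\<lambda>x. c * ln x ^ j \<le> x powr e"]) (rule ln_power_le_powr)

lemma log_large: "\<forall>\<^sub>F n::nat in sequentially. c \<le> ln (real n)"
 by (rule eventually_nat_ln) (rule eventually_ge_at_top)

lemma loglog_large: "\<forall>\<^sub>F n::nat in sequentially. c \<le> ln (ln (real n))"
proof (rule eventually_nat_ln)
 show "\<forall>\<^sub>F x in at_top. c \<le> ln x" using ln_at_top by (simp add: filterlim_at_top)
qed

lemma log_loglog_power_le_powr:
 assumes "0 < e"
 shows "\<forall>\<^sub>F n::nat in sequentially. c * ln (real n) ^ i * ln (ln (real n)) ^ j \<le> real n powr e"
proof -
 have "\<forall>\<^sub>F n::nat in sequentially. \<bar>c\<bar> * ln (real n) ^ (i + j) \<le> real n powr e"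
  by (rule eventually_nat_real[where P = "\<lambda>x. \<bar>c\<bar> * ln x ^ (i + j) \<le> x powr e"]) (rule ln_power_le_powr[OF assms])
 then show ?thesis using log_large[of 1] loglog_large[of 1]
 proof eventually_elim
  case (elim n)
  have "ln (ln (real n)) \<le> ln (real n)" using elim ln_le_minus_one[of "ln (real n)"] by linarith
  then have "ln (ln (real n)) ^ j \<le> ln (real n) ^ j" using elim by (intro power_mono) auto
  then have "c * ln (real n) ^ i * ln (ln (real n)) ^ j \<le> \<bar>c\<bar> * ln (real n) ^ i * ln (real n) ^ j"
   using elim by (intro mult_mono) auto
  also have "\<dots> = \<bar>c\<bar> * ln (real n) ^ (i + j)" by (simp add: power_add)
  finally show ?case using elim(1) by linarith
 qed
qed

section \<open>Size of the wheel and of the root\<close>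

lemma primorial_times_le: "primorial m * m \<le> m ^ (m::nat)"
proof (cases "m = 0")
 case False
 let ?A = "{p. prime p \<and> p < m}"
 have "finite ?A" by (rule finite_subset[of _ "{..<m}"]) auto
 have "?A \<subseteq> {1..<m}" by (auto dest: prime_gt_0_nat simp: Suc_le_eq)
 then have c: "card ?A \<le> m - 1" using card_mono[of "{1..<m}" ?A] by simp
 have "\<Prod>?A \<le> (\<Prod>p\<in>?A. m)" by (intro prod_mono) auto
 also have "\<dots> = m ^ card ?A" by simp
 also have "\<dots> \<le> m ^ (m - 1)" using c False by (intro power_increasing) auto
 finally have "\<Prod>?A * m \<le> m ^ (m - 1) * m" by (rule mult_le_mono1)
 also have "\<dots> = m ^ m" using False by (metis power_minus_mult neq0_conv)
 finally show ?thesis .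
qed simp

text \<open>From \<open>y < primorial m * m\<close> and the bound \<open>m^m\<close> on this product
  follows that \<open>ln y\<close> is at most \<open>m^2\<close>. This is far from the true size of
  \<open>m\<close>, but only its logarithm matters: any fixed power of \<open>ln n\<close> as a
  lower bound gives the same order, here the cube root and hence the factor
  \<open>1/3\<close>.\<close>

lemma wheel_modulus_large:
 assumes "0 < K"
 shows "\<forall>\<^sub>F n::nat in sequentially. \<forall>y m. 2 \<le> y \<and> n \<le> y ^ K \<and> y < primorial m * m \<longrightarrow>
  3 \<le> m \<and> ln (ln (real n)) / 3 \<le> ln (real (m - 1))"
proof -
 have "\<forall>\<^sub>F n::nat in sequentially. 4 * real K * ln (ln (real n)) ^ 0 \<le> ln (real n) powr (1/3)"
  by (rule loglog_power_le_log) simp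
 then show ?thesis using log_large[of 8] loglog_large[of 1]
 proof (eventually_elim, intro allI impI)
  fix n y m :: nat
  assume L: "4 * real K * ln (ln (real n)) ^ 0 \<le> ln (real n) powr (1/3)" "8 \<le> ln (real n)" "1 \<le> ln (ln (real n))"
   and *: "2 \<le> y \<and> n \<le> y ^ K \<and> y < primorial m * m"
  define x where "x = ln (real n)"
  define z where "z = x powr (1/3)"
  have n0: "0 < real n" using L(2) by (cases "n = 0") auto
  have z3: "z ^ 3 = x" using L(2) by (simp add: z_def x_def powr_powr flip: powr_realpow)
  have z2: "2 \<le> z"
  proof (rule ccontr)
   assume "\<not> 2 \<le> z"
   then have "z ^ 3 < 2 ^ 3" by (intro power_strict_mono) (auto simp: z_def)
   then show False using z3 L(2) by (simp add: x_def)
  qed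
  have m0: "0 < m" using * by (cases "m = 0") auto
  have "real y \<le> real (m ^ m)" using * primorial_times_le[of m] by simp
  then have "ln (real y) \<le> ln (real (m ^ m))" using * by (subst ln_le_cancel_iff) auto
  also have "\<dots> = real m * ln (real m)" using m0 by (simp add: ln_realpow)
  also have "\<dots> \<le> real m * real m" using m0 ln_le_minus_one[of "real m"] by (intro mult_left_mono) auto
  finally have 1: "ln (real y) \<le> real m ^ 2" by (simp add: power2_eq_square)
  have "real n \<le> real (y ^ K)" using * by simp
  then have "ln (real n) \<le> ln (real (y ^ K))" using n0 * by (subst ln_le_cancel_iff) auto
  also have "\<dots> = real K * ln (real y)" using * by (simp add: ln_realpow)
  also have "\<dots> \<le> real K * real m ^ 2" using 1 by (intro mult_left_mono) auto
  finally have 2: "z ^ 3 \<le> real K * real m ^ 2" using z3 by (simp add: x_def)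
  \<comment> \<open>Since \<open>4 * K\<close> is at most \<open>z\<close>, the bound of
    \<open>z^3\<close> by \<open>K * m^2\<close> improves to \<open>2 * z\<close> being at most
    \<open>m\<close>; the doubling pays for passing to \<open>m - 1\<close>.\<close>
  have "4 * real K * real m ^ 2 \<le> z * real m ^ 2" using L(1) by (intro mult_right_mono) (auto simp: z_def x_def)
  then have "z * (2 * z) ^ 2 \<le> z * real m ^ 2" using 2 by (simp add: power2_eq_square power3_eq_cube)
  then have "(2 * z) ^ 2 \<le> real m ^ 2" using z2 by simp
  then have "2 * z \<le> real m" by (rule power2_le_imp_le) simp
  then have zm: "z \<le> real m - 1" "3 \<le> real m" using z2 by linarith+
  have rm: "real (m - 1) = real m - 1" using m0 by (simp add: of_nat_diff)
  have "ln z = ln x / 3" unfolding z_def using L(2) by (simp add: ln_powr x_def)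
  moreover have "ln z \<le> ln (real m - 1)" using zm z2 by (subst ln_le_cancel_iff) auto
  ultimately show "3 \<le> m \<and> ln (ln (real n)) / 3 \<le> ln (real (m - 1))" using zm(2) rm by (simp add: x_def)
 qed
qed

lemma floorlog_le_ln: "1 \<le> ln (real n) \<Longrightarrow> real (floorlog 2 n + 1) \<le> 4 * ln (real n)"
proof -
 assume L: "1 \<le> ln (real n)"
 then have n: "0 < n" by (cases "n = 0") auto
 have f: "0 < floorlog 2 n" using n floorlog_eq_zero_iff[of 2 n] by linarith
 have "2 ^ (floorlog 2 n - 1) \<le> n" using floorlog_bounds[of n 2] n by simp
 then have "real (2 ^ (floorlog 2 n - 1)) \<le> real n" by (simp only: of_nat_le_iff)
 then have "ln (real (2 ^ (floorlog 2 n - 1))) \<le> ln (real n)" using n by (subst ln_le_cancel_iff) auto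
 then have "real (floorlog 2 n - 1) * ln 2 \<le> ln (real n)" by (simp add: ln_realpow)
 moreover have "real (floorlog 2 n - 1) * (1/2) \<le> real (floorlog 2 n - 1) * ln 2"
  using ln2_ge_two_thirds by (intro mult_left_mono) auto
 ultimately have "real (floorlog 2 n - 1) \<le> 2 * ln (real n)" by linarith
 moreover have "real (floorlog 2 n - 1) = real (floorlog 2 n) - 1" using f by (simp add: of_nat_diff)
 ultimately show ?thesis using L by simp
qed

lemma root_lower:
 assumes "0 < K" "n \<le> y ^ K"
 shows "real n powr (1 / real K) \<le> real y"
proof -
 have "real n \<le> real y ^ K" using assms(2) by (simp flip: of_nat_power)
 then have "real n powr (1 / real K) \<le> (real y ^ K) powr (1 / real K)" by (intro powr_mono2) auto
 also have "\<dots> = real y"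
 proof (cases "y = 0")
  case False
  then have "(real y ^ K) powr (1 / real K) = (real y powr real K) powr (1 / real K)" by (simp add: powr_realpow)
  then show ?thesis using False assms(1) by (simp add: powr_powr)
 qed (use assms in simp)
 finally show ?thesis .
qed

context linear_forms
begin

section \<open>Cost terms against the target rate\<close>

definition rate :: "nat \<Rightarrow> real" where "rate n = real n / ln (ln (real n)) ^ (k - 1)"

text \<open>Covers the setup, the naive tests and the selection of classes, all cubic in
  \<open>y\<close>; for \<open>K\<close> at least 6 a cube of \<open>y\<close> is of order at most
  the square root of \<open>n\<close>.\<close>

lemma cube_le_rate:
 assumes "6 \<le> K"
 shows "\<forall>\<^sub>F n in sequentially. \<forall>y. real y \<le> 2 * real n powr (1 / real K) \<longrightarrow> c * real y ^ 3 \<le> rate n"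
proof -
 have "\<forall>\<^sub>F n::nat in sequentially. 8 * \<bar>c\<bar> * ln (real n) ^ 0 * ln (ln (real n)) ^ (k - 1) \<le> real n powr (1/2)"
  by (rule log_loglog_power_le_powr) simp
 then show ?thesis using log_large[of 1] loglog_large[of 1]
 proof (eventually_elim, intro allI impI)
  fix n y :: nat
  assume L: "8 * \<bar>c\<bar> * ln (real n) ^ 0 * ln (ln (real n)) ^ (k - 1) \<le> real n powr (1/2)" "1 \<le> ln (real n)" "1 \<le> ln (ln (real n))"
   and y: "real y \<le> 2 * real n powr (1 / real K)"
  have n1: "1 \<le> real n" using L(2) by (cases "n = 0") auto
  have "real y ^ 3 \<le> (2 * real n powr (1 / real K)) ^ 3" using y by (intro power_mono) auto
  also have "\<dots> = 8 * real n powr (3 / real K)" using n1 by (simp add: power_mult_distrib powr_powr flip: powr_realpow)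
  also have "\<dots> \<le> 8 * real n powr (1/2)" using n1 assms by (intro mult_left_mono powr_mono) (auto simp: field_simps)
  finally have "\<bar>c\<bar> * real y ^ 3 \<le> \<bar>c\<bar> * (8 * real n powr (1/2))" by (intro mult_left_mono) auto
  moreover have "c * real y ^ 3 \<le> \<bar>c\<bar> * real y ^ 3" by (intro mult_right_mono) auto
  moreover have "\<bar>c\<bar> * (8 * real n powr (1/2)) \<le> rate n"
  proof -
   have "8 * \<bar>c\<bar> * ln (ln (real n)) ^ (k - 1) * real n powr (1/2) \<le> real n powr (1/2) * real n powr (1/2)"
    using L(1) by (intro mult_right_mono) auto
   also have "\<dots> = real n" using n1 by (simp flip: powr_add)
   finally show ?thesis using L(3) unfolding rate_def by (simp add: pos_le_divide_eq mult_ac)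
  qed
  ultimately show "c * real y ^ 3 \<le> rate n" by linarith
 qed
qed

text \<open>Pays for computing the nonresidue bound: at most \<open>n / y\<close> numbers at
  polylogarithmic cost each, and the power \<open>n^(1/K)\<close> gained from \<open>y\<close> beats
  all logarithms.\<close>

lemma quotient_cost_le_rate:
 assumes "0 < K" "0 \<le> c"
 shows "\<forall>\<^sub>F n in sequentially. \<forall>y X. n \<le> y ^ K \<and> real X \<le> c * ln (real n) ^ 3 \<longrightarrow> real (n div y * X) \<le> rate n"
proof -
 have "\<forall>\<^sub>F n::nat in sequentially. c * ln (real n) ^ 3 * ln (ln (real n)) ^ (k - 1) \<le> real n powr (1 / real K)"
  using assms by (intro log_loglog_power_le_powr) simp
 then show ?thesis using log_large[of 1] loglog_large[of 1]
 proof (eventually_elim, intro allI impI)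
  fix n y X :: nat
  assume L: "c * ln (real n) ^ 3 * ln (ln (real n)) ^ (k - 1) \<le> real n powr (1 / real K)" "1 \<le> ln (real n)" "1 \<le> ln (ln (real n))"
   and *: "n \<le> y ^ K \<and> real X \<le> c * ln (real n) ^ 3"
  have n1: "1 \<le> real n" using L(2) by (cases "n = 0") auto
  define z where "z = real n powr (1 / real K)"
  have z: "0 < z" "z \<le> real y" using n1 root_lower[of K n y] * assms(1) by (auto simp: z_def)
  have "real (n div y) \<le> real n / real y" by (rule of_nat_div_le_of_nat)
  also have "\<dots> \<le> real n / z" using z n1 by (intro divide_left_mono) auto
  finally have "real (n div y * X) \<le> real n / z * (c * ln (real n) ^ 3)"
   unfolding of_nat_mult using * z n1 by (intro mult_mono) auto
  also have "\<dots> \<le> rate n"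
  proof -
   have "real n * (c * ln (real n) ^ 3 * ln (ln (real n)) ^ (k - 1)) \<le> real n * z"
    using L(1) unfolding z_def by (intro mult_left_mono) auto
   then show ?thesis using L(3) z unfolding rate_def by (simp add: field_simps)
  qed
  finally show "real (n div y * X) \<le> rate n" .
 qed
qed

text \<open>With \<open>l = ln (ln n)\<close>, up to constants: \<open>M * (3/l)^k\<close> classes,
  \<open>n / (M * y^2)\<close> segments in each, cost \<open>y^2 * l\<close> per segment.
  \<open>M\<close> and \<open>y^2\<close> cancel, leaving \<open>n * l / l^k\<close>. Since
  \<open>M * y^2\<close> is at most \<open>8 * n\<close>, rounding the number of segments up costs
  only a constant factor.\<close>

lemma wheel_cost_le_rate:
 assumes "3 \<le> K" "0 < c"
 shows "\<exists>C>0. \<forall>\<^sub>F n in sequentially. \<forall>y m S N x0. 2 \<le> y \<and> n \<le> y ^ K \<and> real y \<le> 2 * real n powr (1 / real K) \<and>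
   primorial m \<le> y \<and> y < primorial m * m \<and>
   real S \<le> c * (real y ^ 2 * ln (ln (real n))) \<and> N \<le> n \<longrightarrow>
  real (card {r. r < primorial m \<and> (avoids_below m (x0 + int r))} *
   ((N div (primorial m * (y * y)) + 1) * S)) \<le> C * rate n"
proof -
 obtain Cw where Cw: "0 < Cw" "\<And>m u. 3 \<le> m \<Longrightarrow> real (card {x \<in> {u..<u + int (primorial m)}. avoids_below m x})
  \<le> Cw * real (primorial m) * (1 / ln (real (m - 1))) ^ k"
  using wheel_density by blast
 have K0: "0 < K" using assms(1) by simp
 show ?thesis
 proof (intro exI[of _ "9 * Cw * 3 ^ k * c"] conjI)
  show "0 < 9 * Cw * 3 ^ k * c" using Cw(1) assms by simp
  show "\<forall>\<^sub>F n in sequentially. \<forall>y m S N x0. 2 \<le> y \<and> n \<le> y ^ K \<and> real y \<le> 2 * real n powr (1 / real K) \<and>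
   primorial m \<le> y \<and> y < primorial m * m \<and>
   real S \<le> c * (real y ^ 2 * ln (ln (real n))) \<and> N \<le> n \<longrightarrow>
   real (card {r. r < primorial m \<and> (avoids_below m (x0 + int r))} *
   ((N div (primorial m * (y * y)) + 1) * S)) \<le> 9 * Cw * 3 ^ k * c * rate n"
   using wheel_modulus_large[OF K0] log_large[of 1] loglog_large[of 1]
  proof (eventually_elim, intro allI impI)
   fix n y m S N :: nat and x0 :: int
   assume A: "\<forall>y m. 2 \<le> y \<and> n \<le> y ^ K \<and> y < primorial m * m \<longrightarrow>
     3 \<le> m \<and> ln (ln (real n)) / 3 \<le> ln (real (m - 1))"
    and L: "1 \<le> ln (real n)" "1 \<le> ln (ln (real n))"
    and *: "2 \<le> y \<and> n \<le> y ^ K \<and> real y \<le> 2 * real n powr (1 / real K) \<and>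
     primorial m \<le> y \<and> y < primorial m * m \<and>
     real S \<le> c * (real y ^ 2 * ln (ln (real n))) \<and> N \<le> n"
   define l where "l = ln (ln (real n))"
   define M where "M = primorial m"
   define G where "G = card {r. r < M \<and> (avoids_below m (x0 + int r))}"
   have l1: "1 \<le> l" using L by (simp add: l_def)
   have n1: "1 \<le> real n" using L(1) by (cases "n = 0") auto
   have M0: "0 < M" unfolding M_def by (simp add: prod_pos prime_gt_0_nat)
   have m: "3 \<le> m" "l / 3 \<le> ln (real (m - 1))" using A * by (auto simp: l_def)
   have G: "real G \<le> Cw * real M * (3 / l) ^ k"
   proof -
    have "G \<le> card {x \<in> {x0..<x0 + int M}. avoids_below m x}"
     unfolding G_def
    proof (rule card_inj_on_le)
     show "inj_on (\<lambda>r. x0 + int r) {r. r < M \<and> (avoids_below m (x0 + int r))}"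
      by (rule inj_onI) simp
     show "finite {x \<in> {x0..<x0 + int M}. avoids_below m x}"
      by (rule finite_subset[of _ "{x0..<x0 + int M}"]) auto
    qed auto
    then have "real G \<le> Cw * real M * (1 / ln (real (m - 1))) ^ k"
     using Cw(2)[OF m(1), of x0] unfolding M_def by linarith
    also have "\<dots> \<le> Cw * real M * (3 / l) ^ k"
     using m l1 Cw(1) by (intro mult_left_mono power_mono) (auto simp: field_simps)
    finally show ?thesis .
   qed
   have y0: "0 < real y" using * by simp
   have My: "real M * real y ^ 2 \<le> 8 * real n"
   proof -
    have "M \<le> y" using * by (simp add: M_def)
    then have "real M * real y ^ 2 \<le> real y * real y ^ 2" by (intro mult_right_mono) auto
    also have "\<dots> = real y ^ 3" by (simp add: power2_eq_square power3_eq_cube)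
    also have "\<dots> \<le> (2 * real n powr (1 / real K)) ^ 3" using * by (intro power_mono) auto
    also have "\<dots> = 8 * real n powr (3 / real K)" using n1 by (simp add: power_mult_distrib powr_powr flip: powr_realpow)
    also have "\<dots> \<le> 8 * real n powr 1" using n1 assms by (intro mult_left_mono powr_mono) (auto simp: field_simps)
    finally show ?thesis using n1 by simp
   qed
   have nb: "real (N div (M * (y * y)) + 1) \<le> 9 * real n / (real M * real y ^ 2)"
   proof -
    have "real (N div (M * (y * y))) \<le> real N / real (M * (y * y))" by (rule of_nat_div_le_of_nat)
    also have "\<dots> \<le> real n / (real M * real y ^ 2)" using * M0 y0
     by (simp add: divide_right_mono power2_eq_square)
    finally have "real (N div (M * (y * y)) + 1) \<le> real n / (real M * real y ^ 2) + 1" by simp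
    also have "1 \<le> 8 * real n / (real M * real y ^ 2)" using My M0 y0 by (simp add: pos_le_divide_eq)
    finally show ?thesis by (simp add: add_divide_distrib[symmetric])
   qed
   have "real (G * ((N div (M * (y * y)) + 1) * S)) = real G * (real (N div (M * (y * y)) + 1) * real S)"
    by (simp only: of_nat_mult)
   also have "\<dots> \<le> Cw * real M * (3 / l) ^ k * (9 * real n / (real M * real y ^ 2) * (c * (real y ^ 2 * l)))"
    using G nb * l1 Cw(1) assms(2) by (intro mult_mono) (auto simp: l_def)
   also have "\<dots> = 9 * Cw * 3 ^ k * c * (real n * l / l ^ k)"
    using M0 y0 by (simp add: power_divide field_simps)
   also have "l ^ k = l * l ^ (k - 1)" using k_pos by (metis power_Suc Suc_diff_1)
   also have "real n * l / (l * l ^ (k - 1)) = rate n" using l1 unfolding rate_def l_def by simp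
   finally show "real (card {r. r < primorial m \<and> (avoids_below m (x0 + int r))} *
    ((N div (primorial m * (y * y)) + 1) * S)) \<le> 9 * Cw * 3 ^ k * c * rate n"
    unfolding G_def M_def .
  qed
 qed
qed

text \<open>Here \<open>k >= 3\<close> decides: with \<open>x = ln n\<close> and
  \<open>l = ln x\<close> about \<open>n * (l/x)^k\<close> positions survive, and a test costs
  \<open>x^(18/7)\<close>, so at least a factor \<open>x^(-3/7)\<close> remains to absorb the powers
  of \<open>l\<close>.\<close>

lemma tests_cost_le_rate:
 assumes "0 < K" "0 \<le> c" "3 \<le> k"
 shows "\<forall>\<^sub>F n in sequentially. \<forall>y X x0 hi. n \<le> y ^ K \<and> real X \<le> c * ln (real n) powr (18/7) \<and> hi < x0 + int n \<longrightarrow>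
  real (card {x \<in> {x0..hi}. avoids_upto y x} * X) \<le> rate n"
proof -
 obtain Cs where Cs: "0 < Cs" "\<forall>\<^sub>F n in sequentially. \<forall>u y. n \<le> y ^ K \<longrightarrow>
  real (card {x \<in> {u..<u + int n}. avoids_upto y x})
   \<le> Cs * real n * (ln (ln (real n)) / ln (real n)) ^ k"
  using survivors_bound[OF assms(1)] by blast
 have "\<forall>\<^sub>F n::nat in sequentially. Cs * c * ln (ln (real n)) ^ (k + (k - 1)) \<le> ln (real n) powr (3/7)"
  by (rule loglog_power_le_log) simp
 then show ?thesis using Cs(2) log_large[of 1] loglog_large[of 1]
 proof (eventually_elim, intro allI impI)
  fix n y X :: nat and x0 hi :: int
  assume L: "Cs * c * ln (ln (real n)) ^ (k + (k - 1)) \<le> ln (real n) powr (3/7)"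
   "1 \<le> ln (real n)" "1 \<le> ln (ln (real n))"
   and S: "\<forall>u y. n \<le> y ^ K \<longrightarrow> real (card {x \<in> {u..<u + int n}. avoids_upto y x})
   \<le> Cs * real n * (ln (ln (real n)) / ln (real n)) ^ k"
   and *: "n \<le> y ^ K \<and> real X \<le> c * ln (real n) powr (18/7) \<and> hi < x0 + int n"
  define x l where "x = ln (real n)" and "l = ln (ln (real n))"
  have x1: "1 \<le> x" "1 \<le> l" using L by (auto simp: x_def l_def)
  have "card {x \<in> {x0..hi}. avoids_upto y x} \<le>
    card {x \<in> {x0..<x0 + int n}. avoids_upto y x}" (is "?c \<le> _")
   using * by (intro card_mono finite_subset[of "{x \<in> {x0..<x0 + int n}. _ x}" "{x0..<x0 + int n}"]) auto
  then have "real ?c \<le> Cs * real n * (l / x) ^ k" using S * unfolding x_def l_def by (meson of_nat_le_iff order_trans)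
  then have "real (?c * X) \<le> Cs * real n * (l / x) ^ k * (c * x powr (18/7))"
   unfolding of_nat_mult using * Cs(1) x1 assms(2) by (intro mult_mono) (auto simp: x_def)
  also have "\<dots> = real n * (Cs * c * l ^ k) * (x powr (18/7) / x ^ k)" by (simp add: power_divide)
  also have "\<dots> \<le> real n * (Cs * c * l ^ k) * x powr (- 3/7)"
  proof (rule mult_left_mono)
   have "x powr (18/7) / x ^ k = x powr (18/7 - real k)" using x1 by (simp add: powr_diff powr_realpow)
   also have "\<dots> \<le> x powr (- 3/7)" using x1 assms(3) by (intro powr_mono) auto
   finally show "x powr (18/7) / x ^ k \<le> x powr (- 3/7)" .
  qed (use Cs(1) x1 assms(2) in auto)
  also have "\<dots> \<le> rate n"
  proof -
   have "real n * (Cs * c * l ^ (k + (k - 1))) \<le> real n * x powr (3/7)"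
    using L(1) unfolding x_def l_def by (intro mult_left_mono) auto
   then have "real n * (Cs * c * l ^ k) * l ^ (k - 1) \<le> real n * x powr (3/7)" by (simp add: power_add mult_ac)
   then have "real n * (Cs * c * l ^ k) * l ^ (k - 1) * x powr (- 3/7) \<le> real n * x powr (3/7) * x powr (- 3/7)"
    by (intro mult_right_mono) auto
   also have "\<dots> = real n" using x1 by (simp flip: powr_add add: mult.assoc)
   finally show ?thesis using x1 unfolding rate_def l_def[symmetric] by (simp add: pos_le_divide_eq mult_ac)
  qed
  finally show "real (?c * X) \<le> rate n" .
 qed
qed

end

section \<open>Register-only subroutines\<close>

definition frame :: "nat set \<Rightarrow> ram_state \<Rightarrow> ram_state \<Rightarrow> bool" where
 "frame X s s' \<longleftrightarrow> mem s' = mem s \<and> cells s' = cells s \<and> printed s' = printed s \<and>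
   (\<forall>x. x \<notin> X \<longrightarrow> reg s' x = reg s x)"

text \<open>Argument in register 20, answer in 22. Trial division without early exit is affordable,
  as it is applied only to numbers up to a constant times \<open>y\<close> and to candidates for
  least nonresidues.\<close>

definition prime_prog :: com where
 "prime_prog =
   22 ::= N 1;;
   21 ::= N 2;;
   Loop (Lt (V 21) (V 20))
    (Cond (Eq (V 20 [mod] V 21) (N 0)) (22 ::= N 0) Skip;;
    21 ::= V 21 [+] N 1)"

lemma prime_iff_no_divisor: "2 \<le> m \<Longrightarrow> prime m \<longleftrightarrow> (\<forall>e\<in>{2..<m}. \<not> e dvd (m::nat))"
proof safe
 fix e assume "2 \<le> m" "prime m" "e \<in> {2..<m}" "e dvd m"
 then show False by (auto simp: prime_nat_iff)
next
 assume m: "2 \<le> m" "\<forall>e\<in>{2..<m}. \<not> e dvd m"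
 obtain q where q: "prime q" "q dvd m" using m prime_factor_nat[of m] by auto
 then have "q = m" using m prime_ge_2_nat[of q] dvd_imp_le[of q m] by (cases "q < m") auto
 then show "prime m" using q by simp
qed

lemma wp_prime_prog:
 assumes "reg s 20 = int m" "2 \<le> m" "int m + 10 < B"
 shows "wp B prime_prog (\<lambda>t s'. t \<le> m \<and> frame {21, 22} s s' \<and> reg s' 22 = of_bool (prime m)) s"
proof -
 let ?I = "\<lambda>t s'. \<exists>d. reg s' 21 = int d \<and> 2 \<le> d \<and> d \<le> m \<and> t + 2 = d \<and>
  reg s' 22 = of_bool (\<forall>e\<in>{2..<d}. \<not> e dvd m) \<and> frame {21, 22} s s'"
 let ?f = "\<lambda>s'. m - nat (reg s' 21)"
 have "10 < B" using assms(3) by linarith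
 then show ?thesis
  unfolding prime_prog_def
 proof (simp add: wp_simps split del: split_of_bool, intro wp_Loop[where I = ?I and f = ?f], goal_cases)
  case 1
  then show ?case using assms by (intro exI[of _ 2]) (auto simp: frame_def)
 next
  case (2 t s')
  then show ?case by simp
 next
  case (3 t s')
  then obtain d where d: "reg s' 21 = int d" "2 \<le> d" "d \<le> m" "t + 2 = d"
   "reg s' 22 = of_bool (\<forall>e\<in>{2..<d}. \<not> e dvd m)" "frame {21, 22} s s'" by blast
  have m: "reg s' 20 = int m" using d(6) assms(1) by (simp add: frame_def)
  have dm: "d < m" using 3 d(1) m by simp
  have set: "{2..<Suc d} = insert d {2..<d}" using d by auto
  have dvd: "int m mod int d = 0 \<longleftrightarrow> d dvd m" by (metis dvd_eq_mod_eq_0 int_dvd_int_iff)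
  have md: "0 \<le> int m mod int d" "int m mod int d < int d" using d by auto
  have fr: "frame {21, 22} s (s'\<lparr>reg := (reg s')(22 := u, 21 := v)\<rparr>)"
   "frame {21, 22} s (s'\<lparr>reg := (reg s')(21 := v)\<rparr>)" for u v
   using d(6) by (auto simp: frame_def)
  have "int m mod (2 + int t) < B"
   using pos_mod_bound[of "2 + int t" "int m"] dm assms(3) d(4) by linarith
  then show ?case
   using d dm m md assms(3) fr
   by (auto simp: wp_simps dvd set intro!: exI[of _ "Suc d"])
 next
  case (4 t s')
  then obtain d where d: "reg s' 21 = int d" "2 \<le> d" "d \<le> m" "t + 2 = d"
   "reg s' 22 = of_bool (\<forall>e\<in>{2..<d}. \<not> e dvd m)" "frame {21, 22} s s'" by blast
  have m: "reg s' 20 = int m" using d(6) assms(1) by (simp add: frame_def)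
  then have "d = m" using 4 d by simp
  then show ?case using d prime_iff_no_divisor[OF assms(2)] by simp
 qed
qed

text \<open>Square and multiply: base, exponent and modulus are passed in registers 23, 24 and 25,
  the result is in 26.\<close>

definition powmod_prog :: com where
 "powmod_prog =
   26 ::= N 1;;
   Loop (Lt (N 0) (V 24))
    (Cond (Eq (V 24 [mod] N 2) (N 1)) (26 ::= V 26 [*] V 23 [mod] V 25) Skip;;
    23 ::= V 23 [*] V 23 [mod] V 25;;
    24 ::= V 24 [div] N 2)"

lemma floorlog_half: "0 < e \<Longrightarrow> floorlog 2 e = Suc (floorlog 2 (e div 2))"
 using compute_floorlog[of 2 e] by simp

lemma wp_powmod_prog:
 assumes "reg s 23 = int b" "reg s 24 = int e" "reg s 25 = int m" "b \<le> m" "2 \<le> m"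
  "int e < B" "int m * int m + 10 < B"
 shows "wp B powmod_prog (\<lambda>t s'. t \<le> floorlog 2 e \<and> frame {23, 24, 26} s s' \<and>
  reg s' 26 = int (b ^ e mod m)) s"
proof -
 \<comment> \<open>The product \<open>r * b'^e'\<close> is preserved modulo \<open>m\<close>, and
   the bit length of \<open>e'\<close> is what remains of the time budget.\<close>
 let ?I = "\<lambda>t s'. \<exists>b' e' r. reg s' 23 = int b' \<and> reg s' 24 = int e' \<and> reg s' 26 = int r \<and>
  b' \<le> m \<and> r < m \<and> e' \<le> e \<and> [r * b' ^ e' = b ^ e] (mod m) \<and> t + floorlog 2 e' \<le> floorlog 2 e \<and>
  frame {23, 24, 26} s s'"
 let ?f = "\<lambda>s'. nat (reg s' 24)"
 have mult: "int x * int z < B \<and> int x * int z \<le> int m * int m" if "x \<le> m" "z \<le> m" for x z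
  using mult_mono[of "int x" "int m" "int z" "int m"] that assms by simp
 have m_le: "int m \<le> int m * int m" using assms(5) by simp
 have B: "10 < B" using assms(7) m_le by linarith
 then show ?thesis
  unfolding powmod_prog_def
 proof (simp add: wp_simps split del: split_of_bool, intro wp_Loop[where I = ?I and f = ?f], goal_cases)
  case 1
  show ?case using assms
   by (intro exI[of _ b] exI[of _ e] exI[of _ 1]) (auto simp: frame_def)
 next
  case (2 t s')
  then show ?case by simp
 next
  case (3 t s')
  then obtain b' e' r where I: "reg s' 23 = int b'" "reg s' 24 = int e'" "reg s' 26 = int r"
   "b' \<le> m" "r < m" "e' \<le> e" "[r * b' ^ e' = b ^ e] (mod m)" "t + floorlog 2 e' \<le> floorlog 2 e"
   "frame {23, 24, 26} s s'" by blast
  have m: "reg s' 25 = int m" using I(9) assms(3) by (simp add: frame_def)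
  have e0: "0 < e'" using 3 I(2) by simp
  have mod2: "int e' mod 2 = 1 \<longleftrightarrow> odd e'" by presburger
  have e2: "int e' div 2 = int (e' div 2)" by simp
  have md: "int x mod int m = int (x mod m)" "x mod m < m" for x using assms(5) by (auto simp: zmod_int)
  have lt: "int (x mod m) < B" for x using md(2)[of x] m_le assms(7) by linarith
  have prod: "int x * int z = int (x * z)" for x z by simp
  have bb: "[(b' * b' mod m) ^ (e' div 2) = b' ^ (2 * (e' div 2))] (mod m)"
   by (simp add: unique_euclidean_semiring_class.cong_def power_mod power_mult power2_eq_square)
  have fl: "Suc (t + floorlog 2 (e' div 2)) \<le> floorlog 2 e" using I(8) floorlog_half[OF e0] by simp
  have small: "int (e' div 2) < B" using I(6) assms(6) by simp
  have "2 < B" using B by simp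
  show ?case
  proof (cases "odd e'")
   case True
   have "[(r * b' mod m) * (b' * b' mod m) ^ (e' div 2) = r * b' * b' ^ (2 * (e' div 2))] (mod m)"
    by (intro cong_mult bb) simp
   also have "r * b' * b' ^ (2 * (e' div 2)) = r * b' ^ e'"
    using True by (metis mult.assoc odd_two_times_div_two_succ power_Suc Suc_eq_plus1)
   also have "[r * b' ^ e' = b ^ e] (mod m)" by (rule I)
   finally have c: "[(r * b' mod m) * (b' * b' mod m) ^ (e' div 2) = b ^ e] (mod m)" .
   have fr: "frame {23, 24, 26} s (s'\<lparr>reg := (reg s')(26 := u, 23 := v, 24 := z)\<rparr>)" for u v z
    using I(9) by (auto simp: frame_def)
   have "int r * int b' < B" "int b' * int b' < B" using mult[of r b'] mult[of b' b'] I by auto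
   then show ?thesis
    using True I e0 m mod2 small c fl fr lt[of "r * b'"] lt[of "b' * b'"] md(2) \<open>2 < B\<close> assms(5)
    by (simp add: wp_simps prod md(1) del: of_nat_mult)
      (intro conjI exI[of _ "b' * b' mod m"] exI[of _ "e' div 2"] exI[of _ "r * b' mod m"], auto intro: less_imp_le)
  next
   case False
   have "[r * (b' * b' mod m) ^ (e' div 2) = r * b' ^ (2 * (e' div 2))] (mod m)"
    by (intro cong_mult bb) simp
   also have "r * b' ^ (2 * (e' div 2)) = r * b' ^ e'" using False by simp
   also have "[r * b' ^ e' = b ^ e] (mod m)" by (rule I)
   finally have c: "[r * (b' * b' mod m) ^ (e' div 2) = b ^ e] (mod m)" .
   have fr: "frame {23, 24, 26} s (s'\<lparr>reg := (reg s')(23 := v, 24 := z)\<rparr>)" for v z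
    using I(9) by (auto simp: frame_def)
   have "int b' * int b' < B" using mult[of b' b'] I by auto
   then show ?thesis
    using False I e0 m mod2 small c fl fr lt[of "b' * b'"] md(2) \<open>2 < B\<close> assms(5)
    by (simp add: wp_simps prod md(1) del: of_nat_mult)
      (intro conjI exI[of _ "b' * b' mod m"] exI[of _ "e' div 2"] exI[of _ r], auto intro: less_imp_le)
  qed
 next
  case (4 t s')
  then obtain b' e' r where I: "reg s' 23 = int b'" "reg s' 24 = int e'" "reg s' 26 = int r"
   "b' \<le> m" "r < m" "e' \<le> e" "[r * b' ^ e' = b ^ e] (mod m)" "t + floorlog 2 e' \<le> floorlog 2 e"
   "frame {23, 24, 26} s s'" by blast
  have "e' = 0" using 4 I(2) by simp
  then have "[r = b ^ e] (mod m)" using I(7) by simp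
  then have "r = b ^ e mod m" using I(5) by (simp add: unique_euclidean_semiring_class.cong_def)
  then show ?case using I by auto
 qed
qed

definition pow_prog :: com where
 "pow_prog =
   32 ::= N 1;;
   33 ::= N 0;;
   Loop (Lt (V 33) (V 28)) (32 ::= V 32 [*] V 31;; 33 ::= V 33 [+] N 1)"

lemma wp_pow_prog:
 assumes "reg s 31 = int b" "reg s 28 = int e" "1 \<le> b" "int b ^ e + 10 < B" "int e + 10 < B"
 shows "wp B pow_prog (\<lambda>t s'. t \<le> e \<and> frame {32, 33} s s' \<and> reg s' 32 = int (b ^ e)) s"
proof -
 let ?I = "\<lambda>t s'. t \<le> e \<and> reg s' 33 = int t \<and> reg s' 32 = int b ^ t \<and> frame {32, 33} s s'"
 let ?f = "\<lambda>s'. e - nat (reg s' 33)"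
 have "10 < B" using assms(5) by linarith
 then show ?thesis
  unfolding pow_prog_def
 proof (simp add: wp_simps split del: split_of_bool, intro wp_Loop[where I = ?I and f = ?f], goal_cases)
  case 1
  then show ?case by (auto simp: frame_def)
 next
  case (2 t s')
  then show ?case by simp
 next
  case (3 t s')
  then have I: "t \<le> e" "reg s' 33 = int t" "reg s' 32 = int b ^ t" "frame {32, 33} s s'" by auto
  have r: "reg s' 31 = int b" "reg s' 28 = int e" using I(4) assms by (simp_all add: frame_def)
  have t: "t < e" using 3 I r by simp
  have "int b ^ Suc t \<le> int b ^ e" using t assms(3) by (intro power_increasing) auto
  then have "int b ^ t * int b < B" using assms(4) by (simp add: mult.commute)
  then show ?case using I r t assms by (auto simp: wp_simps frame_def abs_mult mult.commute)
 next
  case (4 t s')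
  then have I: "t \<le> e" "reg s' 33 = int t" "reg s' 32 = int b ^ t" "frame {32, 33} s s'" by auto
  have "reg s' 28 = int e" using I(4) assms by (simp add: frame_def)
  then have "t = e" using 4 I by simp
  then show ?case using I by simp
 qed
qed

text \<open>Bisection for the integer root of register 27 with exponent in register 28, followed by
  one comparison; the answer is in register 34.\<close>

definition ispow_prog :: com where
 "ispow_prog =
   29 ::= N 1;;
   30 ::= V 27;;
   Loop (Lt (V 29 [+] N 1) (V 30))
    (31 ::= (V 29 [+] V 30) [div] N 2;;
    pow_prog;;
    Cond (Lt (V 27) (V 32)) (30 ::= V 31) (29 ::= V 31));;
   31 ::= V 29;;
   pow_prog;;
   Cond (Eq (V 32) (V 27)) (34 ::= N 1) (34 ::= N 0)"

lemma wp_ispow_prog: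
 assumes "reg s 27 = int m" "reg s 28 = int e" "2 \<le> m" "2 \<le> e" "int m ^ e + 10 < B" "int e + 10 < B"
 shows "wp B ispow_prog (\<lambda>t s'. t \<le> (e + 1) * (floorlog 2 m + 1) \<and>
  frame {29, 30, 31, 32, 33, 34} s s' \<and> reg s' 34 = of_bool (\<exists>a. m = a ^ e)) s"
proof -
 let ?F = "{29, 30, 31, 32, 33, 34} :: nat set"
 \<comment> \<open>The budget is tied to \<open>hi - lo - 1\<close>, which is at least halved
   whichever end moves and is 0 at exit; each bisection costs at most \<open>e + 1\<close>.\<close>
 let ?I = "\<lambda>t s'. \<exists>lo hi. reg s' 29 = int lo \<and> reg s' 30 = int hi \<and> 1 \<le> lo \<and> lo < hi \<and> hi \<le> m \<and>
  lo ^ e \<le> m \<and> m < hi ^ e \<and> t + (e + 1) * floorlog 2 (hi - lo - 1) \<le> (e + 1) * floorlog 2 m \<and> frame ?F s s'"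
 let ?f = "\<lambda>s'. nat (reg s' 30 - reg s' 29)"
 have mB: "int m * 2 + 10 < B"
 proof -
  have "int m * int m = int m ^ 2" by (simp add: power2_eq_square)
  also have "\<dots> \<le> int m ^ e" using assms(3,4) by (intro power_increasing) auto
  finally have "int m * int m \<le> int m ^ e" .
  moreover have "int m * 2 \<le> int m * int m" using assms(3) by (intro mult_left_mono) auto
  ultimately show ?thesis using assms(5) by linarith
 qed
 have m_less: "m < m ^ e"
 proof -
  have "m ^ 1 < m ^ e" using assms(3,4) by (intro power_strict_increasing) auto
  then show ?thesis by simp
 qed
 have powB: "int x ^ e + 10 < B" if "x \<le> m" for x
 proof -
  have "int x ^ e \<le> int m ^ e" using that by (intro power_mono) auto
  then show ?thesis using assms(5) by linarith
 qed
 have "10 < B" "int m < B" using mB by linarith+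
 then show ?thesis
  unfolding ispow_prog_def
 proof (simp add: wp_simps assms(1) split del: split_of_bool, intro wp_Loop[where I = ?I and f = ?f], goal_cases)
  case 1
  have "(e + 1) * floorlog 2 (m - 1 - 1) \<le> (e + 1) * floorlog 2 m"
   by (intro mult_le_mono2 floorlog_mono) simp
  then show ?case using assms m_less
   by (rule_tac exI[of _ 1], rule_tac exI[of _ m]) (auto simp: frame_def)
 next
  case (2 t s')
  then show ?case using mB by auto
 next
  case (3 t s')
  then obtain lo hi where I: "reg s' 29 = int lo" "reg s' 30 = int hi" "1 \<le> lo" "lo < hi" "hi \<le> m"
   "lo ^ e \<le> m" "m < hi ^ e" "t + (e + 1) * floorlog 2 (hi - lo - 1) \<le> (e + 1) * floorlog 2 m"
   "frame ?F s s'" by blast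
  have gap: "lo + 1 < hi" using 3 I by simp
  define mid where "mid = (lo + hi) div 2"
  have mid: "lo < mid" "mid < hi" "1 \<le> mid" "mid \<le> m" unfolding mid_def using gap I(5) by auto
  have midi: "(int lo + int hi) div 2 = int mid" by (simp add: mid_def)
  let ?s1 = "s'\<lparr>reg := (reg s')(31 := int mid)\<rparr>"
  have "wp B pow_prog (\<lambda>t s''. t \<le> e \<and> frame {32, 33} ?s1 s'' \<and> reg s'' 32 = int (mid ^ e)) ?s1"
   by (rule wp_pow_prog) (use I assms mid powB[of mid] in \<open>auto simp: frame_def\<close>)
  moreover have "Suc (t + t1) + (e + 1) * floorlog 2 g \<le> (e + 1) * floorlog 2 m"
   if "t1 \<le> e" "g \<le> (hi - lo - 1) div 2" for t1 g
  proof -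
   have "Suc (floorlog 2 g) \<le> Suc (floorlog 2 ((hi - lo - 1) div 2))" using that(2) floorlog_mono by simp
   also have "\<dots> = floorlog 2 (hi - lo - 1)" using gap by (intro floorlog_half[symmetric]) simp
   finally have "(e + 1) * Suc (floorlog 2 g) \<le> (e + 1) * floorlog 2 (hi - lo - 1)" by (rule mult_le_mono2)
   then show ?thesis using I(8) that(1) by simp
  qed
  moreover have "hi - mid - 1 \<le> (hi - lo - 1) div 2" "mid - lo - 1 \<le> (hi - lo - 1) div 2"
  proof -
   define g where "g = hi - lo"
   have hi: "hi = lo + g" using gap by (simp add: g_def)
   have "(lo + hi) div 2 = (2 * lo + g) div 2" by (simp add: hi mult_2)
   then have mid: "mid = lo + g div 2" by (simp add: mid_def)
   have "g - g div 2 - 1 \<le> (g - 1) div 2" "g div 2 - 1 \<le> (g - 1) div 2" by presburger+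
   then show "hi - mid - 1 \<le> (hi - lo - 1) div 2" "mid - lo - 1 \<le> (hi - lo - 1) div 2"
    by (simp_all add: hi mid)
  qed
  ultimately have "wp B pow_prog (\<lambda>t1. wp B (Cond (Lt (V 27) (V 32)) (30 ::= V 31) (29 ::= V 31))
    (\<lambda>t2 s''. ?I (Suc (t + (t1 + t2))) s'' \<and> ?f s'' < ?f s')) ?s1"
  proof (elim wp_mono, goal_cases)
   case (1 t1 s'')
   have r: "reg s'' 27 = int m" "reg s'' 31 = int mid" "reg s'' 29 = int lo" "reg s'' 30 = int hi"
    using 1 I(1,2,9) assms by (simp_all add: frame_def)
   have fr: "frame ?F s (s''\<lparr>reg := (reg s'')(30 := v)\<rparr>)" "frame ?F s (s''\<lparr>reg := (reg s'')(29 := v)\<rparr>)" for v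
    using 1 I(9) by (auto simp: frame_def)
   show ?case
   proof (cases "m < mid ^ e")
    case True
    then have "int m < int (mid ^ e)" by (simp only: of_nat_less_iff)
    then show ?thesis using 1 I mid r fr True mB
     by (simp add: wp_simps)
   next
    case False
    then have "\<not> int m < int (mid ^ e)" by (metis of_nat_less_iff)
    then show ?thesis using 1 I mid r fr False mB
     by (simp add: wp_simps)
   qed
  qed
  then show ?case using I mid mB by (simp add: wp_simps midi)
 next
  case (4 t s')
  then obtain lo hi where I: "reg s' 29 = int lo" "reg s' 30 = int hi" "1 \<le> lo" "lo < hi" "hi \<le> m"
   "lo ^ e \<le> m" "m < hi ^ e" "t + (e + 1) * floorlog 2 (hi - lo - 1) \<le> (e + 1) * floorlog 2 m"
   "frame ?F s s'" by blast
  have hi: "hi = Suc lo" using 4 I by simp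
  have iff: "lo ^ e = m \<longleftrightarrow> (\<exists>a. m = a ^ e)"
  proof
   assume "\<exists>a. m = a ^ e"
   then obtain a where a: "m = a ^ e" by blast
   have "lo \<le> a"
   proof (rule ccontr)
    assume "\<not> lo \<le> a"
    then have "a ^ e < lo ^ e" using assms(4) by (intro power_strict_mono) auto
    then show False using I(6) a by simp
   qed
   moreover have "a < hi" using I(7) a by (simp add: power_less_imp_less_base)
   ultimately have "a = lo" using hi by simp
   then show "lo ^ e = m" using a by simp
  qed auto
  let ?s1 = "s'\<lparr>reg := (reg s')(31 := int lo)\<rparr>"
  have "wp B pow_prog (\<lambda>t s''. t \<le> e \<and> frame {32, 33} ?s1 s'' \<and> reg s'' 32 = int (lo ^ e)) ?s1"
   by (rule wp_pow_prog) (use I assms powB[of lo] in \<open>auto simp: frame_def\<close>)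
  then have "wp B pow_prog (\<lambda>t1. wp B (Cond (Eq (V 32) (V 27)) (34 ::= N 1) (34 ::= N 0))
   (\<lambda>t2 s''. t + (t1 + t2) \<le> (e + 1) * (floorlog 2 m + 1) \<and> frame ?F s s'' \<and>
    reg s'' 34 = of_bool (\<exists>a. m = a ^ e))) ?s1"
  proof (elim wp_mono, goal_cases)
   case (1 t1 s'')
   have r: "reg s'' 27 = int m" using 1 I(9) assms by (simp add: frame_def)
   have fr: "frame ?F s (s''\<lparr>reg := (reg s'')(34 := v)\<rparr>)" for v
    using 1 I(9) by (auto simp: frame_def)
   have "t + t1 \<le> (e + 1) * (floorlog 2 m + 1)" using 1 I(8) by simp
   moreover have "int (lo ^ e) = int m \<longleftrightarrow> lo ^ e = m" by (simp only: of_nat_eq_iff)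
   ultimately show ?case using 1 r fr mB iff by (auto simp: wp_simps)
  qed
  then show ?case using I mB by (simp add: wp_simps)
 qed
qed

text \<open>Tries 3, 4, 5, ... in turn, filters primes by trial division and evaluates the symbol by
  Euler's criterion after reducing \<open>L\<close>. Register 37 is the flag for continuing.\<close>

definition nonresidue_prog :: com where
 "nonresidue_prog =
   36 ::= N 2;;
   37 ::= N 1;;
   Loop (Eq (V 37) (N 1))
    (36 ::= V 36 [+] N 1;;
    20 ::= V 36;;
    prime_prog;;
    Cond (Eq (V 22) (N 1))
     (23 ::= V 35 [mod] V 36;;
      24 ::= (V 36 [-] N 1) [div] N 2;;
      25 ::= V 36;;
      powmod_prog;;
      Cond (Eq (V 26) (N 1)) Skip (37 ::= N 0))
     Skip)"

lemma Legendre_mod: "Legendre (a mod p) p = Legendre a p"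
 by (simp add: Legendre_def QuadRes_def unique_euclidean_semiring_class.cong_def)

lemma floorlog_le_self: "floorlog 2 x \<le> x"
proof (induction x rule: less_induct)
 case (less x)
 show ?case
 proof (cases "x = 0")
  case False
  then have "floorlog 2 x = Suc (floorlog 2 (x div 2))" by (intro floorlog_half) simp
  also have "\<dots> \<le> Suc (x div 2)" using less[of "x div 2"] False by simp
  also have "\<dots> \<le> x" using False by simp
  finally show ?thesis .
 qed (simp add: floorlog_def)
qed

text \<open>A candidate \<open>p\<close> costs at most \<open>p\<close> iterations of trial division
  and fewer for the power, so the total is quadratic in the answer. Values stay near
  \<open>L^2\<close> at most, as the answer is at most \<open>L\<close>.\<close>

lemma wp_nonresidue_prog:
 assumes "reg s 35 = int L" "1 < L" "odd L" "int L * int L + 20 < B"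
 shows "wp B nonresidue_prog (\<lambda>t s'. t \<le> 3 * least_nonresidue L ^ 2 \<and>
  frame {20, 21, 22, 23, 24, 25, 26, 36, 37} s s' \<and> reg s' 36 = int (least_nonresidue L)) s"
proof -
 let ?F = "{20, 21, 22, 23, 24, 25, 26, 36, 37} :: nat set"
 define l where "l = least_nonresidue L"
 have l: "prime l" "odd l" "Legendre (int L) (int l) \<noteq> 1" "l \<le> L"
  using least_nonresidue[OF assms(2,3)] by (simp_all add: l_def)
 have l3: "3 \<le> l" using l(1,2) prime_ge_2_nat[OF l(1)] by (cases "l = 2") auto
 have LL: "int L \<le> int L * int L" using assms(2) by simp
 have bnd: "int q * int q + 20 < B" "int q + 20 < B" if "q \<le> l" for q
 proof -
  have "int q * int q \<le> int L * int L" using that l(4) by (intro mult_mono) auto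
  then show "int q * int q + 20 < B" using assms(4) by linarith
  show "int q + 20 < B" using that l(4) LL assms(4) by linarith
 qed
 let ?I = "\<lambda>t s'. \<exists>q g. reg s' 36 = int q \<and> reg s' 37 = of_bool g \<and> 2 \<le> q \<and> q \<le> l \<and> (g \<longleftrightarrow> q < l) \<and>
  t \<le> (q - 2) * (3 * l) \<and> frame ?F s s'"
 let ?f = "\<lambda>s'. l - nat (reg s' 36)"
 have "20 < B" using bnd(2)[of l] by linarith
 then show ?thesis
  unfolding nonresidue_prog_def l_def[symmetric]
 proof (simp add: wp_simps split del: split_of_bool, intro wp_Loop[where I = ?I and f = ?f], goal_cases)
  case 1
  then show ?case using l3 by (intro exI[of _ 2] exI[of _ True]) (auto simp: frame_def)
 next
  case (2 t s')
  then show ?case using bnd[of l] by auto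
 next
  case (3 t s')
  then obtain q g where I: "reg s' 36 = int q" "reg s' 37 = of_bool g" "2 \<le> q" "q \<le> l" "g \<longleftrightarrow> q < l"
   "t \<le> (q - 2) * (3 * l)" "frame ?F s s'" by blast
  have g: "g" "q < l" using 3 I by (auto split: if_splits)
  define p where "p = Suc q"
  have p: "2 \<le> p" "p \<le> l" "3 \<le> p" using g I by (auto simp: p_def)
  note b = bnd[OF p(2)]
  have time: "Suc (t + t1) \<le> (p - 2) * (3 * l)" if "t1 \<le> p + floorlog 2 ((p - 1) div 2)" for t1
  proof -
   have "floorlog 2 ((p - 1) div 2) \<le> (p - 1) div 2" by (rule floorlog_le_self)
   then have "Suc t1 \<le> 3 * l" using that p by simp
   moreover have "p - 2 = Suc (q - 2)" using I p_def by simp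
   ultimately show ?thesis using I(6) by simp
  qed
  let ?s1 = "s'\<lparr>reg := (reg s')(36 := int p, 20 := int p)\<rparr>"
  let ?Q = "\<lambda>t1 s''. ?I (Suc (t + t1)) s'' \<and> ?f s'' < ?f s'"
  have Q: "?Q t1 s''" if "reg s'' 36 = int p" "reg s'' 37 = of_bool (p < l)"
   "t1 \<le> p + floorlog 2 ((p - 1) div 2)" "frame ?F s s''" for t1 s''
  proof
   show "?I (Suc (t + t1)) s''"
    using that p time[of t1] by (intro exI[of _ p] exI[of _ "p < l"]) simp
   show "?f s'' < ?f s'" using that(1) I(1) g by (simp add: p_def)
  qed
  have "wp B prime_prog (\<lambda>t s''. t \<le> p \<and> frame {21, 22} ?s1 s'' \<and> reg s'' 22 = of_bool (prime p)) ?s1"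
   by (rule wp_prime_prog) (use p b in auto)
  then have "wp B prime_prog (\<lambda>t1. wp B (Cond (Eq (V 22) (N 1))
     (23 ::= V 35 [mod] V 36;;
      24 ::= (V 36 [-] N 1) [div] N 2;;
      25 ::= V 36;;
      powmod_prog;;
      Cond (Eq (V 26) (N 1)) Skip (37 ::= N 0))
     Skip) (\<lambda>t2. ?Q (t1 + t2))) ?s1"
  proof (elim wp_mono, goal_cases)
   case (1 t1 s2)
   have r: "reg s2 36 = int p" "reg s2 35 = int L" "reg s2 37 = 1"
    using 1 I(2,7) g(1) assms(1) by (simp_all add: frame_def)
   have fr2: "frame ?F s s2" using 1 I(7) by (auto simp: frame_def)
   show ?case
   proof (cases "prime p")
    case False
    then have "p < l" using l p by (cases "p = l") auto
    then have "?Q t1 s2" using 1 r fr2 by (intro Q) auto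
    then show ?thesis using 1 False b by (simp add: wp_simps)
   next
    case True
    then have oddp: "odd p" using p by (simp add: prime_odd_nat)
    let ?s3 = "s2\<lparr>reg := (reg s2)(23 := int (L mod p), 24 := int ((p - 1) div 2), 25 := int p)\<rparr>"
    have "wp B powmod_prog (\<lambda>t s'. t \<le> floorlog 2 ((p - 1) div 2) \<and> frame {23, 24, 26} ?s3 s' \<and>
      reg s' 26 = int ((L mod p) ^ ((p - 1) div 2) mod p)) ?s3"
     by (rule wp_powmod_prog) (use p b in \<open>auto intro: less_imp_le\<close>)
    then have "wp B powmod_prog (\<lambda>t3. wp B (Cond (Eq (V 26) (N 1)) Skip (37 ::= N 0))
      (\<lambda>t4. ?Q (t1 + (t3 + t4)))) ?s3"
    proof (elim wp_mono, goal_cases)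
     case (1 t3 s4)
     have r4: "reg s4 36 = int p" "reg s4 37 = 1"
      using 1 r by (simp_all add: frame_def)
     have fr4: "frame ?F s s4" using 1 fr2 by (auto simp: frame_def)
     have iff: "(L mod p) ^ ((p - 1) div 2) mod p = 1 \<longleftrightarrow> Legendre (int L) (int p) = 1"
     proof -
      have "Legendre (int (L mod p)) (int p) = Legendre (int L) (int p)"
       using Legendre_mod[of "int L" "int p"] by (simp only: zmod_int)
      moreover have "2 < p" using p by simp
      ultimately show ?thesis
       using power_half_mod_prime(1,3)[OF True \<open>2 < p\<close>, of "L mod p"] by metis
     qed
     show ?case
     proof (cases "(L mod p) ^ ((p - 1) div 2) mod p = 1")
      case T: True
      then have "p \<noteq> l" using iff l by auto
      then have "p < l" using p by simp
      then have "?Q (t1 + t3) s4" using r4 fr4 1 \<open>t1 \<le> p \<and> _\<close> by (intro Q) auto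
      moreover have "reg s4 26 = 1" using 1 T by simp
      ultimately show ?thesis using b by (simp add: wp_simps)
     next
      case F: False
      then have "Legendre (int L) (int p) \<noteq> 1" using iff by simp
      then have "l \<le> p" unfolding l_def using True oddp by (intro least_nonresidue_le) auto
      then have "p = l" using p by simp
      let ?s5 = "s4\<lparr>reg := (reg s4)(37 := 0)\<rparr>"
      have "frame ?F s ?s5" using fr4 by (auto simp: frame_def)
      then have "?Q (t1 + t3) ?s5" using r4 1 \<open>p = l\<close> \<open>t1 \<le> p \<and> _\<close> by (intro Q) auto
      moreover have "reg s4 26 \<noteq> 1" using 1 F by (metis of_nat_1 of_nat_eq_iff)
      ultimately show ?thesis using b by (simp add: wp_simps)
     qed
    qed
    moreover have "int L mod int p = int (L mod p)" by (simp add: zmod_int)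
    moreover have "(int p - 1) div 2 = int ((p - 1) div 2)" using p by (simp add: of_nat_diff zdiv_int)
    moreover have "int (L mod p) < B"
    proof -
     have "L mod p < p" using p by simp
     then show ?thesis using b(2) by linarith
    qed
    moreover have "int ((p - 1) div 2) \<le> int p" by simp
    ultimately show ?thesis using 1 True b r p
     by (simp add: wp_simps)
   qed
  qed
  moreover have "int q + 1 = int p" by (simp add: p_def)
  ultimately show ?case using I b by (simp add: wp_simps)
 next
  case (4 t s')
  then obtain q g where I: "reg s' 36 = int q" "reg s' 37 = of_bool g" "2 \<le> q" "q \<le> l" "g \<longleftrightarrow> q < l"
   "t \<le> (q - 2) * (3 * l)" "frame ?F s s'" by blast
  have "q = l" using 4 I by (auto split: if_splits)
  moreover have "(l - 2) * (3 * l) \<le> 3 * l ^ 2" by (simp add: power2_eq_square)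
  ultimately show ?case using I by auto
 qed
qed

section \<open>The primality test as a program\<close>

definition powers_prog :: "nat \<Rightarrow> com" where
 "powers_prog K =
   42 ::= N 1;;
   38 ::= N 2;;
   Loop (Lt (V 38) (N (int K + 1)))
    (27 ::= V 16;;
    28 ::= V 38;;
    ispow_prog;;
    Cond (Eq (V 34) (N 1)) (42 ::= N 0) Skip;;
    38 ::= V 38 [+] N 1)"

definition witness_prog :: com where
 "witness_prog =
   39 ::= (V 16 [-] N 1) [div] N 2;;
   Cond (Eq (V 16 [mod] N 8) (N 1))
    (35 ::= V 16;; nonresidue_prog;; 45 ::= V 36)
    (Cond (Eq (V 16 [mod] N 8) (N 5)) (45 ::= N 2) (45 ::= V 16 [-] N 1))"

definition base_prog :: "nat \<Rightarrow> com" where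
 "base_prog q = 23 ::= V q;; 24 ::= V 39;; 25 ::= V 16;; powmod_prog"

text \<open>The witness base has to give -1, the further bases 1 or -1. All integers up to the bound
  serve as bases, which spares a primality test of the base; a prime \<open>m\<close> passes for
  each of them below \<open>m\<close>.\<close>

definition bases_prog :: com where
 "bases_prog =
   base_prog 45;;
   Cond (Eq (V 26) (V 16 [-] N 1)) Skip (42 ::= N 0);;
   Cond (Lt (V 5) (V 16)) (44 ::= V 5 [+] N 1) (44 ::= V 16);;
   43 ::= N 2;;
   Loop (Lt (V 43) (V 44))
    (base_prog 43;;
    Cond (Eq (V 26) (N 1)) Skip (Cond (Eq (V 26) (V 16 [-] N 1)) Skip (42 ::= N 0));;
    43 ::= V 43 [+] N 1)"

text \<open>Perfect powers are discarded before a witness is sought: in class 1 modulo 8 the bound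
  on that search holds for nonsquares only.\<close>

definition test_prog :: "nat \<Rightarrow> com" where
 "test_prog K = powers_prog K;; Cond (Eq (V 42) (N 1)) (witness_prog;; bases_prog) Skip"

text \<open>The interface between the program, which decides this condition, and the number theory,
  which equates it with primality at sieved positions.\<close>

definition test_passes :: "nat \<Rightarrow> nat \<Rightarrow> nat \<Rightarrow> bool" where
 "test_passes K bd m \<longleftrightarrow> (\<forall>e\<in>{2..K}. \<not> (\<exists>a. m = a ^ e)) \<and>
   witness_base m ^ ((m - 1) div 2) mod m = m - 1 \<and>
   (\<forall>q. 2 \<le> q \<and> q \<le> bd \<and> q < m \<longrightarrow> q ^ ((m - 1) div 2) mod m \<in> {1, m - 1})"

text \<open>\<open>W\<close> bounds all input numbers and \<open>B\<close> all values that fit into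
  a word; the exponent \<open>K + 12\<close> leaves room for \<open>K\<close>-th powers and for form
  values at positions up to \<open>W^5\<close>. \<open>E\<close> is known to the analysis only: the
  program finds its own bound, which is at most \<open>E\<close>, and Conjecture A enters through
  the size of \<open>E\<close> alone.\<close>

locale sieve_run = linear_forms k a b for k :: nat and a b :: "nat \<Rightarrow> int" +
 fixes K n E :: nat and W B :: int
 assumes K: "3 \<le> K"
  and W: "4 \<le> W" "int k < W" "int n < W" "\<And>i. i < k \<Longrightarrow> a i < W" "\<And>i. i < k \<Longrightarrow> \<bar>b i\<bar> < W"
  and B: "W ^ (K + 12) + int K \<le> B"
  and E: "2 \<le> E" "\<And>L. pseudosquare_candidate L \<Longrightarrow> L \<le> n \<Longrightarrow> least_nonresidue L \<le> E"
begin

lemma less_B: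
 assumes "v \<le> W ^ (K + 11)"
 shows "v + 100 < B" "v + int K + 100 < B"
proof -
 have "(4::int) ^ 4 \<le> W ^ 4" using W(1) by (intro power_mono) auto
 also have "\<dots> \<le> W ^ (K + 11)" using W(1) by (intro power_increasing) auto
 finally have 1: "256 \<le> W ^ (K + 11)" by simp
 have "4 * W ^ (K + 11) \<le> W * W ^ (K + 11)" using W(1) by (intro mult_right_mono) auto
 also have "\<dots> = W ^ Suc (K + 11)" by (rule power_Suc[symmetric])
 also have "Suc (K + 11) = K + 12" by simp
 finally have "4 * W ^ (K + 11) \<le> W ^ (K + 12)" .
 then show "v + int K + 100 < B" using 1 assms B by linarith
 then show "v + 100 < B" by linarith
qed

lemma pow_le_B:
 assumes "v \<le> W ^ j" "j \<le> K + 11"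
 shows "v + 100 < B" "v + int K + 100 < B"
proof -
 have "W ^ j \<le> W ^ (K + 11)" using assms(2) W(1) by (intro power_increasing) auto
 then show "v + 100 < B" "v + int K + 100 < B" using less_B[of v] assms(1) by auto
qed

lemma B_consts: "100 < B" "int K + 100 < B"
 using pow_le_B[of 0 0] by auto

abbreviation "bits \<equiv> floorlog 2 n"

text \<open>Perfect power tests, search for the witness base, Euler powers. The term
  \<open>E^2\<close> is the source of the exponent \<open>18/7\<close>.\<close>

definition "test_cost = K * ((K + 2) * (bits + 1)) + 3 * E\<^sup>2 + (E + 1) * (bits + 1)"

lemma m_bounds:
 assumes "m \<le> n"
 shows "int m + 100 < B" "int m * int m + 100 < B" "e \<le> K \<Longrightarrow> int m ^ e + 100 < B"
proof -
 have mW: "int m \<le> W" using assms W(3) by simp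
 then show "int m + 100 < B" using pow_le_B(1)[of "int m" 1] by simp
 have "int m * int m \<le> W * W" using mW W(1) by (intro mult_mono) auto
 then show "int m * int m + 100 < B" using pow_le_B(1)[of "int m * int m" 2] by (simp add: power2_eq_square)
 show "int m ^ e + 100 < B" if "e \<le> K"
 proof -
  have "int m ^ e \<le> W ^ e" using mW by (intro power_mono) auto
  then show ?thesis using pow_le_B(1)[of "int m ^ e" e] that by simp
 qed
qed

lemma wp_powers_prog:
 assumes "reg s 16 = int m" "2 \<le> m" "m \<le> n"
 shows "wp B (powers_prog K) (\<lambda>t s'. t \<le> K * ((K + 2) * (bits + 1)) \<and>
  frame {27, 28, 29, 30, 31, 32, 33, 34, 38, 42} s s' \<and>
  reg s' 42 = of_bool (\<forall>e\<in>{2..K}. \<not> (\<exists>a. m = a ^ e))) s"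
proof -
 let ?F = "{27, 28, 29, 30, 31, 32, 33, 34, 38, 42} :: nat set"
 let ?P = "\<lambda>e. \<not> (\<exists>a. m = a ^ e)"
 let ?I = "\<lambda>t s'. \<exists>e. reg s' 38 = int e \<and> 2 \<le> e \<and> e \<le> K + 1 \<and>
  reg s' 42 = of_bool (\<forall>e'\<in>{2..<e}. ?P e') \<and> t \<le> (e - 2) * ((K + 2) * (bits + 1)) \<and> frame ?F s s'"
 let ?f = "\<lambda>s'. K + 1 - nat (reg s' 38)"
 note mb = m_bounds[OF assms(3)]
 have fl: "floorlog 2 m \<le> bits" by (rule floorlog_mono) (rule assms)
 show ?thesis
  unfolding powers_prog_def using B_consts
 proof (simp add: wp_simps split del: split_of_bool, intro wp_Loop[where I = ?I and f = ?f], goal_cases)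
  case 1
  then show ?case using K by (intro exI[of _ 2]) (auto simp: frame_def)
 next
  case (2 t s')
  then show ?case by simp
 next
  case (3 t s')
  then obtain e where I: "reg s' 38 = int e" "2 \<le> e" "e \<le> K + 1"
   "reg s' 42 = of_bool (\<forall>e'\<in>{2..<e}. ?P e')" "t \<le> (e - 2) * ((K + 2) * (bits + 1))" "frame ?F s s'" by blast
  have eK: "e \<le> K" using 3 I by simp
  have set: "{2..<Suc e} = insert e {2..<e}" using I by auto
  have r: "reg s' 16 = int m" using I(6) assms(1) by (simp add: frame_def)
  let ?s1 = "s'\<lparr>reg := (reg s')(27 := int m, 28 := int e)\<rparr>"
  have "wp B ispow_prog (\<lambda>t s''. t \<le> (e + 1) * (floorlog 2 m + 1) \<and>
    frame {29, 30, 31, 32, 33, 34} ?s1 s'' \<and> reg s'' 34 = of_bool (\<exists>a. m = a ^ e)) ?s1"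
   using mb(3)[OF eK] B_consts eK I by (intro wp_ispow_prog) (auto simp: assms)
  then have "wp B ispow_prog (\<lambda>t1. wp B (Cond (Eq (V 34) (N 1)) (42 ::= N 0) Skip;; 38 ::= V 38 [+] N 1)
    (\<lambda>t2 s''. ?I (Suc (t + (t1 + t2))) s'' \<and> ?f s'' < ?f s')) ?s1"
  proof (elim wp_mono, goal_cases)
   case (1 t1 s2)
   have r2: "reg s2 38 = int e" "reg s2 42 = of_bool (\<forall>e'\<in>{2..<e}. ?P e')"
    using 1 I by (simp_all add: frame_def)
   have fr: "frame ?F s (s2\<lparr>reg := (reg s2)(42 := v, 38 := z)\<rparr>)" "frame ?F s (s2\<lparr>reg := (reg s2)(38 := z)\<rparr>)" for v z
    using 1 I(6) by (auto simp: frame_def)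
   have "t1 \<le> (e + 1) * (floorlog 2 m + 1)" using 1 by simp
   also have "\<dots> \<le> (K + 1) * (bits + 1)" using eK fl by (intro mult_le_mono) auto
   finally have "Suc t1 \<le> (K + 2) * (bits + 1)" by simp
   moreover have "Suc e - 2 = Suc (e - 2)" using I by simp
   ultimately have time: "Suc (t + t1) \<le> (Suc e - 2) * ((K + 2) * (bits + 1))"
    using I(5) by simp
   have "?I (Suc (t + t1)) (s2\<lparr>reg := (reg s2)(42 := 0, 38 := int e + 1)\<rparr>)" if "\<exists>a. m = a ^ e"
    using that time fr I eK by (intro exI[of _ "Suc e"]) (auto simp: set)
   moreover have "?I (Suc (t + t1)) (s2\<lparr>reg := (reg s2)(38 := int e + 1)\<rparr>)" if "?P e"
    using that time fr I eK r2 by (intro exI[of _ "Suc e"]) (auto simp: set)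
   moreover have "int e + 1 < B" using B_consts eK by linarith
   ultimately show ?case using 1 r2 I(1) eK B_consts
    by (cases "\<exists>a. m = a ^ e") (simp_all add: wp_simps split del: split_of_bool)
  qed
  then show ?case using r I B_consts mb eK by (simp add: wp_simps split del: split_of_bool)
 next
  case (4 t s')
  then obtain e where I: "reg s' 38 = int e" "2 \<le> e" "e \<le> K + 1"
   "reg s' 42 = of_bool (\<forall>e'\<in>{2..<e}. ?P e')" "t \<le> (e - 2) * ((K + 2) * (bits + 1))" "frame ?F s s'" by blast
  have "e = K + 1" using 4 I by simp
  moreover have "{2..<K + 1} = {2..K}" by auto
  moreover have "(K + 1 - 2) * ((K + 2) * (bits + 1)) \<le> K * ((K + 2) * (bits + 1))" by (rule mult_le_mono1) simp
  ultimately show ?case using I by (auto intro: order_trans split del: split_of_bool)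
 qed
qed

text \<open>Being nonsquare makes an \<open>m\<close> in class 1 modulo 8 a pseudosquare candidate,
  so the search ends at \<open>E\<close> or before.\<close>

lemma wp_witness_prog:
 assumes "reg s 16 = int m" "2 < m" "odd m" "m \<le> n" "\<not> is_square m"
 shows "wp B witness_prog (\<lambda>t s'. t \<le> 3 * E\<^sup>2 \<and>
  frame {20, 21, 22, 23, 24, 25, 26, 35, 36, 37, 39, 45} s s' \<and>
  reg s' 39 = int ((m - 1) div 2) \<and> reg s' 45 = int (witness_base m)) s"
proof -
 let ?F = "{20, 21, 22, 23, 24, 25, 26, 35, 36, 37, 39, 45} :: nat set"
 note mb = m_bounds[OF assms(4)]
 have half: "(int m - 1) div 2 = int ((m - 1) div 2)" using assms(2) by (simp add: of_nat_diff zdiv_int)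
 have mod8: "int m mod 8 = int (m mod 8)" by (simp add: zmod_int)
 have halfB: "int ((m - 1) div 2) < B" using mb(1) by linarith
 have mod8B: "int (m mod 8) < B" using B_consts by (simp add: less_trans[of "int (m mod 8)" 8])
 have B: "10 < B" "int m < B" using B_consts mb by linarith+
 let ?s1 = "s\<lparr>reg := (reg s)(39 := int ((m - 1) div 2))\<rparr>"
 consider "m mod 8 = 1" | "m mod 8 = 5" | "m mod 8 \<noteq> 1" "m mod 8 \<noteq> 5" by blast
 then show ?thesis
 proof cases
  case 1
  let ?s2 = "?s1\<lparr>reg := (reg ?s1)(35 := int m)\<rparr>"
  have "wp B nonresidue_prog (\<lambda>t s'. t \<le> 3 * least_nonresidue m ^ 2 \<and>
   frame {20, 21, 22, 23, 24, 25, 26, 36, 37} ?s2 s' \<and> reg s' 36 = int (least_nonresidue m)) ?s2"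
   using mb assms by (intro wp_nonresidue_prog) auto
  then have "wp B nonresidue_prog (\<lambda>t1. wp B (45 ::= V 36) (\<lambda>t2 s'. t1 + t2 \<le> 3 * E\<^sup>2 \<and>
   frame ?F s s' \<and> reg s' 39 = int ((m - 1) div 2) \<and> reg s' 45 = int (witness_base m))) ?s2"
  proof (elim wp_mono, goal_cases)
   case (1 t1 s')
   have fr: "frame ?F s (s'\<lparr>reg := (reg s')(45 := v)\<rparr>)" for v
    using 1 by (auto simp: frame_def)
   have le: "least_nonresidue m \<le> E" using E(2)[of m] assms \<open>m mod 8 = 1\<close> by (auto simp: pseudosquare_candidate_def)
   then have "3 * (least_nonresidue m)\<^sup>2 \<le> 3 * E\<^sup>2" by (simp add: power_mono)
   then have "t1 \<le> 3 * E\<^sup>2" using 1 by linarith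
   moreover have "least_nonresidue m \<le> m" using assms by (intro least_nonresidue) auto
   then have "int (least_nonresidue m) < B" using B by linarith
   moreover have "reg s' 39 = int ((m - 1) div 2)" using 1 by (simp add: frame_def)
   ultimately show ?case using 1 fr \<open>m mod 8 = 1\<close> by (auto simp: wp_simps witness_base_def)
  qed
  then show ?thesis unfolding witness_prog_def
   using assms(1) 1 B halfB by (simp add: wp_simps half mod8)
 next
  case 2
  then show ?thesis unfolding witness_prog_def
   using assms(1) B halfB by (simp add: wp_simps half mod8 frame_def witness_base_def)
 next
  case 3
  then have "int (m mod 8) \<noteq> 1" "int (m mod 8) \<noteq> 5" by linarith+
  then show ?thesis unfolding witness_prog_def
   using assms(1,2) B halfB mod8B 3
   by (simp add: wp_simps half mod8 frame_def witness_base_def of_nat_diff del: of_nat_mod)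
 qed
qed

lemma wp_base_prog:
 assumes "reg s 16 = int m" "reg s 39 = int ((m - 1) div 2)" "reg s q = int c" "c \<le> m" "2 < m" "m \<le> n"
  "q \<notin> {23, 24, 25}"
 shows "wp B (base_prog q) (\<lambda>t s'. t \<le> bits \<and> frame {23, 24, 25, 26} s s' \<and>
  reg s' 26 = int (c ^ ((m - 1) div 2) mod m)) s"
proof -
 note mb = m_bounds[OF assms(6)]
 let ?s1 = "s\<lparr>reg := (reg s)(23 := int c, 24 := int ((m - 1) div 2), 25 := int m)\<rparr>"
 have halfB: "int ((m - 1) div 2) < B" using mb(1) by linarith
 have "wp B powmod_prog (\<lambda>t s'. t \<le> floorlog 2 ((m - 1) div 2) \<and> frame {23, 24, 26} ?s1 s' \<and>
  reg s' 26 = int (c ^ ((m - 1) div 2) mod m)) ?s1"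
  using mb halfB assms by (intro wp_powmod_prog) auto
 then have "wp B powmod_prog (\<lambda>t s'. t \<le> bits \<and> frame {23, 24, 25, 26} s s' \<and>
  reg s' 26 = int (c ^ ((m - 1) div 2) mod m)) ?s1"
 proof (elim wp_mono, goal_cases)
  case (1 t s')
  have "floorlog 2 ((m - 1) div 2) \<le> bits" using assms(6) by (intro floorlog_mono) linarith
  then show ?case using 1 by (auto simp: frame_def)
 qed
 moreover have "int c < B" "int m < B" using mb(1) assms(4) by linarith+
 ultimately show ?thesis unfolding base_prog_def using assms halfB by (simp add: wp_simps)
qed

lemma wp_bases_prog:
 assumes "reg s 16 = int m" "reg s 39 = int ((m - 1) div 2)" "reg s 45 = int c" "c \<le> m" "2 < m" "m \<le> n"
  "reg s 5 = int bd" "bd \<le> E" "reg s 42 = 1" "int bd < W"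
 shows "wp B bases_prog (\<lambda>t s'. t \<le> (E + 1) * (bits + 1) \<and>
  frame {23, 24, 25, 26, 42, 43, 44} s s' \<and>
  reg s' 42 = of_bool (c ^ ((m - 1) div 2) mod m = m - 1 \<and>
   (\<forall>q. 2 \<le> q \<and> q \<le> bd \<and> q < m \<longrightarrow> q ^ ((m - 1) div 2) mod m \<in> {1, m - 1}))) s"
proof -
 let ?F = "{23, 24, 25, 26, 42, 43, 44} :: nat set"
 note mb = m_bounds[OF assms(6)]
 have B: "10 < B" "int m + 10 < B" "int bd + 10 < B"
  using B_consts mb pow_le_B(1)[of "int bd" 1] assms(10) by auto
 have m1: "int m - 1 = int (m - 1)" using assms by (simp add: of_nat_diff)
 \<comment> \<open>Exclusive end of the range of bases; the base \<open>m\<close> itself would give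
   0 even for a prime \<open>m\<close>.\<close>
 define lim where "lim = (if bd < m then bd + 1 else m)"
 have lim: "q < lim \<longleftrightarrow> q \<le> bd \<and> q < m" for q by (auto simp: lim_def)
 have limE: "lim - 2 \<le> E" using assms(8) by (auto simp: lim_def)
 define w where "w \<longleftrightarrow> c ^ ((m - 1) div 2) mod m = m - 1"
 define G where "G q \<longleftrightarrow> q ^ ((m - 1) div 2) mod m \<in> {1, m - 1}" for q
 let ?post = "\<lambda>t s'. t \<le> (E + 1) * (bits + 1) \<and> frame ?F s s' \<and>
  reg s' 42 = of_bool (w \<and> (\<forall>q. 2 \<le> q \<and> q \<le> bd \<and> q < m \<longrightarrow> G q))"
 let ?loop = "Loop (Lt (V 43) (V 44)) (base_prog 43;;
    Cond (Eq (V 26) (N 1)) Skip (Cond (Eq (V 26) (V 16 [-] N 1)) Skip (42 ::= N 0));;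
    43 ::= V 43 [+] N 1)"
 have loop: "wp B ?loop (\<lambda>t. ?post (t0 + t)) s0"
  if s0: "t0 \<le> bits" "reg s0 43 = 2" "reg s0 44 = int lim" "reg s0 42 = of_bool w" "frame ?F s s0" for s0 t0
 proof -
  let ?I = "\<lambda>t s'. \<exists>q. reg s' 43 = int q \<and> reg s' 44 = int lim \<and> 2 \<le> q \<and> q \<le> max 2 lim \<and>
   reg s' 42 = of_bool (w \<and> (\<forall>q'\<in>{2..<q}. G q')) \<and> t \<le> (q - 2) * (bits + 1) \<and> frame ?F s s'"
  let ?f = "\<lambda>s'. lim - nat (reg s' 43)"
  show ?thesis
  proof (rule wp_Loop[where I = ?I and f = ?f], goal_cases)
   case 1
   show ?case using s0 by (intro exI[of _ 2]) auto
  next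
   case (2 t s')
   then show ?case by simp
  next
   case (3 t s')
   then obtain q where I: "reg s' 43 = int q" "reg s' 44 = int lim" "2 \<le> q" "q \<le> max 2 lim"
    "reg s' 42 = of_bool (w \<and> (\<forall>q'\<in>{2..<q}. G q'))" "t \<le> (q - 2) * (bits + 1)" "frame ?F s s'" by blast
   have q: "q < lim" "q \<le> bd" "q < m" using 3 I lim by auto
   have set: "{2..<Suc q} = insert q {2..<q}" using I by auto
   have r: "reg s' 16 = int m" "reg s' 39 = int ((m - 1) div 2)" using I(7) assms by (simp_all add: frame_def)
   have "wp B (base_prog 43) (\<lambda>t s''. t \<le> bits \<and> frame {23, 24, 25, 26} s' s'' \<and>
     reg s'' 26 = int (q ^ ((m - 1) div 2) mod m)) s'"
    using r I q assms by (intro wp_base_prog) auto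
   then have "wp B (base_prog 43) (\<lambda>t1. wp B (Cond (Eq (V 26) (N 1)) Skip (Cond (Eq (V 26) (V 16 [-] N 1)) Skip (42 ::= N 0));;
    43 ::= V 43 [+] N 1) (\<lambda>t2 s''. ?I (Suc (t + (t1 + t2))) s'' \<and> ?f s'' < ?f s')) s'"
   proof (elim wp_mono, goal_cases)
    case (1 t1 s2)
    have r2: "reg s2 43 = int q" "reg s2 44 = int lim" "reg s2 42 = of_bool (w \<and> (\<forall>q'\<in>{2..<q}. G q'))"
     "reg s2 16 = int m" "reg s2 26 = int (q ^ ((m - 1) div 2) mod m)"
     using 1 I r by (simp_all add: frame_def)
    have fr: "frame ?F s (s2\<lparr>reg := (reg s2)(42 := v, 43 := z)\<rparr>)" "frame ?F s (s2\<lparr>reg := (reg s2)(43 := z)\<rparr>)" for v z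
     using 1 I(7) by (auto simp: frame_def)
    have q2: "Suc q - 2 = Suc (q - 2)" using I by simp
    have "Suc (t + t1) \<le> (bits + 1) + (q - 2) * (bits + 1)" using 1 I(6) by linarith
    then have time: "Suc (t + t1) \<le> (Suc q - 2) * (bits + 1)" unfolding q2 mult_Suc .
    have G_iff: "G q \<longleftrightarrow> reg s2 26 = 1 \<or> reg s2 26 = int m - 1"
     unfolding r2(5) m1 G_def by (metis insert_iff of_nat_1 of_nat_eq_iff singletonD)
    have qB: "int q + 1 < B" using q B by linarith
    have "?I (Suc (t + t1)) (s2\<lparr>reg := (reg s2)(42 := 0, 43 := int q + 1)\<rparr>)" if "\<not> G q"
     using that time fr I q r2 by (intro exI[of _ "Suc q"]) (auto simp: set)
    moreover have "?I (Suc (t + t1)) (s2\<lparr>reg := (reg s2)(43 := int q + 1)\<rparr>)" if "G q"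
     using that time fr I q r2 by (intro exI[of _ "Suc q"]) (auto simp: set)
    ultimately show ?case
    proof (cases "G q")
     case True
     then consider "reg s2 26 = 1" | "reg s2 26 \<noteq> 1" "reg s2 26 = int m - 1" using G_iff by blast
     then show ?thesis
      using True \<open>G q \<Longrightarrow> _\<close> r2(1,4) qB B I(1) q
      by cases (simp_all add: wp_simps split del: split_of_bool)
    next
     case False
     then show ?thesis
      using \<open>\<not> G q \<Longrightarrow> _\<close> G_iff r2(1,4) qB B I(1) q
      by (simp add: wp_simps split del: split_of_bool)
    qed
   qed
   then show ?case by (simp add: wp_Seq)
  next
   case (4 t s')
   then obtain q where I: "reg s' 43 = int q" "reg s' 44 = int lim" "2 \<le> q" "q \<le> max 2 lim"
    "reg s' 42 = of_bool (w \<and> (\<forall>q'\<in>{2..<q}. G q'))" "t \<le> (q - 2) * (bits + 1)" "frame ?F s s'" by blast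
   have q: "lim \<le> q" using 4 I by simp
   have "(\<forall>q'\<in>{2..<q}. G q') \<longleftrightarrow> (\<forall>q. 2 \<le> q \<and> q \<le> bd \<and> q < m \<longrightarrow> G q)"
   proof -
    have "q' < q \<longleftrightarrow> q' \<le> bd \<and> q' < m" if "2 \<le> q'" for q' using that q I(4) lim[of q'] by auto
    then show ?thesis by auto
   qed
   moreover have "t \<le> E * (bits + 1)"
   proof -
    have "q - 2 \<le> E" using I(4) limE by auto
    then have "(q - 2) * (bits + 1) \<le> E * (bits + 1)" by (rule mult_le_mono1)
    then show ?thesis using I(6) by linarith
   qed
   ultimately show ?case using I s0(1) by simp
  qed
 qed
 have "wp B (base_prog 45) (\<lambda>t s'. t \<le> bits \<and> frame {23, 24, 25, 26} s s' \<and>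
   reg s' 26 = int (c ^ ((m - 1) div 2) mod m)) s"
  using assms by (intro wp_base_prog) auto
 then have "wp B (base_prog 45) (\<lambda>t1. wp B (Cond (Eq (V 26) (V 16 [-] N 1)) Skip (42 ::= N 0);;
   Cond (Lt (V 5) (V 16)) (44 ::= V 5 [+] N 1) (44 ::= V 16);;
   43 ::= N 2;; ?loop) (\<lambda>t2. ?post (t1 + t2))) s"
 proof (elim wp_mono, goal_cases)
  case (1 t1 s1)
  have r: "reg s1 16 = int m" "reg s1 5 = int bd" "reg s1 42 = 1"
   using 1 assms by (simp_all add: frame_def)
  have w_iff: "w \<longleftrightarrow> reg s1 26 = int m - 1"
   using 1 unfolding w_def m1 by (metis of_nat_eq_iff)
  have fr: "frame ?F s (s1\<lparr>reg := (reg s1)(42 := u, 44 := v, 43 := z)\<rparr>)"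
   "frame ?F s (s1\<lparr>reg := (reg s1)(44 := v, 43 := z)\<rparr>)" for u v z
   using 1 by (auto simp: frame_def)
  have lims: "bd < m \<Longrightarrow> int bd + 1 = int lim" "\<not> bd < m \<Longrightarrow> int m = int lim" by (auto simp: lim_def)
  have A: "wp B ?loop (\<lambda>t. ?post (t1 + t)) (s1\<lparr>reg := (reg s1)(44 := int lim, 43 := 2)\<rparr>)" if w
   by (rule loop) (use 1 r fr that in auto)
  have A': "wp B ?loop (\<lambda>t. ?post (t1 + t)) (s1\<lparr>reg := (reg s1)(42 := 0, 44 := int lim, 43 := 2)\<rparr>)" if "\<not> w"
   by (rule loop) (use 1 r fr that in auto)
  show ?case
   using A A' r w_iff B lims
   by (cases w; cases "bd < m") (simp_all add: wp_simps split del: split_of_bool)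
 qed
 then show ?thesis unfolding bases_prog_def w_def G_def by (simp only: wp_Seq)
qed

lemma wp_test_prog:
 assumes "reg s 16 = int m" "2 < m" "odd m" "m \<le> n" "reg s 5 = int bd" "bd \<le> E" "int bd < W"
 shows "wp B (test_prog K) (\<lambda>t s'. t \<le> test_cost \<and>
  frame ({20..39} \<union> {42..45}) s s' \<and> reg s' 42 = of_bool (test_passes K bd m)) s"
proof -
 let ?F = "{20..39} \<union> {42..45} :: nat set"
 let ?P = "\<forall>e\<in>{2..K}. \<not> (\<exists>a. m = a ^ e)"
 let ?post = "\<lambda>t s'. t \<le> test_cost \<and> frame ?F s s' \<and> reg s' 42 = of_bool (test_passes K bd m)"
 have "wp B (powers_prog K) (\<lambda>t s'. t \<le> K * ((K + 2) * (bits + 1)) \<and>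
  frame {27, 28, 29, 30, 31, 32, 33, 34, 38, 42} s s' \<and> reg s' 42 = of_bool ?P) s"
  using assms by (intro wp_powers_prog) auto
 then have "wp B (powers_prog K) (\<lambda>t1. wp B (Cond (Eq (V 42) (N 1)) (witness_prog;; bases_prog) Skip)
  (\<lambda>t2. ?post (t1 + t2))) s"
 proof (elim wp_mono, goal_cases)
  case (1 t1 s1)
  show ?case
  proof (cases ?P)
   case False
   then have "\<not> test_passes K bd m" by (simp add: test_passes_def)
   moreover have "frame ?F s s1" using 1 by (auto simp: frame_def)
   moreover have "reg s1 42 = 0" using 1 False by simp
   moreover have "t1 \<le> test_cost" using 1 unfolding test_cost_def by linarith
   ultimately show ?thesis using B_consts by (simp add: wp_simps)
  next
   case True
   have nsq: "\<not> is_square m" using True K by (auto simp: is_nth_power_def)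
   have r: "reg s1 16 = int m" "reg s1 5 = int bd" "reg s1 42 = 1"
    using 1 True assms by (simp_all add: frame_def)
   have c: "witness_base m \<le> m"
    using least_nonresidue(4)[of m] assms by (auto simp: witness_base_def)
   have "wp B witness_prog (\<lambda>t s'. t \<le> 3 * E\<^sup>2 \<and>
    frame {20, 21, 22, 23, 24, 25, 26, 35, 36, 37, 39, 45} s1 s' \<and>
    reg s' 39 = int ((m - 1) div 2) \<and> reg s' 45 = int (witness_base m)) s1"
    using r nsq assms by (intro wp_witness_prog) auto
   then have "wp B witness_prog (\<lambda>t2. wp B bases_prog (\<lambda>t3. ?post (t1 + (t2 + t3)))) s1"
   proof (elim wp_mono, goal_cases)
    case (1 t2 s2)
    have r2: "reg s2 16 = int m" "reg s2 5 = int bd" "reg s2 42 = 1"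
     using 1 r by (simp_all add: frame_def)
    have fr2: "frame ?F s s2" using 1 \<open>t1 \<le> _ \<and> _\<close> by (auto simp: frame_def)
    have "wp B bases_prog (\<lambda>t s'. t \<le> (E + 1) * (bits + 1) \<and>
     frame {23, 24, 25, 26, 42, 43, 44} s2 s' \<and>
     reg s' 42 = of_bool (witness_base m ^ ((m - 1) div 2) mod m = m - 1 \<and>
     (\<forall>q. 2 \<le> q \<and> q \<le> bd \<and> q < m \<longrightarrow> q ^ ((m - 1) div 2) mod m \<in> {1, m - 1}))) s2"
     using r2 1 c assms by (intro wp_bases_prog) auto
    then show ?case
    proof (elim wp_mono, goal_cases)
     case (1 t3 s3)
     have "frame ?F s s3" using 1 fr2 by (auto simp: frame_def)
     moreover have "t1 + (t2 + t3) \<le> test_cost"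
      using 1 \<open>t1 \<le> _ \<and> _\<close> \<open>t2 \<le> _ \<and> _\<close> unfolding test_cost_def by linarith
     ultimately show ?case using 1 True by (simp add: test_passes_def)
    qed
   qed
   then show ?thesis using r B_consts by (simp add: wp_simps)
  qed
 qed
 then show ?thesis unfolding test_prog_def by (simp only: wp_Seq)
qed

end

section \<open>Setup programs\<close>

text \<open>A linear search is cheap enough: the root is about \<open>n^(1/K)\<close>, and a round
  has constant cost since \<open>K\<close> is fixed.\<close>

definition root_prog :: "nat \<Rightarrow> com" where
 "root_prog K =
   2 ::= N 2;;
   31 ::= V 2;;
   28 ::= N (int K);;
   pow_prog;;
   Loop (Lt (V 32) (V 50))
    (2 ::= V 2 [+] N 1;;
    31 ::= V 2;;
    pow_prog)"

text \<open>Register 17 runs through all integers, and the loop stops once the product times the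
  next integer exceeds \<open>y\<close>. This yields \<open>y < primorial m * m\<close>, from which
  the size of \<open>m\<close> is derived.\<close>

definition wheel_prog :: com where
 "wheel_prog =
   3 ::= N 1;;
   17 ::= N 2;;
   Loop (Lt (V 3 [*] V 17) (V 2 [+] N 1))
    (20 ::= V 17;;
    prime_prog;;
    Cond (Eq (V 22) (N 1)) (3 ::= V 3 [*] V 17) Skip;;
    17 ::= V 17 [+] N 1)"

text \<open>Walks through 9, 17, 25, ... up to \<open>n div y\<close> and keeps the largest least
  nonresidue in register 5. Squares are skipped, since their search ends only at a prime
  factor.\<close>

definition bound_prog :: com where
 "bound_prog =
   4 ::= V 2 [*] V 2;;
   46 ::= V 50 [div] V 2;;
   5 ::= N 2;;
   47 ::= N 9;;
   Loop (Lt (V 47) (V 46 [+] N 1))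
    (27 ::= V 47;;
    28 ::= N 2;;
    ispow_prog;;
    Cond (Eq (V 34) (N 1)) Skip
     (35 ::= V 47;;
      nonresidue_prog;;
      Cond (Lt (V 5) (V 36)) (5 ::= V 36) Skip);;
    47 ::= V 47 [+] N 8)"

text \<open>Division rounds down, so the negative of \<open>(b - 2) div a\<close> is the ceiling of
  \<open>(2 - b) / a\<close>, the least position with value at least 2.\<close>

definition form_range_prog :: com where
 "form_range_prog =
   Get 40 (N 2 [+] N 2 [*] V 14);;
   Get 41 (N 3 [+] N 2 [*] V 14);;
   48 ::= N 0 [-] (V 41 [-] N 2) [div] V 40;;
   49 ::= (V 50 [-] V 41) [div] V 40"

definition range_prog :: com where
 "range_prog =
   14 ::= N 0;;
   form_range_prog;;
   6 ::= V 48;;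
   7 ::= V 49;;
   14 ::= N 1;;
   Loop (Lt (V 14) (V 0))
    (form_range_prog;;
    Cond (Lt (V 6) (V 48)) (6 ::= V 48) Skip;;
    Cond (Lt (V 49) (V 7)) (7 ::= V 49) Skip;;
    14 ::= V 14 [+] N 1)"

lemma int_le_div_iff: "0 < a \<Longrightarrow> x \<le> p div a \<longleftrightarrow> x * a \<le> (p::int)"
proof
 assume a: "0 < a" "x \<le> p div a"
 then have "x * a \<le> p div a * a" by (intro mult_right_mono) auto
 also have "\<dots> \<le> p" using a div_mult_mod_eq[of p a] pos_mod_sign[of a p] by linarith
 finally show "x * a \<le> p" .
next
 assume a: "0 < a" "x * a \<le> p"
 then have "x * a div a \<le> p div a" by (intro zdiv_mono1)
 then show "x \<le> p div a" using a by simp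
qed

lemma abs_div_le: "0 < a \<Longrightarrow> \<bar>p div a\<bar> \<le> \<bar>p::int\<bar>"
proof -
 assume a: "0 < a"
 have "- \<bar>p\<bar> \<le> p div a"
 proof -
  have "- \<bar>p\<bar> * a \<le> - \<bar>p\<bar> * 1" using a by (intro mult_left_mono_neg) auto
  then show ?thesis using a by (simp add: int_le_div_iff)
 qed
 moreover have "p div a \<le> \<bar>p\<bar>"
 proof -
  have "p < (\<bar>p\<bar> + 1) * 1" by simp
  also have "\<dots> \<le> (\<bar>p\<bar> + 1) * a" using a by (intro mult_left_mono) auto
  finally have "\<not> (\<bar>p\<bar> + 1) * a \<le> p" by simp
  then have "\<not> \<bar>p\<bar> + 1 \<le> p div a" using int_le_div_iff[OF a] by blast
  then show ?thesis by linarith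
 qed
 ultimately show ?thesis by (simp add: abs_le_iff)
qed

context sieve_run
begin

definition input_ok :: "ram_state \<Rightarrow> bool" where
 "input_ok s \<longleftrightarrow> mem s 0 = int k \<and> mem s 1 = int n \<and>
   (\<forall>i<k. mem s (2 + 2 * i) = a i \<and> mem s (3 + 2 * i) = b i) \<and> 2 + 2 * k \<le> cells s"

definition y :: nat where "y = (LEAST y. 2 \<le> y \<and> n \<le> y ^ K)"

lemma y_bounds: "2 \<le> y" "n \<le> y ^ K" "int y < W" "2 \<le> v \<Longrightarrow> n \<le> v ^ K \<Longrightarrow> y \<le> v"
proof -
 have "max 2 n ^ 1 \<le> max 2 n ^ K" using K by (intro power_increasing) auto
 then have *: "2 \<le> max 2 n \<and> n \<le> max 2 n ^ K" by auto
 from LeastI[where P = "\<lambda>y. 2 \<le> y \<and> n \<le> y ^ K", OF *] show "2 \<le> y" "n \<le> y ^ K"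
  by (auto simp: y_def)
 have "y \<le> max 2 n" unfolding y_def by (rule Least_le) (rule *)
 then show "int y < W" using W by linarith
 show "2 \<le> v \<Longrightarrow> n \<le> v ^ K \<Longrightarrow> y \<le> v" unfolding y_def by (rule Least_le) simp
qed

lemma wp_root_prog:
 assumes "reg s 50 = int n"
 shows "wp B (root_prog K) (\<lambda>t s'. t \<le> K + y * (K + 1) \<and> frame {2, 28, 31, 32, 33} s s' \<and>
  reg s' 2 = int y) s"
proof -
 let ?F = "{2, 28, 31, 32, 33} :: nat set"
 have vB: "int v ^ K + 100 < B" "int v + 100 < B" if "v \<le> y" for v
 proof -
  have vW: "int v \<le> W" using that y_bounds(3) by linarith
  then have "int v ^ K \<le> W ^ K" by (intro power_mono) auto
  then show "int v ^ K + 100 < B" using pow_le_B[of "int v ^ K" K] by simp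
  show "int v + 100 < B" using pow_le_B[of "int v" 1] vW by simp
 qed
 let ?loop = "Loop (Lt (V 32) (V 50)) (2 ::= V 2 [+] N 1;; 31 ::= V 2;; pow_prog)"
 let ?post = "\<lambda>t s'. t \<le> K + y * (K + 1) \<and> frame ?F s s' \<and> reg s' 2 = int y"
 have loop: "wp B ?loop (\<lambda>t. ?post (t0 + t)) s0"
  if s0: "t0 \<le> K" "reg s0 2 = 2" "reg s0 28 = int K" "reg s0 32 = int (2 ^ K)" "frame ?F s s0" for t0 s0
 proof -
  let ?I = "\<lambda>t s'. \<exists>v. reg s' 2 = int v \<and> reg s' 28 = int K \<and> reg s' 32 = int (v ^ K) \<and> 2 \<le> v \<and> v \<le> y \<and>
   t \<le> (v - 2) * (K + 1) \<and> frame ?F s s'"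
  let ?f = "\<lambda>s'. y - nat (reg s' 2)"
  show ?thesis
  proof (rule wp_Loop[where I = ?I and f = ?f], goal_cases)
   case 1
   show ?case using s0 y_bounds by (intro exI[of _ 2]) auto
  next
   case (2 t s')
   then show ?case by simp
  next
   case (3 t s')
   then obtain v where I: "reg s' 2 = int v" "reg s' 28 = int K" "reg s' 32 = int (v ^ K)" "2 \<le> v" "v \<le> y"
    "t \<le> (v - 2) * (K + 1)" "frame ?F s s'" by blast
   have "reg s' 50 = int n" using I(7) assms by (simp add: frame_def)
   then have "int (v ^ K) < int n" using 3 I(3) by simp
   then have "v ^ K < n" by (simp only: of_nat_less_iff)
   then have "v \<noteq> y" using y_bounds(2) by auto
   then have v: "Suc v \<le> y" using I by simp
   let ?s1 = "s'\<lparr>reg := (reg s')(2 := int (Suc v), 31 := int (Suc v))\<rparr>"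
   have "wp B pow_prog (\<lambda>t s''. t \<le> K \<and> frame {32, 33} ?s1 s'' \<and> reg s'' 32 = int (Suc v ^ K)) ?s1"
    using vB[OF v] B_consts I by (intro wp_pow_prog) auto
   then have "wp B pow_prog (\<lambda>t1 s''. ?I (Suc (t + t1)) s'' \<and> ?f s'' < ?f s') ?s1"
   proof (elim wp_mono, goal_cases)
    case (1 t1 s2)
    have r: "reg s2 2 = int (Suc v)" "reg s2 28 = int K" using 1 I by (simp_all add: frame_def)
    have fr: "frame ?F s s2" using 1 I(7) by (auto simp: frame_def)
    have v2: "Suc v - 2 = Suc (v - 2)" using I by simp
    have "Suc (t + t1) \<le> (K + 1) + (v - 2) * (K + 1)" using 1 I(6) by linarith
    then have "Suc (t + t1) \<le> (Suc v - 2) * (K + 1)" unfolding v2 mult_Suc .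
    then have "?I (Suc (t + t1)) s2" using r fr 1 I v by (intro exI[of _ "Suc v"]) auto
    then show ?case using r I v by simp
   qed
   moreover have i1: "int v + 1 = int (Suc v)" by simp
   ultimately show ?case using I vB[OF v] B_consts by (simp add: wp_simps i1 del: of_nat_Suc)
  next
   case (4 t s')
   then obtain v where I: "reg s' 2 = int v" "reg s' 28 = int K" "reg s' 32 = int (v ^ K)" "2 \<le> v" "v \<le> y"
    "t \<le> (v - 2) * (K + 1)" "frame ?F s s'" by blast
   have "reg s' 50 = int n" using I(7) assms by (simp add: frame_def)
   then have "\<not> int (v ^ K) < int n" using 4 I(3) by simp
   then have "n \<le> v ^ K" by (metis of_nat_less_iff not_less)
   then have "v = y" using y_bounds(4)[of v] I by simp
   moreover have "(v - 2) * (K + 1) \<le> v * (K + 1)" by (rule mult_le_mono1) simp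
   ultimately show ?case using I s0(1) by auto
  qed
 qed
 let ?s1 = "s\<lparr>reg := (reg s)(2 := 2, 31 := 2, 28 := int K)\<rparr>"
 have "wp B pow_prog (\<lambda>t s''. t \<le> K \<and> frame {32, 33} ?s1 s'' \<and> reg s'' 32 = int (2 ^ K)) ?s1"
  using vB[OF y_bounds(1)] B_consts by (intro wp_pow_prog) auto
 then have "wp B pow_prog (\<lambda>t1. wp B ?loop (\<lambda>t2. ?post (t1 + t2))) ?s1"
 proof (elim wp_mono, goal_cases)
  case (1 t1 s2)
  show ?case by (rule loop) (use 1 in \<open>auto simp: frame_def\<close>)
 qed
 then show ?thesis unfolding root_prog_def using B_consts by (simp add: wp_simps)
qed

lemma wp_wheel_prog:
 assumes "reg s 2 = int y"
 shows "wp B wheel_prog (\<lambda>t s'. t \<le> (y + 1) * (y + 1) \<and> frame {3, 17, 20, 21, 22} s s' \<and>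
  (\<exists>m. 2 \<le> m \<and> reg s' 3 = int (primorial m) \<and> primorial m \<le> y \<and>
   y < primorial m * m)) s"
proof -
 let ?F = "{3, 17, 20, 21, 22} :: nat set"
 let ?M = "\<lambda>m. primorial m :: nat"
 let ?I = "\<lambda>t s'. \<exists>q. reg s' 17 = int q \<and> reg s' 3 = int (?M q) \<and> 2 \<le> q \<and> q \<le> y + 1 \<and> ?M q \<le> y \<and>
  t \<le> (q - 2) * (y + 1) \<and> frame ?F s s'"
 let ?f = "\<lambda>s'. y + 1 - nat (reg s' 17)"
 have yB: "int y + 100 < B" "int y * int y + 100 < B" "int y * (int y + 1) + 100 < B"
 proof -
  have yW: "int y + 1 \<le> W" using y_bounds(3) by simp
  then show "int y + 100 < B" using pow_le_B[of "int y" 1] by simp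
  have "int y * (int y + 1) \<le> W * W" using yW by (intro mult_mono) auto
  then show "int y * (int y + 1) + 100 < B" using pow_le_B[of "int y * (int y + 1)" 2] by (simp add: power2_eq_square)
  then show "int y * int y + 100 < B" by (simp add: algebra_simps)
 qed
 have Mpos: "1 \<le> ?M q" for q by (simp add: Suc_le_eq prod_pos prime_gt_0_nat)
 have M2: "?M 2 = 1"
 proof -
  have "{p::nat. prime p \<and> p < 2} = {}" by (auto dest: prime_ge_2_nat)
  then show ?thesis by (simp only: prod.empty)
 qed
 have MSuc: "?M (Suc q) = (if prime q then ?M q * q else ?M q)" for q
 proof -
  have "{p. prime p \<and> p < Suc q} = (if prime q then insert q {p. prime p \<and> p < q} else {p. prime p \<and> p < q})"
   by (auto simp: less_Suc_eq)
  then show ?thesis by (simp add: mult.commute)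
 qed
 show ?thesis
  unfolding wheel_prog_def using B_consts
 proof (simp only: wp_simps, simp add: assms, intro wp_Loop[where I = ?I and f = ?f], goal_cases)
  case 1
  show ?case using y_bounds(1) M2 by (intro exI[of _ 2]) (auto simp: frame_def)
 next
  case (2 t s')
  then obtain q where I: "reg s' 17 = int q" "reg s' 3 = int (?M q)" "2 \<le> q" "q \<le> y + 1" "?M q \<le> y" "frame ?F s s'" by blast
  have "reg s' 2 = int y" using I(6) assms by (simp add: frame_def)
  moreover have "int (?M q) * int q \<le> int y * (int y + 1)" using I by (intro mult_mono) (auto simp del: of_nat_prod)
  ultimately show ?case using I yB by (simp del: of_nat_prod)
 next
  case (3 t s')
  then obtain q where I: "reg s' 17 = int q" "reg s' 3 = int (?M q)" "2 \<le> q" "q \<le> y + 1" "?M q \<le> y"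
   "t \<le> (q - 2) * (y + 1)" "frame ?F s s'" by blast
  have ry: "reg s' 2 = int y" using I(7) assms by (simp add: frame_def)
  have "int (?M q) * int q < int y + 1" using 3 I ry by (simp del: of_nat_prod)
  then have "int (?M q * q) < int (y + 1)" by simp
  then have "?M q * q < y + 1" by (simp only: of_nat_less_iff)
  then have Mq: "?M q * q \<le> y" by simp
  have "1 * q \<le> ?M q * q" using Mpos[of q] by (rule mult_le_mono1)
  then have qy: "q \<le> y" using Mq by linarith
  let ?s1 = "s'\<lparr>reg := (reg s')(20 := int q)\<rparr>"
  have "wp B prime_prog (\<lambda>t s''. t \<le> q \<and> frame {21, 22} ?s1 s'' \<and> reg s'' 22 = of_bool (prime q)) ?s1"
   using I yB qy by (intro wp_prime_prog) auto
  define Q where "Q = (\<lambda>t1 s''. ?I (Suc (t + t1)) s'' \<and> ?f s'' < ?f s')"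
  from \<open>wp B prime_prog _ ?s1\<close>
  have "wp B prime_prog (\<lambda>t1. wp B (Cond (Eq (V 22) (N 1)) (3 ::= V 3 [*] V 17) Skip;; 17 ::= V 17 [+] N 1)
   (\<lambda>t2. Q (t1 + t2))) ?s1"
  proof (elim wp_mono, goal_cases)
   case (1 t1 s2)
   have r: "reg s2 17 = int q" "reg s2 3 = int (?M q)" using 1 I by (simp_all add: frame_def)
   have fr: "frame ?F s (s2\<lparr>reg := (reg s2)(3 := u, 17 := v)\<rparr>)" "frame ?F s (s2\<lparr>reg := (reg s2)(17 := v)\<rparr>)" for u v
    using 1 I(7) by (auto simp: frame_def)
   have q2: "Suc q - 2 = Suc (q - 2)" using I by simp
   have "Suc (t + t1) \<le> (y + 1) + (q - 2) * (y + 1)" using 1 I(6) qy by linarith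
   then have time: "Suc (t + t1) \<le> (Suc q - 2) * (y + 1)" unfolding q2 mult_Suc .
   have qB: "int (Suc q) < B" using qy yB by linarith
   have "int (?M q * q) \<le> int y" using Mq by (simp only: of_nat_le_iff)
   then have MB: "int (?M q * q) < B" using yB by linarith
   have i1: "int q + 1 = int (Suc q)" "int (?M q) * int q = int (?M q * q)" by simp_all
   have Q: "Q t1 s3" if "reg s3 17 = int (Suc q)" "reg s3 3 = int (?M (Suc q))" "?M (Suc q) \<le> y" "frame ?F s s3" for s3
    unfolding Q_def
   proof
    show "?I (Suc (t + t1)) s3" using that time I qy by (intro exI[of _ "Suc q"] conjI) (auto simp del: of_nat_prod)
    show "?f s3 < ?f s'" using that(1) I(1) qy by simp
   qed
   show ?case
   proof (cases "prime q")
    case True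
    have "Q t1 (s2\<lparr>reg := (reg s2)(3 := int (?M q * q), 17 := int (Suc q))\<rparr>)"
     using True MSuc[of q] fr Mq by (intro Q) auto
    then show ?thesis using True 1 r qB MB B_consts
     by (simp add: wp_simps i1 del: of_nat_prod of_nat_mult of_nat_Suc)
   next
    case False
    have "Q t1 (s2\<lparr>reg := (reg s2)(17 := int (Suc q))\<rparr>)"
     using False MSuc[of q] fr I r by (intro Q) auto
    then show ?thesis using False 1 r qB B_consts
     by (simp add: wp_simps i1 del: of_nat_prod of_nat_mult of_nat_Suc)
   qed
  qed
  moreover have "int q < B" using qy yB by linarith
  ultimately have "wp B (20 ::= V 17;; prime_prog;; Cond (Eq (V 22) (N 1)) (3 ::= V 3 [*] V 17) Skip;; 17 ::= V 17 [+] N 1) Q s'"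
   using I(1) by (simp add: wp_Seq wp_Assign)
  then show ?case unfolding Q_def .
 next
  case (4 t s')
  then obtain q where I: "reg s' 17 = int q" "reg s' 3 = int (?M q)" "2 \<le> q" "q \<le> y + 1" "?M q \<le> y"
   "t \<le> (q - 2) * (y + 1)" "frame ?F s s'" by blast
  have "reg s' 2 = int y" using I(7) assms by (simp add: frame_def)
  then have "\<not> int (?M q) * int q < int y + 1" using 4 I by (simp del: of_nat_prod)
  then have "\<not> int (?M q * q) < int (y + 1)" by simp
  then have "\<not> ?M q * q < y + 1" by (metis of_nat_less_iff)
  then have "y < ?M q * q" by simp
  moreover have "(q - 2) * (y + 1) \<le> (y + 1) * (y + 1)" using I by (intro mult_le_mono1) simp
  then have "t \<le> (y + 1) * (y + 1)" using I(6) by linarith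
  ultimately show ?case using I by (intro conjI exI[of _ q]) auto
 qed
qed

definition "bound_cost = (n div y) * (3 * (bits + 1) + 3 * E\<^sup>2 + 1)"

lemma wp_bound_prog:
 assumes "reg s 2 = int y" "reg s 50 = int n"
 shows "wp B bound_prog (\<lambda>t s'. t \<le> bound_cost \<and> frame ({4, 5, 46, 47} \<union> {20..37}) s s' \<and>
  reg s' 4 = int (y * y) \<and> (\<exists>bd. reg s' 5 = int bd \<and> 2 \<le> bd \<and> bd \<le> E \<and> int bd < W \<and>
   (\<forall>L. pseudosquare_candidate L \<and> L \<le> n div y \<longrightarrow> least_nonresidue L \<le> bd))) s"
proof -
 let ?F = "{4, 5, 46, 47} \<union> {20..37} :: nat set"
 define X where "X = n div y"
 have Xn: "X \<le> n" by (simp add: X_def)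
 define c where "c = 3 * (bits + 1) + 3 * E\<^sup>2 + 1"
 have XB: "int X + 100 < B" "int n + 100 < B" using m_bounds(1)[of X] m_bounds(1)[of n] Xn by auto
 have yyB: "int (y * y) < B"
 proof -
  have "int y * int y \<le> W * W" using y_bounds(3) by (intro mult_mono) auto
  then show ?thesis using pow_le_B[of "int y * int y" 2] by (simp add: power2_eq_square)
 qed
 let ?C = "\<lambda>L bd. 2 \<le> bd \<and> bd \<le> E \<and> int bd < W \<and>
   (\<forall>L'. pseudosquare_candidate L' \<and> L' < L \<longrightarrow> least_nonresidue L' \<le> bd)"
 \<comment> \<open>\<open>L\<close> is the next number to be examined; the \<open>max\<close> covers
   the case that \<open>X\<close> is below 9 and the loop never runs.\<close>
 let ?I = "\<lambda>t s'. \<exists>L bd. reg s' 47 = int L \<and> reg s' 46 = int X \<and> reg s' 4 = int (y * y) \<and> reg s' 5 = int bd \<and>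
  9 \<le> L \<and> L mod 8 = 1 \<and> L \<le> max 9 (X + 8) \<and> ?C L bd \<and> t \<le> (L - 9) * c \<and> frame ?F s s'"
 let ?f = "\<lambda>s'. X + 8 - nat (reg s' 47)"
 have "wp B bound_prog (\<lambda>t s'. t \<le> X * c \<and> frame ?F s s' \<and>
  reg s' 4 = int (y * y) \<and> (\<exists>bd. reg s' 5 = int bd \<and> 2 \<le> bd \<and> bd \<le> E \<and> int bd < W \<and>
   (\<forall>L. pseudosquare_candidate L \<and> L \<le> X \<longrightarrow> least_nonresidue L \<le> bd))) s"
 proof -
  have y0: "y \<noteq> 0" using y_bounds by auto
  have conv: "int y * int y = int (y * y)" "int n div int y = int X" by (simp_all add: X_def zdiv_int)
  have "int X < B" using XB by linarith
  then show ?thesis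
   unfolding bound_prog_def using B_consts yyB y0
  proof (simp only: wp_simps, simp add: assms conv del: of_nat_mult, intro wp_Loop[where I = ?I and f = ?f], goal_cases)
   case 1
   have "\<not> (pseudosquare_candidate L' \<and> L' < 9)" for L'
   proof
    assume "pseudosquare_candidate L' \<and> L' < 9"
    then have "1 < L'" "L' mod 8 = 1" "L' < 9" by (auto simp: pseudosquare_candidate_def)
    then show False by presburger
   qed
   then show ?case using E(1) W(1)
    by (intro exI[of _ 9] exI[of _ 2]) (auto simp: frame_def)
  next
   case (2 t s')
   then show ?case using XB by auto
  next
   case (3 t s')
   then obtain L bd where I: "reg s' 47 = int L" "reg s' 46 = int X" "reg s' 4 = int (y * y)" "reg s' 5 = int bd"
    "9 \<le> L" "L mod 8 = 1" "L \<le> max 9 (X + 8)" "?C L bd" "t \<le> (L - 9) * c" "frame ?F s s'" by blast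
   have LX: "L \<le> X" using 3 I by simp
   then have Ln: "L \<le> n" using Xn by simp
   note mb = m_bounds[OF Ln]
   have bB: "int bd < B" using I(8) pow_le_B[of "int bd" 1] by auto
   have oddL: "odd L" using I(6) by presburger
   have fl: "floorlog 2 L \<le> bits" by (rule floorlog_mono) (rule Ln)
   let ?next = "47 ::= V 47 [+] N 8"
   let ?Q = "\<lambda>t1 s''. ?I (Suc (t + t1)) s'' \<and> ?f s'' < ?f s'"
   have nxt: "wp B ?next (\<lambda>t2. ?Q (t1 + t2)) s2"
    if s2: "reg s2 47 = int L" "reg s2 46 = int X" "reg s2 4 = int (y * y)" "reg s2 5 = int bd'" "frame ?F s s2"
     "bd \<le> bd'" "bd' \<le> E" "int bd' < W" "pseudosquare_candidate L \<longrightarrow> least_nonresidue L \<le> bd'" "t1 + 1 \<le> c" for s2 t1 bd'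
   proof -
    \<comment> \<open>Candidates are 1 modulo 8, so \<open>L\<close> is the only possible one in the
      window that a step of 8 adds.\<close>
    have "least_nonresidue L' \<le> bd'" if L': "pseudosquare_candidate L'" "L' < L + 8" for L'
    proof (cases "L' < L")
     case True
     then show ?thesis using I(8) L' s2(6) by (meson order_trans)
    next
     case False
     have "L' mod 8 = L mod 8" using L'(1) I(6) by (simp add: pseudosquare_candidate_def)
     then have "8 dvd L' - L" using False by (simp add: mod_eq_dvd_iff_nat)
     moreover have "L' - L < 8" using L'(2) False by simp
     ultimately have "L' = L" using False dvd_imp_le[of 8 "L' - L"] by (cases "L' = L") auto
     then show ?thesis using s2(9) L' by simp
    qed
    moreover have "Suc (t + t1) \<le> (L + 8 - 9) * c"
    proof -
     have "Suc (t + t1) \<le> (L - 9) * c + c" using I(9) s2(10) by linarith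
     also have "\<dots> = (L - 9 + 1) * c" by simp
     also have "\<dots> \<le> (L + 8 - 9) * c" using I(5) by (intro mult_le_mono1) simp
     finally show ?thesis .
    qed
    moreover have "frame ?F s (s2\<lparr>reg := (reg s2)(47 := v)\<rparr>)" for v using s2(5) by (auto simp: frame_def)
    moreover have "(L + 8) mod 8 = 1" using I(6) by simp
    ultimately have "?I (Suc (t + t1)) (s2\<lparr>reg := (reg s2)(47 := int (L + 8))\<rparr>)"
     using s2 I(5,8) LX by (intro exI[of _ "L + 8"] exI[of _ bd']) auto
    then show ?thesis using s2(1) mb I(1) LX by (simp add: wp_simps)
   qed
   let ?s1 = "s'\<lparr>reg := (reg s')(27 := int L, 28 := 2)\<rparr>"
   have "wp B ispow_prog (\<lambda>t s''. t \<le> (2 + 1) * (floorlog 2 L + 1) \<and>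
     frame {29, 30, 31, 32, 33, 34} ?s1 s'' \<and> reg s'' 34 = of_bool (\<exists>a. L = a ^ 2)) ?s1"
    using mb(3)[of 2] K B_consts I(5) by (intro wp_ispow_prog) auto
   then have "wp B ispow_prog (\<lambda>t1. wp B (Cond (Eq (V 34) (N 1)) Skip
     (35 ::= V 47;; nonresidue_prog;; Cond (Lt (V 5) (V 36)) (5 ::= V 36) Skip);; ?next)
     (\<lambda>t2. ?Q (t1 + t2))) ?s1"
   proof (elim wp_mono, goal_cases)
    case (1 t1 s2)
    have "(2 + 1) * (floorlog 2 L + 1) \<le> 3 * (bits + 1)" using fl by simp
    then have t1: "t1 \<le> 3 * (bits + 1)" using 1 by linarith
    have r: "reg s2 47 = int L" "reg s2 46 = int X" "reg s2 4 = int (y * y)" "reg s2 5 = int bd"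
     using 1 I by (simp_all add: frame_def)
    have fr: "frame ?F s s2" using 1 I(10) by (auto simp: frame_def)
    show ?case
    proof (cases "\<exists>a. L = a ^ 2")
     case True
     then have "\<not> pseudosquare_candidate L" by (auto simp: pseudosquare_candidate_def is_nth_power_def)
     then have "wp B ?next (\<lambda>t2. ?Q (t1 + t2)) s2"
      using r fr I(8) t1 by (intro nxt[of _ bd]) (auto simp: c_def)
     moreover have "reg s2 34 = 1" using 1 True by simp
     ultimately show ?thesis using B_consts by (simp add: wp_simps)
    next
     case False
     then have cand: "pseudosquare_candidate L" using I(5,6) by (auto simp: pseudosquare_candidate_def is_nth_power_def)
     then have lE: "least_nonresidue L \<le> E" using E(2) Ln by simp
     have lL: "least_nonresidue L \<le> L" using I(5) oddL by (intro least_nonresidue) auto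
     have lW: "int (least_nonresidue L) < W" using lL Ln W(3) by linarith
     have lB: "int (least_nonresidue L) < B" using lL mb by linarith
     let ?s3 = "s2\<lparr>reg := (reg s2)(35 := int L)\<rparr>"
     have "wp B nonresidue_prog (\<lambda>t s'. t \<le> 3 * least_nonresidue L ^ 2 \<and>
      frame {20, 21, 22, 23, 24, 25, 26, 36, 37} ?s3 s' \<and> reg s' 36 = int (least_nonresidue L)) ?s3"
      using mb I(5) oddL by (intro wp_nonresidue_prog) auto
     then have "wp B nonresidue_prog (\<lambda>t2. wp B (Cond (Lt (V 5) (V 36)) (5 ::= V 36) Skip)
      (\<lambda>t3. wp B ?next (\<lambda>t4. ?Q (t1 + (t2 + t3 + t4))))) ?s3"
     proof (elim wp_mono, goal_cases)
      case (1 t2 s4)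
      have r4: "reg s4 47 = int L" "reg s4 46 = int X" "reg s4 4 = int (y * y)" "reg s4 5 = int bd"
       using 1 r by (simp_all add: frame_def)
      have fr4: "frame ?F s s4" using 1 fr by (auto simp: frame_def)
      have "3 * (least_nonresidue L)\<^sup>2 \<le> 3 * E\<^sup>2" using lE by (simp add: power_mono)
      then have time: "t1 + t2 + 1 \<le> c" using 1 t1 unfolding c_def by linarith
      have A: "wp B ?next (\<lambda>t4. ?Q (t1 + t2 + t4)) s4" if "least_nonresidue L \<le> bd"
       using r4 fr4 I(8) time that by (intro nxt[of _ bd]) auto
      have "frame ?F s (s4\<lparr>reg := (reg s4)(5 := v)\<rparr>)" for v using fr4 by (auto simp: frame_def)
      then have A': "wp B ?next (\<lambda>t4. ?Q (t1 + t2 + t4)) (s4\<lparr>reg := (reg s4)(5 := int (least_nonresidue L))\<rparr>)"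
       if "bd < least_nonresidue L"
       using r4 I(8) time that lE lW by (intro nxt[of _ "least_nonresidue L"]) auto
      show ?case using A A' r4 1 lB
       by (cases "least_nonresidue L \<le> bd") (simp_all add: wp_Cond wp_Assign wp_Skip add.assoc)
     qed
     moreover have "reg s2 34 = 0" using 1 False by simp
     ultimately show ?thesis using B_consts r(1) mb by (simp add: wp_Seq wp_Cond wp_Assign wp_Skip add.assoc)
    qed
   qed
   moreover have "int L < B" using mb by linarith
   ultimately show ?case using I B_consts by (simp add: wp_Seq wp_Assign add.assoc)
  next
   case (4 t s')
   then obtain L bd where I: "reg s' 47 = int L" "reg s' 46 = int X" "reg s' 4 = int (y * y)" "reg s' 5 = int bd"
    "9 \<le> L" "L mod 8 = 1" "L \<le> max 9 (X + 8)" "?C L bd" "t \<le> (L - 9) * c" "frame ?F s s'" by blast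
   have LX: "X < L" using 4 I by simp
   have "(L - 9) * c \<le> X * c" using I(7) by (intro mult_le_mono1) auto
   then have "t \<le> X * c" using I(9) by linarith
   then show ?case using I LX by auto
  qed
 qed
 then show ?thesis by (simp only: X_def c_def bound_cost_def)
qed

text \<open>The equivalences pin down both ends, so \<open>lo\<close> for all forms does not change
  with \<open>n\<close>; this later bounds the values near \<open>lo\<close>. The threshold 2 is the
  least prime.\<close>

definition range_ok :: "nat \<Rightarrow> int \<Rightarrow> int \<Rightarrow> bool" where
 "range_ok m lo hi \<longleftrightarrow> (\<forall>x. (\<forall>i<m. 2 \<le> form i x) \<longleftrightarrow> lo \<le> x) \<and> (\<forall>x. (\<forall>i<m. form i x \<le> int n) \<longleftrightarrow> x \<le> hi) \<and>
   \<bar>lo\<bar> \<le> 2 * W \<and> \<bar>hi\<bar> \<le> 2 * W"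

lemma wp_form_range_prog:
 assumes "input_ok s" "reg s 14 = int i" "i < k" "reg s 50 = int n"
 shows "wp B form_range_prog (\<lambda>t s'. t = 0 \<and> frame {40, 41, 48, 49} s s' \<and>
  (\<forall>x. 2 \<le> form i x \<longleftrightarrow> reg s' 48 \<le> x) \<and> (\<forall>x. form i x \<le> int n \<longleftrightarrow> x \<le> reg s' 49) \<and>
  \<bar>reg s' 48\<bar> \<le> 2 * W \<and> \<bar>reg s' 49\<bar> \<le> 2 * W) s"
proof -
 have ai: "0 < a i" "a i < W" "\<bar>b i\<bar> < W" using a_pos W assms(3) by auto
 have WB: "4 * W + 100 < B" using pow_le_B[of "4 * W" 2] W(1) by (simp add: power2_eq_square)
 have iB: "int i < W" using assms(3) W(2) by linarith
 have m: "mem s (nat (2 + 2 * int i)) = a i" "mem s (nat (3 + 2 * int i)) = b i"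
 proof -
  have "nat (2 + 2 * int i) = 2 + 2 * i" "nat (3 + 2 * int i) = 3 + 2 * i" by auto
  then show "mem s (nat (2 + 2 * int i)) = a i" "mem s (nat (3 + 2 * int i)) = b i"
   using assms(1,3) by (simp_all add: input_ok_def)
 qed
 have cells: "max (cells s) (Suc (nat (2 + 2 * int i))) = cells s" "max (cells s) (Suc (nat (3 + 2 * int i))) = cells s"
  using assms(1,3) by (auto simp: input_ok_def)
 have nb: "a i < B" "\<bar>b i\<bar> < B" "\<bar>b i - 2\<bar> < B" "\<bar>int n - b i\<bar> < B" using ai WB W(1,3) by linarith+
 define l where "l = (b i - 2) div a i"
 define h where "h = (int n - b i) div a i"
 have l: "\<bar>l\<bar> \<le> 2 * W" using abs_div_le[OF ai(1), of "b i - 2"] ai W by (simp add: l_def)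
 have h: "\<bar>h\<bar> \<le> 2 * W" using abs_div_le[OF ai(1), of "int n - b i"] ai W by (simp add: h_def)
 have "2 \<le> form i x \<longleftrightarrow> - l \<le> x" for x
  using int_le_div_iff[OF ai(1), of "- x" "b i - 2"] unfolding l_def[symmetric] form_def
  by (auto simp: mult.commute)
 moreover have "form i x \<le> int n \<longleftrightarrow> x \<le> h" for x
  using int_le_div_iff[OF ai(1), of x "int n - b i"] unfolding h_def[symmetric] form_def
  by (auto simp: mult.commute)
 ultimately show ?thesis
  unfolding form_range_prog_def using assms ai WB l h iB W nb
  by (simp add: wp_simps m cells l_def[symmetric] h_def[symmetric] frame_def)
qed

lemma wp_range_prog:
 assumes "input_ok s" "reg s 0 = int k" "reg s 50 = int n"
 shows "wp B range_prog (\<lambda>t s'. t \<le> k \<and> frame {6, 7, 14, 40, 41, 48, 49} s s' \<and> range_ok k (reg s' 6) (reg s' 7)) s"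
proof -
 let ?F = "{6, 7, 14, 40, 41, 48, 49} :: nat set"
 have WB: "4 * W + 100 < B" using pow_le_B[of "4 * W" 2] W(1) by (simp add: power2_eq_square)
 let ?I = "\<lambda>t s'. \<exists>i. reg s' 14 = int i \<and> 1 \<le> i \<and> i \<le> k \<and> t < i \<and> range_ok i (reg s' 6) (reg s' 7) \<and> frame ?F s s'"
 let ?f = "\<lambda>s'. k - nat (reg s' 14)"
 let ?body = "form_range_prog;;
    Cond (Lt (V 6) (V 48)) (6 ::= V 48) Skip;;
    Cond (Lt (V 49) (V 7)) (7 ::= V 49) Skip;;
    14 ::= V 14 [+] N 1"
 have loop: "wp B (Loop (Lt (V 14) (V 0)) ?body) (\<lambda>t s'. t \<le> k \<and> frame ?F s s' \<and> range_ok k (reg s' 6) (reg s' 7)) s0"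
  if s0: "?I 0 s0" for s0
 proof (rule wp_Loop[where I = ?I and f = ?f], goal_cases)
  case 1
  show ?case by (rule s0)
 next
  case (2 t s')
  then show ?case by simp
 next
  case (3 t s')
  then obtain i where I: "reg s' 14 = int i" "1 \<le> i" "i \<le> k" "t < i" "range_ok i (reg s' 6) (reg s' 7)" "frame ?F s s'" by blast
  have r: "reg s' 0 = int k" "reg s' 50 = int n" "input_ok s'"
   using I(6) assms by (simp_all add: frame_def input_ok_def)
  have ik: "i < k" using 3 I r by simp
  have "wp B form_range_prog (\<lambda>t s''. t = 0 \<and> frame {40, 41, 48, 49} s' s'' \<and>
   (\<forall>x. 2 \<le> form i x \<longleftrightarrow> reg s'' 48 \<le> x) \<and> (\<forall>x. form i x \<le> int n \<longleftrightarrow> x \<le> reg s'' 49) \<and>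
   \<bar>reg s'' 48\<bar> \<le> 2 * W \<and> \<bar>reg s'' 49\<bar> \<le> 2 * W) s'"
   using r I ik by (intro wp_form_range_prog) auto
  then have "wp B form_range_prog (\<lambda>t1. wp B (Cond (Lt (V 6) (V 48)) (6 ::= V 48) Skip;;
    Cond (Lt (V 49) (V 7)) (7 ::= V 49) Skip;; 14 ::= V 14 [+] N 1)
   (\<lambda>t2 s''. ?I (Suc (t + (t1 + t2))) s'' \<and> ?f s'' < ?f s')) s'"
  proof (elim wp_mono, goal_cases)
   case (1 t1 s2)
   have r2: "reg s2 14 = int i" "reg s2 6 = reg s' 6" "reg s2 7 = reg s' 7" using 1 I by (simp_all add: frame_def)
   have ro: "range_ok (Suc i) (max (reg s' 6) (reg s2 48)) (min (reg s' 7) (reg s2 49))"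
    using 1 I(5) unfolding range_ok_def by (auto simp: less_Suc_eq all_conj_distrib)
   have fr: "frame ?F s s2" using 1 I(6) by (auto simp: frame_def)
   have iB: "int i + 1 < B" using ik W WB by linarith
   have "?I (Suc (t + t1)) (s2\<lparr>reg := \<rho>(14 := int i + 1)\<rparr>)"
    if "\<rho> 6 = max (reg s' 6) (reg s2 48)" "\<rho> 7 = min (reg s' 7) (reg s2 49)" "frame ?F s (s2\<lparr>reg := \<rho>\<rparr>)" for \<rho>
   proof (intro exI[of _ "Suc i"] conjI)
    show "frame ?F s (s2\<lparr>reg := \<rho>(14 := int i + 1)\<rparr>)" using that(3) by (auto simp: frame_def)
   qed (use that ro I ik 1 in auto)
   note J = this
   have 6: "reg s2 48 < B" "- B < reg s2 48" "reg s2 49 < B" "- B < reg s2 49" using 1 WB W(1) by linarith+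
   show ?case
   proof (cases "reg s2 6 < reg s2 48"; cases "reg s2 49 < reg s2 7")
    assume c: "reg s2 6 < reg s2 48" "reg s2 49 < reg s2 7"
    have "?I (Suc (t + t1)) (s2\<lparr>reg := (reg s2)(6 := reg s2 48, 7 := reg s2 49, 14 := int i + 1)\<rparr>)"
     using c r2 fr by (intro J) (auto simp: frame_def)
    then show ?case using c r2 iB 6 I(1) ik 1 by (simp add: wp_simps abs_less_iff)
   next
    assume c: "reg s2 6 < reg s2 48" "\<not> reg s2 49 < reg s2 7"
    have "?I (Suc (t + t1)) (s2\<lparr>reg := (reg s2)(6 := reg s2 48, 14 := int i + 1)\<rparr>)"
     using c r2 fr by (intro J) (auto simp: frame_def)
    then show ?case using c r2 iB 6 I(1) ik 1 by (simp add: wp_simps abs_less_iff)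
   next
    assume c: "\<not> reg s2 6 < reg s2 48" "reg s2 49 < reg s2 7"
    have "?I (Suc (t + t1)) (s2\<lparr>reg := (reg s2)(7 := reg s2 49, 14 := int i + 1)\<rparr>)"
     using c r2 fr by (intro J) (auto simp: frame_def)
    then show ?case using c r2 iB 6 I(1) ik 1 by (simp add: wp_simps abs_less_iff)
   next
    assume c: "\<not> reg s2 6 < reg s2 48" "\<not> reg s2 49 < reg s2 7"
    have "?I (Suc (t + t1)) (s2\<lparr>reg := (reg s2)(14 := int i + 1)\<rparr>)"
     using c r2 fr by (intro J) (auto simp: frame_def)
    then show ?case using c r2 iB 6 I(1) ik 1 by (simp add: wp_simps abs_less_iff)
   qed
  qed
  then show ?case by (simp add: wp_Seq)
 next
  case (4 t s')
  then obtain i where I: "reg s' 14 = int i" "1 \<le> i" "i \<le> k" "t < i" "range_ok i (reg s' 6) (reg s' 7)" "frame ?F s s'" by blast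
  have "reg s' 0 = int k" using I(6) assms by (simp add: frame_def)
  then have "i = k" using 4 I by simp
  then show ?case using I by auto
 qed
 let ?s1 = "s\<lparr>reg := (reg s)(14 := 0)\<rparr>"
 have "wp B form_range_prog (\<lambda>t s''. t = 0 \<and> frame {40, 41, 48, 49} ?s1 s'' \<and>
   (\<forall>x. 2 \<le> form 0 x \<longleftrightarrow> reg s'' 48 \<le> x) \<and> (\<forall>x. form 0 x \<le> int n \<longleftrightarrow> x \<le> reg s'' 49) \<and>
   \<bar>reg s'' 48\<bar> \<le> 2 * W \<and> \<bar>reg s'' 49\<bar> \<le> 2 * W) ?s1"
  using assms k_pos by (intro wp_form_range_prog) (auto simp: input_ok_def)
 then have "wp B form_range_prog (\<lambda>t1. wp B (6 ::= V 48;; 7 ::= V 49;; 14 ::= N 1;; Loop (Lt (V 14) (V 0)) ?body)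
   (\<lambda>t2 s'. t1 + t2 \<le> k \<and> frame ?F s s' \<and> range_ok k (reg s' 6) (reg s' 7))) ?s1"
 proof (elim wp_mono, goal_cases)
  case (1 t1 s2)
  let ?s3 = "s2\<lparr>reg := (reg s2)(6 := reg s2 48, 7 := reg s2 49, 14 := 1)\<rparr>"
  have "?I 0 ?s3"
  proof (intro exI[of _ 1] conjI)
   show "frame ?F s ?s3" using 1 by (auto simp: frame_def)
   show "range_ok 1 (reg ?s3 6) (reg ?s3 7)" using 1 by (simp add: range_ok_def)
  qed (use k_pos in auto)
  note loop[OF this]
  moreover have "reg s2 48 < B" "- B < reg s2 48" "reg s2 49 < B" "- B < reg s2 49" using 1 WB W(1) by linarith+
  ultimately show ?case using 1 B_consts by (simp add: wp_Seq wp_Assign abs_less_iff)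
 qed
 then show ?thesis unfolding range_prog_def using B_consts by (simp add: wp_Seq wp_Assign)
qed

end

section \<open>The segmented wheel sieve\<close>

definition load_form :: com where
 "load_form =
   Get 40 (N 2 [+] N 2 [*] V 14);;
   Get 41 (N 3 [+] N 2 [*] V 14);;
   16 ::= V 40 [*] V 13 [+] V 41"

definition naive_prog :: com where
 "naive_prog =
   15 ::= N 1;;
   14 ::= N 0;;
   Loop (Lt (V 14) (V 0))
    (load_form;;
    20 ::= V 16;;
    prime_prog;;
    Cond (Eq (V 22) (N 1)) Skip (15 ::= N 0);;
    14 ::= V 14 [+] N 1)"

text \<open>The first \<open>y\<close> positions are tested naively. Beyond them every form exceeds
  \<open>y\<close>, so a sieving prime never strikes out a position where it is itself the
  value.\<close>

definition small_prog :: com where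
 "small_prog =
   13 ::= V 6;;
   Loop (Lt (V 13) (V 8))
    (Cond (Lt (V 7) (V 13)) Skip
     (naive_prog;; Cond (Eq (V 15) (N 1)) (Print (V 13)) Skip);;
    13 ::= V 13 [+] N 1)"

definition tests_prog :: "nat \<Rightarrow> com" where
 "tests_prog K =
   15 ::= N 1;;
   14 ::= N 0;;
   Loop (Lt (V 14) (V 0))
    (load_form;;
    test_prog K;;
    Cond (Eq (V 42) (N 1)) Skip (15 ::= N 0);;
    14 ::= V 14 [+] N 1)"

text \<open>Instead of factoring \<open>M\<close>, all numbers from 2 to \<open>y\<close> that
  divide it are tried; a common divisor with the form value clears register 11.\<close>

definition coprime_prog :: com where
 "coprime_prog =
   17 ::= N 2;;
   Loop (Lt (V 17) (V 2 [+] N 1))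
    (Cond (Eq (V 3 [mod] V 17) (N 0))
     (Cond (Eq (V 16 [mod] V 17) (N 0)) (11 ::= N 0) Skip) Skip;;
    17 ::= V 17 [+] N 1)"

definition good_prog :: com where
 "good_prog =
   11 ::= N 1;;
   13 ::= V 8 [+] V 9;;
   14 ::= N 0;;
   Loop (Lt (V 14) (V 0)) (load_form;; coprime_prog;; 14 ::= V 14 [+] N 1)"

definition clear_prog :: com where
 "clear_prog =
   12 ::= N 0;;
   Loop (Lt (V 12) (V 4)) (Put (V 19 [+] V 12) (N 0);; 12 ::= V 12 [+] N 1)"

definition mark_prog :: com where
 "mark_prog =
   12 ::= V 18;;
   Loop (Lt (V 12) (V 4)) (Put (V 19 [+] V 12) (N 1);; 12 ::= V 12 [+] V 17)"

text \<open>The offset at which the prime in register 17 divides the form is found by trying all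
  residues in register 18 rather than by a modular inverse; this costs one round per residue. Each
  hit starts a marking run.\<close>

definition offsets_prog :: com where
 "offsets_prog =
   18 ::= N 0;;
   Loop (Lt (V 18) (V 17))
    (13 ::= V 8 [+] V 9 [+] V 3 [*] (V 10 [+] V 18);;
    load_form;;
    Cond (Eq (V 16 [mod] V 17) (N 0)) mark_prog Skip;;
    18 ::= V 18 [+] N 1)"

definition forms_prog :: com where
 "forms_prog =
   14 ::= N 0;;
   Loop (Lt (V 14) (V 0)) (offsets_prog;; 14 ::= V 14 [+] N 1)"

definition sieve_prog :: com where
 "sieve_prog =
   17 ::= N 2;;
   Loop (Lt (V 17) (V 2 [+] N 1))
    (20 ::= V 17;;
    prime_prog;;
    Cond (Eq (V 22) (N 1)) forms_prog Skip;;
    17 ::= V 17 [+] N 1)"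

definition scan_prog :: "nat \<Rightarrow> com" where
 "scan_prog K =
   12 ::= N 0;;
   Loop (Lt (V 12) (V 4))
    (Get 49 (V 19 [+] V 12);;
    Cond (Eq (V 49) (N 0))
     (13 ::= V 8 [+] V 9 [+] V 3 [*] (V 10 [+] V 12);;
      Cond (Lt (V 7) (V 13)) Skip
       (tests_prog K;; Cond (Eq (V 15) (N 1)) (Print (V 13)) Skip))
     Skip;;
    12 ::= V 12 [+] N 1)"

definition block_prog :: "nat \<Rightarrow> com" where
 "block_prog K = clear_prog;; sieve_prog;; scan_prog K"

text \<open>Index \<open>u\<close> in the class of \<open>r\<close> stands for the position
  \<open>x0 + r + M * u\<close>; a block covers \<open>y^2\<close> consecutive indices, starting at
  the one in register 10.\<close>

definition class_prog :: "nat \<Rightarrow> com" where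
 "class_prog K =
   10 ::= N 0;;
   Loop (Lt (V 8 [+] V 9 [+] V 3 [*] V 10) (V 7 [+] N 1))
    (block_prog K;; 10 ::= V 10 [+] V 4)"

definition classes_prog :: "nat \<Rightarrow> com" where
 "classes_prog K =
   9 ::= N 0;;
   Loop (Lt (V 9) (V 3))
    (good_prog;;
    Cond (Eq (V 11) (N 1)) (class_prog K) Skip;;
    9 ::= V 9 [+] N 1)"

text \<open>Adds the results of the setup. Correctness of the test rests on \<open>bd\<close>
  bounding the least nonresidues up to \<open>n div y\<close>, its cost on \<open>bd\<close> being
  at most \<open>E\<close>.\<close>

locale sieve_phase = sieve_run k a b K n E W B
 for k :: nat and a b :: "nat \<Rightarrow> int" and K n E :: nat and W B :: int +
 fixes m bd :: nat and lo hi :: int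
 assumes m: "2 \<le> m" "primorial m \<le> y"
  and bd: "2 \<le> bd" "bd \<le> E" "int bd < W"
   "\<And>L. pseudosquare_candidate L \<Longrightarrow> L \<le> n div y \<Longrightarrow> least_nonresidue L \<le> bd"
  and range: "range_ok k lo hi"
begin

definition M :: nat where "M = primorial m"
definition x0 :: int where "x0 = lo + int y"
definition D :: nat where "D = y * y"
text \<open>First cell behind the input; from here on each position of a segment has one cell for
  its mark.\<close>

definition base :: nat where "base = 2 + 2 * k"

text \<open>What all sieving loops rely on and preserve: input intact, space bounded, setup
  registers unchanged.\<close>

definition env :: "ram_state \<Rightarrow> bool" where
 "env s \<longleftrightarrow> input_ok s \<and> cells s \<le> base + D \<and> reg s 0 = int k \<and> reg s 50 = int n \<and>
   reg s 2 = int y \<and> reg s 3 = int M \<and> reg s 4 = int D \<and> reg s 5 = int bd \<and>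
   reg s 6 = lo \<and> reg s 7 = hi \<and> reg s 8 = x0 \<and> reg s 19 = int base"

definition marks :: "nat set \<Rightarrow> ram_state \<Rightarrow> bool" where
 "marks S s \<longleftrightarrow> (\<forall>u<D. mem s (base + u) = of_bool (u \<in> S))"

text \<open>Counterpart of \<open>frame\<close> for programs that write marks; there
  \<open>env\<close> and \<open>marks\<close> describe the memory.\<close>

definition keep :: "nat set \<Rightarrow> ram_state \<Rightarrow> ram_state \<Rightarrow> bool" where
 "keep F s s' \<longleftrightarrow> printed s' = printed s \<and> (\<forall>x. x \<notin> F \<longrightarrow> reg s' x = reg s x)"

definition allprime :: "int \<Rightarrow> bool" where "allprime x \<longleftrightarrow> (\<forall>i<k. prime (form i x))"
definition rough :: "int \<Rightarrow> bool" where "rough x \<longleftrightarrow> (avoids_upto y x)"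

lemma M_pos: "0 < M" unfolding M_def by (simp add: prod_pos prime_gt_0_nat)
lemma M_le: "M \<le> y" using m by (simp add: M_def)

lemma env_regs:
 assumes "env s"
 shows "reg s 0 = int k" "reg s 2 = int y" "reg s 3 = int M" "reg s 4 = int D" "reg s 5 = int bd"
  "reg s 6 = lo" "reg s 7 = hi" "reg s 8 = x0" "reg s 19 = int base" "input_ok s"
 using assms by (auto simp: env_def)

lemma env_upd [simp]:
 "x \<notin> {0, 50, 2, 3, 4, 5, 6, 7, 8, 19} \<Longrightarrow> env (s\<lparr>reg := \<rho>(x := v)\<rparr>) = env (s\<lparr>reg := \<rho>\<rparr>)"
 by (auto simp: env_def input_ok_def)

lemma env_printed [simp]: "env (s\<lparr>printed := p\<rparr>) = env s"
 by (simp add: env_def input_ok_def)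

lemma env_frame:
 assumes "env s" "frame F s s'" "F \<inter> {0, 50, 2, 3, 4, 5, 6, 7, 8, 19} = {}"
 shows "env s'"
 using assms(1,2) assms(3)[unfolded disjoint_iff] by (auto simp: env_def input_ok_def frame_def)

lemma marks_upd [simp]: "marks S (s\<lparr>reg := \<rho>\<rparr>) = marks S s" "marks S (s\<lparr>printed := p\<rparr>) = marks S s"
 by (simp_all add: marks_def)

lemma marks_frame: "frame F s s' \<Longrightarrow> marks S s' = marks S s"
 by (simp add: marks_def frame_def)

lemma small_B: "int y + 100 < B" "int D + 100 < B" "int base + int D + 100 < B" "int k + 100 < B" "1000 < B"
 "int M + 100 < B" "int base + 100 < B"
proof -
 have yW: "int y \<le> W" using y_bounds(3) by simp
 have "int y * int y \<le> W * W" using yW by (intro mult_mono) auto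
 then have D: "int D \<le> W ^ 2" by (simp add: D_def power2_eq_square)
 have W2: "W * 4 \<le> W ^ 2" "W ^ 2 * 4 \<le> W ^ 3"
  using W(1) by (simp_all add: power2_eq_square power3_eq_cube)
 show "int y + 100 < B" using pow_le_B(1)[of "int y" 1] yW by simp
 then show "int M + 100 < B" using M_le by linarith
 show "int D + 100 < B" using pow_le_B(1)[of "int D" 2] D by simp
 have "int base + int D \<le> W ^ 3" using D W2 W(1,2) unfolding base_def by simp
 then show "int base + int D + 100 < B" using pow_le_B(1)[of "int base + int D" 3] by simp
 then show "int base + 100 < B" by simp
 show "int k + 100 < B" using pow_le_B(1)[of "int k" 1] W(2) by simp
 have "4 ^ 5 \<le> W ^ 5" using W(1) by (intro power_mono) auto
 then show "1000 < B" using pow_le_B(1)[of "W ^ 5" 5] by simp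
qed

text \<open>Coefficients below \<open>W\<close> and positions up to \<open>W^5\<close> give form
  values up to \<open>W^7\<close>, well inside the word bound.\<close>

lemma x_B:
 assumes "\<bar>x\<bar> \<le> W ^ 5" "i < k"
 shows "\<bar>x\<bar> + 100 < B" "\<bar>a i * x\<bar> < B" "\<bar>form i x\<bar> + 100 < B" "\<bar>a i\<bar> < B" "\<bar>b i\<bar> < B"
proof -
 have ai: "0 < a i" "a i < W" "\<bar>b i\<bar> < W" using a_pos W assms by auto
 show "\<bar>x\<bar> + 100 < B" using pow_le_B(1)[OF assms(1)] by simp
 have "\<bar>a i * x\<bar> \<le> W * W ^ 5" unfolding abs_mult using ai assms by (intro mult_mono) auto
 then have ax: "\<bar>a i * x\<bar> \<le> W ^ 6" by (simp add: power_Suc[symmetric])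
 then have "\<bar>a i * x\<bar> + 100 < B" using pow_le_B(1)[of "\<bar>a i * x\<bar>" 6] by simp
 then show "\<bar>a i * x\<bar> < B" by linarith
 have "W \<le> W ^ 6" using power_increasing[of 1 6 W] W(1) by simp
 then have "\<bar>form i x\<bar> \<le> 2 * W ^ 6"
  using ax ai abs_triangle_ineq[of "a i * x" "b i"] unfolding form_def by linarith
 also have "\<dots> \<le> W * W ^ 6" using W(1) by (intro mult_right_mono) auto
 finally have "\<bar>form i x\<bar> \<le> W ^ 7" by (simp add: power_Suc[symmetric])
 then show "\<bar>form i x\<bar> + 100 < B" using pow_le_B(1)[of "\<bar>form i x\<bar>" 7] by simp
 have "W + 100 < B" using pow_le_B(1)[of W 1] by simp
 then show "\<bar>a i\<bar> < B" "\<bar>b i\<bar> < B" using ai by linarith+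
qed

lemma wp_load_form:
 assumes "input_ok s" "reg s 14 = int i" "i < k" "reg s 13 = x" "\<bar>x\<bar> \<le> W ^ 5"
 shows "wp B load_form Q s \<longleftrightarrow> Q 0 (s\<lparr>reg := (reg s)(40 := a i, 41 := b i, 16 := form i x)\<rparr>)"
proof -
 note xB = x_B[OF assms(5,3)]
 have iB: "int i < B" "2 * int i < B" "2 + 2 * int i < B" "3 + 2 * int i < B"
  using small_B(7) assms(3) unfolding base_def by linarith+
 have "nat (2 + 2 * int i) = 2 + 2 * i" "nat (3 + 2 * int i) = 3 + 2 * i" by auto
 then have m: "mem s (nat (2 + 2 * int i)) = a i" "mem s (nat (3 + 2 * int i)) = b i"
  using assms(1,3) by (simp_all add: input_ok_def)
 have cells: "max (cells s) (Suc (nat (2 + 2 * int i))) = cells s" "max (cells s) (Suc (nat (3 + 2 * int i))) = cells s"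
  using assms(1,3) by (auto simp: input_ok_def)
 have "\<bar>form i x\<bar> < B" using xB by linarith
 then show ?thesis
  unfolding load_form_def using assms xB iB small_B(5)
  by (simp add: wp_simps m cells form_def)
qed

lemma form_mono: "i < k \<Longrightarrow> x \<le> z \<Longrightarrow> form i x + (z - x) \<le> form i z"
proof -
 assume *: "i < k" "x \<le> z"
 have "1 * (z - x) \<le> a i * (z - x)" using * a_pos[of i] by (intro mult_right_mono) auto
 then show ?thesis by (simp add: form_def algebra_simps)
qed

lemma form_lo: "i < k \<Longrightarrow> lo \<le> x \<Longrightarrow> 2 \<le> form i x"
 using range by (auto simp: range_ok_def)

lemma form_hi: "i < k \<Longrightarrow> x \<le> hi \<Longrightarrow> form i x \<le> int n"
 using range by (auto simp: range_ok_def)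

lemma form_x0: "i < k \<Longrightarrow> x0 \<le> x \<Longrightarrow> int y + 2 \<le> form i x"
proof -
 assume *: "i < k" "x0 \<le> x"
 have "form i (x - int y) + (x - (x - int y)) \<le> form i x" using * by (intro form_mono) auto
 moreover have "2 \<le> form i (x - int y)" using * by (intro form_lo) (auto simp: x0_def)
 ultimately show ?thesis by simp
qed

lemma range_abs: "lo \<le> x \<Longrightarrow> x \<le> hi + W ^ 4 \<Longrightarrow> \<bar>x\<bar> \<le> W ^ 5"
proof -
 assume *: "lo \<le> x" "x \<le> hi + W ^ 4"
 have "\<bar>lo\<bar> \<le> 2 * W" "\<bar>hi\<bar> \<le> 2 * W" using range by (auto simp: range_ok_def)
 moreover have "W ^ 1 \<le> W ^ 4" using W(1) by (intro power_increasing) auto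
 moreover have "4 * W ^ 4 \<le> W * W ^ 4" using W(1) by (intro mult_right_mono) auto
 moreover have "W * W ^ 4 = W ^ 5" by (simp add: power_Suc[symmetric])
 ultimately show ?thesis using * by simp
qed

lemma range_abs': "lo \<le> x \<Longrightarrow> x \<le> hi \<Longrightarrow> \<bar>x\<bar> \<le> W ^ 5"
 using range_abs[of x] zero_le_power[of W 4] W(1) by linarith

lemma wp_naive_prog:
 assumes "env s" "reg s 13 = x" "\<bar>x\<bar> \<le> W ^ 5" "\<And>i. i < k \<Longrightarrow> 2 \<le> form i x \<and> form i x \<le> int F"
 shows "wp B naive_prog (\<lambda>t s'. t \<le> k * (F + 1) \<and> frame {14, 15, 16, 20, 21, 22, 40, 41} s s' \<and>
  reg s' 15 = of_bool (allprime x)) s"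
proof -
 let ?F = "{14, 15, 16, 20, 21, 22, 40, 41} :: nat set"
 let ?I = "\<lambda>t s'. \<exists>i. reg s' 14 = int i \<and> i \<le> k \<and> reg s' 15 = of_bool (\<forall>j<i. prime (form j x)) \<and>
  t \<le> i * (F + 1) \<and> frame ?F s s'"
 let ?f = "\<lambda>s'. k - nat (reg s' 14)"
 show ?thesis
  unfolding naive_prog_def using small_B(5)
 proof (simp add: wp_Seq wp_Assign split del: split_of_bool, intro wp_Loop[where I = ?I and f = ?f], goal_cases)
  case 1
  show ?case by (intro exI[of _ 0]) (auto simp: frame_def)
 next
  case (2 t s')
  then show ?case by simp
 next
  case (3 t s')
  then obtain i where I: "reg s' 14 = int i" "i \<le> k" "reg s' 15 = of_bool (\<forall>j<i. prime (form j x))"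
   "t \<le> i * (F + 1)" "frame ?F s s'" by blast
  have e: "env s'" using env_frame[OF assms(1) I(5)] by simp
  have r: "reg s' 13 = x" using I(5) assms(2) by (simp add: frame_def)
  have ik: "i < k" using 3 I env_regs[OF e] by simp
  define p where "p = nat (form i x)"
  have p: "form i x = int p" "2 \<le> p" "p \<le> F" using assms(4)[OF ik] by (auto simp: p_def)
  have pp: "prime p \<longleftrightarrow> prime (form i x)" by (simp add: p(1))
  have pB: "int p + 10 < B" using x_B(3)[OF assms(3) ik] p by simp
  let ?s1 = "s'\<lparr>reg := (reg s')(40 := a i, 41 := b i, 16 := int p, 20 := int p)\<rparr>"
  define Q where "Q = (\<lambda>t1 s''. ?I (Suc (t + t1)) s'' \<and> ?f s'' < ?f s')"
  have Q: "Q t1 s''" if "reg s'' 14 = int (Suc i)" "reg s'' 15 = of_bool (\<forall>j<Suc i. prime (form j x))" "t1 \<le> F" "frame ?F s s''" for t1 s''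
   unfolding Q_def
  proof
   have "Suc (t + t1) \<le> Suc i * (F + 1)" using that(3) I(4) by simp
   then show "?I (Suc (t + t1)) s''" using that ik by (intro exI[of _ "Suc i"] conjI) auto
   show "?f s'' < ?f s'" using that(1) I(1) ik by simp
  qed
  have i1: "int i + 1 = int (Suc i)" by simp
  have iB: "int (Suc i) < B" using ik small_B by linarith
  have SU: "(\<forall>j<Suc i. prime (form j x)) \<longleftrightarrow> (\<forall>j<i. prime (form j x)) \<and> prime (form i x)"
   by (auto simp only: less_Suc_eq)
  have "wp B prime_prog (\<lambda>t s''. t \<le> p \<and> frame {21, 22} ?s1 s'' \<and> reg s'' 22 = of_bool (prime p)) ?s1"
   using p pB by (intro wp_prime_prog) auto
  then have "wp B prime_prog (\<lambda>t1. wp B (Cond (Eq (V 22) (N 1)) Skip (15 ::= N 0);; 14 ::= V 14 [+] N 1)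
    (\<lambda>t2. Q (t1 + t2))) ?s1"
  proof (elim wp_mono, goal_cases)
   case (1 t1 s2)
   have r2: "reg s2 14 = int i" "reg s2 15 = of_bool (\<forall>j<i. prime (form j x))" using 1 I by (simp_all add: frame_def)
   have fr: "frame ?F s (s2\<lparr>reg := (reg s2)(15 := v, 14 := z)\<rparr>)" "frame ?F s (s2\<lparr>reg := (reg s2)(14 := z)\<rparr>)" for v z
    using 1 I(5) by (auto simp: frame_def)
   show ?case
   proof (cases "prime p")
    case True
    have "Q t1 (s2\<lparr>reg := (reg s2)(14 := int (Suc i))\<rparr>)"
     by (rule Q) (use True pp r2 fr 1 p(3) SU in simp_all)
    then show ?thesis using True 1 r2 iB small_B(5) by (simp add: wp_simps i1 del: of_nat_Suc split del: split_of_bool)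
   next
    case False
    have "Q t1 (s2\<lparr>reg := (reg s2)(15 := 0, 14 := int (Suc i))\<rparr>)"
     by (rule Q) (use False pp r2 fr 1 p(3) SU in simp_all)
    then show ?thesis using False 1 r2 iB small_B(5) by (simp add: wp_simps i1 del: of_nat_Suc split del: split_of_bool)
   qed
  qed
  then have "wp B (load_form;; 20 ::= V 16;; prime_prog;; Cond (Eq (V 22) (N 1)) Skip (15 ::= N 0);; 14 ::= V 14 [+] N 1) Q s'"
   using pB p by (simp add: wp_Seq wp_Assign wp_load_form[OF env_regs(10)[OF e] I(1) ik r assms(3)])
  then show ?case unfolding Q_def .
 next
  case (4 t s')
  then obtain i where I: "reg s' 14 = int i" "i \<le> k" "reg s' 15 = of_bool (\<forall>j<i. prime (form j x))"
   "t \<le> i * (F + 1)" "frame ?F s s'" by blast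
  have e: "env s'" using env_frame[OF assms(1) I(5)] by simp
  have "i = k" using 4 I env_regs(1)[OF e] by simp
  then show ?case using I by (simp add: allprime_def)
 qed
qed

text \<open>At a surviving position the form value has no prime factor up to \<open>y\<close>; in
  particular it is odd, and the soundness theorem applies. Conversely a prime passes for every base
  below it.\<close>

lemma test_correct:
 assumes "x0 \<le> x" "x \<le> hi" "rough x" "i < k"
 shows "2 < nat (form i x)" "odd (nat (form i x))" "nat (form i x) \<le> n" "form i x = int (nat (form i x))"
  "test_passes K bd (nat (form i x)) \<longleftrightarrow> prime (form i x)"
proof -
 define p where "p = nat (form i x)"
 have y2: "2 \<le> y" by (rule y_bounds)
 have f: "int y + 2 \<le> form i x" "form i x \<le> int n" using form_x0[OF assms(4,1)] form_hi[OF assms(4,2)] by auto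
 show fp: "form i x = int (nat (form i x))" using f by simp
 then have p: "form i x = int p" by (simp add: p_def)
 show p2: "2 < nat (form i x)" using f y2 by simp
 show pn: "nat (form i x) \<le> n" using f by simp
 have rgh: "y < q" if "prime q" "q dvd p" for q
 proof (rule ccontr)
  assume "\<not> y < q"
  moreover have "hits q x" unfolding hits_def using assms(4) p that(2) by auto
  ultimately show False using assms(3) that(1) by (simp add: rough_def)
 qed
 have "\<not> 2 dvd p" using rgh[of 2] y2 by auto
 then show odd: "odd (nat (form i x))" by (simp add: p_def)
 have "test_passes K bd p \<longleftrightarrow> prime p"
 proof
  assume t: "test_passes K bd p"
  show "prime p"
  proof (rule pseudosquare_test_sound[of p n y K bd "witness_base p"])
   show "1 < p" "odd p" "p \<le> n" using p2 odd pn by (simp_all add: p_def)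
   show "n \<le> y ^ K" by (rule y_bounds)
   show "0 < y" using y2 by simp
   show "p \<noteq> c ^ e" if "2 \<le> e" "e \<le> K" for e c using t that by (auto simp: test_passes_def)
   show "least_nonresidue L \<le> bd" if "1 < L" "L \<le> n div y" "\<not> is_square L" "L mod 8 = 1" for L
    using bd(4)[of L] that by (simp add: pseudosquare_candidate_def)
   show "witness_base p ^ ((p - 1) div 2) mod p = p - 1" using t by (simp add: test_passes_def)
   show "q ^ ((p - 1) div 2) mod p \<in> {1, p - 1}" if "2 \<le> q" "q \<le> bd" "q < p" for q
    using t that unfolding test_passes_def by blast
  qed (use rgh bd in auto)
 next
  assume pr: "prime p"
  have p2': "2 < p" using p2 by (simp add: p_def)
  have "\<not> (\<exists>c. p = c ^ e)" if "e \<in> {2..K}" for e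
  proof
   assume "\<exists>c. p = c ^ e"
   then obtain c where "p = c ^ e" by blast
   then show False using pr that by (auto simp: prime_power_iff)
  qed
  moreover have "q ^ ((p - 1) div 2) mod p \<in> {1, p - 1}" if "2 \<le> q \<and> q \<le> bd \<and> q < p" for q
   using power_half_mod_prime_cases[OF pr p2', of q] that by linarith
  ultimately show "test_passes K bd p" using witness_base_prime[OF pr p2'] unfolding test_passes_def by blast
 qed
 then show "test_passes K bd (nat (form i x)) \<longleftrightarrow> prime (form i x)" unfolding p_def[symmetric] p by simp
qed

text \<open>A prime value with a prime factor up to \<open>y\<close> would equal that factor, but
  from \<open>x0\<close> on all values are at least \<open>y + 2\<close>.\<close>

lemma allprime_rough: "x0 \<le> x \<Longrightarrow> allprime x \<Longrightarrow> rough x"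
 unfolding rough_def
proof (intro allI impI notI)
 fix p assume *: "x0 \<le> x" "allprime x" "prime p \<and> p \<le> y" "hits p x"
 then obtain i where i: "i < k" "int p dvd form i x" by (auto simp: hits_def)
 have "prime (form i x)" using *(2) i by (simp add: allprime_def)
 then have "int p = form i x" using i(2) *(3) primes_dvd_imp_eq[of "int p" "form i x"] by simp
 moreover have "int y + 2 \<le> form i x" using form_x0[OF i(1) *(1)] .
 ultimately show False using *(3) by linarith
qed

lemma wp_tests_prog:
 assumes "env s" "reg s 13 = x" "x0 \<le> x" "x \<le> hi" "rough x"
 shows "wp B (tests_prog K) (\<lambda>t s'. t \<le> k * (test_cost + 1) \<and>
  frame ({14, 15, 16, 40, 41} \<union> {20..39} \<union> {42..45}) s s' \<and> reg s' 15 = of_bool (allprime x)) s"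
proof -
 let ?F = "{14, 15, 16, 40, 41} \<union> {20..39} \<union> {42..45} :: nat set"
 have x5: "\<bar>x\<bar> \<le> W ^ 5" using assms(3,4) by (intro range_abs') (auto simp: x0_def)
 let ?I = "\<lambda>t s'. \<exists>i. reg s' 14 = int i \<and> i \<le> k \<and> reg s' 15 = of_bool (\<forall>j<i. prime (form j x)) \<and>
  t \<le> i * (test_cost + 1) \<and> frame ?F s s'"
 let ?f = "\<lambda>s'. k - nat (reg s' 14)"
 show ?thesis
  unfolding tests_prog_def using small_B(5)
 proof (simp add: wp_Seq wp_Assign split del: split_of_bool, intro wp_Loop[where I = ?I and f = ?f], goal_cases)
  case 1
  show ?case by (intro exI[of _ 0]) (auto simp: frame_def)
 next
  case (2 t s')
  then show ?case by simp
 next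
  case (3 t s')
  then obtain i where I: "reg s' 14 = int i" "i \<le> k" "reg s' 15 = of_bool (\<forall>j<i. prime (form j x))"
   "t \<le> i * (test_cost + 1)" "frame ?F s s'" by blast
  have e: "env s'" using env_frame[OF assms(1) I(5)] by simp
  have r: "reg s' 13 = x" using I(5) assms(2) by (simp add: frame_def)
  have ik: "i < k" using 3 I env_regs[OF e] by simp
  note tc = test_correct[OF assms(3-5) ik]
  define p where "p = nat (form i x)"
  have p: "form i x = int p" using tc(4) by (simp add: p_def)
  let ?s1 = "s'\<lparr>reg := (reg s')(40 := a i, 41 := b i, 16 := int p)\<rparr>"
  define Q where "Q = (\<lambda>t1 s''. ?I (Suc (t + t1)) s'' \<and> ?f s'' < ?f s')"
  have Q: "Q t1 s''" if "reg s'' 14 = int (Suc i)" "reg s'' 15 = of_bool (\<forall>j<Suc i. prime (form j x))" "t1 \<le> test_cost" "frame ?F s s''" for t1 s''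
   unfolding Q_def
  proof
   have "Suc (t + t1) \<le> Suc i * (test_cost + 1)" using that(3) I(4) by simp
   then show "?I (Suc (t + t1)) s''" using that ik by (intro exI[of _ "Suc i"] conjI) auto
   show "?f s'' < ?f s'" using that(1) I(1) ik by simp
  qed
  have i1: "int i + 1 = int (Suc i)" by simp
  have iB: "int (Suc i) < B" using ik small_B by linarith
  have SU: "(\<forall>j<Suc i. prime (form j x)) \<longleftrightarrow> (\<forall>j<i. prime (form j x)) \<and> prime (form i x)"
   by (auto simp only: less_Suc_eq)
  have "wp B (test_prog K) (\<lambda>t s''. t \<le> test_cost \<and> frame ({20..39} \<union> {42..45}) ?s1 s'' \<and>
    reg s'' 42 = of_bool (test_passes K bd p)) ?s1"
   using tc env_regs(5)[OF e] bd by (intro wp_test_prog) (auto simp: p_def)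
  then have "wp B (test_prog K) (\<lambda>t1. wp B (Cond (Eq (V 42) (N 1)) Skip (15 ::= N 0);; 14 ::= V 14 [+] N 1)
    (\<lambda>t2. Q (t1 + t2))) ?s1"
  proof (elim wp_mono, goal_cases)
   case (1 t1 s2)
   have r2: "reg s2 14 = int i" "reg s2 15 = of_bool (\<forall>j<i. prime (form j x))" using 1 I by (simp_all add: frame_def)
   have r42: "reg s2 42 = of_bool (prime (form i x))" using 1 tc(5) by (simp add: p_def)
   have fr: "frame ?F s (s2\<lparr>reg := (reg s2)(15 := v, 14 := z)\<rparr>)" "frame ?F s (s2\<lparr>reg := (reg s2)(14 := z)\<rparr>)" for v z
    using 1 I(5) by (auto simp: frame_def)
   show ?case
   proof (cases "prime (form i x)")
    case True
    have "Q t1 (s2\<lparr>reg := (reg s2)(14 := int (Suc i))\<rparr>)"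
     by (rule Q) (use True r2 fr 1 SU in simp_all)
    then show ?thesis using True r42 r2 iB small_B(5) by (simp add: wp_simps i1 del: of_nat_Suc split del: split_of_bool)
   next
    case False
    have "Q t1 (s2\<lparr>reg := (reg s2)(15 := 0, 14 := int (Suc i))\<rparr>)"
     by (rule Q) (use False r2 fr 1 SU in simp_all)
    then show ?thesis using False r42 r2 iB small_B(5) by (simp add: wp_simps i1 del: of_nat_Suc split del: split_of_bool)
   qed
  qed
  then have "wp B (load_form;; test_prog K;; Cond (Eq (V 42) (N 1)) Skip (15 ::= N 0);; 14 ::= V 14 [+] N 1) Q s'"
   using p by (simp add: wp_Seq wp_load_form[OF env_regs(10)[OF e] I(1) ik r x5])
  then show ?case unfolding Q_def .
 next
  case (4 t s')
  then obtain i where I: "reg s' 14 = int i" "i \<le> k" "reg s' 15 = of_bool (\<forall>j<i. prime (form j x))"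
   "t \<le> i * (test_cost + 1)" "frame ?F s s'" by blast
  have e: "env s'" using env_frame[OF assms(1) I(5)] by simp
  have "i = k" using 4 I env_regs(1)[OF e] by simp
  then show ?case using I by (simp add: allprime_def)
 qed
qed

text \<open>A bound on the values met by the naive tests: the forms increase, so their values before
  \<open>x0\<close> are smaller, and a sum bounds each summand.\<close>

definition F0 :: nat where "F0 = (\<Sum>i<k. nat (form i x0))"

lemma wp_small_prog:
 assumes "env s"
 shows "wp B small_prog (\<lambda>t s'. t \<le> y * (k * (F0 + 1) + 1) \<and> env s' \<and>
  set (printed s') = set (printed s) \<union> {x. lo \<le> x \<and> x < x0 \<and> x \<le> hi \<and> allprime x}) s"
proof -
 define c where "c = k * (F0 + 1) + 1"
 let ?P = "\<lambda>z. set (printed s) \<union> {x. lo \<le> x \<and> x < z \<and> x \<le> hi \<and> allprime x}"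
 let ?I = "\<lambda>t s'. \<exists>j. reg s' 13 = lo + int j \<and> j \<le> y \<and> set (printed s') = ?P (lo + int j) \<and> t \<le> j * c \<and> env s'"
 let ?f = "\<lambda>s'. nat (x0 - reg s' 13)"
 have loB: "\<bar>lo\<bar> < B"
 proof -
  have "\<bar>lo\<bar> \<le> 2 * W" using range by (simp add: range_ok_def)
  also have "2 * W \<le> W ^ 2" using W(1) by (simp add: power2_eq_square)
  finally show ?thesis using pow_le_B(1)[of "\<bar>lo\<bar>" 2] by simp
 qed
 have "wp B small_prog (\<lambda>t s'. t \<le> y * c \<and> env s' \<and> set (printed s') = ?P x0) s"
  unfolding small_prog_def using loB env_regs(6)[OF assms]
 proof (simp add: wp_Seq wp_Assign, intro wp_Loop[where I = ?I and f = ?f], goal_cases)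
  case 1
  show ?case using assms by (intro exI[of _ 0]) auto
 next
  case (2 t s')
  then show ?case by simp
 next
  case (3 t s')
  then obtain j where I: "reg s' 13 = lo + int j" "j \<le> y" "set (printed s') = ?P (lo + int j)" "t \<le> j * c" "env s'" by blast
  have jy: "j < y" using 3 I(1) env_regs(8)[OF I(5)] by (simp add: x0_def)
  define x where "x = lo + int j"
  have x1: "lo + int (Suc j) = x + 1" by (simp add: x_def)
  have P1: "?P (x + 1) = ?P x \<union> (if x \<le> hi \<and> allprime x then {x} else {})"
   unfolding x_def by (auto simp: le_less)
  have xB: "\<bar>x + 1\<bar> < B"
  proof -
   have "\<bar>lo\<bar> \<le> 2 * W" using range by (simp add: range_ok_def)
   moreover have "int j < W" using jy y_bounds(3) by linarith
   moreover have "4 * W \<le> W ^ 2" using W(1) by (simp add: power2_eq_square)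
   ultimately show ?thesis using pow_le_B(1)[of "4 * W" 2] W(1) unfolding x_def by linarith
  qed
  define Q where "Q = (\<lambda>t1 s''. ?I (Suc (t + t1)) s'' \<and> ?f s'' < ?f s')"
  have Q: "Q t1 s''" if "reg s'' 13 = x + 1" "set (printed s'') = ?P (x + 1)" "t1 + 1 \<le> c" "env s''" for t1 s''
   unfolding Q_def
  proof
   have "Suc (t + t1) \<le> Suc j * c" using that(3) I(4) by simp
   then show "?I (Suc (t + t1)) s''"
    by (intro exI[of _ "Suc j"] conjI) (use that jy in \<open>simp_all only: x1 Suc_le_eq\<close>)
   show "?f s'' < ?f s'" using that(1) I(1) jy by (simp add: x_def x0_def)
  qed
  show ?case
  proof (cases "hi < x")
   case True
   have "Q 0 (s'\<lparr>reg := (reg s')(13 := x + 1)\<rparr>)"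
    using True I P1 by (intro Q) (auto simp: x_def c_def)
   then have "wp B (Cond (Lt (V 7) (V 13)) Skip (naive_prog;; Cond (Eq (V 15) (N 1)) (Print (V 13)) Skip);; 13 ::= V 13 [+] N 1) Q s'"
    using True I(1) env_regs(7)[OF I(5)] xB small_B(5) by (simp add: wp_simps x_def[symmetric])
   then show ?thesis unfolding Q_def .
  next
   case False
   have x5: "\<bar>x\<bar> \<le> W ^ 5" using False by (intro range_abs') (auto simp: x_def)
   have "form i x \<le> int F0" if "i < k" for i
   proof -
    have "form i x + (x0 - x) \<le> form i x0" using that jy by (intro form_mono) (auto simp: x_def x0_def)
    moreover have "nat (form i x0) \<le> F0" unfolding F0_def using that by (intro member_le_sum) auto
    moreover have "x \<le> x0" using jy by (simp add: x_def x0_def)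
    ultimately show ?thesis by linarith
   qed
   then have "wp B naive_prog (\<lambda>t s''. t \<le> k * (F0 + 1) \<and> frame {14, 15, 16, 20, 21, 22, 40, 41} s' s'' \<and>
    reg s'' 15 = of_bool (allprime x)) s'"
    using I x5 form_lo by (intro wp_naive_prog) (auto simp: x_def)
   then have "wp B naive_prog (\<lambda>t1. wp B (Cond (Eq (V 15) (N 1)) (Print (V 13)) Skip) (\<lambda>t2. wp B (13 ::= V 13 [+] N 1)
    (\<lambda>t3. Q (t1 + t2 + t3)))) s'"
   proof (elim wp_mono, goal_cases)
    case (1 t1 s2)
    have e: "env s2" using env_frame[OF I(5), of "{14, 15, 16, 20, 21, 22, 40, 41}" s2] 1 by simp
    have r: "reg s2 13 = x" "printed s2 = printed s'" using 1 I by (simp_all add: frame_def x_def)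
    have "Q t1 (s2\<lparr>reg := (reg s2)(13 := x + 1)\<rparr>)" if "\<not> allprime x"
     using that 1 e r I(3) P1 by (intro Q) (auto simp: c_def x_def)
    moreover have "Q t1 (s2\<lparr>printed := printed s2 @ [x], reg := (reg s2)(13 := x + 1)\<rparr>)" if "allprime x"
    proof -
     have "env (s2\<lparr>printed := printed s2 @ [x], reg := (reg s2)(13 := x + 1)\<rparr>)"
      using e by (simp add: env_def input_ok_def)
     then show ?thesis using that 1 r I(3) P1 False by (intro Q) (auto simp: c_def x_def)
    qed
    ultimately show ?case using 1 r xB small_B(5) by (cases "allprime x") (simp_all add: wp_simps)
   qed
   then have "wp B (Cond (Lt (V 7) (V 13)) Skip (naive_prog;; Cond (Eq (V 15) (N 1)) (Print (V 13)) Skip);; 13 ::= V 13 [+] N 1) Q s'"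
    using False I(1) env_regs(7)[OF I(5)] by (simp add: wp_Seq wp_Cond x_def[symmetric])
   then show ?thesis unfolding Q_def .
  qed
 next
  case (4 t s')
  then obtain j where I: "reg s' 13 = lo + int j" "j \<le> y" "set (printed s') = ?P (lo + int j)" "t \<le> j * c" "env s'" by blast
  have "j = y" using 4 I(1,2) env_regs(8)[OF I(5)] by (simp add: x0_def)
  then show ?case using I by (simp add: x0_def)
 qed
 then show ?thesis by (simp only: c_def)
qed

text \<open>Since \<open>M\<close> is at most \<open>y\<close>, all its divisors above 1 are
  covered, so goodness means that no form value at the representative shares a prime factor with
  \<open>M\<close>.\<close>

definition good :: "nat \<Rightarrow> bool" where
 "good r \<longleftrightarrow> (\<forall>i<k. \<forall>q\<in>{2..y}. q dvd M \<longrightarrow> \<not> int q dvd form i (x0 + int r))"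

lemma wp_coprime_prog:
 assumes "env s" "reg s 16 = z" "reg s 11 = of_bool g" "\<bar>z\<bar> < B"
 shows "wp B coprime_prog (\<lambda>t s'. t \<le> y \<and> frame {11, 17} s s' \<and>
  reg s' 11 = of_bool (g \<and> (\<forall>q\<in>{2..y}. q dvd M \<longrightarrow> \<not> int q dvd z))) s"
proof -
 let ?F = "{11, 17} :: nat set"
 let ?G = "\<lambda>q. q dvd M \<longrightarrow> \<not> int q dvd z"
 let ?I = "\<lambda>t s'. \<exists>q. reg s' 17 = int q \<and> 2 \<le> q \<and> q \<le> y + 1 \<and> t + 2 \<le> q \<and>
  reg s' 11 = of_bool (g \<and> (\<forall>q'\<in>{2..<q}. ?G q')) \<and> frame ?F s s'"
 let ?f = "\<lambda>s'. y + 1 - nat (reg s' 17)"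
 show ?thesis
  unfolding coprime_prog_def using small_B(5)
 proof (simp add: wp_Seq wp_Assign split del: split_of_bool, intro wp_Loop[where I = ?I and f = ?f], goal_cases)
  case 1
  show ?case using y_bounds(1) assms by (intro exI[of _ 2]) (auto simp: frame_def)
 next
  case (2 t s')
  then obtain q where I: "frame ?F s s'" by blast
  then have "env s'" using env_frame[OF assms(1)] by simp
  then show ?case using small_B env_regs(2)[of s'] by simp
 next
  case (3 t s')
  then obtain q where I: "reg s' 17 = int q" "2 \<le> q" "q \<le> y + 1" "t + 2 \<le> q"
   "reg s' 11 = of_bool (g \<and> (\<forall>q'\<in>{2..<q}. ?G q'))" "frame ?F s s'" by blast
  have e: "env s'" using env_frame[OF assms(1) I(6)] by simp
  have r: "reg s' 16 = z" using I(6) assms(2) by (simp add: frame_def)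
  have qy: "q \<le> y" using 3 I(1) env_regs(2)[OF e] by simp
  have set: "{2..<Suc q} = insert q {2..<q}" using I by auto
  have i1: "int q + 1 = int (Suc q)" by simp
  have qB: "int (Suc q) < B" "int q < B" using qy small_B by linarith+
  have modB: "\<bar>int M mod int q\<bar> < B" "\<bar>z mod int q\<bar> < B"
  proof -
   have "0 \<le> v mod int q \<and> v mod int q < int q" for v using I(2) by simp
   then show "\<bar>int M mod int q\<bar> < B" "\<bar>z mod int q\<bar> < B" using qB(2) by (smt (verit))+
  qed
  have d: "int M mod int q = 0 \<longleftrightarrow> q dvd M" "z mod int q = 0 \<longleftrightarrow> int q dvd z"
   by (auto simp: dvd_eq_mod_eq_0[symmetric])
  define Q where "Q = (\<lambda>t1 s''. ?I (Suc (t + t1)) s'' \<and> ?f s'' < ?f s')"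
  have fr: "frame ?F s (s'\<lparr>reg := (reg s')(11 := v, 17 := z)\<rparr>)" "frame ?F s (s'\<lparr>reg := (reg s')(17 := z)\<rparr>)" for v z
   using I(6) by (auto simp: frame_def)
  have Q: "Q 0 s''" if "reg s'' 17 = int (Suc q)" "reg s'' 11 = of_bool (g \<and> (\<forall>q'\<in>{2..<Suc q}. ?G q'))" "frame ?F s s''" for s''
   unfolding Q_def
  proof
   show "?I (Suc (t + 0)) s''" using that I qy by (intro exI[of _ "Suc q"] conjI) auto
   show "?f s'' < ?f s'" using that(1) I(1) qy by simp
  qed
  have A: "Q 0 (s'\<lparr>reg := (reg s')(17 := int (Suc q))\<rparr>)" if "?G q"
   using that I(5) fr by (intro Q) (auto simp: set)
  have A': "Q 0 (s'\<lparr>reg := (reg s')(11 := 0, 17 := int (Suc q))\<rparr>)" if "\<not> ?G q"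
   using that fr by (intro Q) (auto simp: set)
  have "wp B (Cond (Eq (V 3 [mod] V 17) (N 0)) (Cond (Eq (V 16 [mod] V 17) (N 0)) (11 ::= N 0) Skip) Skip;;
    17 ::= V 17 [+] N 1) Q s'"
   using A A' I(1,2) r env_regs(3)[OF e] modB qB small_B(5)
   by (simp add: wp_simps d i1 del: of_nat_Suc split del: split_of_bool)
  then show ?case unfolding Q_def .
 next
  case (4 t s')
  then obtain q where I: "reg s' 17 = int q" "2 \<le> q" "q \<le> y + 1" "t + 2 \<le> q"
   "reg s' 11 = of_bool (g \<and> (\<forall>q'\<in>{2..<q}. ?G q'))" "frame ?F s s'" by blast
  have e: "env s'" using env_frame[OF assms(1) I(6)] by simp
  have "q = y + 1" using 4 I(1,3) env_regs(2)[OF e] by simp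
  moreover have "{2..<y + 1} = {2..y}" by auto
  ultimately show ?case using I by simp
 qed
qed

lemma wp_good_prog:
 assumes "env s" "reg s 9 = int r" "r < M"
 shows "wp B good_prog (\<lambda>t s'. t \<le> k * (y + 1) \<and> frame {11, 13, 14, 16, 17, 40, 41} s s' \<and>
  reg s' 11 = of_bool (good r)) s"
proof -
 let ?F = "{11, 13, 14, 16, 17, 40, 41} :: nat set"
 define x where "x = x0 + int r"
 let ?G = "\<lambda>i. \<forall>q\<in>{2..y}. q dvd M \<longrightarrow> \<not> int q dvd form i x"
 let ?I = "\<lambda>t s'. \<exists>i. reg s' 14 = int i \<and> reg s' 13 = x \<and> i \<le> k \<and> reg s' 11 = of_bool (\<forall>j<i. ?G j) \<and>
  t \<le> i * (y + 1) \<and> frame ?F s s'"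
 let ?f = "\<lambda>s'. k - nat (reg s' 14)"
 have x5: "\<bar>x\<bar> \<le> W ^ 5"
 proof -
  have "\<bar>lo\<bar> \<le> 2 * W" using range by (simp add: range_ok_def)
  moreover have "int r < W" using assms(3) M_le y_bounds(3) by linarith
  moreover have "4 * W \<le> W ^ 2" using W(1) by (simp add: power2_eq_square)
  moreover have "W ^ 2 \<le> W ^ 5" using W(1) by (intro power_increasing) auto
  ultimately show ?thesis using y_bounds(3) unfolding x_def x0_def by linarith
 qed
 then have xB: "\<bar>x\<bar> < B" using pow_le_B(1)[of "\<bar>x\<bar>" 5] by simp
 have "wp B good_prog (\<lambda>t s'. t \<le> k * (y + 1) \<and> frame ?F s s' \<and> reg s' 11 = of_bool (\<forall>i<k. ?G i)) s"
  unfolding good_prog_def using small_B(5) xB env_regs(8)[OF assms(1)] assms(2)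
 proof (simp add: wp_Seq wp_Assign x_def[symmetric] split del: split_of_bool, intro wp_Loop[where I = ?I and f = ?f], goal_cases)
  case 1
  show ?case by (intro exI[of _ 0]) (auto simp: frame_def)
 next
  case (2 t s')
  then show ?case by simp
 next
  case (3 t s')
  then obtain i where I: "reg s' 14 = int i" "reg s' 13 = x" "i \<le> k" "reg s' 11 = of_bool (\<forall>j<i. ?G j)"
   "t \<le> i * (y + 1)" "frame ?F s s'" by blast
  have e: "env s'" using env_frame[OF assms(1) I(6)] by simp
  have ik: "i < k" using 3 I env_regs(1)[OF e] by simp
  have i1: "int i + 1 = int (Suc i)" by simp
  have iB: "int (Suc i) < B" using ik small_B by linarith
  let ?s1 = "s'\<lparr>reg := (reg s')(40 := a i, 41 := b i, 16 := form i x)\<rparr>"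
  define Q where "Q = (\<lambda>t1 s''. ?I (Suc (t + t1)) s'' \<and> ?f s'' < ?f s')"
  have "env ?s1" using e by simp
  then have "wp B coprime_prog (\<lambda>t s''. t \<le> y \<and> frame {11, 17} ?s1 s'' \<and>
   reg s'' 11 = of_bool ((\<forall>j<i. ?G j) \<and> (\<forall>q\<in>{2..y}. q dvd M \<longrightarrow> \<not> int q dvd form i x))) ?s1"
   using I(4) x_B(3)[OF x5 ik] by (intro wp_coprime_prog) auto
  then have "wp B coprime_prog (\<lambda>t1. wp B (14 ::= V 14 [+] N 1) (\<lambda>t2. Q (t1 + t2))) ?s1"
  proof (elim wp_mono, goal_cases)
   case (1 t1 s2)
   have r2: "reg s2 14 = int i" "reg s2 13 = x" using 1 I by (simp_all add: frame_def)
   have fr: "frame ?F s (s2\<lparr>reg := (reg s2)(14 := z)\<rparr>)" for z using 1 I(6) by (auto simp: frame_def)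
   have "Q t1 (s2\<lparr>reg := (reg s2)(14 := int (Suc i))\<rparr>)"
    unfolding Q_def
   proof
    have "Suc (t + t1) \<le> Suc i * (y + 1)" using 1 I(5) by simp
    then show "?I (Suc (t + t1)) (s2\<lparr>reg := (reg s2)(14 := int (Suc i))\<rparr>)"
     using 1 r2 fr ik by (intro exI[of _ "Suc i"] conjI) (auto simp: less_Suc_eq)
    show "?f (s2\<lparr>reg := (reg s2)(14 := int (Suc i))\<rparr>) < ?f s'" using I(1) ik by simp
   qed
   then show ?case using r2 iB small_B(5) by (simp add: wp_Assign i1 del: of_nat_Suc)
  qed
  then have "wp B (load_form;; coprime_prog;; 14 ::= V 14 [+] N 1) Q s'"
   by (simp add: wp_Seq wp_load_form[OF env_regs(10)[OF e] I(1) ik I(2) x5])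
  then show ?case unfolding Q_def .
 next
  case (4 t s')
  then obtain i where I: "reg s' 14 = int i" "reg s' 13 = x" "i \<le> k" "reg s' 11 = of_bool (\<forall>j<i. ?G j)"
   "t \<le> i * (y + 1)" "frame ?F s s'" by blast
  have e: "env s'" using env_frame[OF assms(1) I(6)] by simp
  have "i = k" using 4 I(1,3) env_regs(1)[OF e] by simp
  then show ?case using I by simp
 qed
 then show ?thesis by (simp only: good_def x_def)
qed

end

context sieve_phase
begin

section \<open>Positions inside a residue class\<close>

definition pos :: "nat \<Rightarrow> nat \<Rightarrow> nat \<Rightarrow> int" where
 "pos r T u = x0 + int r + int M * (int T + int u)"

text \<open>Advancing the index by \<open>q\<close> moves the position by \<open>q * M\<close>, so
  the hits of \<open>q\<close> form progressions of indices with difference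
  \<open>q\<close>.\<close>

lemma form_pos_mod: "int q dvd form i (pos r T u) \<longleftrightarrow> int q dvd form i (pos r T (u mod q))"
proof -
 have "form i (pos r T u) - form i (pos r T (u mod q)) = a i * int M * (int u - int (u mod q))"
  by (simp add: form_def pos_def algebra_simps)
 moreover have "int u - int (u mod q) = int q * int (u div q)"
  by (metis add_diff_cancel_right' div_mult_mod_eq mult.commute of_nat_add of_nat_mult)
 ultimately have "int q dvd form i (pos r T u) - form i (pos r T (u mod q))" by simp
 then show ?thesis by (metis diff_add_cancel dvd_add_right_iff)
qed

text \<open>A block starts inside the range but may overrun it by up to \<open>M * D\<close>, which
  is at most \<open>W^3\<close>; the bound \<open>W^5\<close> covers the overrun.\<close>

lemma pos_bounds:
 assumes "r < M" "pos r T 0 \<le> hi" "u \<le> D"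
 shows "x0 \<le> pos r T u" "\<bar>pos r T u\<bar> \<le> W ^ 5" "int T + int u + 100 < B" "int M * (int T + int u) + 100 < B"
  "\<bar>x0 + int r\<bar> < B" "int M * int T + 100 < B" "\<bar>x0 + int r + int M * (int T + int u)\<bar> < B"
  "\<bar>int M * (int T + int u)\<bar> < B"
proof -
 have M1: "1 \<le> int M" using M_pos by simp
 have MW: "int M \<le> W" "int y \<le> W" "int r \<le> W" using M_le y_bounds(3) assms(1) by linarith+
 have lohi: "\<bar>lo\<bar> \<le> 2 * W" "\<bar>hi\<bar> \<le> 2 * W" using range by (auto simp: range_ok_def)
 have "int y * int y \<le> W * W" using MW by (intro mult_mono) auto
 moreover have "int u \<le> int (y * y)" using assms(3) unfolding D_def by (simp only: of_nat_le_iff)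
 ultimately have DW: "int u \<le> W ^ 2" by (simp add: power2_eq_square)
 have "int M * int u \<le> W * W ^ 2" using MW DW by (intro mult_mono) auto
 then have Mu: "int M * int u \<le> W ^ 3" by (simp add: power_Suc[symmetric])
 have nn: "0 \<le> int M * int T" "0 \<le> int M * int u" by auto
 have split: "int M * (int T + int u) = int M * int T + int M * int u" by (simp add: algebra_simps)
 show x0: "x0 \<le> pos r T u" unfolding pos_def split using nn by linarith
 have MT: "int M * int T \<le> hi - x0" using assms(2) unfolding pos_def by simp
 have W34: "W ^ 3 \<le> W ^ 4" "W ^ 2 \<le> W ^ 3" using W(1) by (intro power_increasing; simp)+
 have W14: "4 * W \<le> W ^ 2" "4 * W ^ 2 \<le> W ^ 3" using W(1) by (simp_all add: power2_eq_square power3_eq_cube)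
 have W4: "4 * W ^ 3 \<le> W ^ 4"
 proof -
  have "4 * W ^ 3 \<le> W * W ^ 3" using W(1) by (intro mult_right_mono) auto
  then show ?thesis by (simp add: power_Suc[symmetric])
 qed
 have "pos r T u = pos r T 0 + int M * int u" unfolding pos_def by (simp add: algebra_simps)
 then have "pos r T u \<le> hi + W ^ 4" using assms(2) Mu W34 by linarith
 moreover have "lo \<le> pos r T u" using x0 unfolding x0_def by linarith
 ultimately show p5: "\<bar>pos r T u\<bar> \<le> W ^ 5" by (intro range_abs)
 have x0abs: "\<bar>x0\<bar> \<le> 3 * W" using lohi MW unfolding x0_def by linarith
 then have MT5: "int M * int T \<le> 5 * W" using MT lohi by linarith
 have "int T \<le> int M * int T" using mult_right_mono[OF M1, of "int T"] by simp
 then have "int T + int u \<le> W ^ 3" using MT5 DW W14 W(1) by linarith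
 then show "int T + int u + 100 < B" using pow_le_B(1)[of "int T + int u" 3] by simp
 have "int M * (int T + int u) \<le> W ^ 4" unfolding split using MT5 Mu W14 W4 W(1) by linarith
 then show "int M * (int T + int u) + 100 < B" using pow_le_B(1)[of "int M * (int T + int u)" 4] by simp
 then show "int M * int T + 100 < B" unfolding split using nn by linarith
 have "0 \<le> int M * (int T + int u)" by simp
 then show "\<bar>int M * (int T + int u)\<bar> < B"
  using \<open>int M * (int T + int u) + 100 < B\<close> by linarith
 have "\<bar>x0 + int r\<bar> \<le> W ^ 2" using x0abs MW W14 by linarith
 then show "\<bar>x0 + int r\<bar> < B" using pow_le_B(1)[of "\<bar>x0 + int r\<bar>" 2] by simp
 show "\<bar>x0 + int r + int M * (int T + int u)\<bar> < B"
  using pow_le_B(1)[OF p5] unfolding pos_def by simp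
qed

lemma D_y_B: "int D + int y + 100 < B"
proof -
 have yW: "int y \<le> W" using y_bounds(3) by simp
 have "int y * int y \<le> W * W" using yW by (intro mult_mono) auto
 then have D: "int D \<le> W ^ 2" by (simp add: D_def power2_eq_square)
 have W2: "W * 4 \<le> W ^ 2" "W ^ 2 * 4 \<le> W ^ 3"
  using W(1) by (simp_all add: power2_eq_square power3_eq_cube)
 have "int D + int y \<le> W ^ 3" using D yW W2 W(1) by linarith
 then show ?thesis using pow_le_B(1)[of "int D + int y" 3] by simp
qed

lemma env_mem:
 assumes "env s" "u < D"
 shows "env (s\<lparr>mem := (mem s)(base + u := v), cells := max (cells s) (Suc (base + u))\<rparr>)"
 using assms by (auto simp: env_def input_ok_def base_def)

lemma wp_clear_prog:
 assumes "env s"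
 shows "wp B clear_prog (\<lambda>t s'. t \<le> D \<and> env s' \<and> marks {} s' \<and> keep {12} s s') s"
proof -
 let ?I = "\<lambda>t s'. t \<le> D \<and> reg s' 12 = int t \<and> env s' \<and> (\<forall>u<t. mem s' (base + u) = 0) \<and> keep {12} s s'"
 let ?f = "\<lambda>s'. D - nat (reg s' 12)"
 show ?thesis
  unfolding clear_prog_def using small_B(5)
 proof (simp add: wp_Seq wp_Assign, intro wp_Loop[where I = ?I and f = ?f], goal_cases)
  case 1
  show ?case using assms by (simp add: keep_def)
 next
  case (2 t s')
  then show ?case by simp
 next
  case (3 t s')
  then have I: "t \<le> D" "reg s' 12 = int t" "env s'" "\<forall>u<t. mem s' (base + u) = 0" "keep {12} s s'" by auto
  have t: "t < D" using 3 I(2) env_regs(4)[OF I(3)] by simp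
  have tB: "int t + 1 < B" "int base + int t < B" using t small_B by linarith+
  have nat: "nat (int base + int t) = base + t" by simp
  let ?s1 = "s'\<lparr>mem := (mem s')(base + t := 0), cells := max (cells s') (Suc (base + t))\<rparr>"
  have e: "env ?s1" using env_mem[OF I(3) t] .
  have "env (?s1\<lparr>reg := (reg ?s1)(12 := int t + 1)\<rparr>)" using e env_upd[of 12 "reg ?s1" "int t + 1" ?s1] by simp
  moreover have "keep {12} s (?s1\<lparr>reg := (reg ?s1)(12 := int t + 1)\<rparr>)" using I(5) by (simp add: keep_def)
  ultimately have "?I (Suc t) (?s1\<lparr>reg := (reg ?s1)(12 := int t + 1)\<rparr>)"
   using I t by (auto simp: less_Suc_eq)
  then show ?case using I(2) t tB small_B(5) env_regs(9)[OF I(3)] by (simp add: wp_simps nat)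
 next
  case (4 t s')
  then have I: "t \<le> D" "reg s' 12 = int t" "env s'" "\<forall>u<t. mem s' (base + u) = 0" "keep {12} s s'" by auto
  have "t = D" using 4 I(1,2) env_regs(4)[OF I(3)] by simp
  then show ?case using I by (simp add: marks_def)
 qed
qed

lemma wp_mark_prog:
 assumes "env s" "reg s 18 = int w" "reg s 17 = int q" "w < q" "2 \<le> q" "q \<le> y" "marks S s"
 shows "wp B mark_prog (\<lambda>t s'. t \<le> D div q + 1 \<and> env s' \<and> marks (S \<union> {u. u mod q = w}) s' \<and> keep {12} s s') s"
proof -
 \<comment> \<open>For \<open>t > 0\<close> the last mark lay below \<open>D\<close>; at exit this
   bounds \<open>(t - 1) * q\<close> by \<open>D\<close> and gives the time bound.\<close>
 let ?I = "\<lambda>t s'. reg s' 12 = int (w + t * q) \<and> (t = 0 \<or> w + (t - 1) * q < D) \<and> env s' \<and>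
  marks (S \<union> {u. u mod q = w \<and> u < w + t * q}) s' \<and> keep {12} s s'"
 let ?f = "\<lambda>s'. D - nat (reg s' 12)"
 have wB: "int w < B" using assms(4,6) small_B by linarith
 have uq: "u < w + Suc t * q \<and> u mod q = w \<longleftrightarrow> (u < w + t * q \<and> u mod q = w) \<or> u = w + t * q" for u t
 proof
  assume u: "u < w + Suc t * q \<and> u mod q = w"
  have e: "u = w + (u div q) * q" using u div_mult_mod_eq[of u q] by (metis add.commute)
  have "(u div q) * q < Suc t * q" using u e by linarith
  then have "u div q < Suc t" using mult_less_cancel2 by blast
  then consider "u div q < t" | "u div q = t" by linarith
  then show "(u < w + t * q \<and> u mod q = w) \<or> u = w + t * q"
  proof cases
   case 1
   then have "(u div q) * q < t * q" using assms(5) by simp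
   then show ?thesis using u e by linarith
  next
   case 2
   then show ?thesis using e by metis
  qed
 next
  assume "(u < w + t * q \<and> u mod q = w) \<or> u = w + t * q"
  then show "u < w + Suc t * q \<and> u mod q = w" using assms(4) by auto
 qed
 show ?thesis
  unfolding mark_prog_def using wB assms(2)
 proof (simp add: wp_Seq wp_Assign, intro wp_Loop[where I = ?I and f = ?f], goal_cases)
  case 1
  have "S \<union> {u. u mod q = w \<and> u < w + 0 * q} = S"
  proof -
   have "\<not> (u mod q = w \<and> u < w)" for u by (metis mod_less_eq_dividend not_less)
   then show ?thesis by auto
  qed
  then show ?case using assms by (simp add: keep_def)
 next
  case (2 t s')
  then show ?case by simp
 next
  case (3 t s')
  then have I: "reg s' 12 = int (w + t * q)" "t = 0 \<or> w + (t - 1) * q < D" "env s'"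
   "marks (S \<union> {u. u mod q = w \<and> u < w + t * q}) s'" "keep {12} s s'" by auto
  define v where "v = w + t * q"
  have "int (w + t * q) < int D" using 3 I(1) env_regs(4)[OF I(3)] by simp
  then have v: "v < D" unfolding v_def by (simp only: of_nat_less_iff)
  have rq: "reg s' 17 = int q" using I(5) assms(3) by (simp add: keep_def)
  have vB: "int v + int q < B" "int base + int v < B" using v small_B(3) D_y_B assms(6) by linarith+
  have nat: "nat (int base + int v) = base + v" by simp
  let ?s1 = "s'\<lparr>mem := (mem s')(base + v := 1), cells := max (cells s') (Suc (base + v))\<rparr>"
  let ?s2 = "?s1\<lparr>reg := (reg ?s1)(12 := int v + int q)\<rparr>"
  have "env ?s1" using env_mem[OF I(3) v] .
  then have "env ?s2" using env_upd[of 12 "reg ?s1" "int v + int q" ?s1] by simp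
  moreover have "keep {12} s ?s2" using I(5) by (simp add: keep_def)
  moreover have "marks (S \<union> {u. u mod q = w \<and> u < w + Suc t * q}) ?s2"
   unfolding marks_def
  proof (intro allI impI)
   fix u assume u: "u < D"
   have "u \<in> S \<union> {u. u mod q = w \<and> u < w + Suc t * q} \<longleftrightarrow> u \<in> S \<union> {u. u mod q = w \<and> u < w + t * q} \<or> u = v"
    using uq[of u t] unfolding v_def by auto
   moreover have "mem s' (base + u) = of_bool (u \<in> S \<union> {u. u mod q = w \<and> u < w + t * q})"
    using I(4) u by (simp add: marks_def)
   ultimately show "mem ?s2 (base + u) = of_bool (u \<in> S \<union> {u. u mod q = w \<and> u < w + Suc t * q})"
    by (cases "u = v") simp_all
  qed
  moreover have "reg ?s2 12 = int (w + Suc t * q)" by (simp add: v_def)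
  moreover have "Suc t = 0 \<or> w + (Suc t - 1) * q < D" using v by (simp add: v_def)
  ultimately have I2: "?I (Suc t) ?s2" by (intro conjI)
  have rv: "reg s' 12 = int v" using I(1) by (simp add: v_def)
  define Q where "Q = (\<lambda>t1 s''. ?I (Suc (t + t1)) s'' \<and> ?f s'' < ?f s')"
  have "?f ?s2 < ?f s'" using v assms(5) rv by simp
  then have "Q 0 ?s2" unfolding Q_def add_0_right by (rule conjI[OF I2])
  then have "wp B (Put (V 19 [+] V 12) (N 1);; 12 ::= V 12 [+] V 17) Q s'"
   using rv rq vB small_B(5) env_regs(9)[OF I(3)] by (simp add: wp_simps nat)
  then show ?case unfolding Q_def .
 next
  case (4 t s')
  then have I: "reg s' 12 = int (w + t * q)" "t = 0 \<or> w + (t - 1) * q < D" "env s'"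
   "marks (S \<union> {u. u mod q = w \<and> u < w + t * q}) s'" "keep {12} s s'" by auto
  have "\<not> int (w + t * q) < int D" using 4 I(1) env_regs(4)[OF I(3)] by simp
  then have D: "D \<le> w + t * q" by (metis of_nat_less_iff not_less)
  have "marks (S \<union> {u. u mod q = w}) s'" using I(4) D by (auto simp: marks_def)
  moreover have "t \<le> D div q + 1"
  proof (cases "t = 0")
   case False
   then have "(t - 1) * q \<le> D" using I(2) by linarith
   then have "t - 1 \<le> D div q" using assms(5) by (simp add: less_eq_div_iff_mult_less_eq)
   then show ?thesis by simp
  qed simp
  ultimately show ?case using I by simp
 qed
qed

definition offset_cost :: "nat \<Rightarrow> nat \<Rightarrow> nat \<Rightarrow> nat \<Rightarrow> nat \<Rightarrow> nat" where
 "offset_cost r T i q w = (if int q dvd form i (pos r T w) then D div q + 1 else 0)"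

text \<open>By periodicity it is enough to inspect one representative of each residue modulo
  \<open>q\<close>.\<close>

lemma wp_offsets_prog:
 assumes "env s" "reg s 9 = int r" "reg s 10 = int T" "reg s 14 = int i" "reg s 17 = int q"
  "i < k" "2 \<le> q" "q \<le> y" "marks S s" "r < M" "pos r T 0 \<le> hi"
 shows "wp B offsets_prog (\<lambda>t s'. t \<le> (\<Sum>w<q. 1 + offset_cost r T i q w) \<and> env s' \<and>
  marks (S \<union> {u. int q dvd form i (pos r T u)}) s' \<and> keep {12, 13, 16, 18, 40, 41} s s') s"
proof -
 let ?F = "{12, 13, 16, 18, 40, 41} :: nat set"
 let ?S = "\<lambda>w. S \<union> {u. u mod q < w \<and> int q dvd form i (pos r T u)}"
 let ?I = "\<lambda>t s'. \<exists>w. reg s' 18 = int w \<and> w \<le> q \<and> t \<le> (\<Sum>w'<w. 1 + offset_cost r T i q w') \<and> env s' \<and>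
  marks (?S w) s' \<and> keep ?F s s'"
 let ?f = "\<lambda>s'. q - nat (reg s' 18)"
 have qD: "q \<le> D" using assms(8) by (simp add: D_def le_square order_trans)
 show ?thesis
  unfolding offsets_prog_def using small_B(5)
 proof (simp add: wp_Seq wp_Assign, intro wp_Loop[where I = ?I and f = ?f], goal_cases)
  case 1
  show ?case using assms by (intro exI[of _ 0]) (simp add: keep_def)
 next
  case (2 t s')
  then show ?case by simp
 next
  case (3 t s')
  then obtain w where I: "reg s' 18 = int w" "w \<le> q" "t \<le> (\<Sum>w'<w. 1 + offset_cost r T i q w')" "env s'"
   "marks (?S w) s'" "keep ?F s s'" by blast
  have rr: "reg s' 9 = int r" "reg s' 10 = int T" "reg s' 14 = int i" "reg s' 17 = int q"
   using I(6) assms(2-5) by (simp_all add: keep_def)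
  have w: "w < q" using 3 I(1) rr(4) by simp
  note pb = pos_bounds[OF assms(10,11), of w]
  have wD: "w \<le> D" using w qD by simp
  define x where "x = pos r T w"
  have xe: "x0 + int r + int M * (int T + int w) = x" by (simp add: x_def pos_def)
  have x5: "\<bar>x\<bar> \<le> W ^ 5" using pb(2) wD by (simp add: x_def)
  have xB: "\<bar>x\<bar> < B" using pb(7) wD xe by simp
  have w1: "int w + 1 = int (Suc w)" by simp
  have wB: "int (Suc w) < B" "int q < B" using w assms(8) small_B by linarith+
  have modB: "\<bar>form i x mod int q\<bar> < B"
  proof -
   have "0 \<le> form i x mod int q" "form i x mod int q < int q" using assms(7) by simp_all
   then show ?thesis using wB by linarith
  qed
  have d: "form i x mod int q = 0 \<longleftrightarrow> int q dvd form i x" by (simp add: dvd_eq_mod_eq_0)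
  define Q where "Q = (\<lambda>t1 s''. ?I (Suc (t + t1)) s'' \<and> ?f s'' < ?f s')"
  have Q: "Q t1 s''" if "reg s'' 18 = int (Suc w)" "t1 \<le> offset_cost r T i q w" "env s''" "marks (?S (Suc w)) s''" "keep ?F s s''" for t1 s''
   unfolding Q_def
  proof
   have "Suc (t + t1) \<le> (\<Sum>w'<Suc w. 1 + offset_cost r T i q w')" using that(2) I(3) by simp
   then show "?I (Suc (t + t1)) s''" using that w by (intro exI[of _ "Suc w"] conjI) auto
   show "?f s'' < ?f s'" using that(1) I(1) w by simp
  qed
  have S_Suc: "?S (Suc w) = ?S w \<union> (if int q dvd form i x then {u. u mod q = w} else {})"
  proof -
   have "int q dvd form i (pos r T u) \<longleftrightarrow> int q dvd form i x" if "u mod q = w" for u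
    using form_pos_mod[of q i r T u] that by (simp add: x_def)
   then show ?thesis by (auto simp: less_Suc_eq)
  qed
  let ?\<rho> = "(reg s')(13 := x, 40 := a i, 41 := b i, 16 := form i x)"
  let ?s1 = "s'\<lparr>reg := ?\<rho>\<rparr>"
  have e1: "env ?s1" using I(4) by simp
  have k1: "keep ?F s' ?s1" by (simp add: keep_def)
  have "wp B (Cond (Eq (V 16 [mod] V 17) (N 0)) mark_prog Skip;; 18 ::= V 18 [+] N 1) Q ?s1"
  proof (cases "int q dvd form i x")
   case True
   have "wp B mark_prog (\<lambda>t s''. t \<le> D div q + 1 \<and> env s'' \<and> marks (?S w \<union> {u. u mod q = w}) s'' \<and> keep {12} ?s1 s'') ?s1"
    using e1 I(1,5) rr w assms(7,8) by (intro wp_mark_prog) auto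
   then have "wp B mark_prog (\<lambda>t1. wp B (18 ::= V 18 [+] N 1) (\<lambda>t2. Q (t1 + t2))) ?s1"
   proof (elim wp_mono, goal_cases)
    case (1 t1 s2)
    have r2: "reg s2 18 = int w" using 1 I(1) by (simp add: keep_def)
    have "env (s2\<lparr>reg := (reg s2)(18 := int (Suc w))\<rparr>)" using 1 by simp
    moreover have "keep ?F s (s2\<lparr>reg := (reg s2)(18 := int (Suc w))\<rparr>)"
     using 1 I(6) by (auto simp: keep_def)
    ultimately have "Q t1 (s2\<lparr>reg := (reg s2)(18 := int (Suc w))\<rparr>)"
     using 1 True S_Suc by (intro Q) (simp_all add: offset_cost_def x_def)
    then show ?case using r2 wB small_B(5) by (simp add: wp_Assign w1 del: of_nat_Suc)
   qed
   then show ?thesis using True rr modB assms(7) small_B(5) by (simp add: wp_Seq wp_Cond d)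
  next
   case False
   have "Q 0 (?s1\<lparr>reg := ?\<rho>(18 := int (Suc w))\<rparr>)"
    using False S_Suc I(4,5,6) by (intro Q) (auto simp: keep_def)
   then show ?thesis using False rr modB assms(7) small_B(5) I(1) wB
    by (simp add: wp_simps d w1 del: of_nat_Suc)
  qed
  then have "wp B (load_form;; Cond (Eq (V 16 [mod] V 17) (N 0)) mark_prog Skip;; 18 ::= V 18 [+] N 1) Q (s'\<lparr>reg := (reg s')(13 := x)\<rparr>)"
   using env_regs(10)[OF I(4)] rr x5 assms(6)
   by (subst wp_Seq, subst wp_load_form[where i = i and x = x]) (auto simp: input_ok_def)
  then have "wp B (13 ::= V 8 [+] V 9 [+] V 3 [*] (V 10 [+] V 18);; load_form;; Cond (Eq (V 16 [mod] V 17) (N 0)) mark_prog Skip;; 18 ::= V 18 [+] N 1) Q s'"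
   using pb wD xB I(1) rr env_regs(3,8)[OF I(4)] xe
   by (subst wp_Seq) (simp add: wp_Assign)
  then show ?case unfolding Q_def .
 next
  case (4 t s')
  then obtain w where I: "reg s' 18 = int w" "w \<le> q" "t \<le> (\<Sum>w'<w. 1 + offset_cost r T i q w')" "env s'"
   "marks (?S w) s'" "keep ?F s s'" by blast
  have "reg s' 17 = int q" using I(6) assms(5) by (simp add: keep_def)
  then have "w = q" using 4 I(1,2) by simp
  moreover have "?S q = S \<union> {u. int q dvd form i (pos r T u)}" using assms(7) by auto
  ultimately show ?case using I by simp
 qed
qed

lemma wp_forms_prog:
 assumes "env s" "reg s 9 = int r" "reg s 10 = int T" "reg s 17 = int q"
  "2 \<le> q" "q \<le> y" "marks S s" "r < M" "pos r T 0 \<le> hi"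
 shows "wp B forms_prog (\<lambda>t s'. t \<le> (\<Sum>i<k. 1 + (\<Sum>w<q. 1 + offset_cost r T i q w)) \<and> env s' \<and>
  marks (S \<union> {u. hits q (pos r T u)}) s' \<and> keep {12, 13, 14, 16, 18, 40, 41} s s') s"
proof -
 let ?F = "{12, 13, 14, 16, 18, 40, 41} :: nat set"
 let ?S = "\<lambda>i. S \<union> {u. \<exists>j<i. int q dvd form j (pos r T u)}"
 let ?c = "\<lambda>i. \<Sum>w<q. 1 + offset_cost r T i q w"
 let ?I = "\<lambda>t s'. \<exists>i. reg s' 14 = int i \<and> i \<le> k \<and> t \<le> (\<Sum>j<i. 1 + ?c j) \<and> env s' \<and> marks (?S i) s' \<and> keep ?F s s'"
 let ?f = "\<lambda>s'. k - nat (reg s' 14)"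
 show ?thesis
  unfolding forms_prog_def using small_B(5)
 proof (simp only: wp_Seq wp_Assign, simp del: sum.lessThan_Suc sum.distrib, intro wp_Loop[where I = ?I and f = ?f], goal_cases)
  case 1
  show ?case using assms by (intro exI[of _ 0]) (simp add: keep_def)
 next
  case (2 t s')
  then show ?case by simp
 next
  case (3 t s')
  then obtain i where I: "reg s' 14 = int i" "i \<le> k" "t \<le> (\<Sum>j<i. 1 + ?c j)" "env s'" "marks (?S i) s'" "keep ?F s s'" by blast
  have rr: "reg s' 9 = int r" "reg s' 10 = int T" "reg s' 17 = int q"
   using I(6) assms(2-4) by (simp_all add: keep_def)
  have ik: "i < k" using 3 I(1) env_regs(1)[OF I(4)] by simp
  have i1: "int i + 1 = int (Suc i)" by simp
  have iB: "int (Suc i) < B" using ik small_B by linarith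
  define Q where "Q = (\<lambda>t1 s''. ?I (Suc (t + t1)) s'' \<and> ?f s'' < ?f s')"
  have "wp B offsets_prog (\<lambda>t s''. t \<le> ?c i \<and> env s'' \<and>
   marks (?S i \<union> {u. int q dvd form i (pos r T u)}) s'' \<and> keep {12, 13, 16, 18, 40, 41} s' s'') s'"
   using I rr ik assms by (intro wp_offsets_prog) auto
  then have "wp B offsets_prog (\<lambda>t1. wp B (14 ::= V 14 [+] N 1) (\<lambda>t2. Q (t1 + t2))) s'"
  proof (elim wp_mono, goal_cases)
   case (1 t1 s2)
   have r2: "reg s2 14 = int i" using 1 I(1) by (simp add: keep_def)
   let ?s3 = "s2\<lparr>reg := (reg s2)(14 := int (Suc i))\<rparr>"
   have "Q t1 ?s3"
    unfolding Q_def
   proof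
    have "Suc (t + t1) \<le> (\<Sum>j<Suc i. 1 + ?c j)" using 1 I(3) by simp
    moreover have "?S (Suc i) = ?S i \<union> {u. int q dvd form i (pos r T u)}" by (auto simp: less_Suc_eq)
    moreover have "keep ?F s ?s3" using 1 I(6) by (auto simp: keep_def)
    moreover have "env ?s3" using 1 by simp
    ultimately show "?I (Suc (t + t1)) ?s3" using 1 ik by (intro exI[of _ "Suc i"] conjI) (simp_all del: sum.lessThan_Suc)
    show "?f ?s3 < ?f s'" using I(1) ik by simp
   qed
   then show ?case using r2 iB small_B(5) by (simp add: wp_Assign i1 del: of_nat_Suc)
  qed
  then have "wp B (offsets_prog;; 14 ::= V 14 [+] N 1) Q s'" by (simp only: wp_Seq)
  then show ?case unfolding Q_def .
 next
  case (4 t s')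
  then obtain i where I: "reg s' 14 = int i" "i \<le> k" "t \<le> (\<Sum>j<i. 1 + ?c j)" "env s'" "marks (?S i) s'" "keep ?F s s'" by blast
  have "i = k" using 4 I(1,2) env_regs(1)[OF I(4)] by simp
  moreover have "?S k = S \<union> {u. hits q (pos r T u)}" by (simp add: hits_def)
  ultimately show ?case using I by auto
 qed
qed

definition prime_cost :: "nat \<Rightarrow> nat \<Rightarrow> nat \<Rightarrow> nat" where
 "prime_cost r T q = 1 + q + (if prime q then \<Sum>i<k. 1 + (\<Sum>w<q. 1 + offset_cost r T i q w) else 0)"

lemma wp_sieve_prog:
 assumes "env s" "reg s 9 = int r" "reg s 10 = int T" "marks {} s" "r < M" "pos r T 0 \<le> hi"
 shows "wp B sieve_prog (\<lambda>t s'. t \<le> (\<Sum>q\<in>{2..<y + 1}. prime_cost r T q) \<and> env s' \<and>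
  marks {u. \<not> rough (pos r T u)} s' \<and> keep {12, 13, 14, 16, 17, 18, 20, 21, 22, 40, 41} s s') s"
proof -
 let ?F = "{12, 13, 14, 16, 17, 18, 20, 21, 22, 40, 41} :: nat set"
 let ?S = "\<lambda>q. {u. \<exists>p<q. prime p \<and> hits p (pos r T u)}"
 let ?I = "\<lambda>t s'. \<exists>q. reg s' 17 = int q \<and> 2 \<le> q \<and> q \<le> y + 1 \<and> t \<le> (\<Sum>q'\<in>{2..<q}. prime_cost r T q') \<and> env s' \<and>
  marks (?S q) s' \<and> keep ?F s s'"
 let ?f = "\<lambda>s'. y + 1 - nat (reg s' 17)"
 have S2: "?S 2 = {}" by (auto dest: prime_ge_2_nat)
 show ?thesis
  unfolding sieve_prog_def using small_B(5)
 proof (simp add: wp_Seq wp_Assign del: sum.op_ivl_Suc, intro wp_Loop[where I = ?I and f = ?f], goal_cases)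
  case 1
  have "marks (?S 2) s" unfolding S2 by (rule assms)
  then show ?case using assms(1) y_bounds(1) by (intro exI[of _ 2]) (simp add: keep_def)
 next
  case (2 t s')
  then obtain q where "env s'" by blast
  then show ?case using small_B env_regs(2)[of s'] by simp
 next
  case (3 t s')
  then obtain q where I: "reg s' 17 = int q" "2 \<le> q" "q \<le> y + 1" "t \<le> (\<Sum>q'\<in>{2..<q}. prime_cost r T q')" "env s'"
   "marks (?S q) s'" "keep ?F s s'" by blast
  have rr: "reg s' 9 = int r" "reg s' 10 = int T" using I(7) assms(2,3) by (simp_all add: keep_def)
  have qy: "q \<le> y" using 3 I(1) env_regs(2)[OF I(5)] by simp
  have i1: "int q + 1 = int (Suc q)" by simp
  have qB: "int (Suc q) < B" "int q + 10 < B" using qy small_B by linarith+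
  have S_Suc: "?S (Suc q) = ?S q \<union> (if prime q then {u. hits q (pos r T u)} else {})" by (auto simp: less_Suc_eq)
  define Q where "Q = (\<lambda>t1 s''. ?I (Suc (t + t1)) s'' \<and> ?f s'' < ?f s')"
  have Q: "Q t1 s''" if "reg s'' 17 = int (Suc q)" "t1 + 1 \<le> prime_cost r T q" "env s''" "marks (?S (Suc q)) s''" "keep ?F s s''" for t1 s''
   unfolding Q_def
  proof
   have "Suc (t + t1) \<le> (\<Sum>q'\<in>{2..<Suc q}. prime_cost r T q')" using that(2) I(2,4) by simp
   then show "?I (Suc (t + t1)) s''" using that I(2) qy by (intro exI[of _ "Suc q"] conjI) (simp_all del: sum.op_ivl_Suc)
   show "?f s'' < ?f s'" using that(1) I(1) qy by simp
  qed
  let ?s1 = "s'\<lparr>reg := (reg s')(20 := int q)\<rparr>"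
  have "wp B prime_prog (\<lambda>t s''. t \<le> q \<and> frame {21, 22} ?s1 s'' \<and> reg s'' 22 = of_bool (prime q)) ?s1"
   using I(2) qB by (intro wp_prime_prog) auto
  then have "wp B prime_prog (\<lambda>t1. wp B (Cond (Eq (V 22) (N 1)) forms_prog Skip;; 17 ::= V 17 [+] N 1) (\<lambda>t2. Q (t1 + t2))) ?s1"
  proof (elim wp_mono, goal_cases)
   case (1 t1 s2)
   then have fr: "frame {21, 22} ?s1 s2" and t1: "t1 \<le> q" and r22: "reg s2 22 = of_bool (prime q)" by auto
   have "env ?s1" using I(5) by simp
   then have e2: "env s2" using env_frame[OF _ fr] by simp
   have r2: "reg s2 17 = int q" "reg s2 9 = int r" "reg s2 10 = int T" using fr I(1) rr by (simp_all add: frame_def)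
   have k2: "keep ?F s s2" using fr I(7) by (auto simp: frame_def keep_def)
   have m2: "marks (?S q) s2" using marks_frame[OF fr] I(6) by simp
   show ?case
   proof (cases "prime q")
    case True
    have "wp B forms_prog (\<lambda>t s''. t \<le> (\<Sum>i<k. 1 + (\<Sum>w<q. 1 + offset_cost r T i q w)) \<and> env s'' \<and>
     marks (?S q \<union> {u. hits q (pos r T u)}) s'' \<and> keep {12, 13, 14, 16, 18, 40, 41} s2 s'') s2"
     using e2 r2 m2 I(2) qy assms(5,6) by (intro wp_forms_prog)
    then have "wp B forms_prog (\<lambda>t2. wp B (17 ::= V 17 [+] N 1) (\<lambda>t3. Q (t1 + (t2 + t3)))) s2"
    proof (elim wp_mono, goal_cases)
     case (1 t2 s3)
     have r3: "reg s3 17 = int q" using 1 r2 by (simp add: keep_def)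
     have "keep ?F s (s3\<lparr>reg := (reg s3)(17 := int (Suc q))\<rparr>)" using 1 k2 by (auto simp: keep_def)
     moreover have "t1 + t2 + 1 \<le> prime_cost r T q" using 1 t1 True unfolding prime_cost_def by simp
     ultimately have "Q (t1 + t2) (s3\<lparr>reg := (reg s3)(17 := int (Suc q))\<rparr>)"
      using 1 True S_Suc by (intro Q) simp_all
     then show ?case using r3 qB small_B(5) by (simp add: wp_Assign i1 del: of_nat_Suc)
    qed
    then show ?thesis using r22 True small_B(5) by (simp add: wp_Seq wp_Cond)
   next
    case False
    have "keep ?F s (s2\<lparr>reg := (reg s2)(17 := int (Suc q))\<rparr>)" using k2 by (auto simp: keep_def)
    then have "Q t1 (s2\<lparr>reg := (reg s2)(17 := int (Suc q))\<rparr>)"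
     using e2 m2 False S_Suc t1 by (intro Q) (simp_all add: prime_cost_def)
    then show ?thesis using r22 False r2 qB small_B(5) by (simp add: wp_simps i1 del: of_nat_Suc)
   qed
  qed
  moreover have "int q < B" using qB by linarith
  ultimately have "wp B (20 ::= V 17;; prime_prog;; Cond (Eq (V 22) (N 1)) forms_prog Skip;; 17 ::= V 17 [+] N 1) Q s'"
   using I(1) by (simp add: wp_Seq wp_Assign)
  then show ?case unfolding Q_def .
 next
  case (4 t s')
  then obtain q where I: "reg s' 17 = int q" "2 \<le> q" "q \<le> y + 1" "t \<le> (\<Sum>q'\<in>{2..<q}. prime_cost r T q')" "env s'"
   "marks (?S q) s'" "keep ?F s s'" by blast
  have q: "q = y + 1" using 4 I(1,3) env_regs(2)[OF I(5)] by simp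
  have "?S q = {u. \<not> rough (pos r T u)}" unfolding q rough_def by (auto simp: less_Suc_eq_le)
  then show ?case using I q by (simp del: sum.op_ivl_Suc)
 qed
qed

definition survivors :: "nat \<Rightarrow> nat \<Rightarrow> nat \<Rightarrow> nat set" where
 "survivors r T c = {u. u < c \<and> pos r T u \<le> hi \<and> rough (pos r T u)}"

text \<open>Skipping marked positions is sound, as they are not rough and hence hold no tuple of
  primes; only rough positions within the range pay for tests.\<close>

lemma wp_scan_prog:
 assumes "env s" "reg s 9 = int r" "reg s 10 = int T" "marks {u. \<not> rough (pos r T u)} s" "r < M" "pos r T 0 \<le> hi"
 shows "wp B (scan_prog K) (\<lambda>t s'. t \<le> D + card (survivors r T D) * (k * (test_cost + 1)) \<and> env s' \<and>
  set (printed s') = set (printed s) \<union> {x. \<exists>u<D. x = pos r T u \<and> x \<le> hi \<and> allprime x} \<and>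
  reg s' 9 = int r \<and> reg s' 10 = int T) s"
proof -
 let ?S = "{u. \<not> rough (pos r T u)}"
 let ?c = "k * (test_cost + 1)"
 let ?P = "\<lambda>v. set (printed s) \<union> {x. \<exists>u<v. x = pos r T u \<and> x \<le> hi \<and> allprime x}"
 let ?I = "\<lambda>t s'. \<exists>v. reg s' 12 = int v \<and> v \<le> D \<and> t \<le> v + card (survivors r T v) * ?c \<and> env s' \<and>
  set (printed s') = ?P v \<and> marks ?S s' \<and> reg s' 9 = int r \<and> reg s' 10 = int T"
 let ?f = "\<lambda>s'. D - nat (reg s' 12)"
 have finS: "finite (survivors r T v)" for v
  by (rule finite_subset[of _ "{..<v}"]) (auto simp: survivors_def)
 show ?thesis
  unfolding scan_prog_def using small_B(5)
 proof (simp add: wp_Seq wp_Assign del: mult_Suc_right, intro wp_Loop[where I = ?I and f = ?f], goal_cases)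
  case 1
  show ?case using assms by (intro exI[of _ 0]) simp
 next
  case (2 t s')
  then show ?case by simp
 next
  case (3 t s')
  then obtain v where I: "reg s' 12 = int v" "v \<le> D" "t \<le> v + card (survivors r T v) * ?c" "env s'"
   "set (printed s') = ?P v" "marks ?S s'" "reg s' 9 = int r" "reg s' 10 = int T" by blast
  have v: "v < D" using 3 I(1) env_regs(4)[OF I(4)] by simp
  note pb = pos_bounds[OF assms(5,6) less_imp_le[OF v]]
  define x where "x = pos r T v"
  have xe: "x0 + int r + int M * (int T + int v) = x" by (simp add: x_def pos_def)
  have xB: "\<bar>x\<bar> < B" using pb(7) xe by simp
  have i1: "int v + 1 = int (Suc v)" by simp
  have vB: "int (Suc v) < B" "int base + int v < B" using v small_B by linarith+
  have P_Suc: "?P (Suc v) = ?P v \<union> (if x \<le> hi \<and> allprime x then {x} else {})"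
   by (auto simp: less_Suc_eq x_def)
  have S_Suc: "survivors r T (Suc v) = (if x \<le> hi \<and> rough x then insert v (survivors r T v) else survivors r T v)"
   by (auto simp: survivors_def less_Suc_eq x_def)
  have vnot: "v \<notin> survivors r T v" by (simp add: survivors_def)
  have nat: "nat (int base + int v) = base + v" by simp
  have cells: "max (cells s') (Suc (base + v)) \<le> base + D" using I(4) v by (simp add: env_def)
  define Q where "Q = (\<lambda>t1 s''. ?I (Suc (t + t1)) s'' \<and> ?f s'' < ?f s')"
  have Q: "Q t1 s''" if "reg s'' 12 = int (Suc v)" "t1 \<le> (if x \<le> hi \<and> rough x then ?c else 0)" "env s''"
   "set (printed s'') = ?P (Suc v)" "marks ?S s''" "reg s'' 9 = int r" "reg s'' 10 = int T" for t1 s''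
   unfolding Q_def
  proof
   have "card (survivors r T (Suc v)) * ?c = card (survivors r T v) * ?c + (if x \<le> hi \<and> rough x then ?c else 0)"
    using S_Suc vnot finS[of v] by simp
   then have "Suc (t + t1) \<le> Suc v + card (survivors r T (Suc v)) * ?c" using that(2) I(3) by linarith
   then show "?I (Suc (t + t1)) s''" using that v by (intro exI[of _ "Suc v"] conjI) (simp_all only: Suc_le_eq)
   show "?f s'' < ?f s'" using that(1) I(1) v by simp
  qed
  have mv: "mem s' (base + v) = of_bool (\<not> rough x)" using I(6) v by (simp add: marks_def x_def)
  let ?mv = "of_bool (\<not> rough x) :: int"
  let ?s1 = "s'\<lparr>reg := (reg s')(49 := ?mv), cells := max (cells s') (Suc (base + v))\<rparr>"
  have e1: "env ?s1" using I(4) cells by (simp add: env_def input_ok_def le_max_iff_disj)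
  let ?tail = "12 ::= V 12 [+] N 1"
  let ?test = "tests_prog K;; Cond (Eq (V 15) (N 1)) (Print (V 13)) Skip"
  have step: "wp B ?tail (\<lambda>t2. Q (t1 + t2)) s2"
   if "reg s2 12 = int v" "t1 \<le> (if x \<le> hi \<and> rough x then ?c else 0)" "env s2"
   "set (printed s2) = ?P (Suc v)" "marks ?S s2" "reg s2 9 = int r" "reg s2 10 = int T" for t1 s2
  proof -
   have "Q t1 (s2\<lparr>reg := (reg s2)(12 := int (Suc v))\<rparr>)" by (rule Q) (use that in simp_all)
   then show ?thesis using that(1) vB small_B(5) by (simp add: wp_Assign i1 del: of_nat_Suc)
  qed
  have "wp B (Cond (Eq (V 49) (N 0))
     (13 ::= V 8 [+] V 9 [+] V 3 [*] (V 10 [+] V 12);; Cond (Lt (V 7) (V 13)) Skip ?test) Skip;; ?tail) Q ?s1"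
  proof (cases "rough x")
   case False
   then have "\<not> allprime x" using allprime_rough[of x] pb(1) by (auto simp: x_def)
   then have "wp B ?tail (\<lambda>t2. Q (0 + t2)) ?s1"
    by (intro step) (use False I e1 P_Suc in \<open>simp_all add: marks_def\<close>)
   then show ?thesis using False small_B(5) by (simp add: wp_Seq wp_Cond wp_Skip)
  next
   case True
   let ?s2 = "?s1\<lparr>reg := (reg ?s1)(13 := x)\<rparr>"
   have e2: "env ?s2" using e1 by (simp add: env_def input_ok_def)
   have m2: "marks ?S ?s2" using I(6) by (simp add: marks_def)
   have "wp B (Cond (Lt (V 7) (V 13)) Skip ?test;; ?tail) Q ?s2"
   proof (cases "hi < x")
    case T: True
    then have "wp B ?tail (\<lambda>t2. Q (0 + t2)) ?s2"
     by (intro step) (use I e2 m2 P_Suc in simp_all)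
    then show ?thesis using T env_regs(7)[OF e2] by (simp add: wp_Seq wp_Cond wp_Skip)
   next
    case F: False
    have "wp B (tests_prog K) (\<lambda>t s'. t \<le> ?c \<and>
     frame ({14, 15, 16, 40, 41} \<union> {20..39} \<union> {42..45}) ?s2 s' \<and> reg s' 15 = of_bool (allprime x)) ?s2"
     using e2 F True pb(1) by (intro wp_tests_prog) (simp_all add: x_def)
    then have "wp B (tests_prog K) (\<lambda>t1. wp B (Cond (Eq (V 15) (N 1)) (Print (V 13)) Skip) (\<lambda>t2. wp B ?tail (\<lambda>t3. Q (t1 + t2 + t3)))) ?s2"
    proof (elim wp_mono, goal_cases)
     case (1 t1 s3)
     then have fr: "frame ({14, 15, 16, 40, 41} \<union> {20..39} \<union> {42..45}) ?s2 s3" and t1: "t1 \<le> ?c"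
      and r15: "reg s3 15 = of_bool (allprime x)" by auto
     have e3: "env s3" by (rule env_frame[OF e2 fr]) auto
     have m3: "marks ?S s3" using marks_frame[OF fr] m2 by simp
     have r3: "reg s3 12 = int v" "reg s3 9 = int r" "reg s3 10 = int T" "reg s3 13 = x" "printed s3 = printed s'"
      using fr I by (simp_all add: frame_def)
     have A: "wp B ?tail (\<lambda>t3. Q (t1 + t3)) s3" if "\<not> allprime x"
      by (rule step) (use that t1 r3 e3 m3 P_Suc I(5) True F in simp_all)
     have A': "wp B ?tail (\<lambda>t3. Q (t1 + t3)) (s3\<lparr>printed := printed s3 @ [x]\<rparr>)" if "allprime x"
      by (rule step) (use that t1 r3 e3 m3 P_Suc I(5) True F in simp_all)
     show ?case using A A' r15 r3(4) small_B(5) by (cases "allprime x") (simp_all add: wp_Cond wp_Print wp_Skip)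
    qed
    then show ?thesis using F env_regs(7)[OF e2] by (simp add: wp_Seq wp_Cond)
   qed
   moreover have "reg ?s1 8 = x0" "reg ?s1 3 = int M" using env_regs(3,8)[OF e1] by auto
   ultimately show ?thesis using True small_B(5) pb xB xe I(1,7,8)
    by (simp add: wp_Seq wp_Cond wp_Assign)
  qed
  moreover have "\<bar>?mv\<bar> < B" using small_B(5) by simp
  ultimately have "wp B (Get 49 (V 19 [+] V 12);; Cond (Eq (V 49) (N 0))
     (13 ::= V 8 [+] V 9 [+] V 3 [*] (V 10 [+] V 12);; Cond (Lt (V 7) (V 13)) Skip ?test) Skip;; ?tail) Q s'"
   using I(1) env_regs(9)[OF I(4)] vB by (subst wp_Seq) (simp add: wp_Get nat mv split del: split_of_bool)
  then show ?case unfolding Q_def .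
 next
  case (4 t s')
  then obtain v where I: "reg s' 12 = int v" "v \<le> D" "t \<le> v + card (survivors r T v) * ?c" "env s'"
   "set (printed s') = ?P v" "marks ?S s'" "reg s' 9 = int r" "reg s' 10 = int T" by blast
  have "v = D" using 4 I(1,2) env_regs(4)[OF I(4)] by simp
  then show ?case using I by simp
 qed
qed

end

context sieve_run
begin

text \<open>In order: trial division and offset search, marking, rounding, and primes dividing a
  leading coefficient. The sum of \<open>y * y div q\<close> is what makes a segment cost
  \<open>y^2 * ln (ln n)\<close>.\<close>

definition sieve_ticks :: nat where
 "sieve_ticks = (k + 1) * (y * (y + 1)) + k * (\<Sum>q | prime q \<and> q \<le> y. y * y div q) + k * y +
   2 * (y * y) * (\<Sum>i<k. nat (a i))"

definition total_ticks :: "nat \<Rightarrow> int \<Rightarrow> int \<Rightarrow> nat" where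
 "total_ticks m lo hi = (let M = primorial m; x0 = lo + int y in
   K + y * (K + 1) + (y + 1) * (y + 1) + bound_cost + k +
   y * (k * ((\<Sum>i<k. nat (form i x0)) + 1) + 1) + M * (1 + k * (y + 1)) +
   card {r. r < M \<and> (avoids_below m (x0 + int r))} *
    ((nat (hi - x0) div (M * (y * y)) + 1) * (1 + 2 * (y * y) + sieve_ticks)) +
   card {x \<in> {x0..hi}. avoids_upto y x} * (k * (test_cost + 1)))"

end

context sieve_phase
begin

section \<open>Cost of a segment and of all classes\<close>

lemma pos_shift: "pos r T u = pos r 0 (T + u)"
 by (simp add: pos_def algebra_simps)

lemma wp_block_prog:
 assumes "env s" "reg s 9 = int r" "reg s 10 = int T" "r < M" "pos r T 0 \<le> hi"
 shows "wp B (block_prog K) (\<lambda>t s'. t \<le> 2 * D + (\<Sum>q\<in>{2..<y + 1}. prime_cost r T q) +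
   card (survivors r T D) * (k * (test_cost + 1)) \<and> env s' \<and>
  set (printed s') = set (printed s) \<union> {x. \<exists>u<D. x = pos r T u \<and> x \<le> hi \<and> allprime x} \<and>
  reg s' 9 = int r \<and> reg s' 10 = int T) s" (is "wp B _ ?Q s")
proof -
 have "wp B clear_prog (\<lambda>t1. wp B sieve_prog (\<lambda>t2. wp B (scan_prog K) (\<lambda>t3. ?Q (t1 + (t2 + t3))))) s"
 proof (rule wp_mono[OF wp_clear_prog[OF assms(1)]], goal_cases)
  case (1 t1 s1)
  have r1: "reg s1 9 = int r" "reg s1 10 = int T" "printed s1 = printed s"
   using 1 assms by (simp_all add: keep_def)
  have "wp B sieve_prog (\<lambda>t s'. t \<le> (\<Sum>q\<in>{2..<y + 1}. prime_cost r T q) \<and> env s' \<and>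
   marks {u. \<not> rough (pos r T u)} s' \<and> keep {12, 13, 14, 16, 17, 18, 20, 21, 22, 40, 41} s1 s') s1"
   using 1 r1 assms by (intro wp_sieve_prog) auto
  then show ?case
  proof (rule wp_mono, goal_cases)
   case (1 t2 s2)
   have r2: "reg s2 9 = int r" "reg s2 10 = int T" "printed s2 = printed s"
    using 1 r1 by (simp_all add: keep_def)
   have "wp B (scan_prog K) (\<lambda>t s'. t \<le> D + card (survivors r T D) * (k * (test_cost + 1)) \<and> env s' \<and>
    set (printed s') = set (printed s2) \<union> {x. \<exists>u<D. x = pos r T u \<and> x \<le> hi \<and> allprime x} \<and>
    reg s' 9 = int r \<and> reg s' 10 = int T) s2"
    using 1 r2 assms by (intro wp_scan_prog) auto
   then show ?case
   proof (rule wp_mono, goal_cases)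
    case (1 t3 s3)
    then show ?case using r2 \<open>t1 \<le> D \<and> _\<close> \<open>t2 \<le> _ \<and> _\<close> by (intro conjI) (auto simp del: sum.op_ivl_Suc)
   qed
  qed
 qed
 then show ?thesis unfolding block_prog_def wp_Seq .
qed

text \<open>If \<open>q\<close> divides \<open>M\<close>, a good class has no hit. If
  \<open>q\<close> divides the leading coefficient but not \<open>M\<close>, all offsets may hit, at
  a cost of at most \<open>2 * D\<close>. Otherwise \<open>a i * M\<close> is invertible modulo
  \<open>q\<close> and at most one offset hits.\<close>

lemma offset_cost_sum:
 assumes "good r" "i < k" "prime q" "q \<le> y"
 shows "(\<Sum>w<q. offset_cost r T i q w) \<le> D div q + 1 + (if int q dvd a i then 2 * D else 0)"
proof -
 let ?H = "{w. w < q \<and> int q dvd form i (pos r T w)}"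
 have q0: "2 \<le> q" using assms(3) by (rule prime_ge_2_nat)
 have sum: "(\<Sum>w<q. offset_cost r T i q w) = card ?H * (D div q + 1)"
  by (simp add: offset_cost_def sum.If_cases Int_def)
 have cq: "card ?H \<le> q" using card_mono[of "{..<q}" ?H] by auto
 have diff: "form i (pos r T w) - form i (pos r T v) = a i * int M * (int w - int v)" for w v
  by (simp add: form_def pos_def algebra_simps)
 consider "q dvd M" | "\<not> q dvd M" "int q dvd a i" | "\<not> q dvd M" "\<not> int q dvd a i" by blast
 then show ?thesis
 proof cases
  case 1
  have "form i (pos r T w) = form i (x0 + int r) + a i * int M * (int T + int w)" for w
   by (simp add: form_def pos_def algebra_simps)
  moreover have "int q dvd a i * int M * z" for z using 1 by simp
  ultimately have "int q dvd form i (pos r T w) \<longleftrightarrow> int q dvd form i (x0 + int r)" for w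
   by (simp add: dvd_add_left_iff)
  then have "?H = {}" using assms 1 q0 by (auto simp: good_def)
  then show ?thesis unfolding sum by (simp only: card.empty)
 next
  case 2
  have "q \<le> D" using assms(4) by (simp add: D_def le_square order_trans)
  have "card ?H * (D div q + 1) \<le> q * (D div q + 1)" using cq by (rule mult_le_mono1)
  also have "\<dots> \<le> D + q" by simp
  finally show ?thesis unfolding sum using 2 \<open>q \<le> D\<close> by simp
 next
  case 3
  have "w = v" if "w \<in> ?H" "v \<in> ?H" for w v
  proof -
   have "int q dvd a i * int M * (int w - int v)" unfolding diff[symmetric] using that by (intro dvd_diff) auto
   then have "int q dvd int w - int v"
    using 3 assms(3) by (simp add: prime_dvd_mult_iff)
   moreover have "\<bar>int w - int v\<bar> < int q" using that by auto
   ultimately show "w = v" using zdvd_imp_le[of "int q" "\<bar>int w - int v\<bar>"] by fastforce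
  qed
  then have "card ?H \<le> 1" by (intro card_le_Suc0_iff_eq[THEN iffD2, unfolded One_nat_def[symmetric]]) auto
  then have "card ?H * (D div q + 1) \<le> 1 * (D div q + 1)" by (rule mult_le_mono1)
  then show ?thesis unfolding sum by simp
 qed
qed

text \<open>A leading coefficient has at most \<open>a i\<close> prime divisors, so the case in
  which all offsets may hit adds only a constant of the pattern times \<open>D\<close>.\<close>

lemma sieve_ticks_bound:
 assumes "good r"
 shows "(\<Sum>q\<in>{2..<y + 1}. prime_cost r T q) \<le> sieve_ticks"
proof -
 let ?P = "{q. prime q \<and> q \<le> y}"
 have Ps: "{q \<in> {2..<y + 1}. prime q} = ?P" by (auto dest: prime_ge_2_nat)
 have finP: "finite ?P" by (rule finite_subset[of _ "{..y}"]) auto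
 have cP: "card ?P \<le> y"
 proof -
  have "?P \<subseteq> {1..y}" by (auto dest: prime_gt_0_nat simp: Suc_le_eq)
  then show ?thesis using card_mono[of "{1..y}" ?P] by simp
 qed
 define c where "c = (\<lambda>i q. if int q dvd a i then 2 * D else 0)"
 have inner: "(\<Sum>i<k. 1 + (\<Sum>w<q. 1 + offset_cost r T i q w)) \<le> k * (y + 1) + (k * (D div q) + k + (\<Sum>i<k. c i q))"
  if "q \<in> ?P" for q
 proof -
  have "(\<Sum>i<k. 1 + (\<Sum>w<q. 1 + offset_cost r T i q w)) \<le> (\<Sum>i<k. (y + 1) + (D div q + 1 + c i q))"
  proof (rule sum_mono)
   fix i assume "i \<in> {..<k}"
   then have "(\<Sum>w<q. offset_cost r T i q w) \<le> D div q + 1 + c i q"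
    using offset_cost_sum[of r i q T] assms that unfolding c_def by simp
   moreover have "(\<Sum>w<q. 1 + offset_cost r T i q w) = q + (\<Sum>w<q. offset_cost r T i q w)"
    by (simp only: sum.distrib) simp
   ultimately show "1 + (\<Sum>w<q. 1 + offset_cost r T i q w) \<le> (y + 1) + (D div q + 1 + c i q)"
    using that by simp
  qed
  also have "\<dots> = k * (y + 1) + (k * (D div q) + k + (\<Sum>i<k. c i q))"
   by (simp only: sum.distrib) (simp add: algebra_simps)
  finally show ?thesis .
 qed
 have "(\<Sum>q\<in>{2..<y + 1}. prime_cost r T q) =
   (\<Sum>q\<in>{2..<y + 1}. 1 + q) + (\<Sum>q\<in>?P. \<Sum>i<k. 1 + (\<Sum>w<q. 1 + offset_cost r T i q w))"
  unfolding prime_cost_def Ps[symmetric]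
  by (subst sum.distrib, subst sum.inter_filter[symmetric]) (simp_all del: sum.op_ivl_Suc)
 moreover have "(\<Sum>q\<in>{2..<y + 1}. 1 + q) \<le> y * (y + 1)"
 proof -
  have "(\<Sum>q\<in>{2..<y + 1}. 1 + q) \<le> of_nat (card {2..<y + 1}) * (y + 1)" by (rule sum_bounded_above) auto
  also have "\<dots> \<le> y * (y + 1)" by (intro mult_le_mono1) simp
  finally show ?thesis .
 qed
 moreover have "(\<Sum>q\<in>?P. \<Sum>i<k. 1 + (\<Sum>w<q. 1 + offset_cost r T i q w)) \<le>
   k * (y * (y + 1)) + k * (\<Sum>q\<in>?P. D div q) + k * y + 2 * D * (\<Sum>i<k. nat (a i))"
 proof -
  have "(\<Sum>q\<in>?P. \<Sum>i<k. 1 + (\<Sum>w<q. 1 + offset_cost r T i q w)) \<le>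
    (\<Sum>q\<in>?P. k * (y + 1) + (k * (D div q) + k + (\<Sum>i<k. c i q)))"
   by (rule sum_mono) (rule inner)
  also have "\<dots> = card ?P * (k * (y + 1)) + k * (\<Sum>q\<in>?P. D div q) + card ?P * k + (\<Sum>q\<in>?P. \<Sum>i<k. c i q)"
   by (simp add: sum.distrib sum_distrib_left del: mult_Suc_right)
  also have "card ?P * (k * (y + 1)) \<le> y * (k * (y + 1))" using cP by (rule mult_le_mono1)
  also have "card ?P * k \<le> y * k" using cP by (rule mult_le_mono1)
  also have "(\<Sum>q\<in>?P. \<Sum>i<k. c i q) \<le> 2 * D * (\<Sum>i<k. nat (a i))"
  proof -
   have "(\<Sum>q\<in>?P. c i q) \<le> 2 * D * nat (a i)" if "i < k" for i
   proof -
    have a0: "0 < a i" using a_pos that by simp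
    have "(\<Sum>q\<in>?P. c i q) = card {q\<in>?P. int q dvd a i} * (2 * D)"
     unfolding c_def by (subst sum.inter_filter[symmetric]) (use finP in simp_all)
    also have "{q\<in>?P. int q dvd a i} \<subseteq> {1..nat (a i)}"
     using a0 by (auto dest!: zdvd_imp_le dest: prime_gt_0_nat simp: Suc_le_eq)
    then have "card {q\<in>?P. int q dvd a i} * (2 * D) \<le> nat (a i) * (2 * D)"
     by (intro mult_le_mono1) (use card_mono[of "{1..nat (a i)}"] in fastforce)
    finally show ?thesis by (simp add: mult.commute)
   qed
   then have "(\<Sum>i<k. \<Sum>q\<in>?P. c i q) \<le> (\<Sum>i<k. 2 * D * nat (a i))" by (intro sum_mono) simp
   then show ?thesis by (subst sum.swap) (simp add: sum_distrib_left)
  qed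
  finally show ?thesis by (simp only: mult.left_commute[of y k] mult.commute[of y k])
 qed
 ultimately show ?thesis unfolding sieve_ticks_def D_def by (simp add: algebra_simps)
qed

definition blocks :: nat where "blocks = nat (hi - x0) div (M * D) + 1"

definition class_survivors :: "nat \<Rightarrow> nat set" where
 "class_survivors r = {u. pos r 0 u \<le> hi \<and> rough (pos r 0 u)}"

lemma pos_ge: "x0 + int u \<le> pos r 0 u"
proof -
 have "1 * int u \<le> int M * int u" using M_pos by (intro mult_right_mono) auto
 then show ?thesis unfolding pos_def by simp
qed

lemma finite_class_survivors: "finite (class_survivors r)"
proof (rule finite_subset)
 show "class_survivors r \<subseteq> {..nat (hi - x0)}"
 proof
  fix u assume "u \<in> class_survivors r"
  then show "u \<in> {..nat (hi - x0)}" using pos_ge[of u r] by (auto simp: class_survivors_def)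
 qed
qed simp

lemma D_pos: "0 < D" using y_bounds(1) by (simp add: D_def)

lemma wp_class_prog:
 assumes "env s" "reg s 9 = int r" "r < M" "good r"
 shows "wp B (class_prog K) (\<lambda>t s'. t \<le> blocks * (1 + 2 * D + sieve_ticks) +
   card (class_survivors r) * (k * (test_cost + 1)) \<and> env s' \<and>
  set (printed s') = set (printed s) \<union> {x. \<exists>u. x = pos r 0 u \<and> x \<le> hi \<and> allprime x} \<and>
  reg s' 9 = int r) s"
proof -
 define c where "c = k * (test_cost + 1)"
 define d where "d = 1 + 2 * D + sieve_ticks"
 let ?P = "\<lambda>T. set (printed s) \<union> {x. \<exists>u<T. x = pos r 0 u \<and> x \<le> hi \<and> allprime x}"
 let ?ok = "\<lambda>T. \<bar>x0 + int r + int M * int T\<bar> < B \<and> \<bar>int M * int T\<bar> < B \<and> int T < B"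
 let ?I = "\<lambda>t s'. \<exists>j. reg s' 10 = int (j * D) \<and> ?ok (j * D) \<and> j \<le> blocks \<and>
  t \<le> j * d + card (survivors r 0 (j * D)) * c \<and> env s' \<and>
  set (printed s') = ?P (j * D) \<and> reg s' 9 = int r"
 let ?f = "\<lambda>s'. nat (hi + 1 - (x0 + int r + int M * reg s' 10))"
 have xr: "\<bar>x0 + int r\<bar> < B"
 proof -
  have "\<bar>lo\<bar> \<le> 2 * W" using range by (simp add: range_ok_def)
  moreover have "int r < W" using assms(3) M_le y_bounds(3) by linarith
  ultimately have "\<bar>x0 + int r\<bar> \<le> 4 * W" using y_bounds(3) unfolding x0_def by linarith
  also have "\<dots> \<le> W ^ 2" using W(1) by (simp add: power2_eq_square)
  finally show ?thesis using pow_le_B(1)[of "\<bar>x0 + int r\<bar>" 2] by simp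
 qed
 have hiB: "\<bar>hi\<bar> + 1 < B"
 proof -
  have "\<bar>hi\<bar> \<le> 2 * W" using range by (simp add: range_ok_def)
  also have "\<dots> \<le> W ^ 2" using W(1) by (simp add: power2_eq_square)
  finally show ?thesis using pow_le_B(1)[of "\<bar>hi\<bar>" 2] by simp
 qed
 \<comment> \<open>Survivors add up over blocks, so tests are charged by their total number in the
   class and not by a worst case per block.\<close>
 have surv: "card (survivors r 0 (T + D)) = card (survivors r 0 T) + card (survivors r T D)" for T
 proof -
  have "survivors r 0 (T + D) = survivors r 0 T \<union> (+) T ` survivors r T D"
  proof (intro equalityI subsetI)
   fix u assume u: "u \<in> survivors r 0 (T + D)"
   show "u \<in> survivors r 0 T \<union> (+) T ` survivors r T D"
   proof (cases "u < T")
    case False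
    then have "u - T \<in> survivors r T D" "u = T + (u - T)"
     using u pos_shift[of r T "u - T"] by (auto simp: survivors_def)
    then show ?thesis by blast
   qed (use u in \<open>auto simp: survivors_def\<close>)
  next
   fix u assume "u \<in> survivors r 0 T \<union> (+) T ` survivors r T D"
   then show "u \<in> survivors r 0 (T + D)" using pos_shift[of r T] by (auto simp: survivors_def)
  qed
  moreover have "survivors r 0 T \<inter> (+) T ` survivors r T D = {}" by (auto simp: survivors_def)
  moreover have "finite (survivors r T' v)" for T' v
   by (rule finite_subset[of _ "{..<v}"]) (auto simp: survivors_def)
  ultimately show ?thesis by (simp add: card_Un_disjoint card_image)
 qed
 have P_Suc: "?P (T + D) = ?P T \<union> {x. \<exists>u<D. x = pos r T u \<and> x \<le> hi \<and> allprime x}" for T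
 proof -
  have "(\<exists>u<T + D. x = pos r 0 u \<and> R x) \<longleftrightarrow> (\<exists>u<T. x = pos r 0 u \<and> R x) \<or> (\<exists>u<D. x = pos r T u \<and> R x)" for x and R :: "int \<Rightarrow> bool"
  proof
   assume "\<exists>u<T + D. x = pos r 0 u \<and> R x"
   then obtain u where u: "u < T + D" "x = pos r 0 u" "R x" by blast
   show "(\<exists>u<T. x = pos r 0 u \<and> R x) \<or> (\<exists>u<D. x = pos r T u \<and> R x)"
   proof (cases "u < T")
    case False
    then have "u - T < D" "x = pos r T (u - T)" using u pos_shift[of r T "u - T"] by auto
    then show ?thesis using u by blast
   qed (use u in blast)
  next
   assume "(\<exists>u<T. x = pos r 0 u \<and> R x) \<or> (\<exists>u<D. x = pos r T u \<and> R x)"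
   then show "\<exists>u<T + D. x = pos r 0 u \<and> R x"
   proof
    assume "\<exists>u<D. x = pos r T u \<and> R x"
    then obtain u where "u < D" "x = pos r T u" "R x" by blast
    then show ?thesis using pos_shift[of r T u] by (intro exI[of _ "T + u"]) auto
   qed (auto intro: less_trans trans_less_add1)
  qed
  from this[of _ "\<lambda>x. x \<le> hi \<and> allprime x"] show ?thesis by blast
 qed
 show ?thesis
  unfolding class_prog_def c_def[symmetric] d_def[symmetric] using small_B(5)
 proof (simp add: wp_Seq wp_Assign, intro wp_Loop[where I = ?I and f = ?f], goal_cases)
  case 1
  show ?case using assms xr by (intro exI[of _ 0]) simp
 next
  case (2 t s')
  then obtain j where "env s'" "reg s' 10 = int (j * D)" "?ok (j * D)" "reg s' 9 = int r" by blast
  moreover have "hi + 1 < B" "- hi - 1 < B" using hiB by linarith+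
  ultimately show ?case using env_regs(3,7,8)[of s'] xr small_B(5) by (simp only: safe_test.simps safe.simps aval.simps) (simp add: abs_less_iff)
 next
  case (3 t s')
  then obtain j where I: "reg s' 10 = int (j * D)" "?ok (j * D)" "j \<le> blocks"
   "t \<le> j * d + card (survivors r 0 (j * D)) * c" "env s'"
   "set (printed s') = ?P (j * D)" "reg s' 9 = int r" by blast
  define T where "T = j * D"
  have T': "Suc j * D = T + D" "int T + int D = int (T + D)" by (simp_all add: T_def)
  have rT: "reg s' 10 = int T" using I(1) by (simp add: T_def)
  have "x0 + int r + int M * int T < hi + 1" using 3 rT I(7) env_regs(3,7,8)[OF I(5)] by simp
  then have le: "pos r T 0 \<le> hi" by (simp add: pos_def)
  note pb = pos_bounds[OF assms(3) le le_refl]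
  have ok: "?ok (T + D)" using pb(3,7,8) by simp
  have "int M * int T \<le> hi - x0" using le by (simp add: pos_def)
  then have "int (M * T) \<le> int (nat (hi - x0))" by (simp add: le_nat_iff)
  then have "M * T \<le> nat (hi - x0)" by (simp only: of_nat_le_iff)
  then have "j * (M * D) \<le> nat (hi - x0)" by (simp add: T_def mult_ac)
  then have j: "Suc j \<le> blocks" using M_pos D_pos by (simp add: blocks_def less_eq_div_iff_mult_less_eq)
  define Q where "Q = (\<lambda>t1 s''. ?I (Suc (t + t1)) s'' \<and> ?f s'' < ?f s')"
  have Q: "Q t1 s''" if "reg s'' 10 = int (T + D)" "t1 + 1 \<le> d + card (survivors r T D) * c" "env s''"
   "set (printed s'') = ?P (T + D)" "reg s'' 9 = int r" for t1 s''
   unfolding Q_def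
  proof
   have "Suc (t + t1) \<le> Suc j * d + card (survivors r 0 (Suc j * D)) * c"
    using that(2) I(4) surv[of T] unfolding T'(1) T_def[symmetric] by (simp add: add_mult_distrib)
   then show "?I (Suc (t + t1)) s''" using that ok j
    unfolding T'(1)[symmetric] by (intro exI[of _ "Suc j"] conjI) (simp_all only: simp_thms)
   have "int M * int T < int M * int (T + D)" using M_pos D_pos by simp
   then show "?f s'' < ?f s'" using that(1) rT \<open>x0 + int r + int M * int T < hi + 1\<close> by simp
  qed
  have "wp B (block_prog K) (\<lambda>t s''. t \<le> 2 * D + (\<Sum>q\<in>{2..<y + 1}. prime_cost r T q) +
    card (survivors r T D) * c \<and> env s'' \<and>
   set (printed s'') = set (printed s') \<union> {x. \<exists>u<D. x = pos r T u \<and> x \<le> hi \<and> allprime x} \<and>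
   reg s'' 9 = int r \<and> reg s'' 10 = int T) s'"
   unfolding c_def using I rT le assms by (intro wp_block_prog)
  then have "wp B (block_prog K) (\<lambda>t1. wp B (10 ::= V 10 [+] V 4) (\<lambda>t2. Q (t1 + t2))) s'"
  proof (rule wp_mono, goal_cases)
   case (1 t1 s2)
   have "t1 + 1 \<le> d + card (survivors r T D) * c"
    using 1 sieve_ticks_bound[OF assms(4), of T] unfolding d_def by linarith
   then have "Q t1 (s2\<lparr>reg := (reg s2)(10 := int (T + D))\<rparr>)"
    using 1 P_Suc[of T] I(6) by (intro Q) (simp_all add: T_def[symmetric])
   then show ?case using 1 env_regs(4)[of s2] ok by (simp add: wp_Assign T'(2) del: of_nat_add)
  qed
  then have "wp B (block_prog K;; 10 ::= V 10 [+] V 4) Q s'" unfolding wp_Seq .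
  then show ?case unfolding Q_def .
 next
  case (4 t s')
  then obtain j where I: "reg s' 10 = int (j * D)" "j \<le> blocks"
   "t \<le> j * d + card (survivors r 0 (j * D)) * c" "env s'"
   "set (printed s') = ?P (j * D)" "reg s' 9 = int r" by blast
  have "\<not> x0 + int r + int M * int (j * D) < hi + 1" using 4 I env_regs(3,7,8)[OF I(4)] by simp
  then have "hi < pos r 0 (j * D)" by (simp add: pos_def)
  moreover have "pos r 0 (j * D) \<le> pos r 0 u" if "j * D \<le> u" for u
  proof -
   have "int (j * D) \<le> int u" using that by (simp only: of_nat_le_iff)
   then have "int M * int (j * D) \<le> int M * int u" by (intro mult_left_mono) auto
   then show ?thesis by (simp add: pos_def)
  qed
  ultimately have u: "u < j * D" if "pos r 0 u \<le> hi" for u using that by (meson leI le_less_trans not_le)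
  have "survivors r 0 (j * D) \<subseteq> class_survivors r" by (auto simp: survivors_def class_survivors_def)
  then have "card (survivors r 0 (j * D)) * c \<le> card (class_survivors r) * c"
   by (intro mult_le_mono1 card_mono finite_class_survivors)
  moreover have "j * d \<le> blocks * d" using I(2) by (rule mult_le_mono1)
  ultimately have "t \<le> blocks * d + card (class_survivors r) * c" using I(3) by linarith
  moreover have "?P (j * D) = set (printed s) \<union> {x. \<exists>u. x = pos r 0 u \<and> x \<le> hi \<and> allprime x}"
   using u by blast
  ultimately show ?case using I(4-6) by simp
 qed
qed

lemma wp_classes_prog:
 assumes "env s"
 shows "wp B (classes_prog K) (\<lambda>t s'. t \<le> M * (1 + k * (y + 1)) +
   card {r. r < M \<and> good r} * (blocks * (1 + 2 * D + sieve_ticks)) +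
   (\<Sum>r<M. card (class_survivors r)) * (k * (test_cost + 1)) \<and> env s' \<and>
  set (printed s') = set (printed s) \<union> {x. \<exists>r<M. \<exists>u. x = pos r 0 u \<and> x \<le> hi \<and> allprime x}) s"
proof -
 define c where "c = k * (test_cost + 1)"
 define d where "d = blocks * (1 + 2 * D + sieve_ticks)"
 define g where "g = 1 + k * (y + 1)"
 let ?P = "\<lambda>r. set (printed s) \<union> {x. \<exists>r'<r. \<exists>u. x = pos r' 0 u \<and> x \<le> hi \<and> allprime x}"
 let ?I = "\<lambda>t s'. \<exists>r. reg s' 9 = int r \<and> r \<le> M \<and>
  t \<le> r * g + card {r'. r' < r \<and> good r'} * d + (\<Sum>r'<r. card (class_survivors r')) * c \<and> env s' \<and>
  set (printed s') = ?P r"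
 let ?f = "\<lambda>s'. M - nat (reg s' 9)"
 show ?thesis
  unfolding classes_prog_def c_def[symmetric] d_def[symmetric] g_def[symmetric] using small_B(5)
 proof (simp add: wp_Seq wp_Assign, intro wp_Loop[where I = ?I and f = ?f], goal_cases)
  case 1
  show ?case using assms by (intro exI[of _ 0]) simp
 next
  case (2 t s')
  then show ?case by simp
 next
  case (3 t s')
  then obtain r where I: "reg s' 9 = int r" "r \<le> M"
   "t \<le> r * g + card {r'. r' < r \<and> good r'} * d + (\<Sum>r'<r. card (class_survivors r')) * c" "env s'"
   "set (printed s') = ?P r" by blast
  have r: "r < M" using 3 I(1) env_regs(3)[OF I(4)] by simp
  have i1: "int r + 1 = int (Suc r)" by simp
  have rB: "int (Suc r) < B" using r small_B(6) by linarith
  have P_Suc: "?P (Suc r) = ?P r \<union> {x. \<exists>u. x = pos r 0 u \<and> x \<le> hi \<and> allprime x}"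
   by (auto simp: less_Suc_eq)
  have G_Suc: "card {r'. r' < Suc r \<and> good r'} = card {r'. r' < r \<and> good r'} + of_bool (good r)"
  proof -
   have "{r'. r' < Suc r \<and> good r'} = (if good r then insert r {r'. r' < r \<and> good r'} else {r'. r' < r \<and> good r'})"
    by (auto simp: less_Suc_eq)
   then show ?thesis by simp
  qed
  \<comment> \<open>A divisor \<open>q\<close> of \<open>M\<close> that divides a form at the
    representative divides it throughout the class, and all values exceed \<open>q\<close>; a
    discarded class contains no solution.\<close>
  have bad: "{x. \<exists>u. x = pos r 0 u \<and> x \<le> hi \<and> allprime x} = {}" if ng: "\<not> good r"
  proof -
   obtain i q where q: "i < k" "2 \<le> q" "q \<le> y" "q dvd M" "int q dvd form i (x0 + int r)"
    using ng by (auto simp: good_def)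
   have False if "allprime (pos r 0 u)" for u
   proof -
    have "form i (pos r 0 u) = form i (x0 + int r) + a i * int M * int u"
     by (simp add: form_def pos_def algebra_simps)
    then have "int q dvd form i (pos r 0 u)" using q(4,5) by simp
    moreover have "prime (form i (pos r 0 u))" using that q(1) by (simp add: allprime_def)
    ultimately have "int q = 1 \<or> int q = form i (pos r 0 u)"
     unfolding prime_int_iff by (metis of_nat_0_le_iff)
    moreover have "int y + 2 \<le> form i (pos r 0 u)"
     using pos_ge[of u r] by (intro form_x0 q(1)) simp
    ultimately show False using q(2,3) by linarith
   qed
   then show ?thesis by blast
  qed
  define Q where "Q = (\<lambda>t1 s''. ?I (Suc (t + t1)) s'' \<and> ?f s'' < ?f s')"
  have Q: "Q t1 s''" if "reg s'' 9 = int (Suc r)" "env s''"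
   "t1 + 1 \<le> g + of_bool (good r) * d + card (class_survivors r) * c"
   "set (printed s'') = ?P (Suc r)" for t1 s''
   unfolding Q_def
  proof
   have "Suc (t + t1) \<le> Suc r * g + card {r'. r' < Suc r \<and> good r'} * d + (\<Sum>r'<Suc r. card (class_survivors r')) * c"
    using that(3) I(3) unfolding G_Suc sum.lessThan_Suc add_mult_distrib mult_Suc by linarith
   then show "?I (Suc (t + t1)) s''" using that r by (intro exI[of _ "Suc r"] conjI) (simp_all only: Suc_le_eq)
   show "?f s'' < ?f s'" using that(1) I(1) r by simp
  qed
  have tail: "wp B (9 ::= V 9 [+] N 1) (\<lambda>t2. Q (t1 + t2)) s2"
   if "reg s2 9 = int r" "env s2" "t1 + 1 \<le> g + of_bool (good r) * d + card (class_survivors r) * c"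
   "set (printed s2) = ?P (Suc r)" for t1 s2
  proof -
   have "Q t1 (s2\<lparr>reg := (reg s2)(9 := int (Suc r))\<rparr>)" by (rule Q) (use that in simp_all)
   then show ?thesis using that(1) rB small_B(5) by (simp add: wp_Assign i1 del: of_nat_Suc)
  qed
  have "wp B good_prog (\<lambda>t1. wp B (Cond (Eq (V 11) (N 1)) (class_prog K) Skip)
    (\<lambda>t2. wp B (9 ::= V 9 [+] N 1) (\<lambda>t3. Q (t1 + (t2 + t3))))) s'"
  proof (rule wp_mono[OF wp_good_prog[OF I(4) I(1) r]], goal_cases)
   case (1 t1 s1)
   then have fr: "frame {11, 13, 14, 16, 17, 40, 41} s' s1" and t1: "t1 + 1 \<le> g"
    and r11: "reg s1 11 = of_bool (good r)" by (auto simp: g_def)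
   have e1: "env s1" by (rule env_frame[OF I(4) fr]) auto
   have r1: "reg s1 9 = int r" "printed s1 = printed s'" using fr I(1) by (simp_all add: frame_def)
   show ?case
   proof (cases "good r")
    case True
    have "wp B (class_prog K) (\<lambda>t2. wp B (9 ::= V 9 [+] N 1) (\<lambda>t3. Q (t1 + (t2 + t3)))) s1"
    proof (rule wp_mono[OF wp_class_prog[OF e1 r1(1) r True]], goal_cases)
     case (1 t2 s2)
     have "wp B (9 ::= V 9 [+] N 1) (\<lambda>t3. Q (t1 + t2 + t3)) s2"
     proof (rule tail)
      show "t1 + t2 + 1 \<le> g + of_bool (good r) * d + card (class_survivors r) * c"
       using 1 t1 True unfolding c_def d_def by simp
      show "set (printed s2) = ?P (Suc r)" unfolding P_Suc using 1 r1(2) I(5) by simp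
     qed (use 1 in simp_all)
     then show ?case by (simp only: add.assoc)
    qed
    then show ?thesis using r11 True small_B(5) by (simp add: wp_Cond)
   next
    case False
    have "wp B (9 ::= V 9 [+] N 1) (\<lambda>t3. Q (t1 + t3)) s1"
    proof (rule tail)
     show "set (printed s1) = ?P (Suc r)" unfolding P_Suc bad[OF False] using r1(2) I(5) by simp
    qed (use t1 r1 e1 in simp_all)
    then show ?thesis using r11 False small_B(5) by (simp add: wp_Cond wp_Skip)
   qed
  qed
  then have "wp B (good_prog;; Cond (Eq (V 11) (N 1)) (class_prog K) Skip;; 9 ::= V 9 [+] N 1) Q s'"
   unfolding wp_Seq .
  then show ?case unfolding Q_def .
 next
  case (4 t s')
  then obtain r where I: "reg s' 9 = int r" "r \<le> M"
   "t \<le> r * g + card {r'. r' < r \<and> good r'} * d + (\<Sum>r'<r. card (class_survivors r')) * c" "env s'"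
   "set (printed s') = ?P r" by blast
  have "r = M" using 4 I(1,2) env_regs(3)[OF I(4)] by simp
  then show ?case using I by simp
 qed
qed

lemma pos_surj:
 assumes "x0 \<le> x"
 shows "\<exists>r<M. \<exists>u. x = pos r 0 u"
proof -
 have "x - x0 = int M * ((x - x0) div int M) + (x - x0) mod int M" by simp
 moreover have "0 \<le> (x - x0) mod int M" "(x - x0) mod int M < int M" "0 \<le> (x - x0) div int M"
  using M_pos assms by (simp_all add: pos_imp_zdiv_nonneg_iff)
 ultimately show ?thesis
  by (intro exI[of _ "nat ((x - x0) mod int M)"] conjI exI[of _ "nat ((x - x0) div int M)"])
   (auto simp: pos_def)
qed

text \<open>Residue and quotient determine a position, so the survivors of different classes are
  distinct positions of one interval, to which the sieve bound applies.\<close>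

lemma class_survivors_sum:
 "(\<Sum>r<M. card (class_survivors r)) \<le> card {x \<in> {x0..hi}. rough x}"
proof -
 have "(\<Sum>r<M. card (class_survivors r)) = card (SIGMA r:{..<M}. class_survivors r)"
  by (simp add: finite_class_survivors)
 also have "\<dots> \<le> card {x \<in> {x0..hi}. rough x}"
 proof (rule card_inj_on_le)
  show "inj_on (\<lambda>(r, u). pos r 0 u) (SIGMA r:{..<M}. class_survivors r)"
  proof (intro inj_onI, clarify)
   fix r u r' u' assume *: "r < M" "r' < M" "pos r 0 u = pos r' 0 u'"
   then have "int (r + M * u) = int (r' + M * u')" by (simp add: pos_def)
   then have e: "r + M * u = r' + M * u'" by (simp only: of_nat_eq_iff)
   have "r = r'" using arg_cong[OF e, of "\<lambda>z. z mod M"] *(1,2) by simp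
   then show "r = r' \<and> u = u'" using e M_pos by simp
  qed
  show "(\<lambda>(r, u). pos r 0 u) ` (SIGMA r:{..<M}. class_survivors r) \<subseteq> {x \<in> {x0..hi}. rough x}"
  proof clarify
   fix r u assume "u \<in> class_survivors r"
   then show "pos r 0 u \<in> {x0..hi} \<and> rough (pos r 0 u)"
    using pos_ge[of u r] by (auto simp: class_survivors_def)
  qed
  show "finite {x \<in> {x0..hi}. rough x}" by (rule finite_subset[of _ "{x0..hi}"]) auto
 qed
 finally show ?thesis .
qed

lemma good_no_hits:
 assumes "good r" "prime p" "p < m"
 shows "\<not> hits p (x0 + int r)"
proof -
 have fin: "finite {p. prime p \<and> p < m}" by (rule finite_subset[of _ "{..<m}"]) auto
 have "p dvd M" unfolding M_def by (rule dvd_prodI[OF fin, of p "\<lambda>p. p"]) (use assms in simp)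
 moreover from this have "p \<le> y" using M_le M_pos by (meson dvd_imp_le order_trans)
 ultimately show ?thesis using assms prime_ge_2_nat[of p] by (auto simp: good_def hits_def)
qed

lemma wp_phase:
 assumes "env s"
 shows "wp B (small_prog;; classes_prog K) (\<lambda>t s'.
  K + y * (K + 1) + (y + 1) * (y + 1) + bound_cost + k + t \<le> total_ticks m lo hi \<and>
  cells s' \<le> 2 + 2 * k + y * y \<and>
  set (printed s') = set (printed s) \<union> {x. lo \<le> x \<and> x \<le> hi \<and> allprime x}) s"
 unfolding wp_Seq
proof (rule wp_mono[OF wp_small_prog[OF assms]], goal_cases)
 case (1 t1 s1)
 then have e1: "env s1" by simp
 show ?case
 proof (rule wp_mono[OF wp_classes_prog[OF e1]], goal_cases)
  case (1 t2 s2)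
  have "card {r. r < M \<and> good r} \<le> card {r. r < M \<and> (avoids_below m (x0 + int r))}"
   using good_no_hits by (intro card_mono) auto
  then have "card {r. r < M \<and> good r} * (blocks * (1 + 2 * D + sieve_ticks)) \<le>
    card {r. r < M \<and> (avoids_below m (x0 + int r))} * (blocks * (1 + 2 * D + sieve_ticks))"
   by (rule mult_le_mono1)
  moreover have "(\<Sum>r<M. card (class_survivors r)) * (k * (test_cost + 1)) \<le>
    card {x \<in> {x0..hi}. rough x} * (k * (test_cost + 1))"
   using class_survivors_sum by (rule mult_le_mono1)
  moreover have "total_ticks m lo hi = K + y * (K + 1) + (y + 1) * (y + 1) + bound_cost + k +
   y * (k * (F0 + 1) + 1) + M * (1 + k * (y + 1)) +
   card {r. r < M \<and> (avoids_below m (x0 + int r))} * (blocks * (1 + 2 * D + sieve_ticks)) +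
   card {x \<in> {x0..hi}. rough x} * (k * (test_cost + 1))"
   unfolding total_ticks_def Let_def F0_def M_def x0_def D_def blocks_def rough_def ..
  ultimately have "K + y * (K + 1) + (y + 1) * (y + 1) + bound_cost + k + (t1 + t2) \<le> total_ticks m lo hi"
   using 1 \<open>t1 \<le> _ \<and> _\<close> by linarith
  moreover have "cells s2 \<le> 2 + 2 * k + y * y" using 1 by (simp add: env_def base_def D_def)
  moreover have "set (printed s2) = set (printed s) \<union> {x. lo \<le> x \<and> x \<le> hi \<and> allprime x}"
  proof -
   have "x0 \<le> x \<longleftrightarrow> (\<exists>r<M. \<exists>u. x = pos r 0 u)" for x
   proof
    show "x0 \<le> x \<Longrightarrow> \<exists>r<M. \<exists>u. x = pos r 0 u" by (rule pos_surj)
    assume "\<exists>r<M. \<exists>u. x = pos r 0 u"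
    then obtain r u where "x = pos r 0 u" by blast
    then show "x0 \<le> x" using pos_ge[of u r] by linarith
   qed
   then have "{x. \<exists>r<M. \<exists>u. x = pos r 0 u \<and> x \<le> hi \<and> allprime x} = {x. x0 \<le> x \<and> x \<le> hi \<and> allprime x}"
    by blast
   moreover have "{x. lo \<le> x \<and> x \<le> hi \<and> allprime x} =
    {x. lo \<le> x \<and> x < x0 \<and> x \<le> hi \<and> allprime x} \<union> {x. x0 \<le> x \<and> x \<le> hi \<and> allprime x}"
    by (auto simp: x0_def)
   ultimately show ?thesis using 1 \<open>t1 \<le> _ \<and> _\<close> by auto
  qed
  ultimately show ?case by simp
 qed
qed

end

text \<open>Register 50 holds \<open>n\<close>, register 8 the first sieved position, register 19
  the address of the marks.\<close>

definition main_prog :: "nat \<Rightarrow> com" where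
 "main_prog K =
   Get 0 (N 0);;
   Get 50 (N 1);;
   root_prog K;;
   wheel_prog;;
   bound_prog;;
   range_prog;;
   8 ::= V 6 [+] V 2;;
   19 ::= N 2 [+] N 2 [*] V 0;;
   small_prog;;
   classes_prog K"

context sieve_run
begin

lemma input_ok_frame: "input_ok s \<Longrightarrow> frame F s s' \<Longrightarrow> input_ok s'"
 by (simp add: input_ok_def frame_def)

theorem wp_main_prog:
 assumes "input_ok s" "cells s \<le> 2 + 2 * k"
 shows "wp B (main_prog K) (\<lambda>t s'. \<exists>m lo hi. 2 \<le> m \<and> primorial m \<le> y \<and> y < primorial m * m \<and>
  range_ok k lo hi \<and> t \<le> total_ticks m lo hi \<and> cells s' \<le> 2 + 2 * k + y * y \<and>
  set (printed s') = set (printed s) \<union> {x. lo \<le> x \<and> x \<le> hi \<and> (\<forall>i<k. prime (form i x))}) s" (is "wp B _ ?Q s")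
proof -
 have kB: "4 * int k + 100 < B" "int n < B" "100 < B" "\<bar>v\<bar> \<le> 3 * W \<Longrightarrow> \<bar>v\<bar> < B" for v
 proof -
  have W4: "4 * W \<le> W ^ 2" using W(1) by (simp add: power2_eq_square)
  then have *: "4 * W + 100 < B" using pow_le_B(1)[of "4 * W" 2] by simp
  show "4 * int k + 100 < B" "int n < B" "100 < B" "\<bar>v\<bar> \<le> 3 * W \<Longrightarrow> \<bar>v\<bar> < B" using * W(1-3) by linarith+
 qed
 let ?s0 = "s\<lparr>reg := (reg s)(0 := int k, 50 := int n)\<rparr>"
 have i0: "input_ok ?s0" using assms(1) by (simp add: input_ok_def)
 let ?tail = "8 ::= V 6 [+] V 2;; 19 ::= N 2 [+] N 2 [*] V 0;; small_prog;; classes_prog K"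
 have "wp B (root_prog K) (\<lambda>t1. wp B wheel_prog (\<lambda>t2. wp B bound_prog (\<lambda>t3. wp B range_prog (\<lambda>t4.
  wp B ?tail (\<lambda>t5. ?Q (t1 + (t2 + (t3 + (t4 + t5))))))))) ?s0"
 proof (rule wp_mono[OF wp_root_prog], goal_cases)
  case 1
  show ?case by simp
 next
  case (2 t1 s1)
  then have fr1: "frame {2, 28, 31, 32, 33} ?s0 s1" and t1: "t1 \<le> K + y * (K + 1)" and r1: "reg s1 2 = int y" by auto
  show ?case
  proof (rule wp_mono[OF wp_wheel_prog[OF r1]], goal_cases)
   case (1 t2 s2)
   then obtain m where fr2: "frame {3, 17, 20, 21, 22} s1 s2" and t2: "t2 \<le> (y + 1) * (y + 1)"
    and m: "2 \<le> m" "reg s2 3 = int (primorial m)" "primorial m \<le> y"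
     "y < primorial m * m" by blast
   have r2: "reg s2 2 = int y" "reg s2 50 = int n" using fr1 fr2 r1 by (simp_all add: frame_def)
   show ?case
   proof (rule wp_mono[OF wp_bound_prog[OF r2]], goal_cases)
    case (1 t3 s3)
    then obtain bd where fr3: "frame ({4, 5, 46, 47} \<union> {20..37}) s2 s3" and t3: "t3 \<le> bound_cost"
     and r4: "reg s3 4 = int (y * y)" and bd: "reg s3 5 = int bd" "2 \<le> bd" "bd \<le> E" "int bd < W"
      "\<forall>L. pseudosquare_candidate L \<and> L \<le> n div y \<longrightarrow> least_nonresidue L \<le> bd" by blast
    have i3: "input_ok s3" using i0 fr1 fr2 fr3 by (blast intro: input_ok_frame)
    have r3: "reg s3 0 = int k" "reg s3 50 = int n" "reg s3 2 = int y" "reg s3 3 = int (primorial m)"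
     using fr1 fr2 fr3 r1 m(2) by (simp_all add: frame_def)
    show ?case
    proof (rule wp_mono[OF wp_range_prog[OF i3 r3(1,2)]], goal_cases)
     case (1 t4 s4)
     define lo hi where "lo = reg s4 6" and "hi = reg s4 7"
     have fr4: "frame {6, 7, 14, 40, 41, 48, 49} s3 s4" and t4: "t4 \<le> k" and ro: "range_ok k lo hi"
      using 1 by (auto simp: lo_def hi_def)
     interpret ph: sieve_phase k a b K n E W B m bd lo hi
      by unfold_locales (use m bd ro in auto)
     have i4: "input_ok s4" using i3 fr4 by (rule input_ok_frame)
     have r4: "reg s4 0 = int k" "reg s4 50 = int n" "reg s4 2 = int y" "reg s4 3 = int (primorial m)"
      "reg s4 4 = int (y * y)" "reg s4 5 = int bd" "cells s4 = cells s" "printed s4 = printed s"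
      using fr1 fr2 fr3 fr4 r3 r4 bd(1) by (simp_all add: frame_def)
     let ?s5 = "s4\<lparr>reg := (reg s4)(8 := lo + int y, 19 := int (2 + 2 * k))\<rparr>"
     have e5: "ph.env ?s5"
      using i4 r4 assms(2) unfolding ph.env_def ph.M_def ph.D_def ph.base_def ph.x0_def
      by (simp add: lo_def hi_def input_ok_def)
     have "\<bar>lo + int y\<bar> \<le> 3 * W" "\<bar>lo\<bar> \<le> 3 * W" using ro y_bounds(3) W(1) unfolding range_ok_def by linarith+
     then have loB: "\<bar>lo + int y\<bar> < B" "\<bar>lo\<bar> < B" by (blast intro: kB(4))+
     have yB: "int y < B" using ph.small_B(1) by linarith
     have "wp B (small_prog;; classes_prog K) (\<lambda>t5. ?Q (t1 + (t2 + (t3 + (t4 + t5))))) ?s5"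
     proof (rule wp_mono[OF ph.wp_phase[OF e5]], goal_cases)
      case (1 t5 s6)
      have "t1 + (t2 + (t3 + (t4 + t5))) \<le> total_ticks m lo hi" using 1 t1 t2 t3 t4 by linarith
      moreover have "set (printed s6) = set (printed s) \<union> {x. lo \<le> x \<and> x \<le> hi \<and> (\<forall>i<k. prime (form i x))}"
       using 1 r4(8) by (simp add: ph.allprime_def)
      ultimately show ?case using 1 m ro by (intro exI[of _ m] exI[of _ lo] exI[of _ hi] conjI) simp_all
     qed
     moreover have "reg s4 6 = lo" by (simp add: lo_def)
     ultimately show ?case using r4 loB yB kB(1,3) by (simp add: wp_Seq wp_Assign)
    qed
   qed
  qed
 qed
 then have "wp B (root_prog K;; wheel_prog;; bound_prog;; range_prog;; ?tail) ?Q ?s0" unfolding wp_Seq .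
 moreover have "max (cells s) (Suc 0) = cells s" "max (cells s) (Suc (Suc 0)) = cells s"
  using assms(1) by (auto simp: input_ok_def)
 ultimately show ?thesis unfolding main_prog_def using assms(1) kB by (simp add: wp_Seq wp_Get input_ok_def)
qed

end

section \<open>The pattern program\<close>

text \<open>All variables are below 60, so scratch registers start there. The program depends on
  \<open>K\<close> only; pattern and search bound are read from memory.\<close>

definition pattern_program :: "nat \<Rightarrow> program" where
 "pattern_program K = code 60 (main_prog K) 0 @ [Halt]"

lemma vars_main_prog: "vars (main_prog K) \<subseteq> {..<60}"
 by (simp add: main_prog_def root_prog_def pow_prog_def wheel_prog_def prime_prog_def bound_prog_def
   nonresidue_prog_def ispow_prog_def powmod_prog_def range_prog_def form_range_prog_def small_prog_def
   naive_prog_def load_form_def classes_prog_def good_prog_def coprime_prog_def class_prog_def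
   block_prog_def clear_prog_def sieve_prog_def forms_prog_def offsets_prog_def mark_prog_def
   scan_prog_def tests_prog_def test_prog_def powers_prog_def
   witness_prog_def bases_prog_def base_prog_def)

text \<open>The value used for \<open>E\<close>, available without any conjecture; inserting 2 keeps
  the set nonempty and the bound at least 2.\<close>

definition nonresidue_bound :: "nat \<Rightarrow> nat" where
 "nonresidue_bound n = Max (insert 2 (least_nonresidue ` {L. pseudosquare_candidate L \<and> L \<le> n}))"

lemma nonresidue_bound:
 "2 \<le> nonresidue_bound n" "pseudosquare_candidate L \<Longrightarrow> L \<le> n \<Longrightarrow> least_nonresidue L \<le> nonresidue_bound n"
 "nonresidue_bound n \<in> insert 2 (least_nonresidue ` {L. pseudosquare_candidate L \<and> L \<le> n})"
proof -
 have "finite {L. pseudosquare_candidate L \<and> L \<le> n}" by (rule finite_subset[of _ "{..n}"]) auto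
 then have fin: "finite (insert 2 (least_nonresidue ` {L. pseudosquare_candidate L \<and> L \<le> n}))" by simp
 show "2 \<le> nonresidue_bound n" "pseudosquare_candidate L \<Longrightarrow> L \<le> n \<Longrightarrow> least_nonresidue L \<le> nonresidue_bound n"
  unfolding nonresidue_bound_def using fin by (auto intro!: Max_ge)
 show "nonresidue_bound n \<in> insert 2 (least_nonresidue ` {L. pseudosquare_candidate L \<and> L \<le> n})"
  unfolding nonresidue_bound_def using fin by (intro Max_in) auto
qed

lemma less_two_power_floorlog: "\<bar>v\<bar> < 2 ^ floorlog 2 (nat \<bar>v\<bar>)"
proof (cases "v = 0")
 case False
 then have "nat \<bar>v\<bar> < 2 ^ floorlog 2 (nat \<bar>v\<bar>)" using floorlog_bounds[of "nat \<bar>v\<bar>" 2] by simp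
 then have "int (nat \<bar>v\<bar>) < int (2 ^ floorlog 2 (nat \<bar>v\<bar>))" by (simp only: of_nat_less_iff)
 then show ?thesis by simp
qed simp

lemma nth_coefficient_pairs:
 assumes "i < length P"
 shows "concat (map (\<lambda>f. [g f, h f]) P) ! (2 * i) = g (P ! i)"
  "concat (map (\<lambda>f. [g f, h f]) P) ! Suc (2 * i) = h (P ! i)"
proof -
 have "concat (map (\<lambda>f. [g f, h f]) P) ! (2 * i) = g (P ! i) \<and> concat (map (\<lambda>f. [g f, h f]) P) ! Suc (2 * i) = h (P ! i)"
  using assms
 proof (induction P arbitrary: i)
  case (Cons f P)
  then show ?case by (cases i) simp_all
 qed simp
 then show "concat (map (\<lambda>f. [g f, h f]) P) ! (2 * i) = g (P ! i)"
  "concat (map (\<lambda>f. [g f, h f]) P) ! Suc (2 * i) = h (P ! i)" by auto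
qed

lemma length_pattern_input: "length (pattern_input P n) = 2 + 2 * length P"
proof -
 have "length (concat (map (\<lambda>f. [coeff f 1, coeff f 0]) P)) = 2 * length P" by (induction P) auto
 then show ?thesis by (simp add: pattern_input_def)
qed

lemma poly_degree_1:
 fixes f :: "'a::comm_semiring_1 poly"
 assumes "degree f = 1"
 shows "f = [:coeff f 0, coeff f 1:]"
proof (rule poly_eqI)
 fix j :: nat
 consider "j = 0" | "j = 1" | "1 < j" by linarith
 then show "coeff f j = coeff [:coeff f 0, coeff f 1:] j"
 proof cases
  case 3
  then have "coeff f j = 0" using assms by (intro coeff_eq_0) simp
  moreover have "coeff [:coeff f 0, coeff f 1:] j = 0" using 3 degree_pCons_le[of "coeff f 0" "[:coeff f 1:]"]
   by (intro coeff_eq_0) (simp add: le_less_trans)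
  ultimately show ?thesis by simp
 qed simp_all
qed

lemma is_pattern_linear_forms:
 assumes "is_pattern P" "2 < length P"
 shows "linear_forms (length P) (\<lambda>i. coeff (P ! i) 1) (\<lambda>i. coeff (P ! i) 0)"
  and "i < length P \<Longrightarrow> poly (P ! i) x = linear_forms.form (\<lambda>i. coeff (P ! i) 1) (\<lambda>i. coeff (P ! i) 0) i x"
proof -
 have P: "degree (P ! i) = 1" "0 < coeff (P ! i) 1" if "i < length P" for i
  using assms(1) that by (auto simp: is_pattern_def dest!: nth_mem)
 have "distinct P" using assms(1) by (simp add: is_pattern_def)
 show lf: "linear_forms (length P) (\<lambda>i. coeff (P ! i) 1) (\<lambda>i. coeff (P ! i) 0)"
 proof
  show "0 < length P" using assms(2) by linarith
  fix i j assume *: "i < length P" "j < length P" "i \<noteq> j"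
  show "(coeff (P ! i) 1, coeff (P ! i) 0) \<noteq> (coeff (P ! j) 1, coeff (P ! j) 0)"
  proof
   assume e: "(coeff (P ! i) 1, coeff (P ! i) 0) = (coeff (P ! j) 1, coeff (P ! j) 0)"
   have "P ! i = [:coeff (P ! i) 0, coeff (P ! i) 1:]" using P *(1) by (intro poly_degree_1)
   also have "\<dots> = [:coeff (P ! j) 0, coeff (P ! j) 1:]" using e by simp
   also have "\<dots> = P ! j" using P *(2) by (intro poly_degree_1[symmetric])
   finally show False using * \<open>distinct P\<close> by (simp add: nth_eq_iff_index_eq)
  qed
 qed (use P in auto)
 assume i: "i < length P"
 have "poly (P ! i) x = poly [:coeff (P ! i) 0, coeff (P ! i) 1:] x" using poly_degree_1[OF P(1)[OF i]] by simp
 then show "poly (P ! i) x = linear_forms.form (\<lambda>i. coeff (P ! i) 1) (\<lambda>i. coeff (P ! i) 0) i x"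
  unfolding linear_forms.form_def[OF lf] by (simp add: mult.commute)
qed

text \<open>With \<open>f\<close> the longest input length and \<open>W = 2^f\<close>, the factor
  \<open>K + 14\<close> lets a word hold numbers below \<open>W^(K + 14) / 2\<close>; the two powers
  beyond \<open>K + 12\<close> absorb the sign bit and the summand \<open>K\<close>.\<close>

lemma pattern_program_run:
 fixes P :: "int poly list" and K n :: nat
 assumes "is_pattern P" "2 < length P" "3 \<le> K"
 defines "k \<equiv> length P" and "a \<equiv> \<lambda>i. coeff (P ! i) 1" and "b \<equiv> \<lambda>i. coeff (P ! i) 0"
  and "w \<equiv> word_size (K + 14) (pattern_input P n)"
 obtains outp t sp W B m lo hi where
  "sieve_run k a b K n (nonresidue_bound n) W B"
  "ram_computes (K + 14) (pattern_program K) (pattern_input P n) outp t sp"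
  "set outp = prime_pattern_positions P n"
  "2 \<le> m" "primorial m \<le> sieve_run.y K n" "sieve_run.y K n < primorial m * m"
  "sieve_run.range_ok a b n W k lo hi"
  "t \<le> length (pattern_program K) * (sieve_run.total_ticks k a b K n (nonresidue_bound n) m lo hi + 1)"
  "sp \<le> w * (card (\<Union>i\<in>set (pattern_program K). set_instr i) + (2 + 2 * k + sieve_run.y K n * sieve_run.y K n))"
proof -
 define inp where "inp = pattern_input P n"
 define f where "f = Max ((\<lambda>v. floorlog 2 (nat \<bar>v\<bar>)) ` set inp)"
 define W where "W = (2::int) ^ f"
 have w: "w = (K + 14) * f" by (simp add: w_def word_size_def f_def inp_def)
 define B where "B = (2::int) ^ (w - 1)"
 have inW: "\<bar>v\<bar> < W" if "v \<in> set inp" for v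
 proof -
  have "floorlog 2 (nat \<bar>v\<bar>) \<le> f" unfolding f_def using that by (intro Max_ge) auto
  then have "(2::int) ^ floorlog 2 (nat \<bar>v\<bar>) \<le> W" unfolding W_def by (intro power_increasing) auto
  then show ?thesis using less_two_power_floorlog[of v] by linarith
 qed
 have inp_mem: "int k \<in> set inp" "int n \<in> set inp" "\<And>i. i < k \<Longrightarrow> a i \<in> set inp" "\<And>i. i < k \<Longrightarrow> b i \<in> set inp"
  by (auto simp: inp_def pattern_input_def k_def a_def b_def)
 \<comment> \<open>The pattern has at least three forms, so the input number \<open>k\<close> alone
   takes two bits, which gives \<open>W\<close> at least 4.\<close>
 have f2: "2 \<le> f"
 proof (rule ccontr)
  assume "\<not> 2 \<le> f"
  then have "f \<le> 1" by simp
  then have "W \<le> 2 ^ 1" unfolding W_def by (intro power_increasing) auto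
  then have "W \<le> 2" by simp
  moreover have "3 \<le> int k" using assms(2) unfolding k_def by simp
  ultimately show False using inW[OF inp_mem(1)] by linarith
 qed
 have W4: "4 \<le> W" using power_increasing[of 2 f "2::int"] f2 by (simp add: W_def)
 have w0: "w = Suc (w - 1)" using f2 unfolding w by simp
 have WB: "W ^ (K + 14) = 2 * B"
  unfolding W_def B_def power_Suc[symmetric] w0[symmetric] by (simp add: w power_mult[symmetric] mult.commute)
 have B: "W ^ (K + 12) + int K \<le> B"
 proof -
  have "int K \<le> 2 ^ K" using less_exp[of K] by (simp add: of_nat_less_numeral_power_cancel_iff less_imp_le)
  also have "\<dots> \<le> W ^ K" using W4 by (intro power_mono) auto
  also have "\<dots> \<le> W ^ (K + 12)" using W4 by (intro power_increasing) auto
  finally have "W ^ (K + 12) + int K \<le> 2 * W ^ (K + 12)" by simp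
  moreover have "4 * 4 * W ^ (K + 12) \<le> W * W * W ^ (K + 12)" using W4 by (intro mult_mono) auto
  moreover have "W * W * W ^ (K + 12) = W ^ (K + 14)" by (simp add: power_add eval_nat_numeral)
  ultimately show ?thesis using WB W4 zero_le_power[of W "K + 12"] by linarith
 qed
 have lf: "linear_forms k a b" unfolding k_def a_def b_def by (rule is_pattern_linear_forms(1)[OF assms(1,2)])
 have SR: "sieve_run k a b K n (nonresidue_bound n) W B"
 proof (intro sieve_run.intro lf sieve_run_axioms.intro)
  show "a i < W" "\<bar>b i\<bar> < W" if "i < k" for i using inW[OF inp_mem(3)[OF that]] inW[OF inp_mem(4)[OF that]] by auto
  show "int k < W" "int n < W" using inW[OF inp_mem(1)] inW[OF inp_mem(2)] by auto
 qed (use W4 B assms(3) nonresidue_bound in auto)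
 interpret sieve_run k a b K n "nonresidue_bound n" W B by (rule SR)
 interpret word_bound w B
 proof
  show "0 < B" by (simp add: B_def)
  show "fits w v" if "\<bar>v\<bar> < B" for v
  proof -
   have "(2::int) ^ w = 2 * B" unfolding B_def by (subst w0) simp
   then show ?thesis using that unfolding fits_def by linarith
  qed
 qed
 define s where "s = init_state inp"
 have len: "length inp = 2 + 2 * k" by (simp add: inp_def length_pattern_input k_def)
 have "input_ok s"
  unfolding input_ok_def
 proof (intro conjI allI impI)
  show "mem s 0 = int k" "mem s 1 = int n" by (simp_all add: s_def init_state_def len) (simp_all add: inp_def pattern_input_def k_def)
  show "2 + 2 * k \<le> cells s" by (simp add: s_def init_state_def len)
  fix i assume i: "i < k"
  have "inp ! (2 + 2 * i) = a i" "inp ! (3 + 2 * i) = b i"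
   using i nth_coefficient_pairs[of i P "\<lambda>f. coeff f 1" "\<lambda>f. coeff f 0"]
   unfolding inp_def pattern_input_def a_def b_def k_def by (simp_all add: eval_nat_numeral)
  then show "mem s (2 + 2 * i) = a i" "mem s (3 + 2 * i) = b i"
   using i by (simp_all add: s_def init_state_def len)
 qed
 moreover have "cells s \<le> 2 + 2 * k" by (simp add: s_def init_state_def len)
 ultimately obtain t s' m lo hi where big: "big B (main_prog K) s t s'"
  and m: "2 \<le> m" "primorial m \<le> y" "y < primorial m * m"
  and ro: "range_ok k lo hi" and t: "t \<le> total_ticks m lo hi" and cells: "cells s' \<le> 2 + 2 * k + y * y"
  and pr: "set (printed s') = set (printed s) \<union> {x. lo \<le> x \<and> x \<le> hi \<and> (\<forall>i<k. prime (form i x))}"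
  using wp_main_prog[of s] unfolding wp_def by blast
 let ?prog = "pattern_program K"
 let ?code = "code 60 (main_prog K) 0"
 have pc: "pc s = 0" by (simp add: s_def init_state_def)
 have "code_at ?prog (pc s) (code 60 (main_prog K) (pc s))"
  unfolding pc code_at_def pattern_program_def by (simp add: nth_append)
 moreover have "agree 60 s s" by (simp add: agree_def)
 ultimately obtain u \<sigma> where u: "reach w ?prog s u \<sigma>" "u \<le> length ?code * (t + 1)"
  "pc \<sigma> = length ?code" "agree 60 \<sigma> s'"
  using code_correct[OF big _ vars_main_prog, of ?prog s] unfolding pc add_0 by blast
 define sp where "sp = w * (card (\<Union>i\<in>set ?prog. set_instr i) + cells \<sigma>)"
 have "ram_computes (K + 14) ?prog inp (printed \<sigma>) u sp"
  unfolding ram_computes_def Let_def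
 proof (intro exI[of _ \<sigma>] conjI)
  show "((\<lambda>s'. Option.bind s' (step (word_size (K + 14) inp) ?prog)) ^^ u) (Some (init_state inp)) = Some \<sigma>"
   using u(1) unfolding reach_def w_def inp_def s_def .
  show "halted ?prog \<sigma>" using u(3) by (simp add: halted_def pattern_program_def nth_append)
 qed (simp_all add: sp_def w_def inp_def)
 moreover have "set (printed \<sigma>) = prime_pattern_positions P n"
 proof -
  have "printed \<sigma> = printed s'" using u(4) by (simp add: agree_def)
  then have "set (printed \<sigma>) = {x. lo \<le> x \<and> x \<le> hi \<and> (\<forall>i<k. prime (form i x))}"
   using pr by (simp add: s_def init_state_def)
  also have "\<dots> = prime_pattern_positions P n"
  proof -
   have pf: "poly (P ! i) x = form i x" if "i < k" for i x
    using is_pattern_linear_forms(2)[OF assms(1,2), of i x] that unfolding a_def b_def k_def .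
   have "set P \<noteq> {}" using assms(2) by auto
   then have "Max ((\<lambda>f. poly f x) ` set P) \<le> int n \<longleftrightarrow> (\<forall>f\<in>set P. poly f x \<le> int n)" for x by simp
   also have "\<dots> x \<longleftrightarrow> (\<forall>i<k. form i x \<le> int n)" for x
    unfolding all_set_conv_all_nth k_def[symmetric] using pf by auto
   finally have mx: "Max ((\<lambda>f. poly f x) ` set P) \<le> int n \<longleftrightarrow> (\<forall>i<k. form i x \<le> int n)" for x .
   have pm: "(\<forall>f\<in>set P. prime (poly f x)) \<longleftrightarrow> (\<forall>i<k. prime (form i x))" for x
    unfolding all_set_conv_all_nth k_def[symmetric] using pf by auto
   have "lo \<le> x" if "\<forall>i<k. prime (form i x)" for x
   proof -
    have "\<forall>i<k. 2 \<le> form i x" using that by (auto intro: prime_ge_2_int)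
    then show ?thesis using ro unfolding range_ok_def by blast
   qed
   moreover have "x \<le> hi \<longleftrightarrow> (\<forall>i<k. form i x \<le> int n)" for x using ro unfolding range_ok_def by blast
   ultimately show ?thesis unfolding prime_pattern_positions_def mx pm by blast
  qed
  finally show ?thesis .
 qed
 moreover have "u \<le> length ?prog * (total_ticks m lo hi + 1)"
 proof -
  have "length ?code * (t + 1) \<le> length ?prog * (total_ticks m lo hi + 1)"
   using t by (intro mult_le_mono) (auto simp: pattern_program_def)
  then show ?thesis using u(2) by linarith
 qed
 moreover have "sp \<le> w * (card (\<Union>i\<in>set ?prog. set_instr i) + (2 + 2 * k + y * y))"
  unfolding sp_def using cells u(4) by (intro mult_le_mono) (simp_all add: agree_def)
 ultimately show ?thesis using that[OF SR _ _ m ro] unfolding inp_def by blast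
qed

context sieve_run
begin

section \<open>Sizes of the individual costs\<close>

lemma y_upper:
 assumes "1 \<le> n"
 shows "real y \<le> 2 * real n powr (1 / real K)"
proof -
 define z where "z = real n powr (1 / real K)"
 define v where "v = max 2 (nat \<lceil>z\<rceil>)"
 have z1: "1 \<le> z" using assms unfolding z_def by (intro ge_one_powr_ge_zero) auto
 have vz: "z \<le> real v" unfolding v_def by linarith
 have "real n = z ^ K" using K assms unfolding z_def by (simp add: powr_powr flip: powr_realpow)
 also have "\<dots> \<le> real v ^ K" using vz z1 by (intro power_mono) auto
 finally have "real n \<le> real (v ^ K)" by simp
 then have "n \<le> v ^ K" by (simp only: of_nat_le_iff)
 moreover have "2 \<le> v" by (simp add: v_def)
 ultimately have "y \<le> v" by (rule y_bounds(4)[rotated])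
 moreover have "real v \<le> 2 * z" using z1 unfolding v_def by linarith
 ultimately show ?thesis unfolding z_def by linarith
qed

text \<open>Every summand is at most a constant of the pattern times \<open>y^2 * ln (ln n)\<close>;
  for the marking sum this is Mertens' bound for the primes up to \<open>y\<close>.\<close>

lemma sieve_ticks_le:
 assumes "4 \<le> y" "y \<le> n" "1 \<le> ln (ln (real n))"
 shows "real (1 + 2 * (y * y) + sieve_ticks) \<le>
  real (2 * (k + 1) + 7 * k + k + 2 * (\<Sum>i<k. nat (a i)) + 3) * (real y ^ 2 * ln (ln (real n)))"
proof -
 define l where "l = ln (ln (real n))"
 define A where "A = (\<Sum>i<k. nat (a i))"
 define D where "D = real y ^ 2 * l"
 have l1: "1 \<le> l" using assms by (simp add: l_def)
 have yy: "real y ^ 2 \<le> D" unfolding D_def using l1 mult_left_mono[of 1 l "real y ^ 2"] by simp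
 have y1: "real y \<le> real y ^ 2" "1 \<le> real y ^ 2" using assms(1) by (auto simp: power2_eq_square intro: mult_ge1_I)
 have "real (\<Sum>q | prime q \<and> q \<le> y. y * y div q) \<le> (\<Sum>q | prime q \<and> real q \<le> real y. real y ^ 2 * (1 / real q))"
  unfolding of_nat_sum of_nat_le_iff
 proof (rule sum_mono)
  fix q
  show "real (y * y div q) \<le> real y ^ 2 * (1 / real q)"
   using of_nat_div_le_of_nat[of "y * y" q, where 'a = real] by (simp add: power2_eq_square)
 qed
 also have "\<dots> = real y ^ 2 * (\<Sum>q | prime q \<and> real q \<le> real y. 1 / real q)" by (simp only: sum_distrib_left)
 also have "\<dots> \<le> real y ^ 2 * (2 * ln (ln (real y)) + 5)"
  using assms(1) by (intro mult_left_mono sum_prime_reciprocals_le) auto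
 also have "\<dots> \<le> real y ^ 2 * (7 * l)"
 proof (rule mult_left_mono)
  have "1 < ln (real y)"
  proof -
   have "exp 1 < real y" using exp_le assms(1) by linarith
   then have "ln (exp 1) < ln (real y)" using assms(1) by (subst ln_less_cancel_iff) auto
   then show ?thesis by simp
  qed
  then have "ln (ln (real y)) \<le> l" unfolding l_def using assms(1,2) by (intro ln_mono) auto
  then show "2 * ln (ln (real y)) + 5 \<le> 7 * l" using l1 by linarith
 qed simp
 finally have S: "real (\<Sum>q | prime q \<and> q \<le> y. y * y div q) \<le> 7 * D" by (simp add: D_def)
 have "real (1 + 2 * (y * y) + sieve_ticks) = 1 + 2 * real y ^ 2 + (real k + 1) * (real y * (real y + 1)) +
   real k * real (\<Sum>q | prime q \<and> q \<le> y. y * y div q) + real k * real y + 2 * real y ^ 2 * real A"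
  unfolding sieve_ticks_def A_def[symmetric] by (simp add: power2_eq_square algebra_simps del: of_nat_sum)
 also have "\<dots> \<le> D + 2 * D + (real k + 1) * (2 * D) + real k * (7 * D) + real k * D + 2 * D * real A"
  using S yy y1 by (intro add_mono mult_left_mono mult_right_mono) (auto simp: power2_eq_square algebra_simps simp del: of_nat_sum)
 also have "\<dots> = real (2 * (k + 1) + 7 * k + k + 2 * A + 3) * D" by (simp add: algebra_simps)
 finally show ?thesis unfolding A_def D_def l_def .
qed

lemma small_ticks_le:
 assumes "M \<le> y" "F \<le> c * y"
 shows "K + y * (K + 1) + (y + 1) * (y + 1) + k + y * (k * (F + 1) + 1) + M * (1 + k * (y + 1)) + 1
  \<le> (2 * K + k + k * (c + 1) + 2 * k + 8) * y ^ 3"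
proof -
 have y1: "1 \<le> y" using y_bounds(1) by simp
 have p: "y \<le> y ^ 3" "y * y \<le> y ^ 3" "1 \<le> y ^ 3"
  using y1 power_increasing[of 1 3 y] power_increasing[of 2 3 y] by (simp_all add: power2_eq_square)
 have "K + y * (K + 1) + (y + 1) * (y + 1) + k + y * (k * (F + 1) + 1) + M * (1 + k * (y + 1)) + 1 \<le>
   K * 1 + y * (K + 1) + (y + y) * (y + y) + k * 1 + y * (k * (c * y + y) + y) + y * (y + k * (y + y)) + 1"
  using assms y1 by (intro add_mono mult_le_mono) auto
 also have "\<dots> = K * 1 + (K + 1) * y + k * 1 + (4 + k * (c + 1) + 1 + 1 + 2 * k) * (y * y) + 1 * 1"
  by (simp add: algebra_simps)
 also have "\<dots> \<le> K * y ^ 3 + (K + 1) * y ^ 3 + k * y ^ 3 + (4 + k * (c + 1) + 1 + 1 + 2 * k) * y ^ 3 + 1 * y ^ 3"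
  using p by (intro add_mono mult_le_mono2) auto
 also have "\<dots> = (2 * K + k + k * (c + 1) + 2 * k + 8) * y ^ 3" by (simp add: algebra_simps)
 finally show ?thesis .
qed

text \<open>The first form grows by at least 1 per step and takes values between 2 and
  \<open>n\<close> on the range.\<close>

lemma range_width:
 assumes "range_ok k lo hi" "lo \<le> x0"
 shows "nat (hi - x0) \<le> n" "0 < n \<Longrightarrow> hi < x0 + int n"
proof -
 have "hi - x0 < int n" if "x0 \<le> hi"
 proof -
  have "form 0 hi \<le> int n" "2 \<le> form 0 x0" using assms k_pos unfolding range_ok_def by auto
  moreover have "1 * (hi - x0) \<le> a 0 * (hi - x0)" using that a_pos[OF k_pos] by (intro mult_right_mono) auto
  ultimately show ?thesis by (simp add: form_def algebra_simps)
 qed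
 then show "nat (hi - x0) \<le> n" "0 < n \<Longrightarrow> hi < x0 + int n" by linarith+
qed

text \<open>With \<open>x = ln n\<close>, \<open>E\<close> is of order \<open>x^(9/7)\<close>;
  squaring gives \<open>18/7\<close>, which exceeds the exponent \<open>9/7 + 1\<close> of the Euler
  powers and stays below 3.\<close>

lemma costs_le:
 assumes L: "1 \<le> ln (real n)" and Ec: "real E \<le> c * ln (real n) powr (9/7)" "0 \<le> c"
 shows "real (k * (test_cost + 1)) \<le> real k * (4 * real K * (real K + 2) + 3 * c\<^sup>2 + 4 * (c + 1) + 1) * ln (real n) powr (18/7)"
  and "real (3 * (bits + 1) + 3 * E\<^sup>2 + 1) \<le> (13 + 3 * c\<^sup>2) * ln (real n) ^ 3"
proof -
 define x where "x = ln (real n)"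
 define X where "X = x powr (18/7)"
 have x1: "1 \<le> x" using L by (simp add: x_def)
 have bits: "real (bits + 1) \<le> 4 * x" unfolding x_def by (rule floorlog_le_ln[OF L])
 have p: "x \<le> X" "1 \<le> X" "X \<le> x ^ 3" "x powr (9/7) * x \<le> X" "(x powr (9/7))\<^sup>2 = X"
 proof -
  have "x powr 1 \<le> X" "x powr 0 \<le> X" unfolding X_def using x1 by (intro powr_mono; simp)+
  then show "x \<le> X" "1 \<le> X" using x1 by simp_all
  have "X \<le> x powr (real 3)" unfolding X_def using x1 by (intro powr_mono) auto
  then show "X \<le> x ^ 3" using x1 by (subst (asm) powr_realpow) auto
  have "x powr (9/7) * x powr 1 \<le> X" unfolding X_def powr_add[symmetric] using x1 by (intro powr_mono) auto
  then show "x powr (9/7) * x \<le> X" using x1 by simp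
  show "(x powr (9/7))\<^sup>2 = X" unfolding X_def power2_eq_square by (simp flip: powr_add)
 qed
 have E0: "real E \<le> c * x powr (9/7)" using Ec by (simp add: x_def)
 have E2: "(real E)\<^sup>2 \<le> c\<^sup>2 * X"
 proof -
  have "(real E)\<^sup>2 \<le> (c * x powr (9/7))\<^sup>2" using E0 by (intro power_mono) auto
  then show ?thesis by (simp add: power_mult_distrib p(5))
 qed
 have E1: "real (E + 1) * real (bits + 1) \<le> 4 * (c + 1) * X"
 proof -
  have "1 \<le> x powr (9/7)" using x1 by (intro ge_one_powr_ge_zero) auto
  then have "real (E + 1) \<le> (c + 1) * x powr (9/7)" using E0 by (simp add: algebra_simps)
  then have "real (E + 1) * real (bits + 1) \<le> (c + 1) * x powr (9/7) * (4 * x)"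
   using bits Ec(2) by (intro mult_mono) auto
  also have "\<dots> = 4 * (c + 1) * (x powr (9/7) * x)" by simp
  also have "\<dots> \<le> 4 * (c + 1) * X" using p(4) Ec(2) by (intro mult_left_mono) auto
  finally show ?thesis .
 qed
 have "real (test_cost + 1) = real K * (real K + 2) * real (bits + 1) + 3 * (real E)\<^sup>2 + real (E + 1) * real (bits + 1) + 1"
  unfolding test_cost_def by (simp add: algebra_simps)
 also have "\<dots> \<le> real K * (real K + 2) * (4 * X) + 3 * (c\<^sup>2 * X) + 4 * (c + 1) * X + X"
  using E1 E2 bits p by (intro add_mono mult_left_mono) auto
 also have "\<dots> = (4 * real K * (real K + 2) + 3 * c\<^sup>2 + 4 * (c + 1) + 1) * X" by (simp add: algebra_simps)
 finally have "real k * real (test_cost + 1) \<le> real k * ((4 * real K * (real K + 2) + 3 * c\<^sup>2 + 4 * (c + 1) + 1) * X)"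
  by (intro mult_left_mono) auto
 then show "real (k * (test_cost + 1)) \<le> real k * (4 * real K * (real K + 2) + 3 * c\<^sup>2 + 4 * (c + 1) + 1) * ln (real n) powr (18/7)"
  unfolding of_nat_mult X_def x_def by (simp only: mult.assoc)
 have "real (3 * (bits + 1) + 3 * E\<^sup>2 + 1) = 3 * real (bits + 1) + 3 * (real E)\<^sup>2 + 1" by simp
 also have "\<dots> \<le> 12 * X + 3 * (c\<^sup>2 * X) + X" using bits E2 p by (intro add_mono) auto
 also have "\<dots> = (13 + 3 * c\<^sup>2) * X" by (simp add: algebra_simps)
 also have "\<dots> \<le> (13 + 3 * c\<^sup>2) * x ^ 3" using p(3) by (intro mult_left_mono) auto
 finally show "real (3 * (bits + 1) + 3 * E\<^sup>2 + 1) \<le> (13 + 3 * c\<^sup>2) * ln (real n) ^ 3" unfolding x_def .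
qed

end

lemma nonresidue_bound_le:
 assumes "conjecture_A"
 shows "\<exists>C>0. \<forall>n. 1 \<le> ln (real n) \<longrightarrow> real (nonresidue_bound n) \<le> C * ln (real n) powr (9/7)"
proof -
 obtain C where C: "0 < C" "\<And>n L. pseudosquare_candidate L \<and> L \<le> n \<Longrightarrow> real (least_nonresidue L) \<le> C * ln (real n) powr (9 / 7)"
  using least_nonresidue_bound[OF assms] by blast
 show ?thesis
 proof (intro exI[of _ "C + 2"] conjI allI impI)
  fix n :: nat assume n: "1 \<le> ln (real n)"
  have p: "1 \<le> ln (real n) powr (9/7)" using n by (intro ge_one_powr_ge_zero) auto
  have "nonresidue_bound n = 2 \<or> (\<exists>L. nonresidue_bound n = least_nonresidue L \<and> pseudosquare_candidate L \<and> L \<le> n)"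
   using nonresidue_bound(3)[of n] by auto
  then have "real (nonresidue_bound n) \<le> max 2 (C * ln (real n) powr (9/7))" using C(2) by fastforce
  also have "\<dots> \<le> (C + 2) * ln (real n) powr (9/7)" using p C(1) by (auto simp: algebra_simps intro: add_increasing)
  finally show "real (nonresidue_bound n) \<le> (C + 2) * ln (real n) powr (9/7)" .
 qed (use C in simp)
qed

context linear_forms
begin

lemma total_ticks_le_rate:
 assumes "conjecture_A" "3 \<le> k" "6 \<le> K"
 shows "\<exists>C. \<forall>\<^sub>F n in sequentially. \<forall>W B m lo hi. sieve_run k a b K n (nonresidue_bound n) W B \<and>
  2 \<le> m \<and> primorial m \<le> sieve_run.y K n \<and> sieve_run.y K n < primorial m * m \<and>
  sieve_run.range_ok a b n W k lo hi \<longrightarrow>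
  real (sieve_run.total_ticks k a b K n (nonresidue_bound n) m lo hi + 1) \<le> C * rate n"
proof -
 obtain CE where CE: "0 < CE" "\<And>n. 1 \<le> ln (real n) \<Longrightarrow> real (nonresidue_bound n) \<le> CE * ln (real n) powr (9/7)"
  using nonresidue_bound_le[OF assms(1)] by blast
 \<comment> \<open>The lower end is the same for all \<open>n\<close>; fixing it here makes
   \<open>cF\<close> a constant of the pattern, so that values near the lower end are at most
   \<open>cF * y\<close>.\<close>
 define lo0 where "lo0 = (SOME lo. \<forall>x. (\<forall>i<k. 2 \<le> form i x) \<longleftrightarrow> lo \<le> x)"
 define cF where "cF = (\<Sum>i<k. nat \<bar>form i lo0\<bar> + nat (a i))"
 define c1 where "c1 = real (2 * K + k + k * (cF + 1) + 2 * k + 8)"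
 define cS where "cS = real (2 * (k + 1) + 7 * k + k + 2 * (\<Sum>i<k. nat (a i)) + 3)"
 define cT where "cT = real k * (4 * real K * (real K + 2) + 3 * CE\<^sup>2 + 4 * (CE + 1) + 1)"
 define cX where "cX = 13 + 3 * CE\<^sup>2"
 have K3: "3 \<le> K" "0 < K" using assms(3) by auto
 have "0 < cS" unfolding cS_def by (simp only: of_nat_0_less_iff add_pos_pos zero_less_numeral add_gr_0 simp_thms)
 then obtain C where C: "\<forall>\<^sub>F n in sequentially. \<forall>y m S N x0. 2 \<le> y \<and> n \<le> y ^ K \<and> real y \<le> 2 * real n powr (1 / real K) \<and>
   primorial m \<le> y \<and> y < primorial m * m \<and>
   real S \<le> cS * (real y ^ 2 * ln (ln (real n))) \<and> N \<le> n \<longrightarrow>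
  real (card {r. r < primorial m \<and> (avoids_below m (x0 + int r))} *
   ((N div (primorial m * (y * y)) + 1) * S)) \<le> C * rate n"
  using wheel_cost_le_rate[OF K3(1), of cS] by blast
 have cT0: "0 \<le> cT" unfolding cT_def using CE(1) by (intro mult_nonneg_nonneg add_nonneg_nonneg) auto
 have cX0: "0 \<le> cX" unfolding cX_def by simp
 \<comment> \<open>These two provide \<open>y\<close> at least 4 and \<open>y\<close> at most
   \<open>n\<close>.\<close>
 have ev4: "\<forall>\<^sub>F n::nat in sequentially. 4 * ln (real n) ^ 0 * ln (ln (real n)) ^ 0 \<le> real n powr (1 / real K)"
  using K3 by (intro log_loglog_power_le_powr) simp
 have ev2: "\<forall>\<^sub>F n::nat in sequentially. 2 * ln (real n) ^ 0 * ln (ln (real n)) ^ 0 \<le> real n powr (1 / 2)"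
  by (intro log_loglog_power_le_powr) simp
 \<comment> \<open>The cubic costs, the nonresidue bound and the tests contribute at most
   \<open>rate n\<close> each; the wheel sieve contributes \<open>C * rate n\<close>.\<close>
 show ?thesis
 proof (intro exI[of _ "C + 3"])
  show "\<forall>\<^sub>F n in sequentially. \<forall>W B m lo hi. sieve_run k a b K n (nonresidue_bound n) W B \<and>
   2 \<le> m \<and> primorial m \<le> sieve_run.y K n \<and> sieve_run.y K n < primorial m * m \<and>
   sieve_run.range_ok a b n W k lo hi \<longrightarrow>
   real (sieve_run.total_ticks k a b K n (nonresidue_bound n) m lo hi + 1) \<le> (C + 3) * rate n"
   using cube_le_rate[OF assms(3), of c1] quotient_cost_le_rate[OF K3(2) cX0] C
    tests_cost_le_rate[OF K3(2) cT0 assms(2)] log_large[of 1] loglog_large[of 1] ev4 ev2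
  proof (eventually_elim, intro allI impI, elim conjE, goal_cases)
   case (1 n W B m lo hi)
   interpret sieve_run k a b K n "nonresidue_bound n" W B by (rule 1)
   note A1 = 1(1)[rule_format] and A2 = 1(2)[rule_format] and A3 = 1(3)[rule_format] and A4 = 1(4)[rule_format]
   let ?M = "primorial m"
   note L = 1(5,6) and ro = \<open>range_ok k lo hi\<close>
   have m: "2 \<le> m" "?M \<le> y" "y < ?M * m" by fact+
   have n1: "1 \<le> n" using L(1) by (cases "n = 0") auto
   have yu: "real y \<le> 2 * real n powr (1 / real K)" by (rule y_upper[OF n1])
   have "4 \<le> real y" using 1(7) root_lower[OF K3(2) y_bounds(2)] by simp
   then have y4: "4 \<le> y" by simp
   have "real y \<le> real n powr (1/2) * real n powr (1 / real K)"
    using yu 1(8) mult_right_mono[of 2 "real n powr (1/2)" "real n powr (1 / real K)"] by simp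
   also have "\<dots> \<le> real n powr 1"
    unfolding powr_add[symmetric] using n1 assms(3) by (intro powr_mono) (auto simp: field_simps)
   finally have yn: "y \<le> n" using n1 by simp
   have plo: "\<forall>x. (\<forall>i<k. 2 \<le> form i x) \<longleftrightarrow> lo \<le> x" using ro by (simp add: range_ok_def)
   then have "\<forall>x. (\<forall>i<k. 2 \<le> form i x) \<longleftrightarrow> lo0 \<le> x"
    unfolding lo0_def by (rule someI[of "\<lambda>lo. \<forall>x. (\<forall>i<k. 2 \<le> form i x) \<longleftrightarrow> lo \<le> x"])
   then have "lo0 \<le> x \<longleftrightarrow> lo \<le> x" for x using plo by simp
   from this[of lo] this[of lo0] have lo: "lo = lo0" by simp
   define x0 where "x0 = lo + int y"
   have F: "(\<Sum>i<k. nat (form i x0)) \<le> cF * y"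
    unfolding cF_def sum_distrib_right
   proof (rule sum_mono)
    fix i assume "i \<in> {..<k}"
    then have a0: "0 < a i" using a_pos by simp
    have "form i x0 = form i lo0 + a i * int y" by (simp add: form_def x0_def lo algebra_simps)
    also have "\<dots> \<le> \<bar>form i lo0\<bar> * int y + a i * int y"
     using y4 mult_left_mono[of 1 "int y" "\<bar>form i lo0\<bar>"] by simp
    also have "\<dots> = int ((nat \<bar>form i lo0\<bar> + nat (a i)) * y)" using a0 by (simp add: algebra_simps)
    finally show "nat (form i x0) \<le> (nat \<bar>form i lo0\<bar> + nat (a i)) * y" by linarith
   qed
   have width: "nat (hi - x0) \<le> n" "hi < x0 + int n"
    using range_width[OF ro, of x0] n1 by (auto simp: x0_def)
   define t1 where "t1 = K + y * (K + 1) + (y + 1) * (y + 1) + k + y * (k * ((\<Sum>i<k. nat (form i x0)) + 1) + 1) +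
    ?M * (1 + k * (y + 1)) + 1"
   have "t1 \<le> (2 * K + k + k * (cF + 1) + 2 * k + 8) * y ^ 3"
    unfolding t1_def by (rule small_ticks_le[OF m(2) F])
   then have "real t1 \<le> real ((2 * K + k + k * (cF + 1) + 2 * k + 8) * y ^ 3)" by (simp only: of_nat_le_iff)
   also have "\<dots> = c1 * real y ^ 3" unfolding c1_def by (simp only: of_nat_mult of_nat_power)
   also have "\<dots> \<le> rate n" by (rule A1[OF yu])
   finally have 2: "real t1 \<le> rate n" .
   note costs = costs_le[OF L(1) CE(2)[OF L(1)] less_imp_le[OF CE(1)]]
   have 3: "real bound_cost \<le> rate n"
    unfolding bound_cost_def using costs(2) y_bounds(2) by (intro A2) (simp add: cX_def)
   have 4: "real (card {r. r < ?M \<and> (avoids_below m (x0 + int r))} *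
     ((nat (hi - x0) div (?M * (y * y)) + 1) * (1 + 2 * (y * y) + sieve_ticks))) \<le> C * rate n"
    using y_bounds(1,2) yu m width(1) sieve_ticks_le[OF y4 yn L(2)] by (intro A3 conjI) (simp_all only: cS_def)
   have 5: "real (card {x \<in> {x0..hi}. avoids_upto y x} * (k * (test_cost + 1))) \<le> rate n"
    using y_bounds(2) width(2) costs(1) by (intro A4 conjI) (simp_all only: cT_def)
   have "total_ticks m lo hi + 1 = t1 + bound_cost +
     card {r. r < ?M \<and> (avoids_below m (x0 + int r))} *
      ((nat (hi - x0) div (?M * (y * y)) + 1) * (1 + 2 * (y * y) + sieve_ticks)) +
     card {x \<in> {x0..hi}. avoids_upto y x} * (k * (test_cost + 1))"
    unfolding total_ticks_def Let_def t1_def x0_def by simp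
   then show "real (total_ticks m lo hi + 1) \<le> (C + 3) * rate n"
    using 2 3 4 5 by (simp only: of_nat_add) (simp add: algebra_simps)
  qed
 qed
qed

end

text \<open>Only one entry of the input changes with \<open>n\<close>; the others add a constant to
  the longest length.\<close>

lemma word_size_pattern_input_le:
 "\<exists>A. \<forall>n. 1 \<le> ln (real n) \<longrightarrow> real (word_size \<kappa> (pattern_input P n)) \<le> A * ln (real n)"
proof -
 let ?fl = "\<lambda>v::int. floorlog 2 (nat \<bar>v\<bar>)"
 define l where "l = int (length P) # concat (map (\<lambda>f. [coeff f 1, coeff f 0]) P)"
 define A where "A = Max (?fl ` set l)"
 show ?thesis
 proof (intro exI[of _ "real \<kappa> * (real A + 4)"] allI impI)
  fix n :: nat assume L: "1 \<le> ln (real n)"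
  have "Max (?fl ` set (pattern_input P n)) \<le> A + floorlog 2 n"
  proof (intro Max.boundedI)
   fix x assume "x \<in> ?fl ` set (pattern_input P n)"
   then have "x \<in> ?fl ` set l \<or> x = floorlog 2 n" by (auto simp: pattern_input_def l_def)
   moreover have "x \<le> A" if "x \<in> ?fl ` set l" unfolding A_def using that by (intro Max_ge) auto
   ultimately show "x \<le> A + floorlog 2 n" by fastforce
  qed (auto simp: pattern_input_def)
  then have "real (Max (?fl ` set (pattern_input P n))) \<le> real A + real (floorlog 2 n)" by linarith
  also have "\<dots> \<le> real A * ln (real n) + 4 * ln (real n)"
   using floorlog_le_ln[OF L] mult_left_mono[OF L, of "real A"] by simp
  finally have "real \<kappa> * real (Max (?fl ` set (pattern_input P n))) \<le> real \<kappa> * ((real A + 4) * ln (real n))"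
   by (intro mult_left_mono) (auto simp: algebra_simps)
  then show "real (word_size \<kappa> (pattern_input P n)) \<le> real \<kappa> * (real A + 4) * ln (real n)"
   by (simp add: word_size_def mult.assoc)
 qed
qed

theorem theorem1p3:
 fixes c :: real
 assumes "c > 2"
 shows "\<exists>(\<kappa>::nat) (prog::program). \<forall>(k::nat) (P::int poly list).
  k > 2 \<and> length P = k \<and> is_pattern P \<longrightarrow>
  (\<exists>(time :: nat \<Rightarrow> nat) (space :: nat \<Rightarrow> nat).
    (\<forall>n. \<exists>outp. ram_computes \<kappa> prog (pattern_input P n) outp (time n) (space n) \<and>
          set outp = prime_pattern_positions P n) \<and>
    (\<forall>\<^sub>F n in sequentially. real (space n) \<le> real n powr (1 / c)) \<and>
    (conjecture_A \<and> conjecture_B \<longrightarrow>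
     (\<lambda>n. real (time n)) \<in> O(\<lambda>n. real n / ln (ln (real n)) ^ (k - 1))))"
proof -
 \<comment> \<open>The space is about a word length times \<open>y^2\<close>, and \<open>y^2\<close>
   is at most \<open>4 * n^(2/K)\<close>, hence at most \<open>4 * n^(1/(2*c))\<close>; the other
   half of the exponent \<open>1/c\<close> absorbs word length and constants. As
   \<open>c > 2\<close>, also \<open>K\<close> is at least 6, which the cubic costs require.\<close>
 define K where "K = nat \<lceil>4 * c\<rceil>"
 have Kc: "4 * c \<le> real K" unfolding K_def by linarith
 then have K6: "6 \<le> K" using assms by linarith
 let ?prog = "pattern_program K"
 show ?thesis
 proof (rule exI[of _ "K + 14"], rule exI[of _ ?prog], intro allI impI, elim conjE)
  fix k :: nat and P :: "int poly list"
  assume k: "2 < k" "length P = k" and P: "is_pattern P"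
  define a where "a = (\<lambda>i. coeff (P ! i) 1)"
  define b where "b = (\<lambda>i. coeff (P ! i) 0)"
  define y where "y = (\<lambda>n. sieve_run.y K n)"
  define R where "R = card (\<Union>i\<in>set ?prog. set_instr i)"
  interpret linear_forms k a b
   using is_pattern_linear_forms(1)[OF P] k unfolding a_def b_def by simp
  \<comment> \<open>All properties of a run are bundled, so that a single choice yields time and
    space as functions of \<open>n\<close>.\<close>
  define X where "X = (\<lambda>n t sp. \<exists>outp W B m lo hi. sieve_run k a b K n (nonresidue_bound n) W B \<and>
   ram_computes (K + 14) ?prog (pattern_input P n) outp t sp \<and>
   set outp = prime_pattern_positions P n \<and>
   2 \<le> m \<and> primorial m \<le> y n \<and> y n < primorial m * m \<and>
   sieve_run.range_ok a b n W k lo hi \<and>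
   t \<le> length ?prog * (sieve_run.total_ticks k a b K n (nonresidue_bound n) m lo hi + 1) \<and>
   sp \<le> word_size (K + 14) (pattern_input P n) * (R + (2 + 2 * k + y n * y n)))"
  have "\<exists>t sp. X n t sp" for n
  proof -
   have lP: "2 < length P" and K3: "3 \<le> K" using k K6 by auto
   show ?thesis
    unfolding X_def
    by (rule pattern_program_run[OF P lP K3, of n, unfolded k(2), folded a_def b_def y_def R_def]) blast
  qed
  then obtain time space where X: "\<And>n. X n (time n) (space n)" by metis
  then have run: "\<exists>outp. ram_computes (K + 14) ?prog (pattern_input P n) outp (time n) (space n) \<and>
    set outp = prime_pattern_positions P n" for n
   unfolding X_def by blast
  have SR: "\<exists>W B. sieve_run k a b K n (nonresidue_bound n) W B" for n using X[of n] unfolding X_def by blast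
  have space: "space n \<le> word_size (K + 14) (pattern_input P n) * (R + (2 + 2 * k + y n * y n))" for n
   using X[of n] unfolding X_def by blast
  have "\<forall>\<^sub>F n in sequentially. real (space n) \<le> real n powr (1 / c)"
  proof -
   obtain A where A: "\<And>n. 1 \<le> ln (real n) \<Longrightarrow> real (word_size (K + 14) (pattern_input P n)) \<le> A * ln (real n)"
    using word_size_pattern_input_le by blast
   define R' where "R' = real (R + 2 + 2 * k) + 4"
   have "\<forall>\<^sub>F n::nat in sequentially. (\<bar>A\<bar> * R') * ln (real n) ^ 1 * ln (ln (real n)) ^ 0 \<le> real n powr (1 / (2 * c))"
    using assms by (intro log_loglog_power_le_powr) simp
   then show ?thesis using log_large[of 1]
   proof eventually_elim
    case (elim n)
    then have n1: "1 \<le> n" by (cases "n = 0") auto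
    define z where "z = real n powr (1 / (2 * c))"
    have z1: "1 \<le> z" unfolding z_def using n1 assms by (intro ge_one_powr_ge_zero) auto
    have "real (y n) \<le> 2 * real n powr (1 / real K)" unfolding y_def using SR[of n] sieve_run.y_upper[OF _ n1] by blast
    then have "real (y n) ^ 2 \<le> (2 * real n powr (1 / real K)) ^ 2" by (intro power_mono) auto
    also have "\<dots> = 4 * real n powr (2 / real K)" using n1 by (simp add: power_mult_distrib powr_powr flip: powr_realpow)
    also have "\<dots> \<le> 4 * z" unfolding z_def
     using n1 Kc assms by (intro mult_left_mono powr_mono) (auto simp: field_simps)
    finally have yz: "real (y n * y n) \<le> 4 * z" by (simp add: power2_eq_square)
    have "real (R + (2 + 2 * k + y n * y n)) = real (R + 2 + 2 * k) * 1 + real (y n * y n)" by simp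
    also have "\<dots> \<le> real (R + 2 + 2 * k) * z + 4 * z" using z1 yz by (intro add_mono mult_left_mono) auto
    finally have Rz: "real (R + (2 + 2 * k + y n * y n)) \<le> R' * z" unfolding R'_def by (simp only: distrib_right)
    have "real (word_size (K + 14) (pattern_input P n)) \<le> \<bar>A\<bar> * ln (real n)"
     using A[OF elim(2)] mult_right_mono[of A "\<bar>A\<bar>" "ln (real n)"] elim(2) by linarith
    then have "real (word_size (K + 14) (pattern_input P n)) * real (R + (2 + 2 * k + y n * y n)) \<le> \<bar>A\<bar> * ln (real n) * (R' * z)"
     using Rz elim(2) by (intro mult_mono) auto
    also have "\<dots> \<le> z * z" using elim(1) z1 mult_right_mono[of "\<bar>A\<bar> * R' * ln (real n)" z z] by (simp add: z_def mult_ac)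
    also have "\<dots> = real n powr (1 / c)" unfolding z_def by (simp flip: powr_add)
    finally have "real (word_size (K + 14) (pattern_input P n) * (R + (2 + 2 * k + y n * y n))) \<le> real n powr (1 / c)"
     by (simp only: of_nat_mult)
    then show ?case using space[of n] by (meson of_nat_le_iff order_trans)
   qed
  qed
  moreover have "(\<lambda>n. real (time n)) \<in> O(\<lambda>n. real n / ln (ln (real n)) ^ (k - 1))" if AB: "conjecture_A \<and> conjecture_B"
  proof -
   obtain C where "\<forall>\<^sub>F n in sequentially. \<forall>W B m lo hi. sieve_run k a b K n (nonresidue_bound n) W B \<and>
    2 \<le> m \<and> primorial m \<le> sieve_run.y K n \<and> sieve_run.y K n < primorial m * m \<and>
    sieve_run.range_ok a b n W k lo hi \<longrightarrow>
    real (sieve_run.total_ticks k a b K n (nonresidue_bound n) m lo hi + 1) \<le> C * rate n"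
    using total_ticks_le_rate[OF conjunct1[OF AB] _ K6] k(1) by fastforce
   then have "\<forall>\<^sub>F n in sequentially. norm (real (time n)) \<le> real (length ?prog) * C * norm (real n / ln (ln (real n)) ^ (k - 1))"
    using loglog_large[of 1]
   proof eventually_elim
    case (elim n)
    obtain W B m lo hi where Y: "sieve_run k a b K n (nonresidue_bound n) W B" "2 \<le> m"
     "primorial m \<le> y n" "y n < primorial m * m" "sieve_run.range_ok a b n W k lo hi"
     and time: "time n \<le> length ?prog * (sieve_run.total_ticks k a b K n (nonresidue_bound n) m lo hi + 1)"
     using X[of n] unfolding X_def by blast
    have "real (time n) \<le> real (length ?prog) * real (sieve_run.total_ticks k a b K n (nonresidue_bound n) m lo hi + 1)"
     using time by (metis of_nat_le_iff of_nat_mult)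
    also have "\<dots> \<le> real (length ?prog) * (C * rate n)"
     using elim(1) Y unfolding y_def by (intro mult_left_mono of_nat_0_le_iff) blast
    also have "\<dots> = real (length ?prog) * C * (real n / ln (ln (real n)) ^ (k - 1))" by (simp add: rate_def)
    also have "real n / ln (ln (real n)) ^ (k - 1) = norm (real n / ln (ln (real n)) ^ (k - 1))"
     using elim(2) by simp
    finally show ?case by simp
   qed
   then show ?thesis by (rule bigoI)
  qed
  ultimately show "\<exists>time space.
    (\<forall>n. \<exists>outp. ram_computes (K + 14) ?prog (pattern_input P n) outp (time n) (space n) \<and>
          set outp = prime_pattern_positions P n) \<and>
    (\<forall>\<^sub>F n in sequentially. real (space n) \<le> real n powr (1 / c)) \<and>
    (conjecture_A \<and> conjecture_B \<longrightarrow>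
     (\<lambda>n. real (time n)) \<in> O(\<lambda>n. real n / ln (ln (real n)) ^ (k - 1)))"
   using run by blast
 qed
qed

end
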